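(* For every non-trivial $C\in\mathcal C$ and every $\alpha<\alpha_-$, $C$ is $\alpha$-Hölder continuous on $\hat{\mathbb C}$ (with respect to $d$). Moreover, $C_{\vec 0}$ is $\alpha_-$-Hölder continuous on $\hat{\mathbb C}$.
   Context: Standing setup. $\hat{\mathbb C}$ with spherical distance $d$. For a semigroup $H$ of rational maps, $F(H)$ is the set of points with a neighbourhood where $H$ is equicontinuous, $J(H)$ its complement. $s\ge1$, $I=\{1,\dots,s+1\}$, $f_1,\dots,f_{s+1}$ rational with $\deg f_i\ge2$, $G=\langle f_1,\dots,f_{s+1}\rangle$, $P(G)=\overline{\bigcup_{g\in G\cup\{\mathrm{id}\}}g(\text{critical values of the }f_i)}$; minimal set: non-empty compact $K$ with $K=\overline{\{g(z):g\in G\}}$ for all $z\in K$. Assume (A1) $P(G)\subset F(G)$; (A2) $f_i^{-1}(J(G))\cap f_j^{-1}(J(G))=\emptyset$ ($i\ne j$); (A3) $G$ has at least two minimal sets. Fix a minimal set $L$. $\vec p\in(0,1)^s$, $\sum p_i<1$, $p_{s+1}=1-\sum_{i\le s}p_i$. $T_{\vec x}(z)$ = probability that the i.i.d. random orbit of $z$ (choosing $f_i$ with probability $x_i$, $x_{s+1}=1-\sum_{i\le s}x_i$) tends to $L$; it is real-analytic in $\vec x$ near $\vec p$ as a map into some $C^a(\hat{\mathbb C})$, and $C_{\vec n}=\partial^{|\vec n|}T_{\vec x}/\partial x_1^{n_1}\cdots\partial x_s^{n_s}|_{\vec x=\vec p}$, $\vec n\in\mathbb N_0^s$ ($C_{\vec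 0}=T_{\vec p}$). $\mathcal C$ = complex span of the $C_{\vec n}$; $C=\sum\beta_{\vec n}C_{\vec n}$ non-trivial if some $\beta_{\vec n}\ne0$. $\mathrm{H\ddot ol}(C,z)=\sup\{\alpha\ge0:\limsup_{y\to z}|C(y)-C(z)|/d(y,z)^\alpha<\infty\}$, $H(C,\alpha)=\{z:\mathrm{H\ddot ol}(C,z)=\alpha\}$, $\alpha_-=\inf\{\alpha:H(C,\alpha)\ne\emptyset\}$ (independent of the non-trivial $C$; $\alpha_->0$). *)

theory Defs
  imports "HOL-Probability.Probability" "HOL-Computational_Algebra.Polynomial"
begin

type_synonym sph = "complex option"  (* None = infinity *)

text \<open>Stereographic embedding of the Riemann sphere onto the unit sphere in C x R = R^3.\<close>
definition stereo :: "sph \<Rightarrow> complex \<times> real" where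
  "stereo w = (case w of None \<Rightarrow> (0, 1)
     | Some z \<Rightarrow> (2 * z / of_real (1 + (cmod z)^2), ((cmod z)^2 - 1) / ((cmod z)^2 + 1)))"

definition sdist :: "sph \<Rightarrow> sph \<Rightarrow> real" where
  "sdist a b = dist (stereo a) (stereo b)"

definition sclosure :: "sph set \<Rightarrow> sph set" where
  "sclosure A = {x. \<forall>e>0. \<exists>a\<in>A. sdist x a < e}"

definition scompact :: "sph set \<Rightarrow> bool" where
  "scompact K \<longleftrightarrow> compact (stereo ` K)"

definition rat_eval :: "complex poly \<Rightarrow> complex poly \<Rightarrow> sph \<Rightarrow> sph" where
  "rat_eval P Q w = (case w of
      Some z \<Rightarrow> (if poly Q z = 0 then None else Some (poly P z / poly Q z))
    | None \<Rightarrow> (if degree P > degree Q then None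
               else if degree P = degree Q then Some (lead_coeff P / lead_coeff Q)
               else Some 0))"

definition rational_map :: "(sph \<Rightarrow> sph) \<Rightarrow> nat \<Rightarrow> bool" where
  "rational_map f d \<longleftrightarrow> (\<exists>P Q. coprime P Q \<and> Q \<noteq> 0 \<and> max (degree P) (degree Q) = d
                                 \<and> f = rat_eval P Q)"

definition critical_point :: "(sph \<Rightarrow> sph) \<Rightarrow> sph \<Rightarrow> bool" where
  "critical_point f z \<longleftrightarrow> (\<forall>e>0. \<not> inj_on f {w. sdist w z < e})"

definition critical_values :: "(sph \<Rightarrow> sph) \<Rightarrow> sph set" where
  "critical_values f = f ` {z. critical_point f z}"

inductive_set semigroup_gen :: "(nat \<Rightarrow> sph \<Rightarrow> sph) \<Rightarrow> nat set \<Rightarrow> (sph \<Rightarrow> sph) set"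
  for f :: "nat \<Rightarrow> sph \<Rightarrow> sph" and I :: "nat set" where
  gen: "i \<in> I \<Longrightarrow> f i \<in> semigroup_gen f I"
| comp: "g \<in> semigroup_gen f I \<Longrightarrow> i \<in> I \<Longrightarrow> f i \<circ> g \<in> semigroup_gen f I"

definition equicont_at :: "(sph \<Rightarrow> sph) set \<Rightarrow> sph \<Rightarrow> bool" where
  "equicont_at H y \<longleftrightarrow>
     (\<forall>\<epsilon>>0. \<exists>\<delta>>0. \<forall>w. sdist w y < \<delta> \<longrightarrow> (\<forall>h\<in>H. sdist (h w) (h y) < \<epsilon>))"

definition fatou :: "(sph \<Rightarrow> sph) set \<Rightarrow> sph set" where
  "fatou H = {z. \<exists>r>0. \<forall>y. sdist y z < r \<longrightarrow> equicont_at H y}"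

definition julia :: "(sph \<Rightarrow> sph) set \<Rightarrow> sph set" where
  "julia H = - fatou H"

definition postcrit :: "(nat \<Rightarrow> sph \<Rightarrow> sph) \<Rightarrow> nat set \<Rightarrow> sph set" where
  "postcrit f I = sclosure (\<Union>g \<in> insert id (semigroup_gen f I). g ` (\<Union>i\<in>I. critical_values (f i)))"

definition minimal_set :: "(sph \<Rightarrow> sph) set \<Rightarrow> sph set \<Rightarrow> bool" where
  "minimal_set G K \<longleftrightarrow> K \<noteq> {} \<and> scompact K \<and> (\<forall>z\<in>K. K = sclosure {g z |g. g \<in> G})"

definition gen_pmf :: "nat \<Rightarrow> (nat \<Rightarrow> real) \<Rightarrow> nat pmf" where
  "gen_pmf s x = embed_pmf (\<lambda>i. if 1 \<le> i \<and> i \<le> s then x i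
                                else if i = s + 1 then 1 - (\<Sum>j\<in>{1..s}. x j) else 0)"

fun rorbit :: "(nat \<Rightarrow> sph \<Rightarrow> sph) \<Rightarrow> (nat \<Rightarrow> nat) \<Rightarrow> nat \<Rightarrow> sph \<Rightarrow> sph" where
  "rorbit f \<omega> 0 z = z"
| "rorbit f \<omega> (Suc n) z = f (\<omega> n) (rorbit f \<omega> n z)"

definition Tprob :: "(nat \<Rightarrow> sph \<Rightarrow> sph) \<Rightarrow> nat \<Rightarrow> sph set \<Rightarrow> (nat \<Rightarrow> real) \<Rightarrow> sph \<Rightarrow> real" where
  "Tprob f s L x z =
     measure (PiM UNIV (\<lambda>_::nat. measure_pmf (gen_pmf s x)))
       {\<omega> \<in> space (PiM UNIV (\<lambda>_::nat. measure_pmf (gen_pmf s x))).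
          (\<lambda>n. infdist (stereo (rorbit f \<omega> n z)) (stereo ` L)) \<longlonglongrightarrow> 0}"

definition coord_deriv :: "nat \<Rightarrow> ((nat \<Rightarrow> real) \<Rightarrow> real) \<Rightarrow> (nat \<Rightarrow> real) \<Rightarrow> real" where
  "coord_deriv i F x = deriv (\<lambda>t. F (x(i := t))) (x i)"

fun mixed_deriv :: "(nat \<Rightarrow> nat) \<Rightarrow> nat \<Rightarrow> ((nat \<Rightarrow> real) \<Rightarrow> real) \<Rightarrow> ((nat \<Rightarrow> real) \<Rightarrow> real)" where
  "mixed_deriv n 0 F = F"
| "mixed_deriv n (Suc j) F = (coord_deriv (Suc j) ^^ n (Suc j)) (mixed_deriv n j F)"

definition multi_index :: "nat \<Rightarrow> (nat \<Rightarrow> nat) \<Rightarrow> bool" where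
  "multi_index s n \<longleftrightarrow> (\<forall>i. n i \<noteq> 0 \<longrightarrow> 1 \<le> i \<and> i \<le> s)"

definition Cn :: "(nat \<Rightarrow> sph \<Rightarrow> sph) \<Rightarrow> nat \<Rightarrow> sph set \<Rightarrow> (nat \<Rightarrow> real) \<Rightarrow> (nat \<Rightarrow> nat) \<Rightarrow> sph \<Rightarrow> real" where
  "Cn f s L p n z = mixed_deriv n s (\<lambda>x. Tprob f s L x z) p"

definition holder_bounded :: "(sph \<Rightarrow> complex) \<Rightarrow> sph \<Rightarrow> real \<Rightarrow> bool" where
  "holder_bounded C z \<alpha> \<longleftrightarrow> (\<exists>M \<delta>. \<delta> > 0 \<and>
     (\<forall>y. y \<noteq> z \<and> sdist y z < \<delta> \<longrightarrow> cmod (C y - C z) \<le> M * sdist y z powr \<alpha>))"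

definition Hol :: "(sph \<Rightarrow> complex) \<Rightarrow> sph \<Rightarrow> ereal" where
  "Hol C z = Sup {ereal \<alpha> |\<alpha>. \<alpha> \<ge> 0 \<and> holder_bounded C z \<alpha>}"

definition Hlevel :: "(sph \<Rightarrow> complex) \<Rightarrow> real \<Rightarrow> sph set" where
  "Hlevel C \<alpha> = {z. Hol C z = ereal \<alpha>}"

definition alpha_minus :: "(sph \<Rightarrow> complex) \<Rightarrow> ereal" where
  "alpha_minus C = Inf {ereal \<alpha> |\<alpha>. Hlevel C \<alpha> \<noteq> {}}"

definition holder_cont :: "(sph \<Rightarrow> complex) \<Rightarrow> real \<Rightarrow> bool" where
  "holder_cont C \<alpha> \<longleftrightarrow> (\<exists>K. \<forall>y z. cmod (C y - C z) \<le> K * sdist y z powr \<alpha>)"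

end

(* Near the Julia set J every word w of generators has inverse branches which, up to a uniform
   constant kappa, are similarities of ratio R w z: postcritical points stay in the Fatou set, so the
   branches omit a fixed ball and a distortion theorem applies.  The branches contract, since
   otherwise G would be equicontinuous at a point of J.  As the sets f_i^{-1}(J) are disjoint, the
   random orbits of two nearby points, one of them in J, merge unless they follow one particular word,
   so that T(H u) - T(H x) = p_w (T u - T x) along the branch H of w, also for complex parameters.
   A combination of parameter derivatives satisfies the same equation, where w acts on the
   coefficients as p_w times a unipotent operator.

   Let a be the supremum of the alpha for which p_w <= K R(w,z)^alpha holds uniformly.  The functional
   equation makes T a-Hoelder and, with Cauchy estimates in the parameters, every combination
   alpha-Hoelder for alpha < a.  If alpha > a, transitivity of G on J and a closing argument give a
   word u with a fixed point q in J for which p_u^n outgrows R(u^n,q)^alpha.  A nonzero combination of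
   least degree that is alpha-Hoelder at q is an eigenvector of u, hence constant near q; this
   contradicts the linear independence of the derivatives near points of J, which follows from the
   same lowering of degrees.  Hence alpha_- = a. *)

theory Submission
  imports Defs "HOL-Complex_Analysis.Complex_Analysis" "HOL-Computational_Algebra.Fundamental_Theorem_Algebra"
begin

section \<open>The Riemann sphere as a metric space\<close>

text \<open>The number \<open>R w z\<close> stands for the inverse of a derivative and is fixed only
  up to powers of \<open>\<kappa>\<close>. So every comparison loses a constant, and a periodic word
  has to win a factor 2 per period to outweigh the losses.

  Normality comes from an omitted ball: a chart with its pole in that ball makes the maps bounded
  holomorphic functions, and Cauchy's estimate takes the place of Montel's theorem.

  Parameter derivatives of p_w exceed p_w by powers of the length |w|. On a small complex polydisc
  the weight of w has modulus at most (1 + \<epsilon>)^|w| p_w, and as R(w,z) decays exponentially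
  in |w| this costs an arbitrarily small part of the exponent. T satisfies the equation with p_w
  itself and loses nothing; hence the different ranges of \<alpha> in the two halves of the theorem.

  The supremum a is attained in p_w \<le> K R(w,z)^a because K is uniform for \<alpha> in bounded
  intervals: exceeding such a K once already closes up to a periodic word with growth, which refutes
  every constant.\<close>

definition stereographic :: "'a::real_inner option \<Rightarrow> 'a \<times> real" where
  "stereographic w = (case w of None \<Rightarrow> (0, 1)
     | Some z \<Rightarrow> ((2 / (1 + (norm z)\<^sup>2)) *\<^sub>R z, ((norm z)\<^sup>2 - 1) / ((norm z)\<^sup>2 + 1)))"

lemma one_plus_norm_sq_pos [simp]: "1 + (norm (z::'a::real_inner))\<^sup>2 > 0" "1 + (norm z)\<^sup>2 \<noteq> 0"
  "(norm z)\<^sup>2 + 1 \<noteq> 0"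
  by (smt (verit) zero_le_power2)+

lemma stereographic_inject:
  assumes "stereographic x = stereographic y" shows "x = y"
proof -
  have N: "stereographic (Some z) \<noteq> stereographic None" for z :: 'a
  proof
    assume "stereographic (Some z) = stereographic None"
    then have "((norm z)\<^sup>2 - 1) / ((norm z)\<^sup>2 + 1) = 1" by (simp add: stereographic_def)
    then have "(norm z)\<^sup>2 - 1 = (norm z)\<^sup>2 + 1" by (simp add: divide_eq_eq split: if_splits)
    then show False by simp
  qed
  have S: "z = w" if "stereographic (Some z) = stereographic (Some w)" for z w :: 'a
  proof -
    define a b where ab: "a = (norm z)\<^sup>2" "b = (norm w)\<^sup>2"
    have p: "a \<ge> 0" "b \<ge> 0" by (auto simp: ab)
    have "(a - 1) / (a + 1) = (b - 1) / (b + 1)"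
      using that by (simp add: stereographic_def ab)
    then have "(a - 1) * (b + 1) = (b - 1) * (a + 1)" using p by (simp add: frac_eq_eq)
    then have "a = b" by (simp add: algebra_simps)
    moreover have "(2 / (1 + a)) *\<^sub>R z = (2 / (1 + b)) *\<^sub>R w"
      using that by (simp add: stereographic_def ab)
    ultimately show ?thesis using p by simp
  qed
  show ?thesis using assms N S by (cases x; cases y; metis)
qed

text \<open>A class instance needs a type variable, so the embedding is generalised to inner product
  spaces. On \<open>complex option\<close> the metric is \<open>sdist\<close>, and compactness,
  continuity and connectedness of the sphere become general metric notions.\<close>

instantiation option :: (real_inner) metric_space
begin

definition dist_option :: "'a option \<Rightarrow> 'a option \<Rightarrow> real" where
  "dist_option x y = dist (stereographic x) (stereographic y)"

definition uniformity_option :: "('a option \<times> 'a option) filter" where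
  "uniformity_option = (INF e\<in>{0 <..}. principal {(x, y). dist x y < e})"

definition open_option :: "'a option set \<Rightarrow> bool" where
  "open_option U \<longleftrightarrow> (\<forall>x\<in>U. eventually (\<lambda>(x', y). x' = x \<longrightarrow> y \<in> U) uniformity)"

instance
proof
  fix x y z :: "'a option"
  show "dist x y = 0 \<longleftrightarrow> x = y"
    unfolding dist_option_def using stereographic_inject by auto
  show "dist x y \<le> dist x z + dist y z"
    unfolding dist_option_def by (rule dist_triangle2)
qed (auto simp: uniformity_option_def open_option_def)

end

lemma stereo_eq_stereographic: "stereo w = stereographic w"
  by (simp add: stereo_def stereographic_def scaleR_conv_of_real split: option.split)

lemma sdist_eq_dist: "sdist a b = dist a b"
  by (simp add: sdist_def dist_option_def stereo_eq_stereographic)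

lemma dist_stereo: "dist (stereo a) (stereo b) = dist a b"
  by (simp add: dist_option_def stereo_eq_stereographic)

lemma norm_stereographic [simp]: "norm (stereographic (x::'a::real_inner option)) = 1"
proof (cases x)
  case None then show ?thesis by (simp add: stereographic_def norm_Pair)
next
  case (Some z)
  define a where "a = (norm z)\<^sup>2"
  have "a \<ge> 0" by (simp add: a_def)
  have "(2 / (1 + a))\<^sup>2 * a + ((a - 1) / (a + 1))\<^sup>2 = 1"
  proof -
    have "(2 / (1 + a))\<^sup>2 * a + ((a - 1) / (a + 1))\<^sup>2 = (4 * a + (a - 1)\<^sup>2) / (1 + a)\<^sup>2"
      by (simp add: power_divide add_divide_distrib add.commute)
    also have "4 * a + (a - 1)\<^sup>2 = (1 + a)\<^sup>2" by (simp add: power2_eq_square algebra_simps)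
    finally show ?thesis using \<open>a \<ge> 0\<close> by simp
  qed
  then show ?thesis
    by (simp add: Some stereographic_def norm_Pair power_mult_distrib a_def[symmetric] power_divide)
qed

lemma dist_stereographic_sq:
  "(dist x y)\<^sup>2 = 2 - 2 * inner (stereographic x) (stereographic (y::'a::real_inner option))"
  unfolding dist_option_def dist_norm power2_norm_eq_inner
  using norm_stereographic[of x] norm_stereographic[of y]
  unfolding norm_eq_1 by (simp add: inner_diff_left inner_diff_right inner_commute)

lemma dist_Some_Some:
  "dist (Some z) (Some (w::'a::real_inner)) = 2 * norm (z - w) / (sqrt (1 + (norm z)\<^sup>2) * sqrt (1 + (norm w)\<^sup>2))"
proof -
  define a b c where abc: "a = (norm z)\<^sup>2" "b = (norm w)\<^sup>2" "c = (norm (z - w))\<^sup>2"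
  have p: "a \<ge> 0" "b \<ge> 0" "c \<ge> 0" by (auto simp: abc)
  have i: "inner z w = (a + b - c) / 2" by (simp add: dot_norm_neg abc)
  have "inner (stereographic (Some z)) (stereographic (Some w))
      = 4 * inner z w / ((1 + a) * (1 + b)) + (a - 1) * (b - 1) / ((1 + a) * (1 + b))"
    using p by (simp add: stereographic_def abc[symmetric] add.commute)
  also have "\<dots> = (2 * (a + b - c) + (a - 1) * (b - 1)) / ((1 + a) * (1 + b))"
  proof -
    have "4 * inner z w = 2 * (a + b - c)" by (simp add: i)
    then show ?thesis by (simp only: add_divide_distrib)
  qed
  also have "2 * (a + b - c) + (a - 1) * (b - 1) = (1 + a) * (1 + b) - 2 * c" by (simp add: algebra_simps)
  also have "((1 + a) * (1 + b) - 2 * c) / ((1 + a) * (1 + b)) = 1 - 2 * c / ((1 + a) * (1 + b))"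
    using p by (simp add: diff_divide_distrib)
  finally have "(dist (Some z) (Some w))\<^sup>2 = 4 * c / ((1 + a) * (1 + b))"
    by (simp add: dist_stereographic_sq)
  also have "\<dots> = (2 * norm (z - w) / (sqrt (1 + a) * sqrt (1 + b)))\<^sup>2"
    using p by (simp add: power_divide power_mult_distrib abc)
  finally show ?thesis using p unfolding abc by (simp add: power2_eq_iff_nonneg)
qed

lemma dist_Some_None: "dist (Some z) None = 2 / sqrt (1 + (norm (z::'a::real_inner))\<^sup>2)"
  and dist_None_Some: "dist None (Some z) = 2 / sqrt (1 + (norm (z::'a::real_inner))\<^sup>2)"
proof -
  define a where a: "a = (norm z)\<^sup>2"
  have p: "a \<ge> 0" by (auto simp: a)
  have "inner (stereographic (Some z)) (stereographic None) = (a - 1) / (a + 1)"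
    by (simp add: stereographic_def a)
  then have "(dist (Some z) None)\<^sup>2 = 2 - 2 * ((a - 1) / (a + 1))"
    by (simp add: dist_stereographic_sq)
  also have "\<dots> = 4 / (1 + a)" using p by (simp add: field_simps)
  also have "\<dots> = (2 / sqrt (1 + a))\<^sup>2"
    using p by (simp add: power_divide)
  finally show 1: "dist (Some z) None = 2 / sqrt (1 + (norm z)\<^sup>2)" using p unfolding a by (simp add: power2_eq_iff_nonneg)
  then show "dist None (Some z) = 2 / sqrt (1 + (norm z)\<^sup>2)" by (simp add: dist_commute)
qed

lemma dist_option_le_2: "dist x (y::'a::real_inner option) \<le> 2"
proof -
  have "dist x y \<le> norm (stereographic x) + norm (stereographic y)"
    unfolding dist_option_def dist_norm by (rule norm_triangle_ineq4)
  then show ?thesis by simp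
qed

lemma range_stereo: "range stereo = sphere 0 1"
proof (intro equalityI subsetI)
  fix u assume "u \<in> range stereo" then show "u \<in> sphere 0 1" by (auto simp: stereo_eq_stereographic)
next
  fix u :: "complex \<times> real" assume u: "u \<in> sphere 0 1"
  obtain w t where ut: "u = (w, t)" by (cases u)
  have n: "(norm w)\<^sup>2 + t\<^sup>2 = 1" using u by (simp add: ut norm_Pair)
  show "u \<in> range stereo"
  proof (cases "t = 1")
    case True
    then have "w = 0" using n by simp
    then show ?thesis using True ut by (auto simp: stereo_def intro!: image_eqI[of _ _ None])
  next
    case False
    have "t\<^sup>2 \<le> 1" using n zero_le_power2[of "norm w"] by linarith
    then have "t \<le> 1" by (simp add: abs_square_le_1 abs_le_iff)
    then have t: "t < 1" using False by simp
    define z where "z = (1 / (1 - t)) *\<^sub>R w"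
    have nz: "(norm z)\<^sup>2 = (1 + t) / (1 - t)"
    proof -
      have "(norm z)\<^sup>2 = (norm w)\<^sup>2 / (1 - t)\<^sup>2"
        by (simp add: z_def power_divide power_mult_distrib)
      also have "(norm w)\<^sup>2 = (1 + t) * (1 - t)" using n by (simp add: power2_eq_square algebra_simps)
      finally show ?thesis using t by (simp add: power2_eq_square)
    qed
    have "1 + (norm z)\<^sup>2 = 2 / (1 - t)" unfolding nz using t by (simp add: field_simps)
    moreover have "(norm z)\<^sup>2 - 1 = 2 * t / (1 - t)" unfolding nz using t by (simp add: field_simps)
    ultimately have "stereographic (Some z) = u"
      using t by (simp add: stereographic_def ut z_def add.commute[of _ 1])
    then show ?thesis using stereo_eq_stereographic by (metis rangeI)
  qed
qed

definition istereo :: "complex \<times> real \<Rightarrow> sph" where "istereo = inv stereo"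

lemma inj_stereo: "inj stereo"
  by (metis inj_def stereo_eq_stereographic stereographic_inject)

lemma istereo_stereo [simp]: "istereo (stereo x) = x"
  by (simp add: istereo_def inj_stereo)

lemma stereo_istereo [simp]: "u \<in> sphere 0 1 \<Longrightarrow> stereo (istereo u) = u"
  unfolding istereo_def by (rule f_inv_into_f) (simp add: range_stereo[symmetric])

lemma stereo_in_sphere [simp]: "stereo x \<in> sphere 0 1" "norm (stereo x) = 1"
  by (auto simp: stereo_eq_stereographic)

lemma continuous_on_stereo: "continuous_on S stereo"
  unfolding continuous_on_iff dist_stereo by blast

lemma continuous_on_istereo: "continuous_on (sphere 0 1) istereo"
  unfolding continuous_on_iff
proof (intro ballI allI impI)
  fix u :: "complex \<times> real" and e :: real assume u: "u \<in> sphere 0 1" and e: "0 < e"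
  show "\<exists>d>0. \<forall>x'\<in>sphere 0 1. dist x' u < d \<longrightarrow> dist (istereo x') (istereo u) < e"
    using e u by (intro exI[of _ e]) (metis dist_stereo stereo_istereo)
qed

lemma compact_UNIV_sph [simp]: "compact (UNIV::sph set)"
proof -
  have "istereo ` sphere 0 1 = UNIV" by (metis UNIV_I image_iff istereo_stereo stereo_in_sphere(1) subsetI subset_antisym subset_UNIV)
  then show ?thesis using compact_continuous_image[OF continuous_on_istereo compact_sphere] by simp
qed

lemma connected_UNIV_sph [simp]: "connected (UNIV::sph set)"
proof -
  have "istereo ` sphere 0 1 = UNIV" by (metis UNIV_I image_iff istereo_stereo stereo_in_sphere(1) subsetI subset_antisym subset_UNIV)
  moreover have "connected (sphere (0::complex \<times> real) 1)" by (rule connected_sphere) simp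
  ultimately show ?thesis using connected_continuous_image[OF continuous_on_istereo] by metis
qed

lemma closed_imp_compact_sph: "closed (S::sph set) \<Longrightarrow> compact S"
  using compact_Int_closed[OF compact_UNIV_sph] by simp

lemma scompact_iff_compact: "scompact K \<longleftrightarrow> compact K"
proof
  assume "scompact K"
  moreover have "stereo ` K \<subseteq> sphere 0 1" using stereo_in_sphere(1) by blast
  ultimately have "compact (istereo ` (stereo ` K))" unfolding scompact_def
    using compact_continuous_image[OF continuous_on_subset[OF continuous_on_istereo]] by blast
  moreover have "istereo ` (stereo ` K) = K" by (simp add: image_image)
  ultimately show "compact K" by simp
next
  assume "compact K"
  then show "scompact K" unfolding scompact_def
    using compact_continuous_image[OF continuous_on_stereo] by blast
qed

lemma sclosure_eq_closure: "sclosure A = closure A"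
  by (auto simp: sclosure_def closure_approachable sdist_eq_dist dist_commute)

text \<open>Infinity and 0 are antipodal, so one of them has distance at least 1 from
  \<open>x\<close>. The distance to \<open>x\<close> is continuous on the connected sphere and takes
  all values in between.\<close>

lemma exists_dist_eq:
  fixes x :: sph assumes "0 \<le> t" "t \<le> 1" shows "\<exists>y. dist x y = t"
proof -
  have "dist (None::sph) (Some 0) = 2" by (simp add: dist_None_Some)
  then have "dist x None \<ge> 1 \<or> dist x (Some 0) \<ge> 1"
    using dist_triangle2[of None "Some 0" x] dist_commute[of x] by (smt (verit))
  then obtain b where b: "dist x b \<ge> 1" by blast
  have "connected ((\<lambda>y. dist x y) ` UNIV)"
    by (rule connected_continuous_image) (auto intro: continuous_intros)
  then have "{0..1} \<subseteq> (\<lambda>y. dist x y) ` UNIV"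
    by (smt (verit, best) UNIV_I atLeastAtMost_iff b connected_contains_Icc dist_self image_eqI in_mono subsetI)
  then show ?thesis using assms by (metis (no_types, lifting) atLeastAtMost_iff image_iff subset_eq)
qed

section \<open>Charts\<close>

definition sinv :: "sph \<Rightarrow> sph" where
  "sinv w = (case w of None \<Rightarrow> Some 0 | Some z \<Rightarrow> if z = 0 then None else Some (1 / z))"

definition strans :: "complex \<Rightarrow> sph \<Rightarrow> sph" where
  "strans c w = map_option (\<lambda>z. c + z) w"

text \<open>The affine chart with the point \<open>e\<close> moved to infinity, by translation and
  inversion if \<open>e\<close> is finite. Charts with an arbitrary pole serve later to make maps
  that omit a ball about \<open>e\<close> bounded. At the pole itself \<open>coord\<close> has the
  dummy value 0.\<close>

definition param :: "sph \<Rightarrow> complex \<Rightarrow> sph" where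
  "param e z = (case e of None \<Rightarrow> Some z | Some c \<Rightarrow> if z = 0 then None else Some (c + 1 / z))"

definition coord :: "sph \<Rightarrow> sph \<Rightarrow> complex" where
  "coord e w = (case e of None \<Rightarrow> (case w of None \<Rightarrow> 0 | Some z \<Rightarrow> z)
     | Some c \<Rightarrow> (case w of None \<Rightarrow> 0 | Some z \<Rightarrow> 1 / (z - c)))"

lemma coord_param [simp]: "coord e (param e z) = z"
  by (simp add: coord_def param_def split: option.split)

lemma param_neq [simp]: "param e z \<noteq> e" "e \<noteq> param e z"
  by (auto simp: param_def split: option.split)

lemma param_coord [simp]: "w \<noteq> e \<Longrightarrow> param e (coord e w) = w"
  by (cases e; cases w) (auto simp: coord_def param_def)

lemma inj_param: "inj (param e)"
  by (metis coord_param injI)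

text \<open>Inversion is a half turn of the unit sphere.\<close>

lemma dist_sinv [simp]: "dist (sinv a) (sinv b) = dist a b"
proof -
  have S: "dist (sinv (Some z)) (sinv (Some w)) = dist (Some z) (Some w)" if "z \<noteq> 0" "w \<noteq> 0" for z w
  proof -
    have e: "sqrt (1 + (norm (1 / u))\<^sup>2) = sqrt (1 + (norm u)\<^sup>2) / norm u" if "u \<noteq> 0" for u :: complex
    proof -
      have "1 + (norm (1 / u))\<^sup>2 = (1 + (norm u)\<^sup>2) / (norm u)\<^sup>2"
        using that by (simp add: norm_divide power_divide field_simps)
      then show ?thesis by (simp add: real_sqrt_divide)
    qed
    have "norm (1 / z - 1 / w) = norm (z - w) / (norm z * norm w)"
      using that by (simp add: diff_frac_eq norm_divide norm_mult norm_minus_commute)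
    then show ?thesis using that by (simp add: sinv_def dist_Some_Some e)
  qed
  have N: "dist (sinv (Some z)) (sinv None) = dist (Some z) None" for z
  proof (cases "z = 0")
    case True then show ?thesis by (simp add: sinv_def dist_commute)
  next
    case False
    have "1 + (norm (1 / z))\<^sup>2 = (1 + (norm z)\<^sup>2) / (norm z)\<^sup>2"
      using False by (simp add: norm_divide power_divide field_simps)
    then show ?thesis using False
      by (simp add: sinv_def dist_Some_Some dist_Some_None real_sqrt_divide norm_divide)
  qed
  have Z: "dist (sinv (Some z)) (sinv (Some 0)) = dist (Some z) (Some 0)" for z
  proof (cases "z = 0")
    case False
    have "1 + (norm (1 / z))\<^sup>2 = (1 + (norm z)\<^sup>2) / (norm z)\<^sup>2"
      using False by (simp add: norm_divide power_divide field_simps)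
    then show ?thesis using False
      by (simp add: sinv_def dist_Some_Some dist_Some_None real_sqrt_divide norm_divide)
  qed auto
  show ?thesis
    using S N Z by (cases a; cases b) (auto, (metis dist_commute)+)
qed

lemma strans_strans [simp]: "strans c (strans d w) = strans (c + d) w" "strans 0 w = w"
  by (cases w; simp add: strans_def add.assoc)+

text \<open>Translations are not isometries. The constant comes from
  \<open>1 + |z|^2 \<le> 2 (1 + |c|^2) (1 + |c + z|^2)\<close>, applied at both ends of the
  chord.\<close>

lemma dist_strans_le: "dist (strans c a) (strans c b) \<le> 2 * (1 + (norm c)\<^sup>2) * dist a b"
proof -
  define K where "K = 2 * (1 + (norm c)\<^sup>2)"
  have K: "K \<ge> 1" by (simp add: K_def)
  have 1: "sqrt (1 + (norm z)\<^sup>2) \<le> sqrt K * sqrt (1 + (norm (c + z))\<^sup>2)" for z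
  proof -
    have "norm z \<le> norm (c + z) + norm c" by (metis add_diff_cancel_left' norm_triangle_ineq4)
    then have "(norm z)\<^sup>2 \<le> (norm (c + z) + norm c)\<^sup>2" by (simp add: power_mono)
    also have "\<dots> \<le> 2 * (norm (c + z))\<^sup>2 + 2 * (norm c)\<^sup>2" using sum_squares_bound[of "norm (c+z)" "norm c"] by (simp add: power2_sum)
    finally have "1 + (norm z)\<^sup>2 \<le> K * (1 + (norm (c + z))\<^sup>2)"
      by (simp add: K_def algebra_simps) (smt (verit) mult_nonneg_nonneg zero_le_power2)
    then show ?thesis by (metis real_sqrt_le_iff real_sqrt_mult)
  qed
  have sK: "sqrt K * sqrt K = K" "sqrt K \<ge> 1" using K by auto
  have "sqrt K \<le> K" using sK K by (metis mult_le_cancel_left1 order_trans zero_le_one linorder_not_less less_le_trans zero_less_one)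
  have pos: "sqrt (1 + (norm z)\<^sup>2) > 0" for z :: complex by simp
  have A: "dist (strans c (Some z)) (strans c (Some w)) \<le> K * dist (Some z) (Some w)" for z w
  proof -
    have "sqrt (1 + (norm z)\<^sup>2) * sqrt (1 + (norm w)\<^sup>2) \<le> (sqrt K * sqrt (1 + (norm (c + z))\<^sup>2)) * (sqrt K * sqrt (1 + (norm (c + w))\<^sup>2))"
      by (intro mult_mono 1) (auto intro!: mult_nonneg_nonneg simp: K_def)
    also have "\<dots> = K * (sqrt (1 + (norm (c + z))\<^sup>2) * sqrt (1 + (norm (c + w))\<^sup>2))"
      using sK(1) by (simp add: algebra_simps)
    finally have *: "sqrt (1 + (norm z)\<^sup>2) * sqrt (1 + (norm w)\<^sup>2) \<le> K * (sqrt (1 + (norm (c + z))\<^sup>2) * sqrt (1 + (norm (c + w))\<^sup>2))" .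
    have "n / B \<le> K * (n / A)" if "A \<le> K * B" "A > 0" "B > 0" "n \<ge> 0" for n A B :: real
    proof -
      have "n * A \<le> n * (K * B)" using that by (intro mult_left_mono) auto
      then show ?thesis using that by (simp add: field_simps)
    qed
    from this[OF *, of "2 * norm (z - w)"] show ?thesis
      by (simp add: strans_def dist_Some_Some pos)
  qed
  have B: "dist (strans c (Some z)) (strans c None) \<le> K * dist (Some z) None" for z
  proof -
    have "2 / sqrt (1 + (norm (c + z))\<^sup>2) \<le> K * (2 / sqrt (1 + (norm z)\<^sup>2))"
    proof -
      have "sqrt (1 + (norm z)\<^sup>2) \<le> K * sqrt (1 + (norm (c + z))\<^sup>2)"
        using 1[of z] \<open>sqrt K \<le> K\<close> by (smt (verit) mult_right_mono pos)
      then show ?thesis using pos[of z] pos[of "c + z"] by (simp add: field_simps)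
    qed
    then show ?thesis by (simp add: strans_def dist_Some_None)
  qed
  have "dist (strans c a) (strans c b) \<le> K * dist a b"
  proof (cases a)
    case None
    then show ?thesis using B by (cases b) (auto simp: dist_commute)
  next
    case (Some z)
    then show ?thesis using A B by (cases b) auto
  qed
  then show ?thesis by (simp add: K_def)
qed

lemma param_Some: "param (Some c) z = strans c (sinv (Some z))"
  by (simp add: param_def strans_def sinv_def)

lemma coord_Some: "w \<noteq> Some c \<Longrightarrow> coord (Some c) w = coord None (sinv (strans (-c) w))"
  by (auto simp: coord_def strans_def sinv_def split: option.split)

lemma dist_Some_Some_le: "dist (Some z) (Some (w::complex)) \<le> 2 * dist z w"
proof -
  have "1 \<le> sqrt (1 + (norm z)\<^sup>2) * sqrt (1 + (norm w)\<^sup>2)"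
    by (rule order_trans[OF _ mult_mono[of 1 _ 1]]) auto
  then have "2 * norm (z - w) / (sqrt (1 + (norm z)\<^sup>2) * sqrt (1 + (norm w)\<^sup>2)) \<le> 2 * norm (z - w) / 1"
    by (intro divide_left_mono) (auto intro!: mult_pos_pos)
  then show ?thesis by (simp add: dist_Some_Some dist_norm)
qed

lemma param_Lipschitz: "\<exists>K>0. \<forall>z w. dist (param e z) (param e w) \<le> K * dist z w"
proof (cases e)
  case None then show ?thesis using dist_Some_Some_le by (intro exI[of _ 2]) (auto simp: param_def)
next
  case (Some c)
  define K where "K = 2 * (1 + (norm c)\<^sup>2)"
  have K: "K \<ge> 1" by (simp add: K_def)
  have "dist (param e z) (param e w) \<le> (K * 2) * dist z w" for z w
  proof -
    have "dist (param e z) (param e w) \<le> K * dist (Some z) (Some w)"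
      unfolding Some param_Some K_def by (rule order_trans[OF dist_strans_le]) simp
    also have "\<dots> \<le> K * (2 * dist z w)" using K by (intro mult_left_mono dist_Some_Some_le) auto
    finally show ?thesis by simp
  qed
  then show ?thesis using K by (intro exI[of _ "K * 2"]) auto
qed

lemma coord_None_Lipschitz:
  assumes "\<eta> > 0"  "dist a None \<ge> \<eta>" "dist b None \<ge> \<eta>"
  shows "dist (coord None a) (coord None b) \<le> 2 / \<eta>\<^sup>2 * dist a b" "norm (coord None a) \<le> 2 / \<eta>"
proof -
  obtain z w where zw: "a = Some z" "b = Some w" using assms by (cases a; cases b) auto
  have p: "sqrt (1 + (norm u)\<^sup>2) > 0" for u :: complex by simp
  have 1: "sqrt (1 + (norm u)\<^sup>2) \<le> 2 / \<eta>" if "dist (Some u) None \<ge> \<eta>" for u :: complex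
    using that assms(1) p[of u] by (simp add: dist_Some_None field_simps)
  have z: "sqrt (1 + (norm z)\<^sup>2) \<le> 2 / \<eta>" "sqrt (1 + (norm w)\<^sup>2) \<le> 2 / \<eta>" using 1 zw assms by auto
  have "norm (z - w) = (sqrt (1 + (norm z)\<^sup>2) * sqrt (1 + (norm w)\<^sup>2)) / 2 * dist a b"
    using p[of z] p[of w] by (simp add: zw dist_Some_Some less_imp_neq[symmetric])
  also have "\<dots> \<le> ((2 / \<eta>) * (2 / \<eta>)) / 2 * dist a b"
    using z assms p[of z] p[of w] by (intro mult_right_mono divide_right_mono mult_mono) auto
  finally show "dist (coord None a) (coord None b) \<le> 2 / \<eta>\<^sup>2 * dist a b"
    by (simp add: zw coord_def dist_norm power2_eq_square)
  have "norm z \<le> sqrt (1 + (norm z)\<^sup>2)" by (intro real_le_rsqrt) auto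
  then show "norm (coord None a) \<le> 2 / \<eta>" using z by (simp add: zw coord_def)
qed

lemma coord_Lipschitz:
  assumes "\<eta> > 0"
  shows "\<exists>K>0. \<forall>a b. dist a e \<ge> \<eta> \<longrightarrow> dist b e \<ge> \<eta> \<longrightarrow>
           dist (coord e a) (coord e b) \<le> K * dist a b \<and> norm (coord e a) \<le> K"
proof (cases e)
  case None
  show ?thesis unfolding None
    using coord_None_Lipschitz[OF assms] assms
    by (intro exI[of _ "max (2 / \<eta>\<^sup>2) (2 / \<eta>)"])
       (auto simp: less_max_iff_disj le_max_iff_disj intro!: order_trans[OF coord_None_Lipschitz(1)[OF assms]] mult_right_mono)
next
  case (Some c)
  define K where "K = 2 * (1 + (norm c)\<^sup>2)"
  have K: "K \<ge> 1" by (simp add: K_def)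
  \<comment> \<open>A point at distance \<eta> from \<open>e\<close> is at distance at least
    \<theta> from infinity after \<open>e\<close> has been translated to 0 and inverted, so the
    estimate for the pole \<open>None\<close> applies.\<close>
  define \<theta> where "\<theta> = \<eta> / K"
  have \<theta>: "\<theta> > 0" using assms K by (simp add: \<theta>_def)
  have L: "dist (sinv (strans (-c) a)) (sinv (strans (-c) b)) \<le> K * dist a b" for a b
    using dist_strans_le[of "-c" a b] by (simp add: K_def)
  have far: "dist (sinv (strans (-c) a)) None \<ge> \<theta>" if "dist a e \<ge> \<eta>" for a
  proof -
    have "dist a e = dist (strans c (strans (-c) a)) (strans c (Some 0))"
      by (simp add: Some) (simp add: strans_def)
    also have "\<dots> \<le> K * dist (strans (-c) a) (Some 0)" unfolding K_def by (rule dist_strans_le)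
    also have "dist (strans (-c) a) (Some 0) = dist (sinv (strans (-c) a)) (sinv (Some 0))" by simp
    also have "sinv (Some 0) = None" by (simp add: sinv_def)
    finally show ?thesis using that K by (simp add: \<theta>_def field_simps)
  qed
  define C where "C = max (2 / \<theta>\<^sup>2 * K) (2 / \<theta>)"
  have "dist (coord e a) (coord e b) \<le> C * dist a b \<and> norm (coord e a) \<le> C" if "dist a e \<ge> \<eta>" "dist b e \<ge> \<eta>" for a b
  proof -
    have ne: "a \<noteq> Some c" "b \<noteq> Some c" using that assms Some by auto
    have "dist (coord e a) (coord e b) \<le> 2 / \<theta>\<^sup>2 * dist (sinv (strans (-c) a)) (sinv (strans (-c) b))"
      unfolding Some coord_Some[OF ne(1)] coord_Some[OF ne(2)]
      using far that by (intro coord_None_Lipschitz[OF \<theta>]) auto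
    also have "\<dots> \<le> 2 / \<theta>\<^sup>2 * (K * dist a b)" using L by (intro mult_left_mono) auto
    also have "\<dots> \<le> C * dist a b" unfolding C_def mult.assoc[symmetric] by (intro mult_right_mono) auto
    finally have 1: "dist (coord e a) (coord e b) \<le> C * dist a b" .
    have "norm (coord e a) \<le> 2 / \<theta>"
      unfolding Some coord_Some[OF ne(1)] using far that by (intro coord_None_Lipschitz[OF \<theta>]) auto
    then show ?thesis using 1 by (auto simp: C_def)
  qed
  moreover have "C > 0" using \<theta> by (simp add: C_def less_max_iff_disj)
  ultimately show ?thesis by blast
qed

text \<open>The charts with poles at infinity and at 0 cover the sphere with a uniform margin, so
  local statements can be checked in these two.\<close>

lemma far_chart: "\<exists>e\<in>{None, Some 0}. dist (x::sph) e \<ge> 1"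
proof -
  have "dist (None::sph) (Some 0) = 2" by (simp add: dist_None_Some)
  then show ?thesis
    using dist_triangle2[of None "Some 0" x] dist_commute[of x] by (smt (verit) insert_iff)
qed

lemma continuous_on_param: "continuous_on S (param e)"
proof -
  obtain K where "K > 0" "\<forall>z w. dist (param e z) (param e w) \<le> K * dist z w" using param_Lipschitz by blast
  then have "K-lipschitz_on S (param e)" by (auto simp: lipschitz_on_def)
  then show ?thesis by (rule lipschitz_on_continuous_on)
qed

lemma continuous_at_coord:
  assumes "a \<noteq> e" shows "isCont (coord e) a"
proof -
  define \<eta> where "\<eta> = dist a e / 2"
  have \<eta>: "\<eta> > 0" using assms by (simp add: \<eta>_def)
  obtain K where K: "K > 0" "\<And>a b. dist a e \<ge> \<eta> \<Longrightarrow> dist b e \<ge> \<eta> \<Longrightarrow> dist (coord e a) (coord e b) \<le> K * dist a b"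
    using coord_Lipschitz[OF \<eta>] by metis
  have "K-lipschitz_on (ball a \<eta>) (coord e)"
  proof (rule lipschitz_onI)
    fix x y assume xy: "x \<in> ball a \<eta>" "y \<in> ball a \<eta>"
    have "dist z e \<ge> \<eta>" if "z \<in> ball a \<eta>" for z
      using that dist_triangle[of a e z] by (simp add: \<eta>_def)
    then show "dist (coord e x) (coord e y) \<le> K * dist x y" using K xy by blast
  qed (use K in auto)
  then have "continuous_on (ball a \<eta>) (coord e)" by (rule lipschitz_on_continuous_on)
  then show ?thesis using \<eta> by (simp add: continuous_on_eq_continuous_at)
qed

section \<open>Holomorphic maps into the sphere\<close>

text \<open>The pole \<open>e\<close> may change from point to point, so that poles of meromorphic
  functions are points like all others.\<close>

definition shol :: "(complex \<Rightarrow> sph) \<Rightarrow> complex set \<Rightarrow> bool" where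
  "shol \<phi> S \<longleftrightarrow> (\<forall>z\<in>S. \<exists>T e k. open T \<and> z \<in> T \<and> k holomorphic_on T \<and> (\<forall>w\<in>T. \<phi> w = param e (k w)))"

definition smap :: "(sph \<Rightarrow> sph) \<Rightarrow> bool" where
  "smap f \<longleftrightarrow> (\<forall>e\<in>{None, Some 0}. shol (\<lambda>z. f (param e z)) UNIV)"

lemma shol_subset: "shol \<phi> S \<Longrightarrow> T \<subseteq> S \<Longrightarrow> shol \<phi> T"
  unfolding shol_def by blast

lemma shol_param: "shol (param e) S"
  unfolding shol_def by (intro ballI exI[of _ UNIV] exI[of _ e] exI[of _ "\<lambda>z. z"]) auto

lemma shol_isCont:
  assumes "shol \<phi> S" "z \<in> S" shows "isCont \<phi> z"
proof -
  obtain T e k where T: "open T" "z \<in> T" "k holomorphic_on T" "\<forall>w\<in>T. \<phi> w = param e (k w)"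
    using assms unfolding shol_def by metis
  have "continuous_on T (\<lambda>w. param e (k w))"
    using holomorphic_on_imp_continuous_on[OF T(3)] continuous_on_compose2[OF continuous_on_param[of UNIV]] by blast
  then have "continuous_on T \<phi>" using T(4) by (simp cong: continuous_on_cong)
  then show ?thesis using T(1,2) by (simp add: continuous_on_eq_continuous_at)
qed

lemma shol_continuous_on: "shol \<phi> S \<Longrightarrow> continuous_on S \<phi>"
  using shol_isCont continuous_at_imp_continuous_on by blast

lemma transition_holomorphic: "(\<lambda>z. coord e (param e' z)) holomorphic_on {z. param e' z \<noteq> e}"
proof (cases e; cases e')
  fix c assume e: "e = None" "e' = Some c"
  have "(\<lambda>z. c + 1 / z) holomorphic_on {z. param e' z \<noteq> e}"
    by (intro holomorphic_intros) (auto simp: param_def e)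
  then show ?thesis by (rule holomorphic_transform) (auto simp: param_def coord_def e)
next
  fix c assume e: "e = Some c" "e' = None"
  have "(\<lambda>z. 1 / (z - c)) holomorphic_on {z. param e' z \<noteq> e}"
    by (intro holomorphic_intros) (auto simp: param_def e)
  then show ?thesis by (rule holomorphic_transform) (auto simp: param_def coord_def e)
next
  fix c c' assume e: "e = Some c" "e' = Some c'"
  have nz: "1 + (c' - c) * z \<noteq> 0" if "param e' z \<noteq> e" for z
  proof (cases "z = 0")
    case False
    then have "c' + 1 / z \<noteq> c" using that by (simp add: param_def e)
    then show ?thesis using False by (simp add: field_simps)
  qed auto
  have "(\<lambda>z. z / (1 + (c' - c) * z)) holomorphic_on {z. param e' z \<noteq> e}"
    by (intro holomorphic_intros) (use nz in auto)
  then show ?thesis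
  proof (rule holomorphic_transform)
    fix z assume z: "z \<in> {z. param e' z \<noteq> e}"
    show "z / (1 + (c' - c) * z) = coord e (param e' z)"
    proof (cases "z = 0")
      case True then show ?thesis by (simp add: param_def coord_def e)
    next
      case False
      have "1 + (c' - c) * z = z * (c' + 1 / z - c)" using False by (simp add: field_simps)
      then show ?thesis using False by (simp add: param_def coord_def e)
    qed
  qed
next
  assume e: "e = None" "e' = None"
  have "(\<lambda>z. z) holomorphic_on {z. param e' z \<noteq> e}" by simp
  then show ?thesis by (rule holomorphic_transform) (auto simp: param_def coord_def e)
qed

lemma coord_holomorphic:
  assumes "shol \<phi> S" "open S" "\<And>z. z \<in> S \<Longrightarrow> \<phi> z \<noteq> e"
  shows "(\<lambda>z. coord e (\<phi> z)) holomorphic_on S"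
proof -
  have "(\<lambda>z. coord e (\<phi> z)) field_differentiable (at z)" if z: "z \<in> S" for z
  proof -
    obtain T e' k where T: "open T" "z \<in> T" "k holomorphic_on T" "\<forall>w\<in>T. \<phi> w = param e' (k w)"
      using assms(1) z unfolding shol_def by metis
    have k: "k ` (T \<inter> S) \<subseteq> {z. param e' z \<noteq> e}" using T(4) assms(3) by force
    have "((\<lambda>z. coord e (param e' z)) \<circ> k) holomorphic_on (T \<inter> S)"
      by (rule holomorphic_on_compose_gen[OF _ transition_holomorphic])
         (use k T(3) in \<open>auto intro: holomorphic_on_subset\<close>)
    then have "(\<lambda>z. coord e (\<phi> z)) holomorphic_on (T \<inter> S)"
      by (rule holomorphic_transform) (use T in auto)
    then show ?thesis using T z assms(2) by (auto simp: holomorphic_on_open field_differentiable_def open_Int)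
  qed
  then show ?thesis using assms(2) by (auto simp: holomorphic_on_open field_differentiable_def)
qed

lemma shol_chart:
  assumes "shol \<phi> S" "open S" "z \<in> S" "\<phi> z \<noteq> e"
  obtains T where "open T" "z \<in> T" "T \<subseteq> S" "(\<lambda>w. coord e (\<phi> w)) holomorphic_on T"
    "\<And>w. w \<in> T \<Longrightarrow> \<phi> w \<noteq> e" "\<And>w. w \<in> T \<Longrightarrow> \<phi> w = param e (coord e (\<phi> w))"
proof -
  define T where "T = S \<inter> \<phi> -` (- {e})"
  have "open T" unfolding T_def using shol_continuous_on[OF assms(1)] assms(2)
    by (intro continuous_open_preimage) auto
  moreover have "shol \<phi> T" using assms(1) by (rule shol_subset) (auto simp: T_def)
  ultimately show ?thesis using that[of T] coord_holomorphic[of \<phi> T e] assms by (auto simp: T_def)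
qed

lemma shol_compose:
  assumes f: "smap f" and \<phi>: "shol \<phi> S" "open S"
  shows "shol (\<lambda>z. f (\<phi> z)) S"
  unfolding shol_def
proof
  fix z assume z: "z \<in> S"
  obtain e where e: "e \<in> {None, Some 0}" "dist (\<phi> z) e \<ge> 1" using far_chart by blast
  then have "\<phi> z \<noteq> e" by auto
  then obtain T where T: "open T" "z \<in> T" "T \<subseteq> S" "(\<lambda>w. coord e (\<phi> w)) holomorphic_on T"
      "\<And>w. w \<in> T \<Longrightarrow> \<phi> w = param e (coord e (\<phi> w))" using shol_chart[OF \<phi> z] by metis
  obtain T' e' k where T': "open T'" "coord e (\<phi> z) \<in> T'" "k holomorphic_on T'"
      "\<And>w. w \<in> T' \<Longrightarrow> f (param e w) = param e' (k w)"
    using f e unfolding smap_def shol_def by (metis UNIV_I)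
  define U where "U = T \<inter> (\<lambda>w. coord e (\<phi> w)) -` T'"
  have "open U" unfolding U_def using holomorphic_on_imp_continuous_on[OF T(4)] T(1) T'(1)
    by (intro continuous_open_preimage) auto
  moreover have "z \<in> U" using T T' by (auto simp: U_def)
  moreover have "(k \<circ> (\<lambda>w. coord e (\<phi> w))) holomorphic_on U"
    by (rule holomorphic_on_compose_gen[OF _ T'(3)])
       (use T(4) in \<open>auto simp: U_def intro: holomorphic_on_subset\<close>)
  moreover have "\<forall>w\<in>U. f (\<phi> w) = param e' ((k \<circ> (\<lambda>w. coord e (\<phi> w))) w)"
    using T(5) T'(4) by (auto simp: U_def) metis
  ultimately show "\<exists>T e k. open T \<and> z \<in> T \<and> k holomorphic_on T \<and> (\<forall>w\<in>T. f (\<phi> w) = param e (k w))"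
    by blast
qed

lemma smap_param: "smap f \<Longrightarrow> shol (\<lambda>z. f (param e z)) S"
  using shol_compose[OF _ shol_param open_UNIV] shol_subset by blast

lemma smap_comp: "smap f \<Longrightarrow> smap g \<Longrightarrow> smap (f \<circ> g)"
  unfolding smap_def[of "f \<circ> g"] using shol_compose[OF _ smap_param[of g _ UNIV]] by simp

lemma smap_id: "smap id" "smap (\<lambda>x. x)"
  by (auto simp: smap_def shol_param)

lemma smap_isCont:
  assumes "smap f" shows "isCont f x"
proof -
  obtain e where e: "dist x e \<ge> 1" using far_chart by blast
  then have xe: "x \<noteq> e" by auto
  have "isCont (\<lambda>z. f (param e z)) (coord e x)"
    using shol_isCont[OF smap_param[OF assms, of e UNIV]] by simp
  moreover have "isCont (coord e) x" using continuous_at_coord[OF xe] .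
  ultimately have "isCont (\<lambda>y. f (param e (coord e y))) x"
    using isCont_o2 by fastforce
  moreover have "eventually (\<lambda>y. f (param e (coord e y)) = f y) (nhds x)"
  proof -
    have "eventually (\<lambda>y. y \<in> - {e}) (nhds x)" using xe by (intro eventually_nhds_in_open) auto
    then show ?thesis by (rule eventually_mono) simp
  qed
  ultimately show ?thesis using isCont_cong by fastforce
qed

lemma smap_continuous_on: "smap f \<Longrightarrow> continuous_on S f"
  by (simp add: continuous_at_imp_continuous_on smap_isCont)

lemma open_param_image:
  assumes "open W" shows "open (param e ` W)"
proof -
  have eq: "param e ` W = (- {e}) \<inter> coord e -` W"
    by (auto simp: image_iff) (metis param_coord)
  have "continuous_on (- {e}) (coord e)"
    by (rule continuous_at_imp_continuous_on) (auto intro: continuous_at_coord)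
  then show ?thesis unfolding eq using assms by (intro continuous_open_preimage) auto
qed

lemma infinite_ball_complex: "r > 0 \<Longrightarrow> infinite (ball (z::complex) r)"
  using uncountable_ball countable_finite by blast

text \<open>In charts the map is holomorphic, and a disc on which it is constant would give an
  infinite fibre; so the open mapping theorem applies.\<close>

lemma smap_open_map:
  assumes f: "smap f" and fin: "\<And>y. finite (f -` {y})" and U: "open U"
  shows "open (f ` U)"
proof -
  have "\<exists>T. open T \<and> y \<in> T \<and> T \<subseteq> f ` U" if "y \<in> f ` U" for y
proof -
  from that obtain x where x: "x \<in> U" "y = f x" by blast
  obtain e where e: "dist x e \<ge> 1" using far_chart by blast
  then have xe: "x \<noteq> e" by auto
  obtain e' where e': "dist (f x) e' \<ge> 1" using far_chart by blast
  then have ye: "f (param e (coord e x)) \<noteq> e'" using xe by auto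
  obtain T where T: "open T" "coord e x \<in> T" "(\<lambda>w. coord e' (f (param e w))) holomorphic_on T"
    "\<And>w. w \<in> T \<Longrightarrow> f (param e w) = param e' (coord e' (f (param e w)))"
    using shol_chart[OF smap_param[OF f, of e UNIV] open_UNIV UNIV_I ye] by metis
  have "open (T \<inter> param e -` U)"
    using T(1) U continuous_on_param by (intro continuous_open_preimage) auto
  then obtain r where r: "r > 0" "ball (coord e x) r \<subseteq> T \<inter> param e -` U"
    using T(2) x xe by (metis IntI open_contains_ball_eq param_coord vimageI)
  define B where "B = ball (coord e x) r"
  have "open ((\<lambda>w. coord e' (f (param e w))) ` B)"
  proof (rule open_mapping_thm[of _ B])
    show "(\<lambda>w. coord e' (f (param e w))) holomorphic_on B"
      using T(3) r by (auto simp: B_def intro: holomorphic_on_subset)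
    show "\<not> (\<lambda>w. coord e' (f (param e w))) constant_on B"
    proof
      assume "(\<lambda>w. coord e' (f (param e w))) constant_on B"
      then obtain c where c: "\<And>w. w \<in> B \<Longrightarrow> coord e' (f (param e w)) = c" unfolding constant_on_def by blast
      have "f (param e w) = param e' c" if w: "w \<in> B" for w
        using T(4)[of w] c[OF w] r w by (auto simp: B_def)
      then have "param e ` B \<subseteq> f -` {param e' c}" by auto
      then have "finite (param e ` B)" using fin finite_subset by blast
      then have "finite B" using inj_param by (metis finite_imageD inj_on_subset subset_UNIV)
      then show False using infinite_ball_complex r by (auto simp: B_def)
    qed
  qed (auto simp: B_def)
  then have "open (param e' ` (\<lambda>w. coord e' (f (param e w))) ` B)" by (rule open_param_image)
  also have "param e' ` (\<lambda>w. coord e' (f (param e w))) ` B = f ` param e ` B"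
    using T(4) r by (force simp: B_def image_image)
  finally have "open (f ` param e ` B)" .
  moreover have "y \<in> f ` param e ` B" using x xe r by (auto simp: B_def intro!: image_eqI[of _ _ "param e (coord e x)"])
  moreover have "f ` param e ` B \<subseteq> f ` U" using r by (auto simp: B_def)
  ultimately show ?thesis by blast
qed
  then show ?thesis using open_subopen by blast
qed

text \<open>The image is open and compact in a connected space.\<close>

lemma smap_surj:
  assumes f: "smap f" and fin: "\<And>y. finite (f -` {y})"
  shows "surj f"
proof -
  have "open (range f)" by (rule smap_open_map[OF f fin]) auto
  moreover have "closed (range f)"
    by (intro compact_imp_closed compact_continuous_image smap_continuous_on f compact_UNIV_sph)
  ultimately show ?thesis
    using connected_UNIV_sph connected_clopen[of "UNIV::sph set"] by (auto simp: connected_clopen)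
qed

text \<open>Near a point the lift is a holomorphic local inverse of \<open>f\<close> composed with
  \<open>q\<close>; continuity of \<open>h\<close> keeps it on the sheet where \<open>f\<close> is
  injective.\<close>

lemma shol_lift:
  assumes f: "smap f" and q: "shol q S" "open S" and h: "continuous_on S h"
    and fh: "\<And>z. z \<in> S \<Longrightarrow> f (h z) = q z"
    and inj: "\<And>z. z \<in> S \<Longrightarrow> \<exists>U. open U \<and> h z \<in> U \<and> inj_on f U"
  shows "shol h S"
  unfolding shol_def
proof
  fix z assume z: "z \<in> S"
  obtain e where e: "dist (h z) e \<ge> 1" using far_chart by blast
  then have he: "h z \<noteq> e" by auto
  obtain e' where e': "dist (q z) e' \<ge> 1" using far_chart by blast
  then have qe: "q z \<noteq> e'" by auto
  obtain U where U: "open U" "h z \<in> U" "inj_on f U" using inj z by blast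
  define F where "F = (\<lambda>w. coord e' (f (param e w)))"
  have "f (param e (coord e (h z))) \<noteq> e'" using he qe fh z by simp
  then obtain T where T: "open T" "coord e (h z) \<in> T" "F holomorphic_on T"
    "\<And>w. w \<in> T \<Longrightarrow> f (param e w) = param e' (F w)"
    unfolding F_def using shol_chart[OF smap_param[OF f, of e UNIV] open_UNIV UNIV_I, of "coord e (h z)" e'] by metis
  define B where "B = T \<inter> param e -` U"
  have B: "open B" "coord e (h z) \<in> B" unfolding B_def
    using T(1,2) U he continuous_on_param by (auto intro: continuous_open_preimage)
  have FB: "F holomorphic_on B" using T(3) by (rule holomorphic_on_subset) (auto simp: B_def)
  have "inj_on F B"
  proof (rule inj_onI)
    fix x y assume xy: "x \<in> B" "y \<in> B" "F x = F y"
    then have "f (param e x) = f (param e y)" using T(4) by (simp add: B_def)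
    then have "param e x = param e y" using xy U(3) by (auto simp: B_def dest: inj_onD)
    then show "x = y" using inj_param by (metis injD)
  qed
  then obtain g where g: "g holomorphic_on (F ` B)" "\<And>w. w \<in> B \<Longrightarrow> g (F w) = w"
    using holomorphic_has_inverse[OF FB B(1)] by metis
  define V where "V = S \<inter> h -` (param e ` B)"
  have V: "open V" unfolding V_def using h q(2) B(1) open_param_image by (intro continuous_open_preimage) auto
  have zV: "z \<in> V" using z B(2) he by (auto simp: V_def intro!: image_eqI[of _ _ "coord e (h z)"])
  have q': "q w = param e' (F (coord e (h w)))" "coord e (h w) \<in> B" "h w = param e (coord e (h w))" if "w \<in> V" for w
    using that T(4) fh[of w] by (auto simp: V_def B_def)
  have qV: "(\<lambda>w. coord e' (q w)) holomorphic_on V"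
    by (rule coord_holomorphic[OF shol_subset[OF q(1)] V]) (use q' in \<open>auto simp: V_def\<close>)
  have "(g \<circ> (\<lambda>w. coord e' (q w))) holomorphic_on V"
    by (rule holomorphic_on_compose_gen[OF qV g(1)]) (use q' in auto)
  moreover have "h w = param e ((g \<circ> (\<lambda>w. coord e' (q w))) w)" if "w \<in> V" for w
    using q'[OF that] g(2) by simp
  ultimately show "\<exists>T e k. open T \<and> z \<in> T \<and> k holomorphic_on T \<and> (\<forall>w\<in>T. h w = param e (k w))"
    using V zV by blast
qed

section \<open>Rational maps\<close>

lemma shol_quotient:
  assumes "\<And>z. \<not> (poly P z = 0 \<and> poly Q z = 0)"
  shows "shol (\<lambda>z. if poly Q z = 0 then None else Some (poly P z / poly Q z)) S"
  unfolding shol_def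
proof
  fix z assume "z \<in> S"
  have op: "open {w. poly R w \<noteq> 0}" for R :: "complex poly"
  proof -
    have "open (poly R -` (- {0}))" by (rule open_vimage) (auto intro: continuous_intros)
    then show ?thesis by (simp add: vimage_def)
  qed
  show "\<exists>T e k. open T \<and> z \<in> T \<and> k holomorphic_on T \<and>
      (\<forall>w\<in>T. (if poly Q w = 0 then None else Some (poly P w / poly Q w)) = param e (k w))"
  proof (cases "poly Q z = 0")
    case False
    then show ?thesis
      by (intro exI[of _ "{w. poly Q w \<noteq> 0}"] exI[of _ None] exI[of _ "\<lambda>w. poly P w / poly Q w"])
         (auto simp: op param_def intro!: holomorphic_intros)
  next
    case True
    then have "poly P z \<noteq> 0" using assms by blast
    then show ?thesis
      by (intro exI[of _ "{w. poly P w \<noteq> 0}"] exI[of _ "Some 0"] exI[of _ "\<lambda>w. poly Q w / poly P w"])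
         (auto simp: op param_def intro!: holomorphic_intros)
  qed
qed

lemma coprime_poly_no_common_root:
  fixes P Q :: "complex poly" assumes "coprime P Q" shows "\<not> (poly P z = 0 \<and> poly Q z = 0)"
proof
  assume "poly P z = 0 \<and> poly Q z = 0"
  then have "[:-z, 1:] dvd P" "[:-z, 1:] dvd Q" by (auto simp: poly_eq_0_iff_dvd)
  then have "is_unit [:-z, 1:]" using assms coprime_common_divisor by blast
  then show False by (simp add: is_unit_iff_degree)
qed

lemma rat_eval_chart_infinity:
  assumes cop: "coprime P Q" and Q: "Q \<noteq> 0"
  shows "\<exists>P' Q'. (\<forall>z. \<not> (poly P' z = 0 \<and> poly Q' z = 0)) \<and>
    (\<forall>z. rat_eval P Q (param (Some 0) z) = (if poly Q' z = 0 then None else Some (poly P' z / poly Q' z)))"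
proof -
  define d where "d = max (degree P) (degree Q)"
  \<comment> \<open>\<open>rv R\<close> is z^d R(1/z), the reversal of the coefficients relative to
    the common degree \<open>d\<close>. The quotient is unchanged off 0, and for
    \<open>R \<noteq> 0\<close> a zero of \<open>rv R\<close> at 0 means that the degree of
    \<open>R\<close> is below \<open>d\<close>.\<close>
  define rv where "rv R = monom 1 (d - degree R) * reflect_poly R" for R :: "complex poly"
  have nz: "poly (rv R) z = z ^ d * poly R (1 / z)" if "z \<noteq> 0" "degree R \<le> d" for z R
    using that by (simp add: rv_def poly_monom poly_reflect_poly_nz power_add[symmetric] inverse_eq_divide)
  have z0: "poly (rv R) 0 = (if degree R < d then 0 else lead_coeff R)" if "degree R \<le> d" for R
    using that by (simp only: rv_def poly_mult poly_monom poly_0_coeff_0[of "reflect_poly R"] coeff_0_reflect_poly) (simp add: power_0_left)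
  have dd: "degree P \<le> d" "degree Q \<le> d" by (auto simp: d_def)
  have lead: "poly (rv Q) 0 \<noteq> 0 \<longleftrightarrow> \<not> degree P > degree Q"
    using Q by (auto simp: z0[OF dd(2)] d_def)
  have "\<not> (poly (rv P) z = 0 \<and> poly (rv Q) z = 0)" for z
  proof (cases "z = 0")
    case True
    show ?thesis
    proof (cases "degree P > degree Q")
      case True': True
      then have "P \<noteq> 0" by auto
      then have "poly (rv P) 0 \<noteq> 0" using True' by (simp add: z0[OF dd(1)] d_def)
      then show ?thesis using True by simp
    qed (use True lead in auto)
  next
    case False
    then show ?thesis using coprime_poly_no_common_root[OF cop, of "1 / z"] dd by (auto simp: nz)
  qed
  moreover have "rat_eval P Q (param (Some 0) z) = (if poly (rv Q) z = 0 then None else Some (poly (rv P) z / poly (rv Q) z))" for z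
  proof (cases "z = 0")
    case True
    have "poly (rv P) 0 / poly (rv Q) 0 = (if degree P = degree Q then lead_coeff P / lead_coeff Q else 0)" if "\<not> degree P > degree Q"
      using that by (auto simp: z0[OF dd(1)] z0[OF dd(2)] d_def)
    then show ?thesis using True lead by (auto simp: param_def rat_eval_def)
  next
    case False
    then show ?thesis using dd by (auto simp: param_def rat_eval_def nz)
  qed
  ultimately show ?thesis by blast
qed

lemma rational_smap:
  assumes "rational_map f d" shows "smap f"
proof -
  obtain P Q where PQ: "coprime P Q" "Q \<noteq> 0" "f = rat_eval P Q"
    using assms unfolding rational_map_def by blast
  have "(\<lambda>z. f (param None z)) = (\<lambda>z. if poly Q z = 0 then None else Some (poly P z / poly Q z))"
    by (auto simp: PQ rat_eval_def param_def)
  then have 1: "shol (\<lambda>z. f (param None z)) UNIV"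
    using shol_quotient[OF coprime_poly_no_common_root[OF PQ(1)]] by simp
  obtain P' Q' where PQ': "\<And>z. \<not> (poly P' z = 0 \<and> poly Q' z = 0)"
    "\<And>z. f (param (Some 0) z) = (if poly Q' z = 0 then None else Some (poly P' z / poly Q' z))"
    using rat_eval_chart_infinity[OF PQ(1,2)] PQ(3) by metis
  have "shol (\<lambda>z. f (param (Some 0) z)) UNIV"
    unfolding PQ'(2) by (rule shol_quotient) (use PQ'(1) in blast)
  then show ?thesis using 1 by (simp add: smap_def)
qed

lemma rational_finite_fibre:
  assumes "rational_map f d" "d \<ge> 1" shows "finite (f -` {y})"
proof -
  obtain P Q where PQ: "coprime P Q" "Q \<noteq> 0" "max (degree P) (degree Q) = d" "f = rat_eval P Q"
    using assms unfolding rational_map_def by blast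
  have "finite {z. f (Some z) = y}"
  proof (cases y)
    case None
    then have "{z. f (Some z) = y} = {z. poly Q z = 0}" by (auto simp: PQ rat_eval_def)
    then show ?thesis using poly_roots_finite[OF PQ(2)] by simp
  next
    case (Some c)
    have "P - smult c Q \<noteq> 0"
    proof
      assume "P - smult c Q = 0"
      then have P: "P = smult c Q" by simp
      then have "Q dvd P" by (simp add: dvd_smult)
      then have "is_unit Q" using PQ(1) by (metis coprime_common_divisor dvd_refl)
      then have "degree Q = 0" using PQ(2) by (simp add: is_unit_iff_degree)
      then show False using P PQ(3) assms(2) by (simp split: if_splits)
    qed
    moreover have "{z. f (Some z) = y} \<subseteq> {z. poly (P - smult c Q) z = 0}"
      by (auto simp: PQ rat_eval_def Some field_simps split: if_splits)
    ultimately show ?thesis using poly_roots_finite finite_subset by blast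
  qed
  moreover have "f -` {y} \<subseteq> insert None (Some ` {z. f (Some z) = y})"
    by (auto simp: image_iff) (metis option.exhaust)
  ultimately show ?thesis using finite_subset by blast
qed

text \<open>Outside the zeros of the Wronskian \<open>W\<close>, of \<open>Q\<close> and of
  \<open>bad\<close>, a point z is a simple zero of P - f(z) Q, and this polynomial has degree at
  least 2; another of its zeros is a second preimage of f(z).\<close>

lemma rational_not_inj:
  assumes "rational_map f d" "d \<ge> 2" shows "\<exists>a b. a \<noteq> b \<and> f a = f b"
proof -
  obtain P Q where PQ: "coprime P Q" "Q \<noteq> 0" "max (degree P) (degree Q) = d" "f = rat_eval P Q"
    using assms unfolding rational_map_def by blast
  define W where "W = pderiv P * Q - P * pderiv Q"
  have W: "W \<noteq> 0"
  proof
    assume "W = 0"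
    then have e: "pderiv P * Q = P * pderiv Q" by (simp add: W_def)
    \<comment> \<open>At a zero of \<open>Q\<close> the left side of \<open>e\<close> vanishes at
      least to the order of \<open>Q\<close>, the right side to one order less.\<close>
    have nQ: "poly Q z \<noteq> 0" for z
    proof
      assume z: "poly Q z = 0"
      then have Pz: "poly P z \<noteq> 0" using coprime_poly_no_common_root[OF PQ(1)] by blast
      then have "P \<noteq> 0" by auto
      have "pderiv Q \<noteq> 0"
      proof
        assume "pderiv Q = 0"
        then have "degree Q = 0" by (simp add: pderiv_eq_0_iff)
        then obtain c where "Q = [:c:]" by (rule degree_eq_zeroE)
        then show False using z PQ(2) by simp
      qed
      moreover have o: "order z Q \<noteq> 0" using z PQ(2) by (simp add: order_root)
      ultimately have "order z Q = Suc (order z (pderiv Q))" using order_pderiv[of Q z] PQ(2) z by auto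
      moreover have n: "P * pderiv Q \<noteq> 0" using \<open>P \<noteq> 0\<close> \<open>pderiv Q \<noteq> 0\<close> by simp
      then have "order z (P * pderiv Q) = order z P + order z (pderiv Q)" by (rule order_mult)
      moreover have "order z P = 0" using Pz by (simp add: order_root)
      moreover have "order z (pderiv P * Q) = order z (pderiv P) + order z Q"
        using n e by (intro order_mult) auto
      ultimately show False using e by simp
    qed
    have q: "degree Q = 0"
      using nQ alg_closed_imp_poly_has_root[of Q] by auto
    then have "pderiv Q = 0" by (simp add: pderiv_eq_0_iff)
    then have "pderiv P = 0" using e PQ(2) by simp
    then show False using q PQ(3) assms(2) by (simp add: pderiv_eq_0_iff)
  qed
  \<comment> \<open>If deg P \<le> deg Q, the zeros of \<open>bad\<close> off those of
    \<open>Q\<close> are the points with the same value as infinity, the one value c for which P - c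
    Q drops in degree.\<close>
  define bad where "bad = (if degree P = degree Q then P - smult (lead_coeff P / lead_coeff Q) Q else P)"
  have bad: "bad \<noteq> 0"
  proof (cases "degree P = degree Q")
    case True
    define c where "c = lead_coeff P / lead_coeff Q"
    have "P - smult c Q \<noteq> 0"
    proof
      assume "P - smult c Q = 0"
      then have P: "P = smult c Q" by simp
      then have "Q dvd P" by (simp add: dvd_smult)
      then have "is_unit Q" using PQ(1) by (metis coprime_common_divisor dvd_refl)
      then have "degree Q = 0" using PQ(2) by (simp add: is_unit_iff_degree)
      then show False using P PQ(3) assms(2) by (simp split: if_splits)
    qed
    then show ?thesis by (simp add: bad_def True c_def)
  next
    case False
    have "P \<noteq> 0"
    proof
      assume "P = 0"
      then have "is_unit Q" using PQ(1) by simp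
      then have "degree Q = 0" using PQ(2) by (simp add: is_unit_iff_degree)
      then show False using \<open>P = 0\<close> PQ(3) assms(2) by simp
    qed
    then show ?thesis using False by (simp add: bad_def)
  qed
  have "finite {z. poly (W * Q * bad) z = 0}" using W PQ(2) bad by (intro poly_roots_finite) simp
  then obtain z where "poly (W * Q * bad) z \<noteq> 0"
    by (metis (mono_tags, lifting) ex_new_if_finite infinite_UNIV_char_0 mem_Collect_eq)
  then have z: "poly W z \<noteq> 0" "poly Q z \<noteq> 0" "poly bad z \<noteq> 0" by auto
  define c where "c = poly P z / poly Q z"
  define R where "R = P - smult c Q"
  have "degree R \<ge> 2"
  proof (cases "degree P = degree Q")
    case True
    have "c \<noteq> lead_coeff P / lead_coeff Q" using z True by (auto simp: bad_def c_def nonzero_divide_eq_eq)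
    then have "coeff R (degree P) \<noteq> 0" using PQ(2) True by (auto simp: R_def field_simps)
    then show ?thesis using True PQ(3) assms(2) by (metis le_degree max.idem order_trans)
  next
    case False
    consider "degree P > degree Q" | "degree P < degree Q" using False by linarith
    then show ?thesis
    proof cases
      case 1
      then have "coeff R (degree P) \<noteq> 0" by (auto simp: R_def coeff_eq_0)
      then show ?thesis using 1 PQ(3) assms(2) by (metis le_degree max.absorb3 order_trans)
    next
      case 2
      then have "c \<noteq> 0" using z by (simp add: bad_def c_def)
      then have "coeff R (degree Q) \<noteq> 0" using 2 PQ(2) by (auto simp: R_def coeff_eq_0)
      then show ?thesis using 2 PQ(3) assms(2) by (metis le_degree max.absorb4 order_trans)
    qed
  qed
  have "poly R z = 0" using z by (simp add: R_def c_def)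
  then obtain R' where R': "R = [:-z, 1:] * R'" by (auto simp: poly_eq_0_iff_dvd elim: dvdE)
  have "R \<noteq> 0" using \<open>degree R \<ge> 2\<close> by auto
  then have "degree R = 1 + degree R'" unfolding R' by (subst degree_mult_eq) auto
  then have "degree R' > 0" using \<open>degree R \<ge> 2\<close> by simp
  then obtain z2 where z2: "poly R' z2 = 0" using alg_closed_imp_poly_has_root by blast
  have "z2 \<noteq> z"
  proof
    assume "z2 = z"
    have "pderiv R = [:-z, 1:] * pderiv R' + R' * pderiv [:-z, 1:]" unfolding R' by (rule pderiv_mult)
    then have "poly (pderiv R) z = 0" using z2 \<open>z2 = z\<close> by simp
    then have "poly (pderiv P) z = c * poly (pderiv Q) z" by (simp add: R_def pderiv_diff pderiv_smult)
    then have "poly W z = 0" using z by (simp add: W_def c_def)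
    then show False using z by simp
  qed
  moreover have R2: "poly R z2 = 0" using z2 by (simp add: R')
  have q2: "poly Q z2 \<noteq> 0"
    using R2 coprime_poly_no_common_root[OF PQ(1), of z2] by (auto simp: R_def)
  then have "f (Some z2) = f (Some z)"
    using R2 z by (simp add: PQ rat_eval_def R_def c_def)
  ultimately show ?thesis by blast
qed

section \<open>Distortion of univalent functions\<close>

text \<open>A logarithm of a univalent function with values off 0 is univalent modulo 2 pi i, so by
  Bloch's theorem its derivative is bounded.\<close>

lemma univalent_deriv_bound:
  assumes hol: "k holomorphic_on ball z r" and inj: "inj_on k (ball z r)" and r: "r > 0"
    and a: "\<And>w. w \<in> ball z r \<Longrightarrow> k w \<noteq> a"
  shows "r * norm (deriv k z) \<le> 12 * (2 * pi) * norm (k z - a)"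
proof -
  have nz: "k w - a \<noteq> 0" if "w \<in> ball z r" for w using a[OF that] by simp
  obtain l where l: "l holomorphic_on ball z r" "\<And>w. w \<in> ball z r \<Longrightarrow> k w - a = exp (l w)"
  proof (rule contractible_imp_holomorphic_log[of "\<lambda>w. k w - a" "ball z r"])
    show "(\<lambda>w. k w - a) holomorphic_on ball z r" using hol by (intro holomorphic_intros)
  qed (use nz in \<open>auto simp: convex_imp_contractible\<close>)
  have z: "z \<in> ball z r" using r by simp
  have dl: "deriv k z = exp (l z) * deriv l z"
  proof -
    have "(l has_field_derivative deriv l z) (at z)"
      using l(1) z by (metis holomorphic_derivI open_ball)
    then have "((\<lambda>w. exp (l w) + a) has_field_derivative exp (l z) * deriv l z) (at z)"
      by (auto intro!: derivative_eq_intros)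
    moreover have ev: "eventually (\<lambda>w. exp (l w) + a = k w) (nhds z)"
    proof -
      have "eventually (\<lambda>w. w \<in> ball z r) (nhds z)" using z by (intro eventually_nhds_in_open) auto
      then show ?thesis by (rule eventually_mono) (use l(2) in \<open>simp add: algebra_simps\<close>)
    qed
    ultimately have "(k has_field_derivative exp (l z) * deriv l z) (at z)"
      using DERIV_cong_ev[OF refl ev refl] by simp
    then show ?thesis by (rule DERIV_imp_deriv)
  qed
  have "r * norm (deriv l z) / 12 \<le> 2 * pi"
  proof (rule ccontr)
    assume c: "\<not> ?thesis"
    define X where "X = r * norm (deriv l z) / 12"
    obtain b where b: "ball b X \<subseteq> l ` ball z r"
      using Bloch[OF l(1) r order_refl] unfolding X_def by blast
    have "2 * pi < X" using c by (simp add: X_def)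
    moreover have "0 < X" using calculation pi_gt_zero by linarith
    ultimately have "b \<in> ball b X" "b + 2 * of_real pi * \<i> \<in> ball b X"
      by (auto simp: dist_norm norm_mult)
    then have "b \<in> l ` ball z r" "b + 2 * of_real pi * \<i> \<in> l ` ball z r" using b by blast+
    then obtain w1 w2 where w: "w1 \<in> ball z r" "l w1 = b" "w2 \<in> ball z r" "l w2 = b + 2 * of_real pi * \<i>"
      unfolding image_iff by (elim bexE) auto
    have "exp (l w1) = exp (l w2)" by (simp add: w exp_add exp_two_pi_i)
    then have "k w1 = k w2" using l(2) w by (metis diff_add_cancel)
    then have "w1 = w2" using inj w by (meson inj_onD)
    then show False using w by auto
  qed
  then have "r * norm (deriv l z) \<le> 12 * (2 * pi)" by simp
  then have "norm (exp (l z)) * (r * norm (deriv l z)) \<le> norm (exp (l z)) * (12 * (2 * pi))"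
    by (intro mult_left_mono) auto
  then show ?thesis using l(2)[OF z] by (simp add: dl norm_mult mult_ac)
qed

text \<open>The quotient \<open>(k w - k z) / (w - z)\<close> is zero free; the maximum principle transfers the
  bound on its logarithmic derivative from a circle to the disc.\<close>

lemma univalent_distortion:
  assumes hol: "k holomorphic_on ball z (2 * r)" and inj: "inj_on k (ball z (2 * r))" and r: "r > 0"
    and w: "norm (w - z) < r"
  shows "norm (deriv k z) * norm (w - z) \<le> exp (24 * pi + 1) * norm (k w - k z)"
    and "norm (k w - k z) \<le> exp (24 * pi + 1) * norm (deriv k z) * norm (w - z)"
proof -
  define B where "B = ball z (2 * r)"
  define \<psi> where "\<psi> u = (if u = z then deriv k z else (k u - k z) / (u - z))" for u
  have holB: "k holomorphic_on B" using hol by (simp add: B_def)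
  have zB: "z \<in> B" using r by (simp add: B_def)
  have \<psi>: "\<psi> holomorphic_on B" unfolding \<psi>_def B_def
    by (rule pole_lemma_open[OF hol, of z]) auto
  have nz: "\<psi> u \<noteq> 0" if "u \<in> B" for u
  proof (cases "u = z")
    case True
    have "deriv k z \<noteq> 0" using holomorphic_injective_imp_regular[OF holB _ _ zB] inj by (auto simp: B_def)
    then show ?thesis using True by (simp add: \<psi>_def)
  next
    case False
    then have "k u \<noteq> k z" using inj that zB by (auto simp: B_def dest: inj_onD)
    then show ?thesis using False by (simp add: \<psi>_def)
  qed
  obtain m where m: "m holomorphic_on B" "\<And>u. u \<in> B \<Longrightarrow> \<psi> u = exp (m u)"
  proof (rule contractible_imp_holomorphic_log[OF \<psi>])
    show "contractible B" by (simp add: B_def convex_imp_contractible)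
  qed (use nz in auto)
  have dm: "deriv m u = deriv k u / (k u - k z) - 1 / (u - z)" if u: "u \<in> B" "u \<noteq> z" for u
  proof -
    have ku: "k u \<noteq> k z" using inj u zB by (auto simp: B_def dest: inj_onD)
    have "(m has_field_derivative deriv m u) (at u)"
      using m(1) u by (metis B_def holomorphic_derivI open_ball)
    then have "((\<lambda>v. exp (m v)) has_field_derivative exp (m u) * deriv m u) (at u)"
      by (auto intro!: derivative_eq_intros)
    moreover have ev: "eventually (\<lambda>v. exp (m v) = (k v - k z) / (v - z)) (nhds u)"
    proof -
      have "eventually (\<lambda>v. v \<in> B - {z}) (nhds u)" using u by (intro eventually_nhds_in_open) (auto simp: B_def)
      then show ?thesis by (rule eventually_mono) (metis (no_types, lifting) DiffE \<psi>_def insertCI m(2))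
    qed
    ultimately have "((\<lambda>v. (k v - k z) / (v - z)) has_field_derivative exp (m u) * deriv m u) (at u)"
      using DERIV_cong_ev[OF refl ev refl] by simp
    moreover have "(k has_field_derivative deriv k u) (at u)"
      using holB u by (metis B_def holomorphic_derivI open_ball)
    then have "((\<lambda>v. (k v - k z) / (v - z)) has_field_derivative
        (deriv k u * (u - z) - (k u - k z)) / ((u - z) * (u - z))) (at u)"
      using u by (auto intro!: derivative_eq_intros)
    ultimately have e: "exp (m u) * deriv m u = (deriv k u * (u - z) - (k u - k z)) / ((u - z) * (u - z))"
      by (rule DERIV_unique)
    have "exp (m u) = (k u - k z) / (u - z)" using m(2)[OF u(1)] u(2) by (simp add: \<psi>_def)
    then have e': "(k u - k z) / (u - z) * deriv m u = (deriv k u * (u - z) - (k u - k z)) / ((u - z) * (u - z))"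
      using e by simp
    have gen: "d = D / a - 1 / b" if "a \<noteq> 0" "b \<noteq> 0" "a / b * d = (D * b - a) / (b * b)" for a b d D :: complex
    proof -
      have "a * d = a / b * d * b" using that(1,2) by simp
      also have "a / b * d = (D * b - a) / (b * b)" by (rule that(3))
      also have "(D * b - a) / (b * b) * b = (D * b - a) / b" using that(1,2) by simp
      also have "\<dots> = D - a / b" using that(1,2) by (simp add: diff_divide_distrib)
      finally have "d = (D - a / b) / a" using that(1,2) by (simp add: nonzero_eq_divide_eq mult.commute)
      then show ?thesis using that(1,2) by (simp add: diff_divide_distrib)
    qed
    show ?thesis by (rule gen[OF _ _ e']) (use ku u in auto)
  qed
  have circ: "norm (deriv m u) \<le> (24 * pi + 1) / r" if u: "norm (u - z) = r" for u
  proof -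
    have uB: "u \<in> B" using u r by (simp add: B_def dist_norm norm_minus_commute)
    have uz: "u \<noteq> z" using u r by auto
    have sub: "ball u r \<subseteq> B"
    proof
      fix v assume "v \<in> ball u r"
      then show "v \<in> B" using u dist_triangle[of z v u] by (simp add: B_def dist_norm norm_minus_commute)
    qed
    have "r * norm (deriv k u) \<le> 12 * (2 * pi) * norm (k u - k z)"
    proof (rule univalent_deriv_bound)
      show "k holomorphic_on ball u r" using holB sub by (rule holomorphic_on_subset)
      show "inj_on k (ball u r)" using inj sub by (auto simp: B_def intro: inj_on_subset)
      fix v assume v: "v \<in> ball u r"
      then have "v \<noteq> z" using u by (auto simp: dist_norm)
      then show "k v \<noteq> k z" using inj_onD[OF inj, of v z] v sub zB unfolding B_def by blast
    qed (use r in auto)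
    moreover have "norm (k u - k z) > 0" using inj uB zB uz by (auto simp: B_def dest: inj_onD)
    ultimately have "norm (deriv k u / (k u - k z)) \<le> 24 * pi / r"
      using r by (simp add: norm_divide field_simps)
    moreover have "norm (1 / (u - z)) = 1 / r" using u by (simp add: norm_divide)
    ultimately show ?thesis unfolding dm[OF uB uz]
      using norm_triangle_ineq4[of "deriv k u / (k u - k z)" "1 / (u - z)"] by (simp add: add_divide_distrib)
  qed
  have disc: "norm (deriv m u) \<le> (24 * pi + 1) / r" if u: "u \<in> cball z r" for u
  proof (rule maximum_modulus_frontier[of "deriv m" "cball z r"])
    have "cball z r \<subseteq> B" using r by (auto simp: B_def)
    then have *: "deriv m holomorphic_on cball z r"
      using holomorphic_deriv[OF m(1)] by (auto simp: B_def intro: holomorphic_on_subset)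
    show "deriv m holomorphic_on interior (cball z r)" using * interior_subset by (rule holomorphic_on_subset)
    show "continuous_on (closure (cball z r)) (deriv m)" using * by (simp add: holomorphic_on_imp_continuous_on)
    fix v assume "v \<in> frontier (cball z r)"
    then have "norm (v - z) = r" using r by (simp add: frontier_def dist_norm norm_minus_commute)
    then show "norm (deriv m v) \<le> (24 * pi + 1) / r" by (rule circ)
  qed (use u in auto)
  have mb: "norm (m w - m z) \<le> 24 * pi + 1"
  proof -
    have "norm (m w - m z) \<le> (24 * pi + 1) / r * norm (w - z)"
    proof (rule field_differentiable_bound[of "cball z r" m "deriv m"])
      fix u assume u: "u \<in> cball z r"
      then have "u \<in> B" using r by (simp add: B_def)
      then show "(m has_field_derivative deriv m u) (at u within cball z r)"
        using m(1) by (metis B_def holomorphic_derivI open_ball has_field_derivative_at_within)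
    qed (use disc w r in \<open>auto simp: dist_norm norm_minus_commute\<close>)
    also have "\<dots> \<le> (24 * pi + 1) / r * r" using w r by (intro mult_left_mono) auto
    finally show ?thesis using r by simp
  qed
  have wB: "w \<in> B" using w r by (simp add: B_def dist_norm norm_minus_commute)
  have re: "\<bar>Re (m w) - Re (m z)\<bar> \<le> 24 * pi + 1"
    using mb abs_Re_le_cmod[of "m w - m z"] by simp
  have \<psi>z: "norm (deriv k z) = exp (Re (m z))" using m(2)[OF zB] by (simp add: \<psi>_def)
  have \<psi>w: "norm (\<psi> w) = exp (Re (m w))" using m(2)[OF wB] by simp
  have kw: "norm (k w - k z) = norm (\<psi> w) * norm (w - z)"
    by (cases "w = z") (auto simp: \<psi>_def norm_divide)
  have "exp (Re (m z)) \<le> exp (24 * pi + 1) * exp (Re (m w))"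
    unfolding exp_add[symmetric] using re by simp
  then show "norm (deriv k z) * norm (w - z) \<le> exp (24 * pi + 1) * norm (k w - k z)"
    unfolding \<psi>z kw \<psi>w mult.assoc[symmetric] by (intro mult_right_mono) auto
  have "exp (Re (m w)) \<le> exp (24 * pi + 1) * exp (Re (m z))"
    unfolding exp_add[symmetric] using re by simp
  then show "norm (k w - k z) \<le> exp (24 * pi + 1) * norm (deriv k z) * norm (w - z)"
    unfolding \<psi>z kw \<psi>w mult.assoc[symmetric] by (intro mult_right_mono) auto
qed

text \<open>The constant of \<open>univalent_distortion\<close> cubed: two factors compare the
  derivatives at a point and at the centre, the third passes from a derivative to a difference
  quotient.\<close>

definition kdist :: real where "kdist = exp (24 * pi + 1) ^ 3"

lemma kdist_ge_1: "kdist \<ge> 1" by (simp add: kdist_def)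

lemma univalent_quasi_similarity:
  assumes hol: "k holomorphic_on ball c r" and inj: "inj_on k (ball c r)" and r: "r > 0"
  obtains \<rho> where "\<rho> > 0"
    "\<And>z w. z \<in> ball c (r/5) \<Longrightarrow> w \<in> ball c (r/5) \<Longrightarrow>
       \<rho> * norm (z - w) \<le> kdist * norm (k z - k w) \<and> norm (k z - k w) \<le> kdist * \<rho> * norm (z - w)"
proof -
  define C where "C = exp (24 * pi + 1)"
  have C: "C \<ge> 1" by (simp add: C_def)
  have D: "norm (deriv k z) * norm (w - z) \<le> C * norm (k w - k z)"
      "norm (k w - k z) \<le> C * norm (deriv k z) * norm (w - z)"
    if z: "z \<in> ball c (r/5)" and w: "w \<in> ball c (r/5)" for z w
  proof -
    \<comment> \<open>Centred at \<open>z\<close>, the disc of radius 4r/5 still lies in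
      \<open>ball c r\<close>, and \<open>w\<close> is within half that radius, as the distortion
      estimate requires.\<close>
    have sub: "ball z (2 * (2 * r / 5)) \<subseteq> ball c r"
    proof
      fix v assume "v \<in> ball z (2 * (2 * r / 5))"
      then show "v \<in> ball c r" using z dist_triangle[of c v z] by simp
    qed
    have "norm (w - z) < 2 * r / 5"
      using z w dist_triangle[of z w c] by (simp add: dist_norm norm_minus_commute)
    then show "norm (deriv k z) * norm (w - z) \<le> C * norm (k w - k z)"
      "norm (k w - k z) \<le> C * norm (deriv k z) * norm (w - z)"
      unfolding C_def
      using univalent_distortion[of k z "2 * r / 5" w] holomorphic_on_subset[OF hol sub] inj_on_subset[OF inj sub] r by auto
  qed
  have c: "c \<in> ball c (r/5)" using r by simp
  have dpos: "norm (deriv k c) > 0"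
    using holomorphic_injective_imp_regular[OF hol _ inj, of c] r by simp
  have up: "norm (deriv k z) \<le> C^2 * norm (deriv k c)" "norm (deriv k c) \<le> C^2 * norm (deriv k z)" if z: "z \<in> ball c (r/5)" for z
  proof -
    have "norm (deriv k z) \<le> C^2 * norm (deriv k c) \<and> norm (deriv k c) \<le> C^2 * norm (deriv k z)"
    proof (cases "z = c")
      case True
      then show ?thesis using C mult_right_mono[of 1 "C^2" "norm (deriv k c)"] by simp
    next
      case False
      then have p: "norm (z - c) > 0" by simp
      have "norm (deriv k z) * norm (z - c) \<le> C * (C * norm (deriv k c) * norm (z - c))"
        using D(1)[OF z c] D(2)[OF c z] C by (smt (verit) mult_left_mono norm_minus_commute)
      moreover have "norm (deriv k c) * norm (z - c) \<le> C * (C * norm (deriv k z) * norm (z - c))"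
        using D(1)[OF c z] D(2)[OF z c] C by (smt (verit) mult_left_mono norm_minus_commute)
      ultimately show ?thesis using p by (simp add: power2_eq_square mult.assoc[symmetric])
    qed
    then show "norm (deriv k z) \<le> C^2 * norm (deriv k c)" "norm (deriv k c) \<le> C^2 * norm (deriv k z)" by auto
  qed
  have K: "kdist = C ^ 3" by (simp add: kdist_def C_def)
  show ?thesis
  proof (rule that[OF dpos])
    fix z w assume zw: "z \<in> ball c (r/5)" "w \<in> ball c (r/5)"
    have "norm (deriv k c) * norm (z - w) \<le> C^2 * norm (deriv k w) * norm (z - w)"
      using up(2)[OF zw(2)] by (intro mult_right_mono) auto
    also have "\<dots> = C^2 * (norm (deriv k w) * norm (z - w))" by simp
    also have "\<dots> \<le> C^2 * (C * norm (k z - k w))" using D(1)[OF zw(2,1)] C by (intro mult_left_mono) auto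
    also have "\<dots> = kdist * norm (k z - k w)" by (simp add: K power3_eq_cube power2_eq_square)
    finally have 1: "norm (deriv k c) * norm (z - w) \<le> kdist * norm (k z - k w)" .
    have "norm (k z - k w) \<le> C * norm (deriv k w) * norm (z - w)" by (rule D(2)[OF zw(2,1)])
    also have "\<dots> \<le> C * (C^2 * norm (deriv k c)) * norm (z - w)"
      using up(1)[OF zw(2)] C by (intro mult_right_mono mult_left_mono) auto
    also have "\<dots> = kdist * norm (deriv k c) * norm (z - w)" by (simp add: K power3_eq_cube power2_eq_square)
    finally show "norm (deriv k c) * norm (z - w) \<le> kdist * norm (k z - k w) \<and> norm (k z - k w) \<le> kdist * norm (deriv k c) * norm (z - w)"
      using 1 by blast
  qed
qed

section \<open>Lifting through maps of the sphere\<close>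

lemma smap_closed_image: "smap f \<Longrightarrow> closed S \<Longrightarrow> closed (f ` S)"
  by (rule compact_imp_closed[OF compact_continuous_image[OF smap_continuous_on closed_imp_compact_sph]])

text \<open>The finitely many preimages have disjoint balls on which \<open>f\<close> is injective.
  The rest \<open>K\<close> of the sphere is compact, so its image is closed and misses a
  neighbourhood of \<open>y\<close>; shrinking to \<open>T\<close> leaves exactly one sheet over
  \<open>T\<close> in each ball.\<close>

lemma finite_fibre_evenly_covered:
  fixes f :: "sph \<Rightarrow> sph"
  assumes f: "smap f" and fin: "\<And>y. finite (f -` {y})"
    and inj: "\<And>x. f x = y \<Longrightarrow> \<exists>U. open U \<and> x \<in> U \<and> inj_on f U"
    and A: "open A" "y \<in> A"
  obtains T V where "open T" "y \<in> T" "T \<subseteq> A" "\<Union>V = f -` T" "\<And>u. u \<in> V \<Longrightarrow> open u"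
    "pairwise disjnt V" "\<And>u. u \<in> V \<Longrightarrow> inj_on f u \<and> f ` u = T"
proof -
  define X where "X = f -` {y}"
  have X: "finite X" using fin by (simp add: X_def)
  have "\<exists>d>0. inj_on f (ball x d)" if "x \<in> X" for x
  proof -
    have "f x = y" using that by (simp add: X_def)
    then obtain U where "open U" "x \<in> U" "inj_on f U" using inj[of x] by auto
    then show ?thesis by (meson inj_on_subset open_contains_ball)
  qed
  then obtain d where d: "\<And>x. x \<in> X \<Longrightarrow> d x > 0 \<and> inj_on f (ball x (d x))" by metis
  have "\<exists>s>0. \<forall>x\<in>X. s \<le> d x \<and> (\<forall>x'\<in>X. x' \<noteq> x \<longrightarrow> 2 * s \<le> dist x x')"
  proof -
    define D where "D = insert 1 (d ` X \<union> (\<lambda>(x, x'). dist x x' / 2) ` {(x, x') \<in> X \<times> X. x' \<noteq> x})"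
    have fD: "finite D"
    proof -
      have "finite {(x, x') \<in> X \<times> X. x' \<noteq> x}" by (rule finite_subset[of _ "X \<times> X"]) (auto simp: X)
      then show ?thesis by (simp add: D_def X)
    qed
    have pos: "\<forall>t\<in>D. t > 0" using d by (auto simp: D_def)
    have "Min D > 0" using pos fD by (subst Min_gr_iff) (auto simp: D_def)
    moreover have "Min D \<le> d x" if "x \<in> X" for x using that fD by (intro Min_le) (auto simp: D_def)
    moreover have "2 * Min D \<le> dist x x'" if "x \<in> X" "x' \<in> X" "x' \<noteq> x" for x x'
    proof -
      have "Min D \<le> dist x x' / 2" using that fD
        by (intro Min_le) (auto simp: D_def intro!: image_eqI[of _ _ "(x, x')"])
      then show ?thesis by simp
    qed
    ultimately show ?thesis by (intro exI[of _ "Min D"]) auto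
  qed
  then obtain s where s: "s > 0" "\<And>x. x \<in> X \<Longrightarrow> s \<le> d x"
     "\<And>x x'. x \<in> X \<Longrightarrow> x' \<in> X \<Longrightarrow> x' \<noteq> x \<Longrightarrow> 2 * s \<le> dist x x'" by metis
  have injs: "inj_on f (ball x s)" if "x \<in> X" for x
    using d[OF that] s(2)[OF that] by (meson inj_on_subset subset_ball)
  have disj: "ball x s \<inter> ball x' s = {}" if "x \<in> X" "x' \<in> X" "x' \<noteq> x" for x x'
  proof (rule ccontr)
    assume "\<not> ?thesis"
    then obtain w where "dist x w < s" "dist x' w < s" by auto
    then show False using dist_triangle2[of x x' w] s(3)[OF that] by linarith
  qed
  define K where "K = - (\<Union>x\<in>X. ball x s)"
  have K: "closed (f ` K)"
    unfolding K_def by (intro smap_closed_image[OF f]) auto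
  have yK: "y \<notin> f ` K"
  proof
    assume "y \<in> f ` K"
    then obtain k where k: "k \<in> K" "f k = y" by auto
    then have "k \<in> X" by (simp add: X_def)
    then show False using k(1) s(1) by (auto simp: K_def)
  qed
  define T where "T = A \<inter> (\<Inter>x\<in>X. f ` ball x s) - f ` K"
  have T: "open T"
    unfolding T_def using A K X by (intro open_Diff open_Int open_INT) (auto intro: smap_open_map[OF f fin])
  have yT: "y \<in> T"
    using A yK s(1) by (auto simp: T_def X_def intro!: image_eqI)
  define V where "V = (\<lambda>x. ball x s \<inter> f -` T) ` X"
  have "open (f -` T)" using T smap_continuous_on[OF f] by (simp add: open_vimage)
  then have V1: "open u" if "u \<in> V" for u using that by (auto simp: V_def)
  have V2: "\<Union>V = f -` T"
  proof
    show "f -` T \<subseteq> \<Union>V"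
    proof
      fix w assume w: "w \<in> f -` T"
      then have "w \<notin> K" by (auto simp: T_def)
      then obtain x where "x \<in> X" "w \<in> ball x s" by (auto simp: K_def)
      then show "w \<in> \<Union>V" using w by (auto simp: V_def)
    qed
  qed (auto simp: V_def)
  have V3: "pairwise disjnt V"
    unfolding pairwise_def
  proof (intro ballI impI)
    fix u v assume uv: "u \<in> V" "v \<in> V" "u \<noteq> v"
    obtain x where x: "x \<in> X" "u = ball x s \<inter> f -` T" using uv by (auto simp: V_def)
    obtain x' where x': "x' \<in> X" "v = ball x' s \<inter> f -` T" using uv by (auto simp: V_def)
    have "x' \<noteq> x" using x x' uv by auto
    then show "disjnt u v" using disj[of x x'] x x' by (auto simp: disjnt_def)
  qed
  have V4: "inj_on f u \<and> f ` u = T" if u: "u \<in> V" for u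
  proof -
    obtain x where x: "x \<in> X" "u = ball x s \<inter> f -` T" using u unfolding V_def by blast
    then have "inj_on f u" using injs by (auto intro: inj_on_subset)
    moreover have "T \<subseteq> f ` u"
    proof
      fix t assume t: "t \<in> T"
      then have "t \<in> f ` ball x s" using x by (auto simp: T_def)
      then show "t \<in> f ` u" using t x by auto
    qed
    ultimately show ?thesis using x by auto
  qed
  show ?thesis
    by (rule that[OF T yT _ V2 V1 V3 V4]) (auto simp: T_def)
qed

lemma stereo_image_openin:
  assumes "open U" "U \<subseteq> C" shows "openin (top_of_set (stereo ` C)) (stereo ` U)"
proof -
  have "continuous_on (stereo ` C) istereo"
    by (rule continuous_on_subset[OF continuous_on_istereo]) auto
  then have "openin (top_of_set (stereo ` C)) (stereo ` C \<inter> istereo -` U)"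
    using assms(1) by (rule continuous_openin_preimage_gen)
  moreover have "stereo ` C \<inter> istereo -` U = stereo ` U" using assms(2) by auto
  ultimately show ?thesis by simp
qed

lemma homeomorphism_stereo: "homeomorphism U (stereo ` U) stereo istereo"
proof -
  have "stereo ` U \<subseteq> sphere 0 1" using stereo_in_sphere(1) by blast
  then have "continuous_on (stereo ` U) istereo" by (rule continuous_on_subset[OF continuous_on_istereo])
  then show ?thesis
    by (simp add: homeomorphism_def image_image continuous_on_stereo)
qed

text \<open>Transported by \<open>stereo\<close> to subsets of \<open>complex \<times> real\<close>,
  the setting in which lifts through covering spaces are available.\<close>

lemma smap_covering_space:
  fixes f :: "sph \<Rightarrow> sph"
  assumes f: "smap f" and fin: "\<And>y. finite (f -` {y})" and A: "open A"
    and inj: "\<And>x. f x \<in> A \<Longrightarrow> \<exists>U. open U \<and> x \<in> U \<and> inj_on f U"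
  shows "covering_space (stereo ` (f -` A)) (stereo \<circ> f \<circ> istereo) (stereo ` A)"
proof
  let ?F = "stereo \<circ> f \<circ> istereo"
  show "continuous_on (stereo ` (f -` A)) ?F"
    by (intro continuous_on_compose continuous_on_stereo smap_continuous_on[OF f] continuous_on_subset[OF continuous_on_istereo]) auto
  show "?F ` stereo ` (f -` A) = stereo ` A"
    using smap_surj[OF f fin] by (auto simp: image_image) (metis imageI surjD vimageI2)
  fix x assume "x \<in> stereo ` A"
  then obtain y where y: "y \<in> A" "x = stereo y" by auto
  have inj': "\<And>x. f x = y \<Longrightarrow> \<exists>U. open U \<and> x \<in> U \<and> inj_on f U" using inj y(1) by simp
  obtain T V where TV: "open T" "y \<in> T" "T \<subseteq> A" "\<Union>V = f -` T" "\<And>u. u \<in> V \<Longrightarrow> open u"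
    "pairwise disjnt V" "\<And>u. u \<in> V \<Longrightarrow> inj_on f u \<and> f ` u = T"
    by (rule finite_fibre_evenly_covered[OF f fin _ A y(1)], erule inj', rule that)
  have homeo: "\<exists>q. homeomorphism (stereo ` u) (stereo ` T) ?F q" if u: "u \<in> V" for u
  proof -
    have "\<exists>g. homeomorphism u T f g"
    proof (rule homeomorphism_injective_open_map[of u f T])
      show "openin (top_of_set T) (f ` U)" if "openin (top_of_set u) U" for U
      proof -
        have "open U" "U \<subseteq> u" using that TV(5)[OF u] by (auto simp: openin_open_eq)
        then have "open (f ` U)" "f ` U \<subseteq> T" using smap_open_map[OF f fin] TV(7)[OF u] by auto
        then show ?thesis using TV(1) by (simp add: openin_open_eq)
      qed
    qed (use TV(7)[OF u] smap_continuous_on[OF f] in auto)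
    then obtain g where g: "homeomorphism u T f g" by blast
    have "homeomorphism (stereo ` u) u istereo stereo" using homeomorphism_stereo homeomorphism_symD by blast
    then have "homeomorphism (stereo ` u) T (f \<circ> istereo) (stereo \<circ> g)" using g by (rule homeomorphism_compose)
    then have "homeomorphism (stereo ` u) (stereo ` T) (stereo \<circ> (f \<circ> istereo)) (stereo \<circ> g \<circ> istereo)"
      using homeomorphism_stereo by (rule homeomorphism_compose)
    then show ?thesis by (auto simp: comp_assoc)
  qed
  show "\<exists>T. x \<in> T \<and> openin (top_of_set (stereo ` A)) T \<and>
     (\<exists>v. \<Union>v = stereo ` (f -` A) \<inter> ?F -` T \<and> (\<forall>u\<in>v. openin (top_of_set (stereo ` (f -` A))) u) \<and>
          pairwise disjnt v \<and> (\<forall>u\<in>v. \<exists>q. homeomorphism u T ?F q))"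
  proof (intro exI[of _ "stereo ` T"] exI[of _ "(`) stereo ` V"] conjI ballI)
    show "x \<in> stereo ` T" using y TV by auto
    show "openin (top_of_set (stereo ` A)) (stereo ` T)" using stereo_image_openin TV by blast
    have "\<Union> ((`) stereo ` V) = stereo ` (\<Union>V)" by auto
    also have "\<dots> = stereo ` (f -` A) \<inter> ?F -` (stereo ` T)"
      unfolding TV(4)
    proof (intro equalityI subsetI)
      fix u assume "u \<in> stereo ` f -` T"
      then obtain w where "u = stereo w" "f w \<in> T" by blast
      then show "u \<in> stereo ` (f -` A) \<inter> ?F -` (stereo ` T)" using TV(3) by auto
    next
      fix u assume "u \<in> stereo ` (f -` A) \<inter> ?F -` (stereo ` T)"
      then obtain w where w: "u = stereo w" "?F u \<in> stereo ` T" by blast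
      then have "f w \<in> T" by (simp add: inj_image_mem_iff[OF inj_stereo])
      then show "u \<in> stereo ` f -` T" using w by blast
    qed
    finally show "\<Union> ((`) stereo ` V) = stereo ` (f -` A) \<inter> ?F -` (stereo ` T)" .
    show "pairwise disjnt ((`) stereo ` V)"
      unfolding pairwise_def
    proof (intro ballI impI)
      fix u v assume uv: "u \<in> (`) stereo ` V" "v \<in> (`) stereo ` V" "u \<noteq> v"
      then obtain u' v' where u'v': "u' \<in> V" "v' \<in> V" "u = stereo ` u'" "v = stereo ` v'" by blast
      then have "u' \<inter> v' = {}" using uv(3) TV(6) by (auto simp: pairwise_def disjnt_def)
      then show "disjnt u v" unfolding u'v' disjnt_def using image_Int[OF inj_stereo] by (metis image_empty)
    qed
  next
    fix u assume "u \<in> (`) stereo ` V"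
    then obtain u' where u': "u' \<in> V" "u = stereo ` u'" by auto
    have "u' \<subseteq> f -` A" using u' TV(3,4) by blast
    then show "openin (top_of_set (stereo ` (f -` A))) u" unfolding u'(2) using TV(5)[OF u'(1)] by (intro stereo_image_openin)
    show "\<exists>q. homeomorphism u (stereo ` T) ?F q" using homeo u' by auto
  qed
qed

lemma smap_lift_disc:
  fixes f :: "sph \<Rightarrow> sph"
  assumes f: "smap f" and fin: "\<And>y. finite (f -` {y})" and A: "open A"
    and inj: "\<And>x. f x \<in> A \<Longrightarrow> \<exists>U. open U \<and> x \<in> U \<and> inj_on f U"
    and U: "convex U" "open U" and q: "shol q U" "\<And>z. z \<in> U \<Longrightarrow> q z \<in> A"
    and z: "z \<in> U" "f a = q z"
  obtains h where "shol h U" "h z = a" "\<And>w. w \<in> U \<Longrightarrow> f (h w) = q w"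
proof -
  have cq: "continuous_on U (stereo \<circ> q)"
    by (intro continuous_on_compose shol_continuous_on[OF q(1)] continuous_on_stereo)
  obtain g where g: "continuous_on U g" "g \<in> U \<rightarrow> stereo ` (f -` A)" "g z = stereo a"
      "\<And>y. y \<in> U \<Longrightarrow> (stereo \<circ> f \<circ> istereo) (g y) = (stereo \<circ> q) y"
  proof (rule covering_space_lift_strong[OF smap_covering_space[OF f fin A inj] _ z(1) _ _ cq])
    show "stereo a \<in> stereo ` (f -` A)" using z q(2) by auto
    show "simply_connected U" using U(1) by (rule convex_imp_simply_connected)
    show "locally path_connected U" using U(2) by (rule open_imp_locally_path_connected)
    show "stereo \<circ> q \<in> U \<rightarrow> stereo ` A" using q(2) by auto
    show "(stereo \<circ> q) z = (stereo \<circ> f \<circ> istereo) (stereo a)" using z by simp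
  qed auto
  define h where "h = istereo \<circ> g"
  have fh: "f (h w) = q w" if "w \<in> U" for w
    using g(4)[OF that] by (simp add: h_def inj_eq[OF inj_stereo])
  have "g ` U \<subseteq> sphere 0 1"
  proof
    fix x assume "x \<in> g ` U"
    then obtain v where "x = stereo v" using g(2) by auto
    then show "x \<in> sphere 0 1" by (simp only: stereo_in_sphere(1))
  qed
  then have ch: "continuous_on U h"
    unfolding h_def by (intro continuous_on_compose g(1) continuous_on_subset[OF continuous_on_istereo])
  have "shol h U"
    by (rule shol_lift[OF f q(1) U(2) ch fh]) (use inj fh q(2) in auto)
  then show ?thesis using that[of h] fh g(3) by (simp add: h_def)
qed

text \<open>The sphere is simply connected, so the identity lifts to a section \<open>g\<close>
  through \<open>stereo a\<close>. By uniqueness of lifts \<open>g \<circ> F\<close> is the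
  identity, and points with equal images coincide.\<close>

lemma locally_injective_smap_inj:
  fixes f :: "sph \<Rightarrow> sph"
  assumes f: "smap f" and fin: "\<And>y. finite (f -` {y})"
    and inj: "\<And>x. \<exists>U. open U \<and> x \<in> U \<and> inj_on f U"
  shows "inj f"
proof (rule injI)
  fix a b assume ab: "f a = f b"
  define F where "F = stereo \<circ> f \<circ> istereo"
  have UN: "stereo ` UNIV = sphere 0 1" by (simp add: range_stereo)
  have cov: "covering_space (sphere 0 1) F (sphere 0 1)"
    using smap_covering_space[OF f fin open_UNIV] inj by (simp add: F_def UN)
  have FS: "F \<in> sphere 0 1 \<rightarrow> sphere 0 1" using stereo_in_sphere(1) by (simp add: F_def del: stereo_in_sphere(2))
  have cF: "continuous_on (sphere 0 1) F" using cov covering_space_imp_continuous by blast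
  obtain g where g: "continuous_on (sphere 0 1) g" "g \<in> sphere 0 1 \<rightarrow> sphere 0 1" "g (F (stereo a)) = stereo a"
      "\<And>y. y \<in> sphere 0 1 \<Longrightarrow> F (g y) = id y"
  proof (rule covering_space_lift_strong[OF cov, of "stereo a" "F (stereo a)" "sphere 0 1" id])
    show "simply_connected (sphere (0::complex \<times> real) 1)" by (rule simply_connected_sphere) simp
    show "locally path_connected (sphere (0::complex \<times> real) 1)" by (rule locally_path_connected_sphere)
    show "F (stereo a) \<in> sphere 0 1" using FS by (meson Pi_mem stereo_in_sphere(1))
  qed auto
  have "(g \<circ> F) (stereo b) = id (stereo b)"
  proof (rule covering_space_lift_unique[OF cov, where f = F and T = "sphere 0 1" and a = "stereo a" and ?g1.0 = "g \<circ> F" and ?g2.0 = id and x = "stereo b"])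
    show "continuous_on (sphere 0 1) (g \<circ> F)"
      using cF g(1) FS by (intro continuous_on_compose) (auto intro: continuous_on_subset)
    show "g \<circ> F \<in> sphere 0 1 \<rightarrow> sphere 0 1" using FS g(2) by auto
    show "F x = F ((g \<circ> F) x)" if "x \<in> sphere 0 1" for x using g(4)[of "F x"] that FS by (auto simp: Pi_iff)
    show "connected (sphere (0::complex \<times> real) 1)" by (rule connected_sphere) simp
  qed (use cF FS g(3) in auto)
  moreover have "F (stereo b) = F (stereo a)" using ab by (simp add: F_def)
  ultimately have "stereo a = stereo b" using g(3) by simp
  then show "a = b" using inj_stereo by (auto dest: injD)
qed

section \<open>Critical values\<close>

lemma noncritical_iff: "\<not> critical_point f z \<longleftrightarrow> (\<exists>U. open U \<and> z \<in> U \<and> inj_on f U)"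
proof -
  have eq: "{w. sdist w z < e} = ball z e" for e by (auto simp: sdist_eq_dist dist_commute)
  have "(\<exists>e>0. inj_on f (ball z e)) \<longleftrightarrow> (\<exists>U. open U \<and> z \<in> U \<and> inj_on f U)"
  proof
    assume "\<exists>e>0. inj_on f (ball z e)"
    then obtain e where "e > 0" "inj_on f (ball z e)" by blast
    then show "\<exists>U. open U \<and> z \<in> U \<and> inj_on f U" by (intro exI[of _ "ball z e"]) auto
  next
    assume "\<exists>U. open U \<and> z \<in> U \<and> inj_on f U"
    then obtain U where U: "open U" "z \<in> U" "inj_on f U" by blast
    then obtain e where "e > 0" "ball z e \<subseteq> U" by (auto simp: open_contains_ball)
    then show "\<exists>e>0. inj_on f (ball z e)" using inj_on_subset[OF U(3)] by blast
  qed
  then show ?thesis unfolding critical_point_def eq by simp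
qed

lemma closed_critical_values:
  assumes "smap f" shows "closed (critical_values f)"
proof -
  have "open {z. \<not> critical_point f z}"
  proof (subst open_subopen, intro ballI)
    fix z assume "z \<in> {z. \<not> critical_point f z}"
    then obtain U where U: "open U" "z \<in> U" "inj_on f U" by (auto simp: noncritical_iff)
    then have "U \<subseteq> {z. \<not> critical_point f z}" by (auto simp: noncritical_iff)
    then show "\<exists>T. open T \<and> z \<in> T \<and> T \<subseteq> {z. \<not> critical_point f z}" using U by blast
  qed
  then have "closed {z. critical_point f z}" by (simp add: closed_def Collect_neg_eq)
  then show ?thesis unfolding critical_values_def
    by (rule smap_closed_image[OF assms])
qed

lemma not_critical_value_imp_inj:
  assumes "f x \<notin> critical_values f" shows "\<exists>U. open U \<and> x \<in> U \<and> inj_on f U"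
  using assms noncritical_iff[of f x] by (auto simp: critical_values_def)

text \<open>Criticality means failure of local injectivity, so a map without critical values would
  be a covering of the sphere by itself, hence injective. The resulting postcritical point is the
  centre of the ball that all inverse branches omit.\<close>

lemma rational_critical_values_nonempty:
  assumes "rational_map f d" "d \<ge> 2" shows "critical_values f \<noteq> {}"
proof
  assume "critical_values f = {}"
  then have "inj f"
    using assms by (intro locally_injective_smap_inj rational_smap[OF assms(1)] rational_finite_fibre[OF assms(1)] not_critical_value_imp_inj) auto
  then show False using rational_not_inj[OF assms] by (auto dest: injD)
qed

section \<open>Words and the semigroup\<close>

text \<open>The first letter acts first, so that prefixes of a word are initial pieces of an orbit,
  and an inverse branch undoes suffixes first.\<close>

primrec fw :: "(nat \<Rightarrow> 'a \<Rightarrow> 'a) \<Rightarrow> nat list \<Rightarrow> 'a \<Rightarrow> 'a" where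
  "fw f [] z = z"
| "fw f (i # w) z = fw f w (f i z)"

lemma fw_append [simp]: "fw f (u @ v) z = fw f v (fw f u z)"
  by (induction u arbitrary: z) auto

lemma semigroup_gen_eq_words: "semigroup_gen f I = {fw f w |w. w \<in> lists I \<and> w \<noteq> []}"
proof (intro equalityI subsetI)
  fix g assume "g \<in> semigroup_gen f I"
  then show "g \<in> {fw f w |w. w \<in> lists I \<and> w \<noteq> []}"
  proof induction
    case (gen i)
    then show ?case by (auto intro!: exI[of _ "[i]"])
  next
    case (comp g i)
    then obtain w where "g = fw f w" "w \<in> lists I" by auto
    then show ?case using comp by (auto intro!: exI[of _ "w @ [i]"])
  qed
next
  fix g assume "g \<in> {fw f w |w. w \<in> lists I \<and> w \<noteq> []}"
  then obtain w where w: "g = fw f w" "w \<in> lists I" "w \<noteq> []" by blast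
  have "w \<in> lists I \<Longrightarrow> w \<noteq> [] \<Longrightarrow> fw f w \<in> semigroup_gen f I" for w
  proof (induction w rule: rev_induct)
    case (snoc i w)
    show ?case
    proof (cases "w = []")
      case True
      have "fw f (w @ [i]) = f i" using True by auto
      then show ?thesis using snoc.prems by (metis append_in_lists_conv Cons_in_lists_iff semigroup_gen.gen)
    next
      case False
      have "fw f (w @ [i]) = f i \<circ> fw f w" by auto
      then show ?thesis using False snoc by (metis append_in_lists_conv Cons_in_lists_iff semigroup_gen.comp)
    qed
  qed simp
  then show "g \<in> semigroup_gen f I" using w by simp
qed

lemma finite_pointwise_convergent_subsequence:
  fixes g :: "nat \<Rightarrow> 'b \<Rightarrow> sph"
  assumes "finite X"
  shows "\<exists>r::nat\<Rightarrow>nat. strict_mono r \<and> (\<forall>x\<in>X. convergent (\<lambda>n. g (r n) x))"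
  using assms
proof induction
  case empty
  then show ?case by (intro exI[of _ id]) (auto simp: strict_mono_def)
next
  case (insert x X)
  then obtain r where r: "strict_mono r" "\<forall>x\<in>X. convergent (\<lambda>n. g (r n) x)" by blast
  obtain l q where q: "strict_mono (q::nat\<Rightarrow>nat)" "((\<lambda>n. g (r n) x) \<circ> q) \<longlonglongrightarrow> l"
    using compact_imp_seq_compact[OF compact_UNIV_sph] unfolding seq_compact_def by (metis UNIV_I)
  have "convergent (\<lambda>n. g ((r \<circ> q) n) y)" if "y \<in> insert x X" for y
  proof (cases "y = x")
    case True then show ?thesis using q(2) by (auto simp: convergent_def o_def)
  next
    case False
    then have "convergent (\<lambda>n. g (r n) y)" using r that by auto
    then show ?thesis using convergent_subseq_convergent[OF _ q(1)] by (auto simp: o_def)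
  qed
  then show ?case using strict_mono_o[OF r(1) q(1)] by blast
qed

section \<open>Fatou and Julia set of the semigroup\<close>

locale rational_semigroup =
  fixes f :: "nat \<Rightarrow> sph \<Rightarrow> sph" and s :: nat
  assumes s_ge: "s \<ge> 1"
    and deg: "\<And>i. i \<in> {1..s+1} \<Longrightarrow> \<exists>d\<ge>2. rational_map (f i) d"
begin

definition II :: "nat set" where "II = {1..s+1}"
definition GG :: "(sph \<Rightarrow> sph) set" where "GG = semigroup_gen f II"
abbreviation "Wd \<equiv> lists II"
abbreviation "FF \<equiv> fatou GG"
abbreviation "JJ \<equiv> julia GG"

lemma II_simps [simp]: "1 \<in> II" "finite II" "II \<noteq> {}" "Suc 0 \<in> II"
  by (auto simp: II_def)

lemma GG_eq: "GG = {fw f w |w. w \<in> Wd \<and> w \<noteq> []}"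
  by (simp add: GG_def semigroup_gen_eq_words)

text \<open>The empty word is included; this does not change equicontinuity and allows recursion on
  words.\<close>

definition eqc :: "sph \<Rightarrow> bool" where
  "eqc y \<longleftrightarrow> (\<forall>\<epsilon>>0. \<exists>\<delta>>0. \<forall>w\<in>Wd. \<forall>x. dist x y < \<delta> \<longrightarrow> dist (fw f w x) (fw f w y) < \<epsilon>)"

lemma gen_smap: "i \<in> II \<Longrightarrow> smap (f i)"
  using deg rational_smap unfolding II_def by blast

lemma gen_finite_fibre: "i \<in> II \<Longrightarrow> finite (f i -` {y})"
  using deg rational_finite_fibre unfolding II_def by (metis one_le_numeral order_trans)

lemma gen_surj: "i \<in> II \<Longrightarrow> surj (f i)"
  using smap_surj gen_smap gen_finite_fibre by blast

lemma gen_open: "i \<in> II \<Longrightarrow> open U \<Longrightarrow> open (f i ` U)"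
  using smap_open_map gen_smap gen_finite_fibre by blast

lemma word_smap: "w \<in> Wd \<Longrightarrow> smap (fw f w)"
proof (induction w)
  case Nil
  have "fw f [] = (\<lambda>x. x)" by auto
  then show ?case using smap_id(2) by metis
next
  case (Cons i w)
  have eq: "fw f (i # w) = fw f w \<circ> f i" by auto
  show ?case unfolding eq using Cons by (intro smap_comp gen_smap) auto
qed

lemma word_isCont: "w \<in> Wd \<Longrightarrow> isCont (fw f w) x"
  using word_smap smap_isCont by blast

lemma word_surj: "w \<in> Wd \<Longrightarrow> \<exists>a. fw f w a = x"
proof (induction w arbitrary: x)
  case (Cons i w)
  then obtain a where "fw f w a = x" by auto
  moreover obtain b where "f i b = a" using gen_surj[of i] Cons by (metis Cons_in_lists_iff surjD)
  ultimately show ?case by auto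
qed simp

lemma equicont_at_iff: "equicont_at GG y \<longleftrightarrow> eqc y"
proof
  assume e: "equicont_at GG y"
  show "eqc y" unfolding eqc_def
  proof (intro allI impI)
    fix \<epsilon> :: real assume \<epsilon>: "\<epsilon> > 0"
    then obtain \<delta> where \<delta>: "\<delta> > 0" "\<And>x h. dist x y < \<delta> \<Longrightarrow> h \<in> GG \<Longrightarrow> dist (h x) (h y) < \<epsilon>"
      using e unfolding equicont_at_def sdist_eq_dist by metis
    have "dist (fw f w x) (fw f w y) < \<epsilon>" if "w \<in> Wd" "dist x y < min \<delta> \<epsilon>" for w x
      using that \<delta>(2)[of x "fw f w"] by (cases "w = []") (auto simp: GG_eq)
    then show "\<exists>\<delta>>0. \<forall>w\<in>Wd. \<forall>x. dist x y < \<delta> \<longrightarrow> dist (fw f w x) (fw f w y) < \<epsilon>"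
      using \<delta>(1) \<epsilon> by (intro exI[of _ "min \<delta> \<epsilon>"]) auto
  qed
next
  assume e: "eqc y"
  show "equicont_at GG y" unfolding equicont_at_def sdist_eq_dist
  proof (intro allI impI)
    fix \<epsilon> :: real assume \<epsilon>: "\<epsilon> > 0"
    then obtain \<delta> where \<delta>: "\<delta> > 0" "\<And>w x. w \<in> Wd \<Longrightarrow> dist x y < \<delta> \<Longrightarrow> dist (fw f w x) (fw f w y) < \<epsilon>"
      using e unfolding eqc_def by metis
    then show "\<exists>\<delta>>0. \<forall>w. dist w y < \<delta> \<longrightarrow> (\<forall>h\<in>GG. dist (h w) (h y) < \<epsilon>)"
      by (intro exI[of _ \<delta>]) (auto simp: GG_eq)
  qed
qed

lemma fatou_iff: "z \<in> FF \<longleftrightarrow> (\<exists>r>0. \<forall>y\<in>ball z r. eqc y)"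
  by (auto simp: fatou_def sdist_eq_dist equicont_at_iff dist_commute)

lemma fatou_eqc: "z \<in> FF \<Longrightarrow> eqc z"
  by (auto simp: fatou_iff)

lemma open_fatou: "open FF"
proof (subst open_subopen, intro ballI)
  fix z assume "z \<in> FF"
  then obtain r where r: "r > 0" "\<forall>y\<in>ball z r. eqc y" by (auto simp: fatou_iff)
  have "ball z r \<subseteq> FF"
  proof
    fix y assume y: "y \<in> ball z r"
    have "ball y (r - dist z y) \<subseteq> ball z r"
    proof
      fix x assume "x \<in> ball y (r - dist z y)"
      then show "x \<in> ball z r" using dist_triangle[of z x y] by simp
    qed
    then show "y \<in> FF" using r y unfolding fatou_iff by (intro exI[of _ "r - dist z y"]) auto
  qed
  then show "\<exists>T. open T \<and> z \<in> T \<and> T \<subseteq> FF" using r by (intro exI[of _ "ball z r"]) auto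
qed

text \<open>As \<open>f i\<close> is open, points near \<open>f i y\<close> are images of points
  near \<open>y\<close>; for these the bound for the word \<open>i # w\<close> is the bound for
  \<open>w\<close>.\<close>

lemma eqc_image: assumes "eqc y" "i \<in> II" shows "eqc (f i y)"
  unfolding eqc_def
proof (intro allI impI)
  fix \<epsilon> :: real assume "\<epsilon> > 0"
  then obtain \<delta> where \<delta>: "\<delta> > 0" "\<And>w x. w \<in> Wd \<Longrightarrow> dist x y < \<delta> \<Longrightarrow> dist (fw f w x) (fw f w y) < \<epsilon>"
    using assms(1) unfolding eqc_def by metis
  have "open (f i ` ball y \<delta>)" using gen_open assms by auto
  then obtain d where d: "d > 0" "ball (f i y) d \<subseteq> f i ` ball y \<delta>"
    using \<delta>(1) by (metis centre_in_ball imageI open_contains_ball)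
  have "dist (fw f w x) (fw f w (f i y)) < \<epsilon>" if w: "w \<in> Wd" and x: "dist x (f i y) < d" for w x
  proof -
    have "x \<in> f i ` ball y \<delta>" using d(2) x by (auto simp: dist_commute)
    then obtain x' where "dist y x' < \<delta>" "x = f i x'" by auto
    then show ?thesis using \<delta>(2)[of "i # w" x'] w assms by (auto simp: dist_commute)
  qed
  then show "\<exists>\<delta>>0. \<forall>w\<in>Wd. \<forall>x. dist x (f i y) < \<delta> \<longrightarrow> dist (fw f w x) (fw f w (f i y)) < \<epsilon>"
    using d(1) by blast
qed

lemma fatou_image: assumes "z \<in> FF" "i \<in> II" shows "f i z \<in> FF"
proof -
  obtain r where r: "r > 0" "\<forall>y\<in>ball z r. eqc y" using assms by (auto simp: fatou_iff)
  have "open (f i ` ball z r)" using gen_open assms by auto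
  then obtain d where d: "d > 0" "ball (f i z) d \<subseteq> f i ` ball z r"
    using r(1) by (metis centre_in_ball imageI open_contains_ball)
  then have "\<forall>y\<in>ball (f i z) d. eqc y" using r(2) eqc_image assms(2) by blast
  then show ?thesis using d(1) fatou_iff by blast
qed

lemma fatou_word: "z \<in> FF \<Longrightarrow> w \<in> Wd \<Longrightarrow> fw f w z \<in> FF"
  by (induction w arbitrary: z) (auto simp: fatou_image)

lemma eqc_preimage: assumes "\<And>i. i \<in> II \<Longrightarrow> eqc (f i y)" shows "eqc y"
  unfolding eqc_def
proof (intro allI impI)
  fix \<epsilon> :: real assume \<epsilon>: "\<epsilon> > 0"
  have "\<exists>\<delta>>0. \<forall>w\<in>Wd. \<forall>x. dist x y < \<delta> \<longrightarrow> dist (fw f w (f i x)) (fw f w (f i y)) < \<epsilon>" if i: "i \<in> II" for i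
  proof -
    obtain \<delta> where \<delta>: "\<delta> > 0" "\<And>w x. w \<in> Wd \<Longrightarrow> dist x (f i y) < \<delta> \<Longrightarrow> dist (fw f w x) (fw f w (f i y)) < \<epsilon>"
      using assms[OF i] \<epsilon> unfolding eqc_def by metis
    have "isCont (f i) y" using gen_smap[OF i] by (rule smap_isCont)
    then obtain d where "d > 0" "\<And>x. dist x y < d \<Longrightarrow> dist (f i x) (f i y) < \<delta>"
      using \<delta>(1) unfolding continuous_at_eps_delta by blast
    then show ?thesis using \<delta>(2) by blast
  qed
  then obtain d where d: "\<And>i. i \<in> II \<Longrightarrow> d i > 0"
    "\<And>i w x. i \<in> II \<Longrightarrow> w \<in> Wd \<Longrightarrow> dist x y < d i \<Longrightarrow> dist (fw f w (f i x)) (fw f w (f i y)) < \<epsilon>" by metis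
  define m where "m = Min (insert \<epsilon> (d ` II))"
  have m: "m > 0" "m \<le> \<epsilon>" using d(1) \<epsilon> by (auto simp: m_def)
  have m3: "m \<le> d i" if "i \<in> II" for i unfolding m_def using that by (intro Min_le) auto
  have "dist (fw f w x) (fw f w y) < \<epsilon>" if w: "w \<in> Wd" and x: "dist x y < m" for w x
  proof (cases w)
    case Nil then show ?thesis using x m by simp
  next
    case (Cons i v)
    then have "i \<in> II" "v \<in> Wd" using w by auto
    then show ?thesis using d(2)[of i v x] m3[of i] x Cons by simp
  qed
  then show "\<exists>\<delta>>0. \<forall>w\<in>Wd. \<forall>x. dist x y < \<delta> \<longrightarrow> dist (fw f w x) (fw f w y) < \<epsilon>" using m(1) by blast
qed

text \<open>One half of the identity of J with the union of the sets f_i^{-1}(J), namely the half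
  that rests on the finiteness of the set of generators.\<close>

lemma fatou_preimage: assumes "\<And>i. i \<in> II \<Longrightarrow> f i z \<in> FF" shows "z \<in> FF"
proof -
  have "open (\<Inter>i\<in>II. f i -` FF)"
    by (intro open_INT) (auto intro!: open_vimage open_fatou smap_continuous_on gen_smap)
  moreover have "z \<in> (\<Inter>i\<in>II. f i -` FF)" using assms by blast
  ultimately obtain r where r: "r > 0" "ball z r \<subseteq> (\<Inter>i\<in>II. f i -` FF)"
    by (metis open_contains_ball)
  have "eqc y" if "y \<in> ball z r" for y
    by (rule eqc_preimage) (use that r fatou_eqc in blast)
  then show ?thesis using r(1) fatou_iff by blast
qed

lemma julia_iff: "z \<in> JJ \<longleftrightarrow> z \<notin> FF" by (simp add: julia_def)

lemma julia_step: "z \<in> JJ \<Longrightarrow> \<exists>i\<in>II. f i z \<in> JJ"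
  using fatou_preimage by (auto simp: julia_iff)

lemma julia_back: "fw f w z \<in> JJ \<Longrightarrow> w \<in> Wd \<Longrightarrow> z \<in> JJ"
  using fatou_word by (auto simp: julia_iff)

lemma closed_julia: "closed JJ" using open_fatou by (simp add: julia_def closed_def)

lemma compact_julia: "compact JJ" using closed_julia closed_imp_compact_sph by blast

lemma uniform_equicont:
  assumes K: "compact K" "K \<subseteq> FF" and \<epsilon>: "\<epsilon> > 0"
  obtains \<delta> where "\<delta> > 0" "\<And>u y w. u \<in> K \<Longrightarrow> dist y u < \<delta> \<Longrightarrow> w \<in> Wd \<Longrightarrow> dist (fw f w y) (fw f w u) < \<epsilon>"
proof -
  have "\<exists>\<delta>>0. \<forall>u\<in>K. \<forall>y. \<forall>w\<in>Wd. dist y u < \<delta> \<longrightarrow> dist (fw f w y) (fw f w u) < \<epsilon>"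
  proof (rule ccontr)
    assume n: "\<not> ?thesis"
    have "\<exists>u y w. u \<in> K \<and> w \<in> Wd \<and> dist y u < 1 / Suc n \<and> \<not> dist (fw f w y) (fw f w u) < \<epsilon>" for n
      using n by (metis of_nat_0_less_iff zero_less_Suc zero_less_divide_1_iff)
    then obtain u y w where uyw: "\<And>n. u n \<in> K" "\<And>n. w n \<in> Wd" "\<And>n::nat. dist (y n) (u n) < 1 / Suc n"
       "\<And>n. \<not> dist (fw f (w n) (y n)) (fw f (w n) (u n)) < \<epsilon>" by metis
    obtain l r where lr: "l \<in> K" "strict_mono (r::nat\<Rightarrow>nat)" "(u \<circ> r) \<longlonglongrightarrow> l"
      using compact_imp_seq_compact[OF K(1)] uyw(1) unfolding seq_compact_def by metis
    obtain \<delta> where \<delta>: "\<delta> > 0" "\<And>w x. w \<in> Wd \<Longrightarrow> dist x l < \<delta> \<Longrightarrow> dist (fw f w x) (fw f w l) < \<epsilon> / 2"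
      using fatou_eqc[of l] lr(1) K(2) \<epsilon> unfolding eqc_def by (metis half_gt_zero subsetD)
    have "eventually (\<lambda>n. dist (u (r n)) l < \<delta> / 2) sequentially"
      using lr(3) \<delta>(1) tendstoD[of "u \<circ> r" l sequentially "\<delta>/2"] by simp
    moreover have "(\<lambda>n. 1 / real (Suc (r n))) \<longlonglongrightarrow> 0"
      using LIMSEQ_subseq_LIMSEQ[OF LIMSEQ_inverse_real_of_nat lr(2)] by (simp add: o_def inverse_eq_divide)
    then have "eventually (\<lambda>n. 1 / real (Suc (r n)) < \<delta> / 2) sequentially"
      using \<delta>(1) by (metis half_gt_zero order_tendstoD(2))
    ultimately have "eventually (\<lambda>n. dist (u (r n)) l < \<delta> / 2 \<and> 1 / real (Suc (r n)) < \<delta> / 2) sequentially"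
      by (rule eventually_conj)
    then obtain n where n: "dist (u (r n)) l < \<delta> / 2" "1 / real (Suc (r n)) < \<delta> / 2"
      by (auto simp: eventually_sequentially)
    have "dist (y (r n)) l < \<delta>"
      using dist_triangle[of "y (r n)" l "u (r n)"] uyw(3)[of "r n"] n by linarith
    then have 1: "dist (fw f (w (r n)) (y (r n))) (fw f (w (r n)) l) < \<epsilon> / 2" using \<delta>(2) uyw(2) by blast
    have 2: "dist (fw f (w (r n)) (u (r n))) (fw f (w (r n)) l) < \<epsilon> / 2" using \<delta> uyw(2) n by auto
    show False using 1 2 uyw(4)[of "r n"] dist_triangle2[of "fw f (w (r n)) (y (r n))" "fw f (w (r n)) (u (r n))" "fw f (w (r n)) l"]
      by linarith
  qed
  then show ?thesis using that by metis
qed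

text \<open>If the Fatou set were the whole sphere, the iterates of \<open>f 1\<close> would be an
  equicontinuous family, and two of them would be uniformly close. Cancelling their common part by
  surjectivity puts an iterate close to the identity, although it identifies \<open>a\<close> and
  \<open>b\<close>.\<close>

lemma julia_nonempty: "JJ \<noteq> {}"
proof
  assume "JJ = {}"
  then have F: "FF = UNIV" by (auto simp: julia_def)
  have 1: "1 \<in> II" by simp
  obtain d where "rational_map (f 1) d" "d \<ge> 2" using deg[of 1] by auto
  then obtain a b where ab: "a \<noteq> b" "f 1 a = f 1 b" using rational_not_inj by blast
  \<comment> \<open>The argument ends with \<open>dist a b < 6 * \<epsilon>\<close>.\<close>
  define \<epsilon> where "\<epsilon> = dist a b / 8"
  have \<epsilon>: "\<epsilon> > 0" using ab by (simp add: \<epsilon>_def)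
  define g where "g n = fw f (replicate n 1)" for n
  have gw: "replicate n 1 \<in> Wd" for n using 1 by (auto simp: in_lists_conv_set)
  obtain \<delta> where \<delta>: "\<delta> > 0" "\<And>u y w. dist y u < \<delta> \<Longrightarrow> w \<in> Wd \<Longrightarrow> dist (fw f w y) (fw f w u) < \<epsilon>"
    using uniform_equicont[OF compact_UNIV_sph _ \<epsilon>] F by auto
  obtain X where X: "finite X" "(UNIV::sph set) \<subseteq> (\<Union>x\<in>X. ball x \<delta>)"
    using compact_eq_totally_bounded[of "UNIV::sph set"] \<delta>(1) by auto
  obtain r where r: "strict_mono r" "\<And>x. x \<in> X \<Longrightarrow> convergent (\<lambda>n. g (r n) x)"
    using finite_pointwise_convergent_subsequence[OF X(1)] by metis
  have "eventually (\<lambda>n. \<forall>x\<in>X. \<forall>m\<ge>n. dist (g (r m) x) (g (r n) x) < \<epsilon>) sequentially"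
  proof (rule eventually_ball_finite[OF X(1)], rule ballI)
    fix x assume "x \<in> X"
    then have "Cauchy (\<lambda>n. g (r n) x)" using r(2) convergent_Cauchy by blast
    then obtain N where "\<And>m n. m \<ge> N \<Longrightarrow> n \<ge> N \<Longrightarrow> dist (g (r m) x) (g (r n) x) < \<epsilon>"
      using \<epsilon> unfolding Cauchy_def by metis
    then show "eventually (\<lambda>n. \<forall>m\<ge>n. dist (g (r m) x) (g (r n) x) < \<epsilon>) sequentially"
      unfolding eventually_sequentially by (intro exI[of _ N]) auto
  qed
  then obtain k where k: "\<And>x m. x \<in> X \<Longrightarrow> m \<ge> k \<Longrightarrow> dist (g (r m) x) (g (r k) x) < \<epsilon>"
    by (auto simp: eventually_sequentially)
  define m where "m = r (Suc k) - r k"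
  have rk: "r (Suc k) = r k + m" "m > 0" using strict_monoD[OF r(1), of k "Suc k"] by (auto simp: m_def)
  have near: "dist (g (r (Suc k)) y) (g (r k) y) < 3 * \<epsilon>" for y
  proof -
    have "y \<in> (\<Union>x\<in>X. ball x \<delta>)" using X(2) by blast
    then obtain x where x: "x \<in> X" "dist x y < \<delta>" by auto
    have a: "dist (g (r (Suc k)) y) (g (r (Suc k)) x) < \<epsilon>" "dist (g (r k) y) (g (r k) x) < \<epsilon>"
      unfolding g_def using \<delta>(2)[OF _ gw] x(2) by (auto simp: dist_commute)
    show ?thesis using a k[OF x(1), of "Suc k"]
        dist_triangle[of "g (r (Suc k)) y" "g (r k) y" "g (r (Suc k)) x"]
        dist_triangle2[of "g (r (Suc k)) x" "g (r k) y" "g (r k) x"] by linarith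
  qed
  have close: "dist (g m z) z < 3 * \<epsilon>" for z
  proof -
    obtain y where y: "g (r k) y = z" using word_surj[OF gw] by (auto simp: g_def)
    have "g (r (Suc k)) y = g m z" unfolding rk(1) y[symmetric] by (simp add: g_def replicate_add)
    then show ?thesis using near[of y] y by simp
  qed
  have "g m a = g m b" using rk(2) ab(2) by (cases m) (auto simp: g_def)
  then have "dist a b < 6 * \<epsilon>" using close[of a] close[of b] dist_triangle2[of a b "g m a"]
    by (simp add: dist_commute)
  then show False using \<epsilon> by (simp add: \<epsilon>_def)
qed

section \<open>The postcritical set and the lifting of inverse branches\<close>

definition PP :: "sph set" where "PP = postcrit f II"

lemma closed_PP: "closed PP" unfolding PP_def postcrit_def sclosure_eq_closure by (rule closed_closure)

lemma PP_nonempty: "PP \<noteq> {}"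
proof -
  have 1: "1 \<in> II" by simp
  obtain d where "rational_map (f 1) d" "d \<ge> 2" using deg[of 1] by auto
  then obtain c where "c \<in> critical_values (f 1)" using rational_critical_values_nonempty by blast
  then show ?thesis unfolding PP_def postcrit_def sclosure_eq_closure
    using 1 closure_subset by fastforce
qed

lemma critical_values_PP: "i \<in> II \<Longrightarrow> critical_values (f i) \<subseteq> PP"
  unfolding PP_def postcrit_def sclosure_eq_closure by (rule order_trans[OF _ closure_subset]) auto

lemma PP_image: assumes "i \<in> II" "y \<in> PP" shows "f i y \<in> PP"
proof -
  define A where "A = (\<Union>g\<in>insert id GG. g ` (\<Union>i\<in>II. critical_values (f i)))"
  have P: "PP = closure A" by (simp add: PP_def postcrit_def sclosure_eq_closure A_def GG_def)
  have "f i ` A \<subseteq> A"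
  proof clarify
    fix a assume "a \<in> A"
    then obtain g c where g: "g \<in> insert id GG" "c \<in> (\<Union>i\<in>II. critical_values (f i))" "a = g c" unfolding A_def by blast
    have "f i \<circ> g \<in> GG"
    proof (cases "g = id")
      case True then show ?thesis using semigroup_gen.gen[OF assms(1)] by (simp add: GG_def)
    next
      case False then show ?thesis using g(1) semigroup_gen.comp[OF _ assms(1)] unfolding GG_def by blast
    qed
    then show "f i a \<in> A" unfolding A_def using g by (intro UN_I[of "f i \<circ> g"]) auto
  qed
  then have "f i ` closure A \<subseteq> closure A"
    by (intro image_closure_subset[OF smap_continuous_on[OF gen_smap[OF assms(1)]]]) (auto intro: closure_subset[THEN subsetD])
  then show ?thesis using P assms(2) by blast
qed

lemma PP_word: "w \<in> Wd \<Longrightarrow> y \<in> PP \<Longrightarrow> fw f w y \<in> PP"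
  by (induction w arbitrary: y) (auto simp: PP_image)

text \<open>The branch \<open>h'\<close> of the remaining word is lifted through \<open>f i\<close>
  last. It avoids the critical values of \<open>f i\<close>, since the remaining word maps these
  into \<open>PP\<close> while \<open>q\<close> stays off \<open>PP\<close>.\<close>

lemma inverse_branch_exists:
  assumes "w \<in> Wd" "convex U" "open U" "shol q U" "\<And>z. z \<in> U \<Longrightarrow> q z \<notin> PP" "z \<in> U" "fw f w a = q z"
  shows "\<exists>h. shol h U \<and> h z = a \<and> (\<forall>v\<in>U. fw f w (h v) = q v)"
  using assms(1,7)
proof (induction w arbitrary: a)
  case Nil
  then show ?case using assms by (intro exI[of _ q]) auto
next
  case (Cons i w)
  then have i: "i \<in> II" and w: "w \<in> Wd" by auto
  obtain h' where h': "shol h' U" "h' z = f i a" "\<forall>v\<in>U. fw f w (h' v) = q v"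
    using Cons.IH[of "f i a"] Cons.prems by auto
  have ncv: "h' v \<in> - critical_values (f i)" if "v \<in> U" for v
    using h'(3) that assms(5)[OF that] PP_word[OF w] critical_values_PP[OF i] by force
  obtain h where "shol h U" "h z = a" "\<And>v. v \<in> U \<Longrightarrow> f i (h v) = h' v"
    by (rule smap_lift_disc[OF gen_smap[OF i] gen_finite_fibre[OF i], of "- critical_values (f i)" U h' z a])
       (use ncv h' assms not_critical_value_imp_inj closed_critical_values[OF gen_smap[OF i]] in auto)
  then show ?case using h'(3) by (intro exI[of _ h]) auto
qed

end

section \<open>Inverse branches near the Julia set\<close>

lemma separate_compact_closed_metric:
  fixes S T :: "'a::metric_space set"
  assumes S: "compact S" and T: "closed T" and disj: "S \<inter> T = {}"
  shows "\<exists>d>0. \<forall>x\<in>S. \<forall>y\<in>T. d \<le> dist x y"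
proof (cases "S = {} \<or> T = {}")
  case True then show ?thesis by (intro exI[of _ 1]) auto
next
  case False
  have "continuous_on S (\<lambda>x. infdist x T)" by (intro continuous_intros)
  then have "\<exists>x\<in>S. \<forall>y\<in>S. infdist x T \<le> infdist y T"
    using continuous_attains_inf[OF S] False by blast
  then obtain x where x: "x \<in> S" "\<forall>y\<in>S. infdist x T \<le> infdist y T" by blast
  have "infdist x T > 0"
    using x(1) disj T False in_closed_iff_infdist_zero[of T x] infdist_nonneg[of x T] by (auto simp: less_le)
  then show ?thesis using x(2) by (intro exI[of _ "infdist x T"]) (auto intro: order_trans infdist_le)
qed

lemma chart_constants:
  assumes "\<eta> > 0"
  shows "\<exists>K\<ge>1. \<forall>e\<in>{None, Some 0, c}. (\<forall>z w. dist (param e z) (param e w) \<le> K * dist z w) \<and>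
     (\<forall>a b. dist a e \<ge> \<eta> \<longrightarrow> dist b e \<ge> \<eta> \<longrightarrow> dist (coord e a) (coord e b) \<le> K * dist a b \<and> norm (coord e a) \<le> K)"
proof -
  have "\<exists>K\<ge>1. (\<forall>z w. dist (param e z) (param e w) \<le> K * dist z w) \<and>
     (\<forall>a b. dist a e \<ge> \<eta> \<longrightarrow> dist b e \<ge> \<eta> \<longrightarrow> dist (coord e a) (coord e b) \<le> K * dist a b \<and> norm (coord e a) \<le> K)" for e
  proof -
    obtain K1 where K1: "\<And>z w. dist (param e z) (param e w) \<le> K1 * dist z w" using param_Lipschitz by metis
    obtain K2 where K2: "\<And>a b. dist a e \<ge> \<eta> \<Longrightarrow> dist b e \<ge> \<eta> \<Longrightarrow> dist (coord e a) (coord e b) \<le> K2 * dist a b \<and> norm (coord e a) \<le> K2"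
      using coord_Lipschitz[OF assms, of e] by metis
    define K where "K = max 1 (max K1 K2)"
    have "K1 * d \<le> K * d" "K2 * d \<le> K * d" if "d \<ge> 0" for d
      using that by (auto simp: K_def intro!: mult_right_mono)
    moreover have "K2 \<le> K" "K \<ge> 1" by (auto simp: K_def)
    ultimately show ?thesis using K1 K2 by (intro exI[of _ K]) (meson order_trans zero_le_dist)
  qed
  then obtain K where K: "\<And>e. K e \<ge> 1" "\<And>e z w. dist (param e z) (param e w) \<le> K e * dist z w"
    "\<And>e a b. dist a e \<ge> \<eta> \<Longrightarrow> dist b e \<ge> \<eta> \<Longrightarrow> dist (coord e a) (coord e b) \<le> K e * dist a b \<and> norm (coord e a) \<le> K e"
    by metis
  define L where "L = Max (K ` {None, Some 0, c})"
  have L: "K e \<le> L" if "e \<in> {None, Some 0, c}" for e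
    unfolding L_def using that by (intro Max_ge) auto
  have "L \<ge> 1" using L[of None] K(1)[of None] by simp
  moreover have "K e * d \<le> L * d" if "e \<in> {None, Some 0, c}" "d \<ge> 0" for e d
    using L[OF that(1)] that(2) by (rule mult_right_mono)
  ultimately show ?thesis using K L by (intro exI[of _ L] conjI ballI allI impI) (meson order_trans zero_le_dist)+
qed

text \<open>Up to \<kappa> the branch is a similarity of ratio \<rho>. The clause on
  \<open>w = u @ v\<close> controls the orbit in between: the image of the branch under a prefix
  \<open>u\<close> is a branch of the suffix \<open>v\<close> and expands at most by \<kappa>. The
  last clause bounds the inner radius of the image from below, in the manner of Koebe's quarter
  theorem.\<close>

definition Br :: "(nat \<Rightarrow> sph \<Rightarrow> sph) \<Rightarrow> real \<Rightarrow> real \<Rightarrow> nat list \<Rightarrow> sph \<Rightarrow> (sph \<Rightarrow> sph) \<Rightarrow> real \<Rightarrow> bool" where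
  "Br f \<kappa> \<delta> w x H \<rho> \<longleftrightarrow> 0 < \<rho> \<and> \<rho> \<le> \<kappa> \<and> (\<forall>y\<in>ball x \<delta>. fw f w (H y) = y) \<and>
     (\<forall>y\<in>ball x \<delta>. \<forall>y'\<in>ball x \<delta>. \<rho> * dist y y' \<le> \<kappa> * dist (H y) (H y') \<and> dist (H y) (H y') \<le> \<kappa> * \<rho> * dist y y') \<and>
     (\<forall>u v. w = u @ v \<longrightarrow> (\<forall>y\<in>ball x \<delta>. \<forall>y'\<in>ball x \<delta>. dist (fw f u (H y)) (fw f u (H y')) \<le> \<kappa> * dist y y')) \<and>
     ball (H x) (\<rho> / \<kappa>) \<subseteq> H ` ball x \<delta>"

locale hyperbolic_semigroup = rational_semigroup +
  assumes A1: "PP \<subseteq> FF"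
    and A2: "\<And>i j. i \<in> II \<Longrightarrow> j \<in> II \<Longrightarrow> i \<noteq> j \<Longrightarrow> f i -` JJ \<inter> f j -` JJ = {}"
begin

lemma julia_unique: "f i z \<in> JJ \<Longrightarrow> f j z \<in> JJ \<Longrightarrow> i \<in> II \<Longrightarrow> j \<in> II \<Longrightarrow> i = j"
  using A2 by blast

text \<open>The orbit of a postcritical point \<open>c\<close> stays in \<open>PP\<close>, at
  distance at least \<open>2 * \<epsilon>0\<close> from the Julia set; by equicontinuity at
  \<open>c\<close> the orbits of a small ball follow it within \<open>\<epsilon>0\<close>. Hence no
  word maps a point of this ball close to the Julia set.\<close>

lemma postcritical_separation:
  obtains c r0 \<epsilon>0 where "c \<in> PP" "r0 > 0" "\<epsilon>0 > 0" "\<And>x y. x \<in> JJ \<Longrightarrow> y \<in> PP \<Longrightarrow> 2 * \<epsilon>0 \<le> dist x y"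
    "\<And>w y. w \<in> Wd \<Longrightarrow> dist y c < r0 \<Longrightarrow> dist (fw f w y) (fw f w c) < \<epsilon>0"
proof -
  have "JJ \<inter> PP = {}" using A1 by (auto simp: julia_iff)
  then obtain d where d: "d > 0" "\<And>x y. x \<in> JJ \<Longrightarrow> y \<in> PP \<Longrightarrow> d \<le> dist x y"
    using separate_compact_closed_metric[OF compact_julia closed_PP] by metis
  obtain c where c: "c \<in> PP" using PP_nonempty by blast
  then have "eqc c" using A1 fatou_eqc by blast
  then obtain r where "r > 0" "\<And>w y. w \<in> Wd \<Longrightarrow> dist y c < r \<Longrightarrow> dist (fw f w y) (fw f w c) < d / 2"
    using d(1) unfolding eqc_def by (metis half_gt_zero)
  then show ?thesis using that[of c r "d/2"] c d by auto
qed

text \<open>An inverse branch omits a fixed ball about a postcritical point, so in the chart at that point it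
  is a bounded univalent function.\<close>

lemma branch_estimate:
  assumes c: "c \<in> PP" and r0: "r0 > 0" and \<epsilon>0: "\<And>x y. x \<in> JJ \<Longrightarrow> y \<in> PP \<Longrightarrow> 2 * \<epsilon>0 \<le> dist x y"
    and eq: "\<And>w y. w \<in> Wd \<Longrightarrow> dist y c < r0 \<Longrightarrow> dist (fw f w y) (fw f w c) < \<epsilon>0"
    and K: "K \<ge> 1" "\<And>e z w. e \<in> {None, Some 0, c} \<Longrightarrow> dist (param e z) (param e w) \<le> K * dist z w"
    "\<And>e a b. e \<in> {None, Some 0, c} \<Longrightarrow> dist a e \<ge> min (1/2) (r0/2) \<Longrightarrow> dist b e \<ge> min (1/2) (r0/2) \<Longrightarrow>
       dist (coord e a) (coord e b) \<le> K * dist a b \<and> norm (coord e a) \<le> K"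
    and \<delta>: "\<delta> > 0" "K * \<delta> \<le> \<epsilon>0"
    and x: "x \<in> JJ" "e \<in> {None, Some 0}" "dist x e \<ge> 1"
    and w: "w \<in> Wd"
    and h: "shol h (ball (coord e x) \<delta>)" "\<And>z. z \<in> ball (coord e x) \<delta> \<Longrightarrow> fw f w (h z) = param e z"
    and \<delta>1: "\<delta>1 > 0" "\<delta>1 \<le> 1/2" "K * \<delta>1 \<le> \<delta> / 10"
    and t: "t = \<delta>1 / (2 * K)"
  shows "\<exists>\<rho>>0. \<rho> \<le> 20 * K * kdist / \<delta> \<and>
    (\<forall>y\<in>ball x \<delta>1. \<forall>y'\<in>ball x \<delta>1. \<rho> * dist y y' \<le> K * K * kdist * dist (h (coord e y)) (h (coord e y')) \<and>
       dist (h (coord e y)) (h (coord e y')) \<le> K * K * kdist * \<rho> * dist y y') \<and>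
    ball (h (coord e x)) (min (r0/2) (\<rho> * t / (kdist * K))) \<subseteq> (\<lambda>y. h (coord e y)) ` ball x \<delta>1 \<and>
    (\<forall>y\<in>ball x \<delta>1. coord e y \<in> ball (coord e x) \<delta> \<and> param e (coord e y) = y)"
proof -
  define \<zeta> where "\<zeta> = coord e x"
  define B where "B = ball \<zeta> \<delta>"
  have e3: "e \<in> {None, Some 0, c}" using x(2) by auto
  have kd: "kdist > 0" using kdist_ge_1 by linarith
  have "x \<noteq> e" using x(3) by auto
  then have px: "param e \<zeta> = x" by (simp add: \<zeta>_def)
  have far: "dist (h z) c \<ge> r0" if z: "z \<in> B" for z
  proof (rule ccontr)
    assume "\<not> ?thesis"
    then have "dist (param e z) (fw f w c) < \<epsilon>0" using eq[OF w, of "h z"] h(2)[of z] z by (simp add: B_def \<zeta>_def)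
    moreover have "dist x (param e z) < \<epsilon>0"
    proof -
      have "dist (param e \<zeta>) (param e z) \<le> K * dist \<zeta> z" using K(2)[OF e3] .
      also have "\<dots> < K * \<delta>" using z K(1) by (simp add: B_def)
      finally show ?thesis using \<delta>(2) px by simp
    qed
    moreover have "2 * \<epsilon>0 \<le> dist x (fw f w c)" using \<epsilon>0[OF x(1) PP_word[OF w c]] .
    ultimately show False using dist_triangle[of x "fw f w c" "param e z"] by linarith
  qed
  define k where "k z = coord c (h z)" for z
  have hc: "h z \<noteq> c" if "z \<in> B" for z using far[OF that] r0 by auto
  have hk: "h z = param c (k z)" if "z \<in> B" for z using hc[OF that] by (simp add: k_def)
  have kh: "k holomorphic_on B" unfolding k_def
    using h(1) hc by (intro coord_holomorphic) (auto simp: B_def \<zeta>_def)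
  have ki: "inj_on k B"
  proof (rule inj_onI)
    fix z z' assume z: "z \<in> B" "z' \<in> B" "k z = k z'"
    then have "h z = h z'" using hk by metis
    then have "param e z = param e z'" using h(2) z by (metis B_def \<zeta>_def)
    then show "z = z'" using inj_param by (metis injD)
  qed
  obtain \<rho> where \<rho>: "\<rho> > 0" "\<And>z w. z \<in> ball \<zeta> (\<delta>/5) \<Longrightarrow> w \<in> ball \<zeta> (\<delta>/5) \<Longrightarrow>
       \<rho> * norm (z - w) \<le> kdist * norm (k z - k w) \<and> norm (k z - k w) \<le> kdist * \<rho> * norm (z - w)"
    using univalent_quasi_similarity[of k \<zeta> \<delta>] kh ki \<delta>(1) unfolding B_def by blast
  have sub: "ball \<zeta> (\<delta>/5) \<subseteq> B" using \<delta>(1) by (auto simp: B_def)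
  have kL: "dist (k z) (k z') \<le> K * dist (h z) (h z') \<and> norm (k z) \<le> K" if "z \<in> B" "z' \<in> B" for z z'
    unfolding k_def using far[OF that(1)] far[OF that(2)] r0 by (intro K(3)) auto
  have hL: "dist (h z) (h z') \<le> K * dist (k z) (k z')" if "z \<in> B" "z' \<in> B" for z z'
    unfolding hk[OF that(1)] hk[OF that(2)] by (intro K(2)) auto
  have mn: "min (1/2) (r0/2) \<le> d" if "d \<ge> 1/2" for d :: real using that by (rule min.coboundedI1)
  have co: "coord e y \<in> ball \<zeta> (\<delta>/5)" "param e (coord e y) = y" "dist y e \<ge> 1/2" if y: "y \<in> ball x \<delta>1" for y
  proof -
    have *: "dist y e \<ge> 1/2" using y x(3) \<delta>1(2) dist_triangle[of x e y] by simp
    then have "dist (coord e x) (coord e y) \<le> K * dist x y" using K(3)[OF e3 mn mn[OF *], of x] x(3) by simp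
    also have "\<dots> < K * \<delta>1" using y K(1) by simp
    finally show "coord e y \<in> ball \<zeta> (\<delta>/5)" using \<delta>1(3) \<delta>(1) by (simp add: \<zeta>_def)
    show "param e (coord e y) = y" using * by (intro param_coord) auto
    show "dist y e \<ge> 1/2" by (rule *)
  qed
  have cL: "dist (coord e y) (coord e y') \<le> K * dist y y'" if "y \<in> ball x \<delta>1" "y' \<in> ball x \<delta>1" for y y'
    using K(3)[OF e3 mn[OF co(3)[OF that(1)]] mn[OF co(3)[OF that(2)]]] by simp
  have pL: "dist y y' \<le> K * dist (coord e y) (coord e y')" if "y \<in> ball x \<delta>1" "y' \<in> ball x \<delta>1" for y y'
    using K(2)[OF e3, of "coord e y" "coord e y'"] co(2) that by auto
  show ?thesis
  proof (intro exI[of _ \<rho>] conjI ballI)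
    show "0 < \<rho>" by (rule \<rho>(1))
  next
    \<comment> \<open>\<open>k\<close> is bounded by \<open>K\<close>, so testing the lower estimate
      on two points at distance \<delta>/10 bounds the ratio from above, uniformly in the
      word.\<close>
    define z where "z = \<zeta> + of_real (\<delta> / 10)"
    have zB: "z \<in> ball \<zeta> (\<delta>/5)" "\<zeta> \<in> ball \<zeta> (\<delta>/5)" using \<delta>(1) by (auto simp: z_def dist_norm)
    have nz: "norm (z - \<zeta>) = \<delta> / 10" using \<delta>(1) by (simp add: z_def)
    have "\<rho> * (\<delta> / 10) \<le> kdist * norm (k z - k \<zeta>)" using \<rho>(2)[OF zB] unfolding nz by blast
    also have "\<dots> \<le> kdist * (K + K)"
    proof -
      have "z \<in> B" "\<zeta> \<in> B" using zB sub by auto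
      then have "norm (k z) \<le> K" "norm (k \<zeta>) \<le> K" using kL by blast+
      then have "norm (k z - k \<zeta>) \<le> K + K" using norm_triangle_ineq4[of "k z" "k \<zeta>"] by linarith
      then show ?thesis using kd by (intro mult_left_mono) auto
    qed
    finally show "\<rho> \<le> 20 * K * kdist / \<delta>" using \<delta>(1) by (simp add: field_simps)
  next
    fix y y' assume y: "y \<in> ball x \<delta>1" "y' \<in> ball x \<delta>1"
    note cb = co(1)[OF y(1)] co(1)[OF y(2)]
    have "\<rho> * dist y y' \<le> \<rho> * (K * dist (coord e y) (coord e y'))" using pL[OF y] \<rho>(1) by (intro mult_left_mono) auto
    also have "\<dots> = K * (\<rho> * norm (coord e y - coord e y'))" by (simp add: dist_norm)
    also have "\<dots> \<le> K * (kdist * norm (k (coord e y) - k (coord e y')))" using \<rho>(2)[OF cb] K(1) by (intro mult_left_mono) auto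
    also have "\<dots> \<le> K * (kdist * (K * dist (h (coord e y)) (h (coord e y'))))"
      using kL cb sub K(1) kd by (intro mult_left_mono) (auto simp: dist_norm subset_iff)
    finally show "\<rho> * dist y y' \<le> K * K * kdist * dist (h (coord e y)) (h (coord e y'))" by (simp add: mult_ac)
    have "dist (h (coord e y)) (h (coord e y')) \<le> K * norm (k (coord e y) - k (coord e y'))"
      using hL cb sub by (auto simp: dist_norm subset_iff)
    also have "\<dots> \<le> K * (kdist * \<rho> * norm (coord e y - coord e y'))" using \<rho>(2)[OF cb] K(1) by (intro mult_left_mono) auto
    also have "\<dots> \<le> K * (kdist * \<rho> * (K * dist y y'))" using cL[OF y] K(1) kd \<rho>(1) by (intro mult_left_mono) (auto simp: dist_norm)
    finally show "dist (h (coord e y)) (h (coord e y')) \<le> K * K * kdist * \<rho> * dist y y'" by (simp add: mult_ac)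
  next
    fix y assume "y \<in> ball x \<delta>1"
    then show "coord e y \<in> ball (coord e x) \<delta>" "param e (coord e y) = y" using co sub unfolding B_def \<zeta>_def by blast+
  next
    have t0: "t > 0" using \<delta>1(1) K(1) t by simp
    have t1: "K * t < \<delta>1" using \<delta>1(1) K(1) t by simp
    have "1 * t \<le> K * t" using t0 K(1) by (intro mult_right_mono) auto
    then have "t \<le> \<delta>1" using t1 by simp
    moreover have "\<delta>1 \<le> K * \<delta>1" using K(1) \<delta>1(1) by simp
    ultimately have t2: "t < \<delta> / 5" using \<delta>1(3) \<delta>(1) by linarith
    then have cb: "cball \<zeta> t \<subseteq> ball \<zeta> (\<delta>/5)" by auto
    have \<zeta>b: "\<zeta> \<in> ball \<zeta> (\<delta>/5)" using \<delta>(1) by simp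
    \<comment> \<open>\<open>k\<close> moves the boundary of \<open>ball \<zeta> t\<close> away from
      \<open>k \<zeta>\<close> by a definite amount, so the open image contains the ball of that
      radius.\<close>
    have im: "ball (k \<zeta>) (\<rho> * t / kdist) \<subseteq> k ` ball \<zeta> t"
    proof (rule ball_subset_open_map_image)
      show "continuous_on (closure (ball \<zeta> t)) k"
        using holomorphic_on_imp_continuous_on[OF kh] cb sub t0 by (auto intro: continuous_on_subset)
      have sb: "ball \<zeta> t \<subseteq> B" using cb sub by (meson ball_subset_cball order_trans)
      have "open (k ` ball \<zeta> t)"
        by (rule open_mapping_thm3[of k "ball \<zeta> t"]) (use sb kh ki in \<open>auto intro: holomorphic_on_subset inj_on_subset\<close>)
      then show "open (k ` interior (ball \<zeta> t))" by (simp add: interior_open)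
      fix z assume "z \<in> frontier (ball \<zeta> t)"
      then have z: "norm (z - \<zeta>) = t" using t0 by (simp add: dist_norm norm_minus_commute)
      then have "z \<in> ball \<zeta> (\<delta>/5)" using t2 by (simp add: dist_norm norm_minus_commute)
      then show "\<rho> * t / kdist \<le> norm (k z - k \<zeta>)" using \<rho>(2)[OF _ \<zeta>b, of z] z kd by (simp add: field_simps)
    qed (use t0 \<rho>(1) kd in auto)
    show "ball (h (coord e x)) (min (r0/2) (\<rho> * t / (kdist * K))) \<subseteq> (\<lambda>y. h (coord e y)) ` ball x \<delta>1"
    proof
      fix y assume y: "y \<in> ball (h (coord e x)) (min (r0/2) (\<rho> * t / (kdist * K)))"
      have \<zeta>B: "\<zeta> \<in> B" using \<delta>(1) by (simp add: B_def)
      have yc: "dist y c \<ge> r0/2" using far[OF \<zeta>B] y dist_triangle[of "h \<zeta>" c y] by (simp add: \<zeta>_def)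
      have "dist (k \<zeta>) (coord c y) \<le> K * dist (h \<zeta>) y"
        unfolding k_def using K(3)[of c "h \<zeta>" y] yc far[OF \<zeta>B] r0 by auto
      also have "\<dots> < K * (\<rho> * t / (kdist * K))" using y K(1) by (intro mult_strict_left_mono) (auto simp: \<zeta>_def)
      also have "\<dots> = \<rho> * t / kdist" using K(1) by simp
      finally obtain z where z: "z \<in> ball \<zeta> t" "coord c y = k z" using im by (auto simp: subset_iff image_iff)
      have zB: "z \<in> B" using z cb sub by (meson ball_subset_cball subsetD)
      have "y \<noteq> c" using yc r0 by auto
      then have "y = param c (k z)" using z(2) by (metis param_coord)
      then have "y = h z" using hk[OF zB] by simp
      moreover have "param e z \<in> ball x \<delta>1"
      proof -
        have "dist (param e \<zeta>) (param e z) \<le> K * dist \<zeta> z" using K(2)[OF e3] .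
        also have "\<dots> \<le> K * t" using z(1) K(1) by (intro mult_left_mono) auto
        finally show ?thesis using t1 px by simp
      qed
      ultimately show "y \<in> (\<lambda>y. h (coord e y)) ` ball x \<delta>1" by (intro image_eqI[of _ _ "param e z"]) auto
    qed
  qed
qed

text \<open>The branch is prescribed by its value at an arbitrary point \<open>x1\<close> of the
  ball, not only at the centre: later the image of a given point is often merely close to the Julia
  point \<open>x\<close>.\<close>

theorem inverse_branches:
  "\<exists>\<delta>>0. \<exists>\<kappa>\<ge>1. \<forall>w\<in>Wd. \<forall>x\<in>JJ. \<forall>x1\<in>ball x \<delta>. \<forall>a. fw f w a = x1 \<longrightarrow> (\<exists>H \<rho>. Br f \<kappa> \<delta> w x H \<rho> \<and> H x1 = a)"
proof -
  obtain c r0 \<epsilon>0 where c: "c \<in> PP" and r0: "r0 > 0" and e0: "\<epsilon>0 > 0" and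
    \<epsilon>0: "\<And>x y. x \<in> JJ \<Longrightarrow> y \<in> PP \<Longrightarrow> 2 * \<epsilon>0 \<le> dist x y" and
    eq: "\<And>w y. w \<in> Wd \<Longrightarrow> dist y c < r0 \<Longrightarrow> dist (fw f w y) (fw f w c) < \<epsilon>0"
    using postcritical_separation by metis
  have "min (1/2) (r0/2) > 0" using r0 by simp
  from chart_constants[OF this, of c] obtain K where K: "K \<ge> 1" "\<And>e z w. e \<in> {None, Some 0, c} \<Longrightarrow> dist (param e z) (param e w) \<le> K * dist z w"
    "\<And>e a b. e \<in> {None, Some 0, c} \<Longrightarrow> dist a e \<ge> min (1/2) (r0/2) \<Longrightarrow> dist b e \<ge> min (1/2) (r0/2) \<Longrightarrow>
       dist (coord e a) (coord e b) \<le> K * dist a b \<and> norm (coord e a) \<le> K"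
    by metis
  define \<delta> where "\<delta> = \<epsilon>0 / K"
  have \<delta>: "\<delta> > 0" "K * \<delta> \<le> \<epsilon>0" using e0 K(1) by (auto simp: \<delta>_def)
  define \<delta>1 where "\<delta>1 = min (1/2) (\<delta> / (10 * K))"
  have \<delta>1: "\<delta>1 > 0" "\<delta>1 \<le> 1/2" "K * \<delta>1 \<le> \<delta> / 10"
    using \<delta> K(1) by (auto simp: \<delta>1_def min_def field_simps)
  define t where "t = \<delta>1 / (2 * K)"
  have t0: "t > 0" using \<delta>1(1) K(1) by (simp add: t_def)
  define R where "R = 20 * K * kdist / \<delta>"
  have kd: "kdist \<ge> 1" by (rule kdist_ge_1)
  have R: "R > 0" using kd K(1) \<delta>(1) by (simp add: R_def)
  \<comment> \<open>All summands are nonnegative, so \<kappa> dominates each of the constants that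
    \<open>Br\<close> asks for.\<close>
  define \<kappa> where "\<kappa> = 1 + K * K * kdist + R + 2 * R / r0 + kdist * K / t + K * K * kdist * R"
  have pos: "K * K * kdist \<ge> 0" "2 * R / r0 \<ge> 0" "kdist * K / t \<ge> 0" "K * K * kdist * R \<ge> 0"
    using kd K(1) R r0 t0 by auto
  have \<kappa>: "\<kappa> \<ge> 1" "\<kappa> \<ge> K * K * kdist" "\<kappa> \<ge> R" "\<kappa> \<ge> 2 * R / r0" "\<kappa> \<ge> kdist * K / t" "\<kappa> \<ge> K * K * kdist * R"
    using pos R unfolding \<kappa>_def by linarith+
  have "\<exists>H \<rho>. Br f \<kappa> \<delta>1 w x H \<rho> \<and> H x1 = a"
    if w: "w \<in> Wd" and x: "x \<in> JJ" and x1: "x1 \<in> ball x \<delta>1" and a: "fw f w a = x1" for w x x1 a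
  proof -
    obtain e where e: "e \<in> {None, Some 0}" "dist x e \<ge> 1" using far_chart by blast
    have mn: "min (1/2) (r0/2) \<le> d" if "d \<ge> 1/2" for d :: real using that by (rule min.coboundedI1)
    define U where "U = ball (coord e x) \<delta>"
    have e3: "e \<in> {None, Some 0, c}" using e by auto
    have x1e: "dist x1 e \<ge> 1/2" using x1 e(2) \<delta>1(2) dist_triangle[of x e x1] by simp
    have "dist (coord e x) (coord e x1) \<le> K * dist x x1" using K(3)[OF e3 mn mn[OF x1e], of x] e(2) by simp
    also have "\<dots> < K * \<delta>1" using x1 K(1) by simp
    finally have x1U: "coord e x1 \<in> U" using \<delta>1(3) \<delta>(1) by (simp add: U_def)
    have px1: "param e (coord e x1) = x1" using x1e by (intro param_coord) auto
    have nPP: "param e z \<notin> PP" if "z \<in> U" for z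
    proof
      assume p: "param e z \<in> PP"
      have "param e (coord e x) = x" using e(2) by (intro param_coord) auto
      then have "dist x (param e z) \<le> K * dist (coord e x) z" using K(2)[OF e3, of "coord e x" z] by simp
      also have "\<dots> \<le> K * \<delta>" using that K(1) by (intro mult_left_mono) (auto simp: U_def)
      finally show False using \<epsilon>0[OF x p] \<delta>(2) e0 by linarith
    qed
    obtain h where h: "shol h U" "h (coord e x1) = a" "\<And>v. v \<in> U \<Longrightarrow> fw f w (h v) = param e v"
      using inverse_branch_exists[OF w, of U "param e" "coord e x1" a] nPP x1U px1 a shol_param by (auto simp: U_def)
    define H where "H y = h (coord e y)" for y
    have hU: "shol h (ball (coord e x) \<delta>)" "\<And>z. z \<in> ball (coord e x) \<delta> \<Longrightarrow> fw f w (h z) = param e z"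
      using h by (auto simp: U_def)
    have "\<exists>\<rho>>0. \<rho> \<le> 20 * K * kdist / \<delta> \<and>
      (\<forall>y\<in>ball x \<delta>1. \<forall>y'\<in>ball x \<delta>1. \<rho> * dist y y' \<le> K * K * kdist * dist (h (coord e y)) (h (coord e y')) \<and>
         dist (h (coord e y)) (h (coord e y')) \<le> K * K * kdist * \<rho> * dist y y') \<and>
      ball (h (coord e x)) (min (r0/2) (\<rho> * t / (kdist * K))) \<subseteq> (\<lambda>y. h (coord e y)) ` ball x \<delta>1 \<and>
      (\<forall>y\<in>ball x \<delta>1. coord e y \<in> ball (coord e x) \<delta> \<and> param e (coord e y) = y)"
      by (rule branch_estimate[of c r0 \<epsilon>0 K \<delta> x e w h \<delta>1 t]) (fact c r0 \<epsilon>0 eq K \<delta> x e w hU \<delta>1 t_def)+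
    then obtain \<rho> where \<rho>0: "0 < \<rho>" "\<rho> \<le> 20 * K * kdist / \<delta>"
      "\<forall>y\<in>ball x \<delta>1. \<forall>y'\<in>ball x \<delta>1. \<rho> * dist y y' \<le> K * K * kdist * dist (h (coord e y)) (h (coord e y')) \<and>
         dist (h (coord e y)) (h (coord e y')) \<le> K * K * kdist * \<rho> * dist y y'"
      "ball (h (coord e x)) (min (r0/2) (\<rho> * t / (kdist * K))) \<subseteq> (\<lambda>y. h (coord e y)) ` ball x \<delta>1"
      "\<forall>y\<in>ball x \<delta>1. coord e y \<in> ball (coord e x) \<delta> \<and> param e (coord e y) = y" by blast
    have Hi: "(\<lambda>y. h (coord e y)) = H" by (auto simp: H_def)
    note \<rho> = \<rho>0[folded H_def U_def R_def, unfolded Hi]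
    have "Br f \<kappa> \<delta>1 w x H \<rho>"
      unfolding Br_def
    proof (intro conjI ballI allI impI)
      show "0 < \<rho>" by (rule \<rho>)
      show "\<rho> \<le> \<kappa>" using \<rho>(2) \<kappa> by linarith
      show "fw f w (H y) = y" if "y \<in> ball x \<delta>1" for y using \<rho>(5) that h(3) by (simp add: H_def)
      fix y y' assume y: "y \<in> ball x \<delta>1" "y' \<in> ball x \<delta>1"
      show "\<rho> * dist y y' \<le> \<kappa> * dist (H y) (H y')"
        by (rule order_trans[OF \<rho>(3)[rule_format, OF y, THEN conjunct1]]) (intro mult_right_mono \<kappa>(2) zero_le_dist)
      show "dist (H y) (H y') \<le> \<kappa> * \<rho> * dist y y'"
        by (rule order_trans[OF \<rho>(3)[rule_format, OF y, THEN conjunct2]]) (intro mult_right_mono \<kappa>(2) zero_le_dist less_imp_le[OF \<rho>(1)])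
    next
      fix u v y y' assume uv: "w = u @ v" and y: "y \<in> ball x \<delta>1" "y' \<in> ball x \<delta>1"
      have u: "u \<in> Wd" and v: "v \<in> Wd" using w uv by auto
      \<comment> \<open>Over the same disc \<open>fw f u\<close> composed with \<open>h\<close> is
        an inverse branch of the suffix \<open>v\<close>; the estimate applies to it with a ratio of
        its own, bounded by \<open>R\<close>.\<close>
      have hu: "shol (\<lambda>z. fw f u (h z)) (ball (coord e x) \<delta>)"
        using shol_compose[OF word_smap[OF u] h(1)] by (simp add: U_def)
      have hv: "fw f v (fw f u (h z)) = param e z" if "z \<in> ball (coord e x) \<delta>" for z
        using h(3)[of z] that uv by (simp add: U_def)
      have "\<exists>\<rho>>0. \<rho> \<le> 20 * K * kdist / \<delta> \<and>
        (\<forall>y\<in>ball x \<delta>1. \<forall>y'\<in>ball x \<delta>1. \<rho> * dist y y' \<le> K * K * kdist * dist (fw f u (h (coord e y))) (fw f u (h (coord e y'))) \<and>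
           dist (fw f u (h (coord e y))) (fw f u (h (coord e y'))) \<le> K * K * kdist * \<rho> * dist y y') \<and>
        ball (fw f u (h (coord e x))) (min (r0/2) (\<rho> * t / (kdist * K))) \<subseteq> (\<lambda>y. fw f u (h (coord e y))) ` ball x \<delta>1 \<and>
        (\<forall>y\<in>ball x \<delta>1. coord e y \<in> ball (coord e x) \<delta> \<and> param e (coord e y) = y)"
        by (rule branch_estimate[of c r0 \<epsilon>0 K \<delta> x e v "\<lambda>z. fw f u (h z)" \<delta>1 t]) (fact c r0 \<epsilon>0 eq K \<delta> x e v hu hv \<delta>1 t_def)+
      then obtain \<rho>' where \<rho>': "0 < \<rho>'" "\<rho>' \<le> R"
        "dist (fw f u (H y)) (fw f u (H y')) \<le> K * K * kdist * \<rho>' * dist y y'" using y unfolding R_def H_def by blast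
      have "K * K * kdist * \<rho>' \<le> \<kappa>"
        using \<rho>'(2) \<kappa>(6) pos(1) mult_left_mono[of \<rho>' R "K * K * kdist"] by linarith
      then show "dist (fw f u (H y)) (fw f u (H y')) \<le> \<kappa> * dist y y'"
        using \<rho>'(3) by (meson mult_right_mono order_trans zero_le_dist)
    next
      have "\<rho> / \<kappa> \<le> r0 / 2"
      proof -
        have "2 * \<rho> \<le> \<kappa> * r0" using \<rho>(2) \<kappa>(4) r0 by (simp add: field_simps)
        then show ?thesis using \<kappa>(1) by (simp add: field_simps)
      qed
      moreover have "\<rho> / \<kappa> \<le> \<rho> * t / (kdist * K)"
      proof -
        have "kdist * K \<le> \<kappa> * t" using \<kappa>(5) t0 by (simp add: field_simps)
        then have "\<rho> * (kdist * K) \<le> \<rho> * (\<kappa> * t)" using \<rho>(1) by (intro mult_left_mono) auto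
        moreover have "kdist * K > 0" using kd K(1) by simp
        ultimately show ?thesis using \<kappa>(1) by (simp add: field_simps)
      qed
      ultimately have "ball (H x) (\<rho> / \<kappa>) \<subseteq> ball (H x) (min (r0/2) (\<rho> * t / (kdist * K)))" by (intro subset_ball) auto
      then show "ball (H x) (\<rho> / \<kappa>) \<subseteq> H ` ball x \<delta>1" using \<rho>(4) by blast
    qed
    then show ?thesis using h(2) by (auto simp: H_def)
  qed
  then show ?thesis using \<delta>1(1) \<kappa>(1) by blast
qed

end

section \<open>Expansion on the Julia set\<close>

lemma choice2: "(\<And>x y. \<exists>z. Q x y z) \<Longrightarrow> \<exists>g. \<forall>x y. Q x y (g x y)"
  by metis

lemma common_prefix_split:
  assumes "length v \<le> length w"
  obtains (prefix) t where "w = v @ t"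
    | (differ) u i j a b where "v = u @ j # a" "w = u @ i # b" "i \<noteq> j"
  using assms
proof (induction v arbitrary: w thesis)
  case Nil
  then show ?case by auto
next
  case (Cons x v)
  obtain y w' where w: "w = y # w'" "length v \<le> length w'" using Cons.prems(3) by (cases w) auto
  show ?case
  proof (cases "x = y")
    case False
    then show ?thesis using Cons.prems(2)[of "[]" x v y w'] w by auto
  next
    case True
    show ?thesis
    proof (rule Cons.IH[OF _ _ w(2)])
      fix t assume "w' = v @ t" then show thesis using Cons.prems(1)[of t] w True by simp
    next
      fix u i j a b assume "v = u @ j # a" "w' = u @ i # b" "i \<noteq> j"
      then show thesis using Cons.prems(2)[of "x # u" j a i b] w True by simp
    qed
  qed
qed

locale branched_semigroup = hyperbolic_semigroup +
  fixes \<kappa> \<delta> :: real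
  assumes \<delta>: "\<delta> > 0" and \<kappa>: "\<kappa> \<ge> 1"
    and branch: "\<And>w x x1 a. w \<in> Wd \<Longrightarrow> x \<in> JJ \<Longrightarrow> x1 \<in> ball x \<delta> \<Longrightarrow> fw f w a = x1 \<Longrightarrow>
        \<exists>H \<rho>. Br f \<kappa> \<delta> w x H \<rho> \<and> H x1 = a"
begin

abbreviation "BB \<equiv> Br f \<kappa> \<delta>"

lemma BB_D:
  assumes "BB w x H \<rho>"
  shows "0 < \<rho>" "\<rho> \<le> \<kappa>" "y \<in> ball x \<delta> \<Longrightarrow> fw f w (H y) = y"
    "y \<in> ball x \<delta> \<Longrightarrow> y' \<in> ball x \<delta> \<Longrightarrow> \<rho> * dist y y' \<le> \<kappa> * dist (H y) (H y')"
    "y \<in> ball x \<delta> \<Longrightarrow> y' \<in> ball x \<delta> \<Longrightarrow> dist (H y) (H y') \<le> \<kappa> * \<rho> * dist y y'"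
    "w = u @ v \<Longrightarrow> y \<in> ball x \<delta> \<Longrightarrow> y' \<in> ball x \<delta> \<Longrightarrow> dist (fw f u (H y)) (fw f u (H y')) \<le> \<kappa> * dist y y'"
    "ball (H x) (\<rho> / \<kappa>) \<subseteq> H ` ball x \<delta>"
  using assms unfolding Br_def by blast+

lemma BB_julia: "BB w x H \<rho> \<Longrightarrow> w \<in> Wd \<Longrightarrow> y \<in> ball x \<delta> \<Longrightarrow> y \<in> JJ \<Longrightarrow> H y \<in> JJ"
  using BB_D(3) julia_back by metis

lemma \<kappa>_pos: "\<kappa> > 0" using \<kappa> by linarith

lemma closed_preimage_julia: "i \<in> II \<Longrightarrow> closed (f i -` JJ)"
  using smap_continuous_on[OF gen_smap] closed_julia by (simp add: closed_vimage)

lemma itinerary_separation: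
  obtains \<eta> where "\<eta> > 0"
    "\<And>i j y z. i \<in> II \<Longrightarrow> j \<in> II \<Longrightarrow> f i y \<in> JJ \<Longrightarrow> f j z \<in> JJ \<Longrightarrow> dist y z < \<eta> \<Longrightarrow> i = j"
proof -
  have "\<exists>d. d > 0 \<and> (i \<in> II \<longrightarrow> j \<in> II \<longrightarrow> i \<noteq> j \<longrightarrow> (\<forall>y z. f i y \<in> JJ \<longrightarrow> f j z \<in> JJ \<longrightarrow> d \<le> dist y z))" for i j
  proof (cases "i \<in> II \<and> j \<in> II \<and> i \<noteq> j")
    case True
    then obtain d where "d > 0" "\<forall>y\<in>f i -` JJ. \<forall>z\<in>f j -` JJ. d \<le> dist y z"
      using separate_compact_closed_metric[OF closed_imp_compact_sph[OF closed_preimage_julia] closed_preimage_julia A2, of i j] by blast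
    then show ?thesis by (intro exI[of _ d]) auto
  next
    case False
    then show ?thesis by (intro exI[of _ 1]) auto
  qed
  then obtain d where "\<forall>i j. d i j > (0::real) \<and> (i \<in> II \<longrightarrow> j \<in> II \<longrightarrow> i \<noteq> j \<longrightarrow> (\<forall>y z. f i y \<in> JJ \<longrightarrow> f j z \<in> JJ \<longrightarrow> d i j \<le> dist y z))"
    using choice2[of "\<lambda>i j d. d > (0::real) \<and> (i \<in> II \<longrightarrow> j \<in> II \<longrightarrow> i \<noteq> j \<longrightarrow> (\<forall>y z. f i y \<in> JJ \<longrightarrow> f j z \<in> JJ \<longrightarrow> d \<le> dist y z))"] by blast
  then have d: "\<And>i j. d i j > 0"
    "\<And>i j y z. i \<in> II \<Longrightarrow> j \<in> II \<Longrightarrow> i \<noteq> j \<Longrightarrow> f i y \<in> JJ \<Longrightarrow> f j z \<in> JJ \<Longrightarrow> d i j \<le> dist y z" by blast+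
  define \<eta> where "\<eta> = Min ((\<lambda>(i, j). d i j) ` (II \<times> II))"
  have "\<eta> > 0" unfolding \<eta>_def using d(1) by (subst Min_gr_iff) auto
  then show ?thesis
  proof (rule that[of \<eta>])
    fix i j y z assume a: "i \<in> II" "j \<in> II" "f i y \<in> JJ" "f j z \<in> JJ" "dist y z < \<eta>"
    have le: "\<eta> \<le> d i j" unfolding \<eta>_def using a by (intro Min_le) (auto intro!: image_eqI[of _ _ "(i, j)"])
    show "i = j"
    proof (rule ccontr)
      assume "i \<noteq> j"
      then have "d i j \<le> dist y z" using d(2)[of i j y z] a by blast
      then show False using le a(5) by linarith
    qed
  qed
qed

text \<open>Where an orbit arrives when it leaves the Julia set through a wrong letter. By
  \<open>A2\<close> this is a compact subset of the Fatou set, so equicontinuity is uniform on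
  it.\<close>

definition CC :: "sph set" where "CC = (\<Union>i\<in>II. \<Union>j\<in>II - {i}. f j ` (f i -` JJ))"

lemma compact_CC: "compact CC"
  unfolding CC_def
  by (intro compact_UN compact_continuous_image smap_continuous_on gen_smap finite_Diff closed_imp_compact_sph closed_preimage_julia) auto

lemma CC_fatou: "CC \<subseteq> FF"
proof
  fix y assume "y \<in> CC"
  then obtain i j z where "i \<in> II" "j \<in> II" "j \<noteq> i" "f i z \<in> JJ" "y = f j z" unfolding CC_def by blast
  then show "y \<in> FF" using julia_unique[of i z j] julia_iff by blast
qed

lemma CC_I: "i \<in> II \<Longrightarrow> j \<in> II \<Longrightarrow> i \<noteq> j \<Longrightarrow> f i z \<in> JJ \<Longrightarrow> f j z \<in> CC"
  unfolding CC_def by blast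

lemma uniform_continuity:
  assumes "\<epsilon> > 0"
  obtains d where "d > 0" "\<And>i a b. i \<in> II \<Longrightarrow> dist a b < d \<Longrightarrow> dist (f i a) (f i b) < \<epsilon>"
proof -
  have "\<exists>d. d > 0 \<and> (i \<in> II \<longrightarrow> (\<forall>a b. dist a b < d \<longrightarrow> dist (f i a) (f i b) < \<epsilon>))" for i
  proof (cases "i \<in> II")
    case True
    then have "uniformly_continuous_on UNIV (f i)"
      by (intro compact_uniformly_continuous smap_continuous_on gen_smap compact_UNIV_sph)
    then obtain d where "d > 0" "\<And>a b. a \<in> UNIV \<Longrightarrow> b \<in> UNIV \<Longrightarrow> dist b a < d \<Longrightarrow> dist (f i b) (f i a) < \<epsilon>"
      using assms by (rule uniformly_continuous_onE) (rule that)
    then show ?thesis by auto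
  qed (auto intro: exI[of _ 1])
  then obtain d where d: "\<forall>i. d i > 0 \<and> (i \<in> II \<longrightarrow> (\<forall>a b. dist a b < d i \<longrightarrow> dist (f i a) (f i b) < \<epsilon>))"
    using choice[of "\<lambda>i d. d > 0 \<and> (i \<in> II \<longrightarrow> (\<forall>a b. dist a b < d \<longrightarrow> dist (f i a) (f i b) < \<epsilon>))"] by blast
  have p: "Min (d ` II) > 0" using d by (subst Min_gr_iff) auto
  show ?thesis
  proof (rule that[OF p])
    fix i and a b :: sph assume a: "i \<in> II" "dist a b < Min (d ` II)"
    have "Min (d ` II) \<le> d i" using a by (intro Min_le) auto
    then show "dist (f i a) (f i b) < \<epsilon>" using a d by force
  qed
qed

text \<open>If long inverse branches do not contract, the semigroup is equicontinuous at every point of the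
  Julia set near a limit of their values: a word either follows the common itinerary, along which
  distances are controlled, or leaves it into the compact subset \<open>CC\<close> of the Fatou set.\<close>

lemma expansion:
  assumes \<epsilon>: "\<epsilon> > 0"
  obtains N where "\<And>w x H \<rho>. w \<in> Wd \<Longrightarrow> length w \<ge> N \<Longrightarrow> x \<in> JJ \<Longrightarrow> BB w x H \<rho> \<Longrightarrow> \<rho> < \<epsilon>"
proof -
  have "\<exists>N. \<forall>w x H \<rho>. w \<in> Wd \<and> length w \<ge> N \<and> x \<in> JJ \<and> BB w x H \<rho> \<longrightarrow> \<rho> < \<epsilon>"
  proof (rule ccontr)
    assume "\<not> ?thesis"
    then have "\<forall>N. \<exists>w x H \<rho>. w \<in> Wd \<and> length w \<ge> N \<and> x \<in> JJ \<and> BB w x H \<rho> \<and> \<rho> \<ge> \<epsilon>"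
      by (meson linorder_not_less)
    then obtain w x H \<rho> where whx: "\<And>n::nat. w n \<in> Wd" "\<And>n. length (w n) \<ge> n" "\<And>n. x n \<in> JJ"
      "\<And>n. BB (w n) (x n) (H n) (\<rho> n)" "\<And>n. \<rho> n \<ge> \<epsilon>" by metis
    define z where "z n = H n (x n)" for n
    have xb: "x n \<in> ball (x n) \<delta>" for n using \<delta> by simp
    have zJ: "z n \<in> JJ" for n unfolding z_def using BB_julia[OF whx(4,1) xb whx(3)] .
    have fz: "fw f (w n) (z n) = x n" for n unfolding z_def using BB_D(3)[OF whx(4) xb] .
    obtain l r where lr: "l \<in> JJ" "strict_mono (r::nat\<Rightarrow>nat)" "(z \<circ> r) \<longlonglongrightarrow> l"
      using compact_imp_seq_compact[OF compact_julia] zJ unfolding seq_compact_def by metis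
    define c where "c = \<epsilon> / \<kappa>"
    define \<Lambda> where "\<Lambda> = \<kappa> * (\<kappa> / \<epsilon>)"
    have c: "c > 0" and \<Lambda>: "\<Lambda> > 0" using \<epsilon> \<kappa>_pos by (auto simp: c_def \<Lambda>_def)
    \<comment> \<open>A point of \<open>ball (z n) c\<close> lies in the image of the branch because
      \<open>\<rho> n \<ge> \<epsilon>\<close>. Passing to its image near \<open>x n\<close> costs
      \<kappa>/\<epsilon>, and the prefix clause of \<open>Br\<close> costs another
      \<kappa>.\<close>
    have Lip: "dist (fw f u y) (fw f u y') \<le> \<Lambda> * dist y y'"
      if y: "y \<in> ball (z n) c" "y' \<in> ball (z n) c" and uv: "w n = u @ v" for n y y' u v
    proof -
      have "c \<le> \<rho> n / \<kappa>" using whx(5)[of n] \<kappa>_pos by (simp add: c_def divide_right_mono)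
      then have "ball (z n) c \<subseteq> ball (z n) (\<rho> n / \<kappa>)" by (rule subset_ball)
      then obtain t t' where t: "t \<in> ball (x n) \<delta>" "y = H n t" "t' \<in> ball (x n) \<delta>" "y' = H n t'"
        using BB_D(7)[OF whx(4)[of n]] y unfolding z_def by blast
      have "\<epsilon> * dist t t' \<le> \<rho> n * dist t t'" using whx(5) by (intro mult_right_mono) auto
      also have "\<dots> \<le> \<kappa> * dist y y'" using BB_D(4)[OF whx(4) t(1,3)] t by simp
      finally have "dist t t' \<le> \<kappa> / \<epsilon> * dist y y'" using \<epsilon> by (simp add: field_simps)
      moreover have "dist (fw f u y) (fw f u y') \<le> \<kappa> * dist t t'" using BB_D(6)[OF whx(4) uv t(1,3)] t by simp
      ultimately show ?thesis unfolding \<Lambda>_def using \<kappa>_pos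
        by (smt (verit) mult.assoc mult_left_mono)
    qed
    obtain \<eta> where \<eta>: "\<eta> > 0"
      "\<And>i j y z. i \<in> II \<Longrightarrow> j \<in> II \<Longrightarrow> f i y \<in> JJ \<Longrightarrow> f j z \<in> JJ \<Longrightarrow> dist y z < \<eta> \<Longrightarrow> i = j"
      using itinerary_separation by metis
    define c1 where "c1 = min (c / 2) (\<eta> / \<Lambda>)"
    have c1: "c1 > 0" "c1 \<le> c / 2" "\<Lambda> * c1 \<le> \<eta>" using c \<Lambda> \<eta>(1) by (auto simp: c1_def min_def field_simps)
    \<comment> \<open>Julia points near \<open>z n\<close> share its itinerary: their images stay
      within \<eta> of those of \<open>z n\<close>, and \<eta> separates the letters that keep a
      point in the Julia set.\<close>
    have itin: "fw f u y \<in> JJ" if y: "y \<in> JJ" "dist (z n) y < c1" and "w n = u @ v" for n y u v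
      using that(3)
    proof (induction u arbitrary: v rule: rev_induct)
      case Nil then show ?case using y by simp
    next
      case (snoc i u)
      have wn: "w n = u @ (i # v)" using snoc.prems by simp
      then have i: "i \<in> II" and u: "u \<in> Wd" and v: "v \<in> Wd" using whx(1)[of n] by auto
      have uJ: "fw f u y \<in> JJ" using snoc.IH[OF wn] .
      have "fw f v (f i (fw f u (z n))) = x n" using fz[of n] wn by simp
      then have iJ: "f i (fw f u (z n)) \<in> JJ" using julia_back[of v] whx(3)[of n] v by metis
      obtain j where j: "j \<in> II" "f j (fw f u y) \<in> JJ" using julia_step[OF uJ] by blast
      have "dist (fw f u y) (fw f u (z n)) \<le> \<Lambda> * dist y (z n)"
        using Lip[OF _ _ wn] y(2) c1 c by (simp add: dist_commute)
      also have "\<dots> < \<Lambda> * c1" using y(2) \<Lambda> by (simp add: dist_commute)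
      finally have "dist (fw f u y) (fw f u (z n)) < \<eta>" using c1 by linarith
      then have "j = i" using \<eta>(2)[OF j(1) i j(2) iJ] by blast
      then show ?case using j by simp
    qed
    have eq: "eqc y" if y: "y \<in> ball l (c1 / 2)" for y
    proof (cases "y \<in> JJ")
      case False then show ?thesis using fatou_eqc by (simp add: julia_iff)
    next
      case True
      show ?thesis unfolding eqc_def
      proof (intro allI impI)
        fix e :: real assume e: "e > 0"
        obtain dF where dF: "dF > 0" "\<And>u y w. u \<in> CC \<Longrightarrow> dist y u < dF \<Longrightarrow> w \<in> Wd \<Longrightarrow> dist (fw f w y) (fw f w u) < e"
          using uniform_equicont[OF compact_CC CC_fatou e] by metis
        obtain d where d: "d > 0" "\<And>i a b. i \<in> II \<Longrightarrow> dist a b < d \<Longrightarrow> dist (f i a) (f i b) < dF"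
          using uniform_continuity[OF dF(1)] by metis
        \<comment> \<open>The bounds serve, in this order, to stay in the ball where
          \<open>Lip\<close> holds, to be \<open>dF\<close>-close after the letter that leaves the
          itinerary, and to treat the words that never leave it.\<close>
        define \<tau> where "\<tau> = min (c1 / 2) (min (d / \<Lambda>) (e / \<Lambda>))"
        have \<tau>: "\<tau> > 0" "\<tau> \<le> c1 / 2" "\<Lambda> * \<tau> \<le> d" "\<Lambda> * \<tau> \<le> e"
          using c1 d(1) e \<Lambda> by (auto simp: \<tau>_def min_def field_simps)
        have "dist (fw f v y') (fw f v y) < e" if v: "v \<in> Wd" and y': "dist y' y < \<tau>" for v y'
        proof -
          have "eventually (\<lambda>k. dist (z (r k)) l < c1 / 2) sequentially"
            using lr(3) c1(1) tendstoD[of "z \<circ> r" l sequentially "c1/2"] by simp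
          then obtain k0 where k0: "\<And>k. k \<ge> k0 \<Longrightarrow> dist (z (r k)) l < c1 / 2" by (auto simp: eventually_sequentially)
          define n where "n = r (max k0 (length v))"
          have nl: "dist (z n) l < c1 / 2" using k0[of "max k0 (length v)"] by (simp add: n_def)
          have "n \<ge> max k0 (length v)" unfolding n_def by (rule seq_suble[OF lr(2)])
          then have len: "length v \<le> length (w n)" using whx(2)[of n] by linarith
          have zy: "dist (z n) y < c1" using nl y dist_triangle[of "z n" y l] by simp
          have "dist (z n) y' < c" using zy y' \<tau>(2) c1(1,2) dist_triangle2[of "z n" y' y] by linarith
          moreover have "dist (z n) y < c" using zy c1 c by linarith
          ultimately have yc: "y' \<in> ball (z n) c" "y \<in> ball (z n) c" by auto
          have lt: "\<Lambda> * dist y' y < \<Lambda> * \<tau>" using y' \<Lambda> by simp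
          show ?thesis
          proof (rule common_prefix_split[OF len])
            fix t assume "w n = v @ t"
            then show ?thesis using Lip[OF yc] lt \<tau>(4) by fastforce
          next
            fix u i j a b assume s: "v = u @ j # a" "w n = u @ i # b" "i \<noteq> j"
            have ij: "i \<in> II" "j \<in> II" "a \<in> Wd" using s v whx(1)[of n] by auto
            have "dist (fw f u y') (fw f u y) < d" using Lip[OF yc s(2)] lt \<tau>(3) by linarith
            then have 1: "dist (f j (fw f u y')) (f j (fw f u y)) < dF" using d(2) ij by blast
            have "f i (fw f u y) \<in> JJ" using itin[OF True zy, of "u @ [i]" b] s(2) by simp
            then have "f j (fw f u y) \<in> CC" using CC_I ij s(3) by blast
            then show ?thesis using dF(2)[OF _ 1 ij(3)] s(1) by simp
          qed
        qed
        then show "\<exists>\<delta>>0. \<forall>w\<in>Wd. \<forall>x. dist x y < \<delta> \<longrightarrow> dist (fw f w x) (fw f w y) < e" using \<tau>(1) by blast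
      qed
    qed
    have "l \<in> FF" unfolding fatou_iff using eq c1(1) by (intro exI[of _ "c1/2"]) auto
    then show False using lr(1) by (simp add: julia_iff)
  qed
  then show ?thesis using that by blast
qed

section \<open>Contraction ratios\<close>

definition Rt :: "nat list \<Rightarrow> sph \<Rightarrow> real \<Rightarrow> bool" where
  "Rt w z \<rho> \<longleftrightarrow> (\<exists>H. BB w (fw f w z) H \<rho> \<and> H (fw f w z) = z)"

text \<open>Plays the role of the inverse of the modulus of the derivative of \<open>w\<close> at
  \<open>z\<close>. Any admissible ratio agrees with the chosen one up to a power of \<kappa>, by
  \<open>R_compare\<close>.\<close>

definition R :: "nat list \<Rightarrow> sph \<Rightarrow> real" where "R w z = (SOME \<rho>. Rt w z \<rho>)"

lemma Rt_R: assumes "w \<in> Wd" "fw f w z \<in> JJ" shows "Rt w z (R w z)"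
proof -
  have "\<exists>\<rho>. Rt w z \<rho>" unfolding Rt_def using branch[OF assms, of "fw f w z" z] \<delta> by auto
  then show ?thesis unfolding R_def by (rule someI_ex)
qed

lemma R_branch:
  assumes "w \<in> Wd" "fw f w z \<in> JJ"
  obtains H where "BB w (fw f w z) H (R w z)" "H (fw f w z) = z"
  using Rt_R[OF assms] unfolding Rt_def by blast

lemma R_pos: "w \<in> Wd \<Longrightarrow> fw f w z \<in> JJ \<Longrightarrow> 0 < R w z" "w \<in> Wd \<Longrightarrow> fw f w z \<in> JJ \<Longrightarrow> R w z \<le> \<kappa>"
  by (erule (1) R_branch, erule BB_D)+

lemma Rt_local:
  assumes "Rt w z \<rho>" "dist z y < \<rho> / \<kappa>"
  shows "dist y z \<le> \<kappa> * \<rho> * dist (fw f w y) (fw f w z)" "\<rho> * dist (fw f w y) (fw f w z) \<le> \<kappa> * dist y z"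
proof -
  obtain H where H: "BB w (fw f w z) H \<rho>" "H (fw f w z) = z" using assms(1) unfolding Rt_def by blast
  have "y \<in> ball (H (fw f w z)) (\<rho> / \<kappa>)" using assms(2) H(2) by simp
  then obtain u where u: "u \<in> ball (fw f w z) \<delta>" "y = H u" using BB_D(7)[OF H(1)] by blast
  have c: "fw f w z \<in> ball (fw f w z) \<delta>" using \<delta> by simp
  have "fw f w y = u" using BB_D(3)[OF H(1) u(1)] u(2) by simp
  then show "dist y z \<le> \<kappa> * \<rho> * dist (fw f w y) (fw f w z)" "\<rho> * dist (fw f w y) (fw f w z) \<le> \<kappa> * dist y z"
    using BB_D(4,5)[OF H(1) u(1) c] u(2) H(2) by auto
qed

lemma exists_near: assumes "r > 0" obtains y where "y \<noteq> x" "dist (x::sph) y < r"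
proof -
  obtain y where "dist x y = min (r/2) 1" using exists_dist_eq[of "min (r/2) 1" x] assms by auto
  then have "dist x y > 0" "dist x y < r" using assms by auto
  then show ?thesis using that[of y] by auto
qed

text \<open>The chain rule. The displacement of one auxiliary point near \<open>z\<close> is
  measured at the start, after \<open>w\<close> and after \<open>w @ v\<close>; each of the three
  ratios involved costs a factor \<kappa>.\<close>

lemma R_mult:
  assumes "w \<in> Wd" "v \<in> Wd" "fw f (w @ v) z \<in> JJ"
  shows "R (w @ v) z \<le> \<kappa>^3 * (R w z * R v (fw f w z))" "R w z * R v (fw f w z) \<le> \<kappa>^3 * R (w @ v) z"
proof -
  have vJ: "fw f v (fw f w z) \<in> JJ" using assms by simp
  have wJ: "fw f w z \<in> JJ" using julia_back[OF vJ assms(2)] .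
  have wv: "w @ v \<in> Wd" using assms by simp
  define \<rho>1 \<rho>2 \<rho>3 where \<rho>: "\<rho>1 = R w z" "\<rho>2 = R v (fw f w z)" "\<rho>3 = R (w @ v) z"
  have p: "\<rho>1 > 0" "\<rho>2 > 0" "\<rho>3 > 0" using R_pos assms vJ wJ wv by (auto simp: \<rho>)
  have Rt: "Rt w z \<rho>1" "Rt v (fw f w z) \<rho>2" "Rt (w @ v) z \<rho>3"
    unfolding \<rho> using Rt_R assms vJ wJ wv by auto
  have "\<rho>2 / \<kappa> > 0" using p \<kappa>_pos by simp
  then obtain d where d: "d > 0" "\<And>y. dist y z < d \<Longrightarrow> dist (fw f w y) (fw f w z) < \<rho>2 / \<kappa>"
    using word_isCont[OF assms(1), of z] unfolding continuous_at_eps_delta by blast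
  have "min d (min (\<rho>1 / \<kappa>) (\<rho>3 / \<kappa>)) > 0" using d p \<kappa>_pos by simp
  then obtain y where y: "y \<noteq> z" "dist z y < min d (min (\<rho>1 / \<kappa>) (\<rho>3 / \<kappa>))" by (rule exists_near)
  define D0 D1 D2 where D: "D0 = dist y z" "D1 = dist (fw f w y) (fw f w z)" "D2 = dist (fw f v (fw f w y)) (fw f v (fw f w z))"
  have 1: "D0 \<le> \<kappa> * \<rho>1 * D1" "\<rho>1 * D1 \<le> \<kappa> * D0" using Rt_local[OF Rt(1), of y] y by (auto simp: D)
  have "dist (fw f w z) (fw f w y) < \<rho>2 / \<kappa>" using d(2)[of y] y by (simp add: dist_commute)
  then have 2: "D1 \<le> \<kappa> * \<rho>2 * D2" "\<rho>2 * D2 \<le> \<kappa> * D1" using Rt_local[OF Rt(2)] by (auto simp: D)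
  have 3: "D0 \<le> \<kappa> * \<rho>3 * D2" "\<rho>3 * D2 \<le> \<kappa> * D0" using Rt_local[OF Rt(3), of y] y by (auto simp: D)
  have "D0 > 0" using y by (simp add: D)
  then have D2: "D2 > 0" using 3(1) p \<kappa>_pos by (metis D(3) dist_pos_lt less_le_not_le mult_eq_0_iff order_less_le zero_le_dist)
  have "\<rho>3 * D2 \<le> \<kappa> * (\<kappa> * \<rho>1 * D1)" using 3(2) 1(1) \<kappa>_pos by (smt (verit) mult_left_mono)
  also have "\<dots> = (\<kappa> * \<kappa> * \<rho>1) * D1" by simp
  also have "\<dots> \<le> (\<kappa> * \<kappa> * \<rho>1) * (\<kappa> * \<rho>2 * D2)" using 2(1) \<kappa>_pos p by (intro mult_left_mono) auto
  finally have "\<rho>3 * D2 \<le> (\<kappa>^3 * (\<rho>1 * \<rho>2)) * D2" by (simp add: power3_eq_cube mult_ac)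
  then show "R (w @ v) z \<le> \<kappa>^3 * (R w z * R v (fw f w z))" using D2 by (simp add: \<rho>)
  have "\<rho>1 * \<rho>2 * D2 = \<rho>1 * (\<rho>2 * D2)" by simp
  also have "\<dots> \<le> \<rho>1 * (\<kappa> * D1)" using 2(2) p by (intro mult_left_mono) auto
  also have "\<dots> = \<kappa> * (\<rho>1 * D1)" by simp
  also have "\<dots> \<le> \<kappa> * (\<kappa> * (\<kappa> * \<rho>3 * D2))"
    using 1(2) 3(1) \<kappa>_pos by (intro mult_left_mono order_trans[OF 1(2)]) auto
  finally have "(\<rho>1 * \<rho>2) * D2 \<le> (\<kappa>^3 * \<rho>3) * D2" by (simp add: power3_eq_cube mult_ac)
  then show "R w z * R v (fw f w z) \<le> \<kappa>^3 * R (w @ v) z" using D2 by (simp add: \<rho>)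
qed

text \<open>Bounded distortion of a branch: both ratios measure the displacement of the same
  auxiliary point near \<open>u\<close>.\<close>

lemma R_compare:
  assumes w: "w \<in> Wd" and H: "BB w x H \<rho>" and x: "x \<in> JJ" and u: "u \<in> JJ" "u \<in> ball x \<delta>"
  shows "R w (H u) \<le> \<kappa>^2 * \<rho>" "\<rho> \<le> \<kappa>^2 * R w (H u)"
proof -
  have fu: "fw f w (H u) = u" using BB_D(3)[OF H u(2)] .
  define \<rho>' where "\<rho>' = R w (H u)"
  have Rt: "Rt w (H u) \<rho>'" unfolding \<rho>'_def using Rt_R[OF w, of "H u"] fu u by simp
  have p: "\<rho>' > 0" "\<rho> > 0" using R_pos(1)[OF w, of "H u"] fu u BB_D(1)[OF H] by (auto simp: \<rho>'_def)
  have "min (\<delta> - dist x u) (\<rho>' / \<kappa> / (\<kappa> * \<rho>)) > 0" using p \<kappa>_pos u by auto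
  then obtain t where t: "t \<noteq> u" "dist u t < min (\<delta> - dist x u) (\<rho>' / \<kappa> / (\<kappa> * \<rho>))" by (rule exists_near)
  have tb: "t \<in> ball x \<delta>" using t dist_triangle[of x t u] by simp
  have ft: "fw f w (H t) = t" using BB_D(3)[OF H tb] .
  have d1: "dist (H t) (H u) \<le> \<kappa> * \<rho> * dist t u" "\<rho> * dist t u \<le> \<kappa> * dist (H t) (H u)" using BB_D(4,5)[OF H tb u(2)] by auto
  have "\<kappa> * \<rho> * dist t u < \<kappa> * \<rho> * (\<rho>' / \<kappa> / (\<kappa> * \<rho>))" using t p \<kappa>_pos by (intro mult_strict_left_mono) (auto simp: dist_commute)
  also have "\<dots> = \<rho>' / \<kappa>" using p \<kappa>_pos by simp
  finally have "dist (H u) (H t) < \<rho>' / \<kappa>" using d1 by (simp add: dist_commute)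
  note L = Rt_local[OF Rt this, unfolded ft fu]
  have D: "dist t u > 0" using t by simp
  have "\<rho>' * dist t u \<le> \<kappa> * (\<kappa> * \<rho> * dist t u)" using L(2) d1(1) \<kappa>_pos by (smt (verit) mult_left_mono)
  then have "\<rho>' * dist t u \<le> (\<kappa>^2 * \<rho>) * dist t u" by (simp add: power2_eq_square mult_ac)
  then show "R w (H u) \<le> \<kappa>^2 * \<rho>" using D by (simp add: \<rho>'_def)
  have "\<rho> * dist t u \<le> \<kappa> * (\<kappa> * \<rho>' * dist t u)" using L(1) d1(2) \<kappa>_pos by (smt (verit) mult_left_mono)
  then have "\<rho> * dist t u \<le> (\<kappa>^2 * \<rho>') * dist t u" by (simp add: power2_eq_square mult_ac)
  then show "\<rho> \<le> \<kappa>^2 * R w (H u)" using D by (simp add: \<rho>'_def)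
qed

lemma R_Nil_ge: assumes "z \<in> JJ" shows "1 \<le> \<kappa> * R [] z"
proof -
  have Rt: "Rt [] z (R [] z)" using Rt_R[of "[]" z] assms by simp
  have "R [] z / \<kappa> > 0" using R_pos(1)[of "[]" z] assms \<kappa>_pos by simp
  then obtain y where y: "y \<noteq> z" "dist z y < R [] z / \<kappa>" by (rule exists_near)
  have "dist y z \<le> \<kappa> * R [] z * dist y z" using Rt_local(1)[OF Rt y(2)] by simp
  then show ?thesis using y(1) by simp
qed

text \<open>Appending a letter shrinks the ratio at most by a constant factor, as needed when a word
  is extended until it just fails a size condition. The reason is uniform continuity: a point at
  distance \<open>t\<close> from \<open>f i z\<close> has no preimage very close to
  \<open>z\<close>.\<close>

lemma R_single_ge:
  obtains c where "c > 0" "\<And>i z. i \<in> II \<Longrightarrow> f i z \<in> JJ \<Longrightarrow> c \<le> R [i] z"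
proof -
  define t where "t = min (\<delta> / 2) 1"
  have t: "t > 0" "t < \<delta>" "t \<le> 1" using \<delta> by (auto simp: t_def)
  obtain \<tau> where \<tau>: "\<tau> > 0" "\<And>i a b. i \<in> II \<Longrightarrow> dist a b < \<tau> \<Longrightarrow> dist (f i a) (f i b) < t"
    using uniform_continuity[OF t(1)] by metis
  have "\<tau> / (\<kappa> * t) \<le> R [i] z" if i: "i \<in> II" and z: "f i z \<in> JJ" for i z
  proof -
    obtain H where H: "BB [i] (f i z) H (R [i] z)" "H (f i z) = z" using R_branch[of "[i]" z] i z by auto
    obtain u where u: "dist (f i z) u = t" using exists_dist_eq[of t "f i z"] t by auto
    have ub: "u \<in> ball (f i z) \<delta>" "f i z \<in> ball (f i z) \<delta>" using u t \<delta> by auto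
    have "dist (H u) z \<le> \<kappa> * R [i] z * t" using BB_D(5)[OF H(1) ub] H(2) u by (simp add: dist_commute)
    moreover have "f i (H u) = u" using BB_D(3)[OF H(1) ub(1)] by simp
    then have "\<not> dist (H u) z < \<tau>" using \<tau>(2)[OF i, of "H u" z] u by (auto simp: dist_commute)
    ultimately have "\<tau> \<le> R [i] z * (\<kappa> * t)" by (simp add: mult_ac)
    then show ?thesis using \<kappa>_pos t by (simp add: pos_divide_le_eq)
  qed
  then show ?thesis using that[of "\<tau> / (\<kappa> * t)"] \<tau>(1) \<kappa>_pos t by auto
qed

lemma R_small:
  assumes "\<epsilon> > 0"
  obtains N where "N \<ge> 1" "\<And>w z. w \<in> Wd \<Longrightarrow> length w \<ge> N \<Longrightarrow> fw f w z \<in> JJ \<Longrightarrow> R w z < \<epsilon>"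
proof -
  obtain N where N: "\<And>w x H \<rho>. w \<in> Wd \<Longrightarrow> length w \<ge> N \<Longrightarrow> x \<in> JJ \<Longrightarrow> BB w x H \<rho> \<Longrightarrow> \<rho> < \<epsilon>"
    by (rule expansion[OF assms]) (rule that)
  have "R w z < \<epsilon>" if w: "w \<in> Wd" "length w \<ge> max 1 N" "fw f w z \<in> JJ" for w z
  proof -
    obtain H where H: "BB w (fw f w z) H (R w z)" by (rule R_branch[OF w(1,3)])
    show ?thesis by (rule N[OF w(1) _ w(3) H]) (use w in simp)
  qed
  then show ?thesis using that[of "max 1 N"] by auto
qed

lemma R_decay:
  obtains N where "N \<ge> 1" "\<And>w z. w \<in> Wd \<Longrightarrow> fw f w z \<in> JJ \<Longrightarrow> R w z \<le> \<kappa> * (1/2) ^ (length w div N)"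
proof -
  \<comment> \<open>Compensates the factor \<open>\<kappa>^3\<close> of \<open>R_mult\<close>, so
    that every block of \<open>N\<close> letters gains a full factor 1/2.\<close>
  have "1 / (2 * \<kappa>^3) > 0" using \<kappa>_pos by simp
  then obtain N where N: "N \<ge> 1" "\<And>w z. w \<in> Wd \<Longrightarrow> length w \<ge> N \<Longrightarrow> fw f w z \<in> JJ \<Longrightarrow> R w z < 1 / (2 * \<kappa>^3)"
    by (rule R_small) (rule that)
  have "R w z \<le> \<kappa> * (1/2) ^ (length w div N)" if "w \<in> Wd" "fw f w z \<in> JJ" for w z
    using that
  proof (induction "length w" arbitrary: w z rule: less_induct)
    case less
    show ?case
    proof (cases "length w < N")
      case True then show ?thesis using R_pos(2) less.prems by simp
    next
      case False
      define u v where uv: "u = take N w" "v = drop N w"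
      have w: "w = u @ v" "length u = N" "length v = length w - N" using False by (auto simp: uv)
      then have W: "u \<in> Wd" "v \<in> Wd" "fw f v (fw f u z) \<in> JJ" using less.prems by auto
      have uJ: "fw f u z \<in> JJ" using julia_back W by blast
      have IH: "R v (fw f u z) \<le> \<kappa> * (1/2) ^ (length v div N)"
      proof (rule less.hyps)
        show "length v < length w" using w(3) N(1) False by linarith
      qed (fact W)+
      have ru: "R u z < 1 / (2 * \<kappa>^3)" using N(2)[OF W(1) _ uJ] w(2) by simp
      have ru0: "0 < R u z" by (rule R_pos(1)[OF W(1) uJ])
      have rv: "0 < R v (fw f u z)" by (rule R_pos(1)[OF W(2,3)])
      have "R w z \<le> \<kappa>^3 * (R u z * R v (fw f u z))" using R_mult(1)[OF W(1,2), of z] less.prems(2) unfolding w(1) by simp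
      also have "\<dots> \<le> \<kappa>^3 * (1 / (2 * \<kappa>^3) * (\<kappa> * (1/2) ^ (length v div N)))"
        using ru ru0 rv IH \<kappa>_pos by (intro mult_left_mono mult_mono) auto
      also have "\<dots> = \<kappa> * (1/2) ^ Suc (length v div N)" using \<kappa>_pos by simp
      also have "Suc (length v div N) = length w div N" using w(3) False N(1) by (simp add: le_div_geq)
      finally show ?thesis .
    qed
  qed
  then show ?thesis using that N(1) by blast
qed

lemma pull_back:
  assumes "w \<in> Wd" "x \<in> JJ" "dist x (fw f w z) < \<delta>"
  obtains H \<rho> where "BB w x H \<rho>" "H x \<in> JJ" "dist z (H x) \<le> \<kappa> * \<rho> * dist (fw f w z) x"
proof -
  obtain H \<rho> where H: "BB w x H \<rho>" "H (fw f w z) = z" using branch[OF assms(1,2), of "fw f w z" z] assms(3) by auto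
  have x: "x \<in> ball x \<delta>" "fw f w z \<in> ball x \<delta>" using assms \<delta> by auto
  show ?thesis using that[OF H(1) BB_julia[OF H(1) assms(1) x(1) assms(2)]] BB_D(5)[OF H(1) x(2,1)] H(2) by simp
qed

end

section \<open>Contraction on the Fatou set\<close>

context branched_semigroup
begin

text \<open>A compact exhaustion of the Fatou set.\<close>

definition FE :: "real \<Rightarrow> sph set" where "FE \<eta> = {z. \<eta> \<le> infdist z JJ}"

lemma closed_FE: "closed (FE \<eta>)"
  unfolding FE_def by (intro closed_Collect_le continuous_intros)

lemma compact_FE: "compact (FE \<eta>)" using closed_FE closed_imp_compact_sph by blast

lemma FE_fatou: "\<eta> > 0 \<Longrightarrow> FE \<eta> \<subseteq> FF"
  unfolding FE_def by (auto simp: julia_def dest: infdist_zero) (metis ComplI infdist_zero linorder_not_le)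

lemma FE_mono: "\<eta> \<le> \<eta>' \<Longrightarrow> FE \<eta>' \<subseteq> FE \<eta>" by (auto simp: FE_def)

lemma infdist_julia_attained: "\<exists>x\<in>JJ. infdist z JJ = dist z x"
proof -
  have "continuous_on JJ (\<lambda>x. dist z x)" by (intro continuous_intros)
  then obtain x where x: "x \<in> JJ" "\<forall>y\<in>JJ. dist z x \<le> dist z y"
    using continuous_attains_inf[OF compact_julia julia_nonempty] by blast
  have "dist z x \<le> infdist z JJ"
    unfolding infdist_notempty[OF julia_nonempty] using x(2) by (intro cINF_greatest[OF julia_nonempty]) auto
  then show ?thesis using infdist_le[OF x(1), of z] x(1) by (intro bexI[of _ x]) auto
qed

lemma fatou_FE:
  assumes "compact K" "K \<subseteq> FF" obtains \<eta> where "\<eta> > 0" "K \<subseteq> FE \<eta>"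
proof -
  have "K \<inter> JJ = {}" using assms by (auto simp: julia_iff)
  then obtain d where d: "d > 0" "\<forall>x\<in>K. \<forall>y\<in>JJ. d \<le> dist x y"
    using separate_compact_closed_metric[OF assms(1) closed_julia] by blast
  have "K \<subseteq> FE d" 
  proof
    fix z assume "z \<in> K"
    moreover obtain x where "x \<in> JJ" "infdist z JJ = dist z x" using infdist_julia_attained by blast
    ultimately show "z \<in> FE d" using d(2) by (simp add: FE_def)
  qed
  then show ?thesis using that d(1) by blast
qed

text \<open>If the image were too close to the Julia set, the branch of \<open>w\<close> through
  \<open>z\<close> would carry the nearest Julia point back to one too close to
  \<open>z\<close>.\<close>

lemma FE_word:
  assumes z: "z \<in> FE \<eta>" and \<eta>: "\<eta> > 0" and w: "w \<in> Wd"
  shows "fw f w z \<in> FE (min \<delta> (\<eta> / \<kappa>^2))"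
proof (rule ccontr)
  assume "\<not> ?thesis"
  then have lt: "infdist (fw f w z) JJ < min \<delta> (\<eta> / \<kappa>^2)" unfolding FE_def mem_Collect_eq not_le .
  obtain x where x: "x \<in> JJ" "infdist (fw f w z) JJ = dist (fw f w z) x" using infdist_julia_attained by blast
  have "dist x (fw f w z) < \<delta>" using lt x by (simp add: dist_commute)
  then obtain H \<rho> where H: "BB w x H \<rho>" "H x \<in> JJ" "dist z (H x) \<le> \<kappa> * \<rho> * dist (fw f w z) x"
    by (rule pull_back[OF w x(1)])
  have "\<eta> \<le> dist z (H x)" using z infdist_le[OF H(2), of z] by (simp add: FE_def)
  also have "\<dots> \<le> \<kappa> * \<kappa> * dist (fw f w z) x"
    by (rule order_trans[OF H(3)]) (use BB_D(2)[OF H(1)] \<kappa>_pos in \<open>intro mult_right_mono mult_left_mono, auto\<close>)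
  also have "\<dots> < \<kappa> * \<kappa> * (\<eta> / \<kappa>^2)" using lt x \<kappa>_pos by (intro mult_strict_left_mono) auto
  also have "\<dots> = \<eta>" using \<kappa>_pos by (simp add: power2_eq_square)
  finally show False by simp
qed

text \<open>The same pull-back, now with a contracting branch: a long word at least doubles the
  distance to the Julia set, up to the size \<delta> of the branches.\<close>

lemma FE_absorb:
  obtains n where "n \<ge> 1" "\<And>w z \<eta>. w \<in> Wd \<Longrightarrow> length w \<ge> n \<Longrightarrow> 0 < \<eta> \<Longrightarrow> \<eta> \<le> \<delta> \<Longrightarrow> z \<in> FE (\<eta> / 2) \<Longrightarrow> fw f w z \<in> FE \<eta>"
proof -
  have "1 / (2 * \<kappa>) > 0" using \<kappa>_pos by simp
  then obtain N where N: "\<And>w x H \<rho>. w \<in> Wd \<Longrightarrow> length w \<ge> N \<Longrightarrow> x \<in> JJ \<Longrightarrow> BB w x H \<rho> \<Longrightarrow> \<rho> < 1 / (2 * \<kappa>)"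
    by (rule expansion) (rule that)
  have "fw f w z \<in> FE \<eta>" if w: "w \<in> Wd" "length w \<ge> max 1 N" and \<eta>: "0 < \<eta>" "\<eta> \<le> \<delta>" and z: "z \<in> FE (\<eta> / 2)" for w z \<eta>
  proof (rule ccontr)
    assume "\<not> ?thesis"
    then have lt: "infdist (fw f w z) JJ < \<eta>" by (simp add: FE_def)
    obtain x where x: "x \<in> JJ" "infdist (fw f w z) JJ = dist (fw f w z) x" using infdist_julia_attained by blast
    have "dist x (fw f w z) < \<delta>" using lt x \<eta> by (simp add: dist_commute)
    then obtain H \<rho> where H: "BB w x H \<rho>" "H x \<in> JJ" "dist z (H x) \<le> \<kappa> * \<rho> * dist (fw f w z) x"
      by (rule pull_back[OF w(1) x(1)])
    have "\<rho> < 1 / (2 * \<kappa>)" using N[OF w(1) _ x(1) H(1)] w(2) by simp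
    then have "\<kappa> * \<rho> \<le> 1/2" using \<kappa>_pos by (simp add: field_simps)
    then have "\<kappa> * \<rho> * dist (fw f w z) x \<le> 1/2 * dist (fw f w z) x" by (intro mult_right_mono) auto
    moreover have "\<eta> / 2 \<le> dist z (H x)" using z infdist_le[OF H(2), of z] by (simp add: FE_def)
    ultimately show False using H(3) lt x by linarith
  qed
  then show ?thesis using that[of "max 1 N"] by auto
qed

text \<open>The Earle--Hamilton argument: if \<open>g\<close> maps a bounded domain deep into itself, then so does
  \<open>g + \<tau> (g - g z)\<close>, whose derivative at \<open>z\<close> is larger by the factor \<open>1 + \<tau>\<close>.\<close>

lemma contraction_step:
  fixes V V' :: "complex set" and g :: "nat list \<Rightarrow> complex \<Rightarrow> complex"
  assumes V: "open V" "V' \<subseteq> V" and \<tau>: "\<tau> > 0" and K: "\<And>z. z \<in> V \<Longrightarrow> norm z \<le> K"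
    and \<epsilon>: "\<And>z z'. z \<in> V' \<Longrightarrow> dist z z' < \<epsilon> \<Longrightarrow> z' \<in> V" "\<tau> * (2 * K) < \<epsilon>"
    and hol: "\<And>w. w \<in> W \<Longrightarrow> g w holomorphic_on V" and im: "\<And>w z. w \<in> W \<Longrightarrow> z \<in> V \<Longrightarrow> g w z \<in> V'"
    and ws: "set ws \<subseteq> W" and h: "h holomorphic_on V" "h ` V \<subseteq> V" and z: "z \<in> V'"
  shows "fold g ws holomorphic_on V \<and> fold g ws ` V \<subseteq> V \<and>
    (\<exists>h'. h' holomorphic_on V \<and> h' ` V \<subseteq> V \<and> norm (deriv (h \<circ> fold g ws) z) * (1 + \<tau>) ^ length ws \<le> norm (deriv h' z))"
  using ws z
proof (induction ws arbitrary: z)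
  case Nil
  then show ?case using h by (auto simp: o_def)
next
  case (Cons w ws)
  have w: "w \<in> W" and ws: "set ws \<subseteq> W" using Cons.prems by auto
  have gz: "g w z \<in> V'" using im[OF w] Cons.prems V by auto
  note IH = Cons.IH[OF ws gz]
  have gw: "g w holomorphic_on V" "g w ` V \<subseteq> V" using hol[OF w] im[OF w] V by auto
  have comp: "h1 \<circ> g1 holomorphic_on V" "(h1 \<circ> g1) ` V \<subseteq> V"
    if "h1 holomorphic_on V" "h1 ` V \<subseteq> V" "g1 holomorphic_on V" "g1 ` V \<subseteq> V" for h1 g1 :: "complex \<Rightarrow> complex"
    using that holomorphic_on_compose_gen[OF that(3,1)] by auto
  have fd: "h1 field_differentiable at u" if "h1 holomorphic_on V" "u \<in> V" for h1 :: "complex \<Rightarrow> complex" and u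
    using that V(1) by (metis holomorphic_on_imp_differentiable_at)
  obtain h' where h': "h' holomorphic_on V" "h' ` V \<subseteq> V"
     "norm (deriv (h \<circ> fold g ws) (g w z)) * (1 + \<tau>) ^ length ws \<le> norm (deriv h' (g w z))" using IH by blast
  define G where "G \<zeta> = g w \<zeta> + of_real \<tau> * (g w \<zeta> - g w z)" for \<zeta>
  have zV: "z \<in> V" using Cons.prems V by auto
  have GV: "G holomorphic_on V" unfolding G_def[abs_def] using gw(1) by (intro holomorphic_intros)
  have "G ` V \<subseteq> V"
  proof
    fix y assume "y \<in> G ` V"
    then obtain \<zeta> where \<zeta>: "\<zeta> \<in> V" "y = G \<zeta>" by auto
    have "norm (g w \<zeta> - g w z) \<le> 2 * K"
      using norm_triangle_ineq4[of "g w \<zeta>" "g w z"] K[of "g w \<zeta>"] K[of "g w z"] gw(2) \<zeta> zV by force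
    then have "dist (g w \<zeta>) y \<le> \<tau> * (2 * K)"
      unfolding \<zeta>(2) G_def using \<tau> by (simp add: dist_norm norm_mult)
    then show "y \<in> V" using \<epsilon>(1)[OF im[OF w \<zeta>(1)], of y] \<epsilon>(2) by linarith
  qed
  note hG = comp[OF h'(1,2) GV this]
  have Gz: "G z = g w z" by (simp add: G_def)
  have "(g w has_field_derivative deriv (g w) z) (at z)" using fd[OF gw(1) zV] field_differentiable_derivI by blast
  then have "(G has_field_derivative (1 + of_real \<tau>) * deriv (g w) z) (at z)"
    unfolding G_def[abs_def] by (auto intro!: derivative_eq_intros simp: algebra_simps)
  then have dG: "deriv G z = (1 + of_real \<tau>) * deriv (g w) z" by (rule DERIV_imp_deriv)
  have "deriv (h' \<circ> G) z = deriv h' (g w z) * deriv G z"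
    using deriv_chain[of G z h'] fd[OF GV zV] fd[OF h'(1), of "G z"] Gz gw(2) zV by auto
  then have n1: "norm (deriv (h' \<circ> G) z) = norm (deriv h' (g w z)) * ((1 + \<tau>) * norm (deriv (g w) z))"
    using \<tau> by (simp add: dG norm_mult) (metis abs_of_pos add_pos_pos norm_of_real of_real_1 of_real_add zero_less_one)
  have fh: "h \<circ> fold g ws holomorphic_on V" using comp[OF h] IH by blast
  have "h \<circ> fold g (w # ws) = (h \<circ> fold g ws) \<circ> g w" by (auto simp: o_def)
  then have "deriv (h \<circ> fold g (w # ws)) z = deriv (h \<circ> fold g ws) (g w z) * deriv (g w) z"
    using deriv_chain[of "g w" z "h \<circ> fold g ws"] fd[OF gw(1) zV] fd[OF fh, of "g w z"] gw(2) zV by auto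
  then have "norm (deriv (h \<circ> fold g (w # ws)) z) * (1 + \<tau>) ^ length (w # ws)
     = (norm (deriv (h \<circ> fold g ws) (g w z)) * (1 + \<tau>) ^ length ws) * ((1 + \<tau>) * norm (deriv (g w) z))"
    by (simp add: norm_mult mult_ac)
  also have "\<dots> \<le> norm (deriv h' (g w z)) * ((1 + \<tau>) * norm (deriv (g w) z))"
    using h'(3) \<tau> by (intro mult_right_mono) auto
  finally have "norm (deriv (h \<circ> fold g (w # ws)) z) * (1 + \<tau>) ^ length (w # ws) \<le> norm (deriv (h' \<circ> G) z)"
    by (simp only: n1)
  moreover have "fold g (w # ws) holomorphic_on V" "fold g (w # ws) ` V \<subseteq> V"
    using comp[of "fold g ws" "g w"] IH gw by (simp_all)
  ultimately show ?case using hG by blast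
qed

text \<open>In a chart whose pole is a Julia point the set \<open>V\<close> is bounded, and words of
  length \<open>n0\<close> map it into \<open>V'\<close>, which has a collar inside
  \<open>V\<close>. So each block of \<open>n0\<close> letters divides the derivative bound by 1 +
  \<tau>, and integration along short chart segments gives contraction of pairs of points.\<close>

lemma fatou_contraction:
  assumes \<eta>: "\<eta> > 0"
  obtains r where "r > 0" "\<And>\<epsilon>. \<epsilon> > 0 \<Longrightarrow> \<exists>N. \<forall>w\<in>Wd. length w \<ge> N \<longrightarrow>
     (\<forall>u\<in>FE \<eta>. \<forall>y. dist y u < r \<longrightarrow> dist (fw f w y) (fw f w u) < \<epsilon>)"
proof -
  obtain e where e: "e \<in> JJ" using julia_nonempty by blast
  define \<eta>0 where "\<eta>0 = min (\<eta> / 2) \<delta>"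
  have \<eta>0: "\<eta>0 > 0" "\<eta>0 \<le> \<eta> / 2" "\<eta>0 \<le> \<delta>" using \<eta> \<delta> by (auto simp: \<eta>0_def)
  obtain n0 where n0: "n0 \<ge> 1" "\<And>w z \<eta>. w \<in> Wd \<Longrightarrow> length w \<ge> n0 \<Longrightarrow> 0 < \<eta> \<Longrightarrow> \<eta> \<le> \<delta> \<Longrightarrow> z \<in> FE (\<eta> / 2) \<Longrightarrow> fw f w z \<in> FE \<eta>"
    by (rule FE_absorb) (rule that)
  obtain K' where K': "K' > 0" "\<And>z w. dist (param e z) (param e w) \<le> K' * dist z w" using param_Lipschitz by metis
  have "\<eta>0 / 2 > 0" using \<eta>0 by simp
  then obtain K where K: "K > 0" "\<And>a b. dist a e \<ge> \<eta>0 / 2 \<Longrightarrow> dist b e \<ge> \<eta>0 / 2 \<Longrightarrow>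
      dist (coord e a) (coord e b) \<le> K * dist a b \<and> norm (coord e a) \<le> K"
    using coord_Lipschitz[of "\<eta>0 / 2" e] by metis
  define dJ where "dJ z = infdist (param e z) JJ" for z
  have far: "t \<le> dist y e" if "t \<le> infdist y JJ" for y t using that infdist_le[OF e, of y] by linarith
  have dJ: "dJ z - K' * dist z z' \<le> dJ z'" for z z'
    using infdist_triangle[of "param e z" JJ "param e z'"] K'(2)[of z z'] unfolding dJ_def by linarith
  define V where "V = {z. \<eta>0 / 2 < dJ z}"
  define V' where "V' = {z. \<eta>0 \<le> dJ z}"
  have oV: "open V" unfolding V_def dJ_def
    by (intro open_Collect_less continuous_intros continuous_on_param)
  have VV: "V' \<subseteq> V" unfolding V_def V'_def using \<eta>0 by auto
  have bV: "norm z \<le> K" if "z \<in> V" for z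
    using K(2)[of "param e z" "param e z"] far[of "\<eta>0/2" "param e z"] that by (auto simp: V_def dJ_def)
  define \<epsilon>1 where "\<epsilon>1 = \<eta>0 / (4 * K')"
  have \<epsilon>1: "\<epsilon>1 > 0" using \<eta>0 K' by (simp add: \<epsilon>1_def)
  have nb: "z' \<in> V" if "z \<in> V'" "dist z z' < \<epsilon>1" for z z'
  proof -
    have "K' * dist z z' < K' * \<epsilon>1" using that K' by simp
    also have "\<dots> = \<eta>0 / 4" using K' by (simp add: \<epsilon>1_def)
    finally have "K' * dist z z' < \<eta>0 / 4" .
    moreover have "\<eta>0 \<le> dJ z" using that by (simp add: V'_def)
    ultimately have "\<eta>0 / 2 < dJ z'" using dJ[of z z'] \<eta>0(1) by linarith
    then show ?thesis by (simp add: V_def)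
  qed
  \<comment> \<open>A displacement by \<tau> times the bound \<open>2 * K\<close> for the diameter
    of \<open>V\<close> has to stay within the collar \<open>\<epsilon>1\<close> of
    \<open>V'\<close>.\<close>
  define \<tau> where "\<tau> = \<epsilon>1 / (4 * K)"
  have \<tau>: "\<tau> > 0" "\<tau> * (2 * K) < \<epsilon>1" using \<epsilon>1 K(1) by (auto simp: \<tau>_def)
  define g where "g w z = coord e (fw f w (param e z))" for w z
  define W where "W = {w\<in>Wd. length w = n0}"
  have fwV: "fw f w (param e z) \<in> FE \<eta>0" if "w \<in> Wd" "length w \<ge> n0" "z \<in> V" for w z
    using n0(2)[OF that(1,2) \<eta>0(1,3), of "param e z"] that(3) by (auto simp: V_def FE_def dJ_def)
  have ne: "fw f w (param e z) \<noteq> e" if "w \<in> Wd" "length w \<ge> n0" "z \<in> V" for w z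
    using fwV[OF that] far[of \<eta>0 e] \<eta>0(1) by (auto simp: FE_def)
  have gh: "g w holomorphic_on V" if "w \<in> W" for w
    unfolding g_def[abs_def]
  proof (rule coord_holomorphic[OF _ oV])
    show "shol (\<lambda>z. fw f w (param e z)) V" using word_smap[of w] that smap_param by (auto simp: W_def)
  qed (use ne that in \<open>auto simp: W_def\<close>)
  have gim: "g w z \<in> V'" if "w \<in> W" "z \<in> V" for w z
    using fwV[of w z] ne[of w z] that by (auto simp: V'_def dJ_def g_def W_def FE_def)
  have split: "\<exists>ws. set ws \<subseteq> W \<and> length ws = k \<and> (\<forall>z\<in>V. fold g ws z = g w z)" if "w \<in> Wd" "length w = k * n0" for w k
    using that
  proof (induction k arbitrary: w)
    case 0
    then show ?case by (intro exI[of _ "[]"]) (auto simp: g_def)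
  next
    case (Suc k)
    define u v where "u = take n0 w" "v = drop n0 w"
    then have uv: "w = u @ v" "length u = n0" "length v = k * n0" using Suc.prems by auto
    then have W: "u \<in> W" "v \<in> Wd" using Suc.prems by (auto simp: W_def)
    obtain ws where ws: "set ws \<subseteq> W" "length ws = k" "\<forall>z\<in>V. fold g ws z = g v z" using Suc.IH[OF W(2) uv(3)] by blast
    have "fold g (u # ws) z = g w z" if z: "z \<in> V" for z
    proof -
      have "g u z \<in> V" using gim[OF W(1) z] VV by auto
      then have "fold g (u # ws) z = g v (g u z)" using ws(3) by simp
      also have "\<dots> = g w z" using ne[of u z] W(1) z by (simp add: g_def uv(1) W_def)
      finally show ?thesis .
    qed
    then show ?case using ws W(1) by (intro exI[of _ "u # ws"]) auto
  qed
  define Q where "Q = K / (\<epsilon>1 / 2)"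
  have Q0: "Q > 0" using K(1) \<epsilon>1 by (simp add: Q_def)
  have cauchy: "norm (deriv h z) \<le> Q" if h: "h holomorphic_on V" "h ` V \<subseteq> V" and z: "z \<in> V'" for h z
  proof -
    have sub: "cball z (\<epsilon>1 / 2) \<subseteq> V" using nb[OF z] \<epsilon>1 by auto
    have "norm ((deriv ^^ 1) h z) \<le> fact 1 * K / (\<epsilon>1 / 2) ^ 1"
    proof (rule Cauchy_inequality)
      show "h holomorphic_on ball z (\<epsilon>1 / 2)" using h(1) sub by (meson ball_subset_cball holomorphic_on_subset order_trans)
      show "continuous_on (cball z (\<epsilon>1 / 2)) h" using h(1) sub by (meson holomorphic_on_imp_continuous_on holomorphic_on_subset)
      show "norm (h x) \<le> K" if "norm (z - x) = \<epsilon>1 / 2" for x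
      proof -
        have "x \<in> V" using sub that by (auto simp: dist_norm)
        then show ?thesis using h(2) bV by blast
      qed
    qed (use \<epsilon>1 in auto)
    then show ?thesis by (simp add: Q_def)
  qed
  have gderiv: "norm (deriv (g w) z) * (1 + \<tau>) ^ k \<le> Q \<and> g w field_differentiable at z"
    if w: "w \<in> Wd" "length w = k * n0" and z: "z \<in> V'" for w k z
  proof -
    obtain ws where ws: "set ws \<subseteq> W" "length ws = k" "\<forall>z\<in>V. fold g ws z = g w z" using split[OF w] by blast
    have id: "(\<lambda>z::complex. z) holomorphic_on V" "(\<lambda>z. z) ` V \<subseteq> V" by auto
    have "fold g ws holomorphic_on V \<and> fold g ws ` V \<subseteq> V \<and>
      (\<exists>h'. h' holomorphic_on V \<and> h' ` V \<subseteq> V \<and> norm (deriv ((\<lambda>z. z) \<circ> fold g ws) z) * (1 + \<tau>) ^ length ws \<le> norm (deriv h' z))"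
      by (rule contraction_step[of V V' \<tau> K \<epsilon>1 W g ws "\<lambda>z. z" z]) (fact oV VV \<tau>(1) bV nb \<tau>(2) gh gim ws(1) id z)+
    then obtain h' where h': "fold g ws holomorphic_on V" "h' holomorphic_on V" "h' ` V \<subseteq> V"
       "norm (deriv ((\<lambda>z. z) \<circ> fold g ws) z) * (1 + \<tau>) ^ length ws \<le> norm (deriv h' z)" by blast
    have ev: "eventually (\<lambda>v. fold g ws v = g w v) (nhds z)"
      using ws(3) z VV oV by (auto simp: eventually_nhds)
    have "(\<lambda>z. z) \<circ> fold g ws = fold g ws" by auto
    then have "norm (deriv (fold g ws) z) * (1 + \<tau>) ^ k \<le> Q" using h'(4) cauchy[OF h'(2,3) z] ws(2) by simp
    moreover have "deriv (fold g ws) z = deriv (g w) z" using ev by (intro deriv_cong_ev) auto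
    moreover have "g w holomorphic_on V" using h'(1) ws(3) holomorphic_transform by blast
    then have "g w field_differentiable at z" using z VV oV holomorphic_on_imp_differentiable_at by blast
    ultimately show ?thesis by simp
  qed
  \<comment> \<open>The first bound keeps \<open>y\<close> away from the pole \<open>e\<close>, the
    second keeps the whole chart segment from \<open>u\<close> to \<open>y\<close> in
    \<open>V'\<close>.\<close>
  define r where "r = min (\<eta> / 2) (\<eta> / (2 * (K' * K)))"
  have r: "r > 0" "r \<le> \<eta> / 2" "K' * (K * r) \<le> \<eta> / 2"
    using \<eta> K K' by (auto simp: r_def min_def field_simps)
  have main: "dist (fw f w y) (fw f w u) \<le> (K' * Q * K * r) * inverse ((1 + \<tau>) ^ k)"
    if w: "w \<in> Wd" "length w = k * n0" "k \<ge> 1" and u: "u \<in> FE \<eta>" and y: "dist y u < r" for w k u y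
  proof -
    have du: "\<eta> \<le> infdist u JJ" using u by (simp add: FE_def)
    have dy: "\<eta> / 2 \<le> infdist y JJ" using du y r(2) infdist_triangle[of u JJ y] by (simp add: dist_commute)
    have ue: "u \<noteq> e" "y \<noteq> e" using far[OF du] far[OF dy] \<eta> by auto
    have c: "dist (coord e u) (coord e y) \<le> K * dist u y"
      using K(2)[of u y] far[OF du] far[OF dy] \<eta>0(1,2) by auto
    have cr: "dist (coord e u) (coord e y) \<le> K * r"
      by (rule order_trans[OF c]) (use y K(1) in \<open>simp add: dist_commute\<close>)
    have seg: "z \<in> V'" if z: "z \<in> closed_segment (coord e u) (coord e y)" for z
    proof -
      have "dist (coord e u) z \<le> dist (coord e u) (coord e y)" using segment_bound(1)[OF z] by (simp add: dist_norm norm_minus_commute)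
      then have "K' * dist (coord e u) z \<le> K' * (K * r)" using cr K' by (intro mult_left_mono) auto
      then have "dJ z \<ge> \<eta> - \<eta> / 2" using dJ[of "coord e u" z] du ue r(3) unfolding dJ_def by simp
      then show ?thesis using \<eta>0(2) by (simp add: V'_def)
    qed
    have "norm (g w (coord e y) - g w (coord e u)) \<le> (Q * inverse ((1 + \<tau>) ^ k)) * norm (coord e y - coord e u)"
    proof (rule field_differentiable_bound[of "closed_segment (coord e u) (coord e y)" "g w" "deriv (g w)"])
      fix z assume z: "z \<in> closed_segment (coord e u) (coord e y)"
      note gd = gderiv[OF w(1,2) seg[OF z]]
      then show "(g w has_field_derivative deriv (g w) z) (at z within closed_segment (coord e u) (coord e y))"
        using field_differentiable_derivI has_field_derivative_at_within by blast
      have "(1 + \<tau>) ^ k > 0" using \<tau> by simp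
      then show "norm (deriv (g w) z) \<le> Q * inverse ((1 + \<tau>) ^ k)" using gd by (simp add: field_simps)
    qed auto
    also have "\<dots> \<le> (Q * inverse ((1 + \<tau>) ^ k)) * (K * r)"
      using cr Q0 \<tau> by (intro mult_left_mono) (auto simp: dist_norm norm_minus_commute)
    finally have gg: "dist (g w (coord e y)) (g w (coord e u)) \<le> (Q * inverse ((1 + \<tau>) ^ k)) * (K * r)" by (simp add: dist_norm)
    have len: "length w \<ge> n0" using w by (simp add: Suc_leI)
    have pu: "coord e u \<in> V" "coord e y \<in> V" using seg[of "coord e u"] seg[of "coord e y"] VV by auto
    have eqs: "fw f w y = param e (g w (coord e y))" "fw f w u = param e (g w (coord e u))"
      using ne[OF w(1) len pu(1)] ne[OF w(1) len pu(2)] ue by (auto simp: g_def)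
    have "dist (fw f w y) (fw f w u) \<le> K' * dist (g w (coord e y)) (g w (coord e u))"
      unfolding eqs by (rule K'(2))
    also have "\<dots> \<le> K' * ((Q * inverse ((1 + \<tau>) ^ k)) * (K * r))" using gg K'(1) by (intro mult_left_mono) auto
    finally show ?thesis by (simp add: mult_ac)
  qed
  show ?thesis
  proof (rule that[OF r(1)])
    fix \<epsilon> :: real assume \<epsilon>: "\<epsilon> > 0"
    obtain d where d: "d > 0" "\<And>u y w. u \<in> FE \<eta>0 \<Longrightarrow> dist y u < d \<Longrightarrow> w \<in> Wd \<Longrightarrow> dist (fw f w y) (fw f w u) < \<epsilon>"
      by (rule uniform_equicont[OF compact_FE FE_fatou[OF \<eta>0(1)] \<epsilon>]) (rule that)
    have "(\<lambda>k. (K' * Q * K * r) * inverse ((1 + \<tau>) ^ k)) \<longlonglongrightarrow> (K' * Q * K * r) * 0"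
      using \<tau> by (intro tendsto_mult tendsto_const LIMSEQ_inverse_realpow_zero) auto
    then have "eventually (\<lambda>k. (K' * Q * K * r) * inverse ((1 + \<tau>) ^ k) < d) sequentially"
      using d(1) by (intro order_tendstoD(2)[where y = "(K' * Q * K * r) * 0"]) auto
    then obtain k0 where k0: "\<And>k. k \<ge> k0 \<Longrightarrow> (K' * Q * K * r) * inverse ((1 + \<tau>) ^ k) < d"
      by (auto simp: eventually_sequentially)
    have "dist (fw f w y) (fw f w u) < \<epsilon>"
      if w: "w \<in> Wd" "length w \<ge> n0 * (k0 + 1)" and u: "u \<in> FE \<eta>" and y: "dist y u < r" for w u y
    proof -
      \<comment> \<open>The first \<open>k * n0\<close> letters bring the two points within
        \<open>d\<close>; uniform equicontinuity on \<open>FE \<eta>0\<close> takes care of the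
        remaining letters.\<close>
      define k where "k = k0 + 1"
      define w1 w2 where w12: "w1 = take (k * n0) w" "w2 = drop (k * n0) w"
      have W: "w = w1 @ w2" "length w1 = k * n0" using w(2) by (auto simp: w12 k_def mult.commute)
      then have W': "w1 \<in> Wd" "w2 \<in> Wd" using w(1) by auto
      have "dist (fw f w1 y) (fw f w1 u) < d"
        using main[OF W'(1) W(2) _ u y] k0[of k] by (simp add: k_def)
      moreover have "fw f w1 u \<in> FE \<eta>0"
      proof (rule n0(2)[OF W'(1) _ \<eta>0(1,3)])
        show "n0 \<le> length w1" using W(2) by (simp add: k_def)
        show "u \<in> FE (\<eta>0 / 2)" using u FE_mono[of "\<eta>0/2" \<eta>] \<eta>0 by auto
      qed
      ultimately show ?thesis using d(2)[OF _ _ W'(2)] W(1) by simp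
    qed
    then show "\<exists>N. \<forall>w\<in>Wd. length w \<ge> N \<longrightarrow> (\<forall>u\<in>FE \<eta>. \<forall>y. dist y u < r \<longrightarrow> dist (fw f w y) (fw f w u) < \<epsilon>)"
      by blast
  qed
qed

end

section \<open>Random orbits and absorption\<close>

lemma rorbit_eq_fw: "rorbit f \<omega> n z = fw f (map \<omega> [0..<n]) z"
  by (induction n) auto

lemma rorbit_add: "rorbit f \<omega> (m + n) z = rorbit f (\<lambda>k. \<omega> (m + k)) n (rorbit f \<omega> m z)"
  by (induction n) auto

locale attractor_system = branched_semigroup +
  fixes L :: "sph set" and p :: "nat \<Rightarrow> real"
  assumes minL: "minimal_set GG L" and other: "\<exists>K. minimal_set GG K \<and> K \<noteq> L"
    and p_pos: "\<And>i. i \<in> {1..s} \<Longrightarrow> 0 < p i" and p_sum: "(\<Sum>i\<in>{1..s}. p i) < 1"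
begin

lemma minimal_closed: "minimal_set GG K \<Longrightarrow> compact K"
  by (simp add: minimal_set_def scompact_iff_compact)

lemma minimal_eq: "minimal_set GG K \<Longrightarrow> z \<in> K \<Longrightarrow> K = closure {g z |g. g \<in> GG}"
  by (simp add: minimal_set_def sclosure_eq_closure)

lemma minimal_word: assumes "minimal_set GG K" "z \<in> K" "w \<in> Wd" shows "fw f w z \<in> K"
proof (cases "w = []")
  case False
  then have "fw f w \<in> GG" using assms(3) GG_eq by blast
  then have "fw f w z \<in> {g z |g. g \<in> GG}" by blast
  then have "fw f w z \<in> closure {g z |g. g \<in> GG}" by (rule closure_subset[THEN subsetD])
  then show ?thesis using minimal_eq[OF assms(1,2)] by simp
qed (use assms in auto)

lemma compact_L: "compact L" and L_nonempty: "L \<noteq> {}"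
  using minL minimal_closed by (auto simp: minimal_set_def)

lemma closed_L: "closed L" using compact_L compact_imp_closed by blast

text \<open>By \<open>A2\<close> a Julia point of \<open>L\<close> leaves the Julia set under any
  letter other than the one that keeps it there, and from then on its orbit stays in some
  \<open>FE m\<close>. But by minimality the closure of this orbit is all of \<open>L\<close>, the
  starting point included.\<close>

lemma L_fatou: "L \<subseteq> FF"
proof
  fix x assume xL: "x \<in> L"
  show "x \<in> FF"
  proof (rule ccontr)
    assume "x \<notin> FF"
    then have x: "x \<in> JJ" by (simp add: julia_iff)
    obtain i where i: "i \<in> II" "f i x \<in> JJ" using julia_step[OF x] by blast
    have "\<exists>j\<in>II. j \<noteq> i"
    proof (cases "i = 1")
      case True
      then show ?thesis using s_ge by (intro bexI[of _ 2]) (auto simp: II_def)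
    next
      case False
      then show ?thesis by (intro bexI[of _ 1]) auto
    qed
    then obtain j where j: "j \<in> II" "j \<noteq> i" by blast
    define y where "y = f j x"
    have yF: "y \<in> FF" using julia_unique[OF i(2) _ i(1) j(1)] j(2) by (auto simp: y_def julia_iff)
    have yL: "y \<in> L" using minimal_word[OF minL xL, of "[j]"] j by (simp add: y_def)
    obtain \<eta> where \<eta>: "\<eta> > 0" "{y} \<subseteq> FE \<eta>" using fatou_FE[of "{y}"] yF by auto
    define m where "m = min \<delta> (\<eta> / \<kappa>^2)"
    have m: "m > 0" using \<delta> \<eta> \<kappa>_pos by (simp add: m_def)
    have "{g y |g. g \<in> GG} \<subseteq> FE m" unfolding m_def using FE_word[of y \<eta>] \<eta> by (auto simp: GG_eq)
    then have "closure {g y |g. g \<in> GG} \<subseteq> FE m" using closed_FE closure_minimal by blast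
    then have "x \<in> FE m" using minimal_eq[OF minL yL] xL by blast
    then show False using FE_fatou[OF m] \<open>x \<notin> FF\<close> by blast
  qed
qed

section \<open>Points whose orbits all tend to \<open>L\<close>, and points none of whose orbits
  do\<close>

definition Om :: "(nat \<Rightarrow> nat) set" where "Om = {\<omega>. \<forall>n. \<omega> n \<in> II}"

definition tends_L :: "(nat \<Rightarrow> nat) \<Rightarrow> sph \<Rightarrow> bool" where
  "tends_L \<omega> z \<longleftrightarrow> (\<lambda>n. infdist (rorbit f \<omega> n z) L) \<longlonglongrightarrow> 0"

definition asym :: "sph \<Rightarrow> sph \<Rightarrow> bool" where
  "asym y z \<longleftrightarrow> (\<forall>\<omega>\<in>Om. (\<lambda>n. dist (rorbit f \<omega> n y) (rorbit f \<omega> n z)) \<longlonglongrightarrow> 0)"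

text \<open>Every sequence in \<open>Om\<close> is meant, not almost every one. Hence
  \<open>UL\<close> and \<open>U0\<close> are forward invariant and respect \<open>asym\<close>, and
  a random orbit is decided once it enters their union.\<close>

definition UL :: "sph set" where "UL = {z. \<forall>\<omega>\<in>Om. tends_L \<omega> z}"
definition U0 :: "sph set" where "U0 = {z. \<forall>\<omega>\<in>Om. \<not> tends_L \<omega> z}"

lemma Om_word: "\<omega> \<in> Om \<Longrightarrow> map \<omega> [0..<n] \<in> Wd"
  by (auto simp: Om_def)

lemma Om_case_nat: "i \<in> II \<Longrightarrow> \<omega> \<in> Om \<Longrightarrow> case_nat i \<omega> \<in> Om"
  by (auto simp: Om_def split: nat.split)

lemma Om_shift: "\<omega> \<in> Om \<Longrightarrow> (\<lambda>k. \<omega> (m + k)) \<in> Om"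
  by (auto simp: Om_def)

lemma rorbit_case_nat: "rorbit f (case_nat i \<omega>) (Suc n) z = rorbit f \<omega> n (f i z)"
  using rorbit_add[of f "case_nat i \<omega>" 1 n z] by simp

lemma tends_L_case_nat: "tends_L (case_nat i \<omega>) z \<longleftrightarrow> tends_L \<omega> (f i z)"
  unfolding tends_L_def
  using filterlim_sequentially_Suc[of "\<lambda>n. infdist (rorbit f (case_nat i \<omega>) n z) L" "nhds 0"]
  by (simp only: rorbit_case_nat)

lemma tends_L_shift: "tends_L (\<lambda>k. \<omega> (m + k)) (rorbit f \<omega> m z) \<longleftrightarrow> tends_L \<omega> z"
  unfolding tends_L_def rorbit_add[symmetric]
  using LIMSEQ_ignore_initial_segment[of "\<lambda>n. infdist (rorbit f \<omega> n z) L" 0 m]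
    LIMSEQ_offset[of "\<lambda>n. infdist (rorbit f \<omega> n z) L" m 0]
  by (auto simp: add.commute)

lemma asym_tends_L: assumes "asym y z" "\<omega> \<in> Om" shows "tends_L \<omega> y \<longleftrightarrow> tends_L \<omega> z"
proof -
  have d: "(\<lambda>n. dist (rorbit f \<omega> n y) (rorbit f \<omega> n z)) \<longlonglongrightarrow> 0" using assms by (auto simp: asym_def)
  have *: "(\<lambda>n. infdist (b n) L) \<longlonglongrightarrow> 0" if "(\<lambda>n. infdist (a n) L) \<longlonglongrightarrow> 0" "(\<lambda>n. dist (a n) (b n)) \<longlonglongrightarrow> 0" for a b :: "nat \<Rightarrow> sph"
  proof (rule tendsto_sandwich[OF _ _ tendsto_const])
    show "(\<lambda>n. infdist (a n) L + dist (a n) (b n)) \<longlonglongrightarrow> 0" using tendsto_add[OF that] by simp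
    show "\<forall>\<^sub>F n in sequentially. infdist (b n) L \<le> infdist (a n) L + dist (a n) (b n)"
    proof (rule always_eventually, rule allI)
      fix n show "infdist (b n) L \<le> infdist (a n) L + dist (a n) (b n)"
        using infdist_triangle[of "b n" L "a n"] by (simp add: dist_commute)
    qed
  qed (auto simp: infdist_nonneg)
  show ?thesis unfolding tends_L_def using *[OF _ d] *[OF _ d[unfolded dist_commute[of "rorbit f \<omega> _ y"]]] by blast
qed

lemma asym_image: assumes "asym y z" "i \<in> II" shows "asym (f i y) (f i z)"
  unfolding asym_def
proof
  fix \<omega> assume "\<omega> \<in> Om"
  then have "(\<lambda>n. dist (rorbit f (case_nat i \<omega>) n y) (rorbit f (case_nat i \<omega>) n z)) \<longlonglongrightarrow> 0"
    using assms Om_case_nat by (auto simp: asym_def)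
  then have "(\<lambda>n. dist (rorbit f (case_nat i \<omega>) (Suc n) y) (rorbit f (case_nat i \<omega>) (Suc n) z)) \<longlonglongrightarrow> 0"
    by (rule LIMSEQ_Suc)
  then show "(\<lambda>n. dist (rorbit f \<omega> n (f i y)) (rorbit f \<omega> n (f i z))) \<longlonglongrightarrow> 0"
    by (simp only: rorbit_case_nat)
qed

lemma asym_UL: "asym y z \<Longrightarrow> y \<in> UL \<longleftrightarrow> z \<in> UL"
  and asym_U0: "asym y z \<Longrightarrow> y \<in> U0 \<longleftrightarrow> z \<in> U0"
  using asym_tends_L by (auto simp: UL_def U0_def)

lemma UL_image: "z \<in> UL \<Longrightarrow> i \<in> II \<Longrightarrow> f i z \<in> UL"
  and U0_image: "z \<in> U0 \<Longrightarrow> i \<in> II \<Longrightarrow> f i z \<in> U0"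
  unfolding UL_def U0_def using Om_case_nat tends_L_case_nat by blast+

lemma U_word: "z \<in> UL \<union> U0 \<Longrightarrow> w \<in> Wd \<Longrightarrow> fw f w z \<in> UL \<union> U0"
proof (induction w arbitrary: z)
  case (Cons i w)
  then have "f i z \<in> UL \<union> U0" using UL_image U0_image by auto
  then show ?case using Cons by simp
qed simp

lemma const_Om: "(\<lambda>_. 1) \<in> Om" by (simp add: Om_def)

lemma UL_U0_disjoint: "UL \<inter> U0 = {}"
  unfolding UL_def U0_def using const_Om by blast

lemma asym_near:
  assumes "\<eta> > 0"
  obtains r where "r > 0" "\<And>u y. u \<in> FE \<eta> \<Longrightarrow> dist y u < r \<Longrightarrow> asym y u"
proof -
  obtain r where r: "r > 0" "\<And>\<epsilon>. \<epsilon> > 0 \<Longrightarrow> \<exists>N. \<forall>w\<in>Wd. length w \<ge> N \<longrightarrow>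
     (\<forall>u\<in>FE \<eta>. \<forall>y. dist y u < r \<longrightarrow> dist (fw f w y) (fw f w u) < \<epsilon>)"
    by (rule fatou_contraction[OF assms]) (rule that)
  have "asym y u" if u: "u \<in> FE \<eta>" "dist y u < r" for u y
    unfolding asym_def
  proof
    fix \<omega> assume \<omega>: "\<omega> \<in> Om"
    show "(\<lambda>n. dist (rorbit f \<omega> n y) (rorbit f \<omega> n u)) \<longlonglongrightarrow> 0"
    proof (rule LIMSEQ_I)
      fix e :: real assume "e > 0"
      then obtain N where N: "\<forall>w\<in>Wd. length w \<ge> N \<longrightarrow> (\<forall>u\<in>FE \<eta>. \<forall>y. dist y u < r \<longrightarrow> dist (fw f w y) (fw f w u) < e)"
        using r(2) by blast
      have "norm (dist (rorbit f \<omega> n y) (rorbit f \<omega> n u) - 0) < e" if "n \<ge> N" for n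
        using N Om_word[OF \<omega>, of n] that u by (simp add: rorbit_eq_fw)
      then show "\<exists>no. \<forall>n\<ge>no. norm (dist (rorbit f \<omega> n y) (rorbit f \<omega> n u) - 0) < e" by blast
    qed
  qed
  then show ?thesis using that r(1) by blast
qed

lemma asym_fatou: assumes "z \<in> FF" obtains r where "r > 0" "\<And>y. dist y z < r \<Longrightarrow> asym y z"
proof -
  obtain \<eta> where \<eta>: "\<eta> > 0" "{z} \<subseteq> FE \<eta>" using fatou_FE[of "{z}"] assms by auto
  obtain r where "r > 0" "\<And>u y. u \<in> FE \<eta> \<Longrightarrow> dist y u < r \<Longrightarrow> asym y u"
    by (rule asym_near[OF \<eta>(1)]) (rule that)
  then show ?thesis using that[of r] \<eta>(2) by auto
qed

text \<open>A letter that takes a Julia point out of the Julia set leads into the compact set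
  \<open>CC\<close>, where nearby points have asymptotic orbits. This is what removes all terms but
  one from the functional equation.\<close>

lemma asym_julia_offbranch:
  obtains \<eta> where "\<eta> > 0"
    "\<And>i j y z. i \<in> II \<Longrightarrow> j \<in> II \<Longrightarrow> i \<noteq> j \<Longrightarrow> f i z \<in> JJ \<Longrightarrow> dist y z < \<eta> \<Longrightarrow> asym (f j y) (f j z)"
proof -
  obtain \<eta> where \<eta>: "\<eta> > 0" "CC \<subseteq> FE \<eta>" using fatou_FE[OF compact_CC CC_fatou] by blast
  obtain r where r: "r > 0" "\<And>u y. u \<in> FE \<eta> \<Longrightarrow> dist y u < r \<Longrightarrow> asym y u"
    by (rule asym_near[OF \<eta>(1)]) (rule that)
  obtain d where d: "d > 0" "\<And>i a b. i \<in> II \<Longrightarrow> dist a b < d \<Longrightarrow> dist (f i a) (f i b) < r"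
    by (rule uniform_continuity[OF r(1)]) (rule that)
  show ?thesis
  proof (rule that[OF d(1)])
    fix i j y z assume a: "i \<in> II" "j \<in> II" "i \<noteq> j" "f i z \<in> JJ" "dist y z < d"
    have "f j z \<in> FE \<eta>" using CC_I[OF a(1-4)] \<eta>(2) by blast
    then show "asym (f j y) (f j z)" using r(2) d(2)[OF a(2,5)] by blast
  qed
qed

lemma L_nbhd: obtains r where "r > 0" "\<And>l y. l \<in> L \<Longrightarrow> dist y l < r \<Longrightarrow> y \<in> UL"
proof -
  obtain \<eta> where \<eta>: "\<eta> > 0" "L \<subseteq> FE \<eta>" using fatou_FE[OF compact_L L_fatou] by blast
  obtain r where r: "r > 0" "\<And>u y. u \<in> FE \<eta> \<Longrightarrow> dist y u < r \<Longrightarrow> asym y u"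
    by (rule asym_near[OF \<eta>(1)]) (rule that)
  have "l \<in> UL" if "l \<in> L" for l
    unfolding UL_def tends_L_def using minimal_word[OF minL that] Om_word by (simp add: rorbit_eq_fw)
  then show ?thesis using that[OF r(1)] r(2) asym_UL \<eta>(2) by blast
qed

lemma UL_nonempty: "\<exists>z. z \<in> UL"
  using L_nbhd L_nonempty by (metis all_not_in_conv dist_self)

text \<open>Distinct minimal sets are disjoint, and orbits in another one stay at positive distance
  from \<open>L\<close>.\<close>

lemma U0_nonempty: "\<exists>z. z \<in> U0"
proof -
  obtain K where K: "minimal_set GG K" "K \<noteq> L" using other by blast
  have disj: "K \<inter> L = {}" using minimal_eq K minL by blast
  then obtain d where d: "d > 0" "\<forall>x\<in>K. \<forall>y\<in>L. d \<le> dist x y"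
    using separate_compact_closed_metric[OF minimal_closed[OF K(1)] closed_L] by blast
  obtain z where z: "z \<in> K" using K by (auto simp: minimal_set_def)
  have "\<not> tends_L \<omega> z" if "\<omega> \<in> Om" for \<omega>
  proof
    assume "tends_L \<omega> z"
    then have "eventually (\<lambda>n. infdist (rorbit f \<omega> n z) L < d) sequentially"
      unfolding tends_L_def using d(1) order_tendstoD(2) by blast
    then obtain n where n: "infdist (rorbit f \<omega> n z) L < d" by (auto simp: eventually_sequentially)
    have "rorbit f \<omega> n z \<in> K" using minimal_word[OF K(1) z Om_word[OF that]] by (simp add: rorbit_eq_fw)
    then have "d \<le> infdist (rorbit f \<omega> n z) L"
      unfolding infdist_notempty[OF L_nonempty] using d(2) by (intro cINF_greatest[OF L_nonempty]) auto
    then show False using n by simp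
  qed
  then show ?thesis unfolding U0_def by blast
qed

text \<open>At most one letter leads from \<open>z\<close> into the Fatou set. From there either
  some word comes close to \<open>L\<close> and hence into \<open>UL\<close>, or no orbit ever does
  and the point is in \<open>U0\<close>; both alternatives persist under small changes of
  \<open>z\<close>.\<close>

lemma absorption_local: "\<exists>w\<in>Wd. \<exists>r>0. \<forall>y\<in>ball z r. fw f w y \<in> UL \<union> U0"
proof -
  obtain v where v: "v \<in> Wd" "fw f v z \<in> FF"
  proof (cases "z \<in> FF")
    case True then show ?thesis using that[of "[]"] by simp
  next
    case False
    then have "z \<in> JJ" by (simp add: julia_iff)
    then obtain i where i: "i \<in> II" "f i z \<in> JJ" using julia_step by blast
    obtain j where j: "j \<in> II" "j \<noteq> i"
    proof (cases "i = 1")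
      case True
      then show ?thesis using s_ge that[of 2] by (auto simp: II_def)
    next
      case False
      then show ?thesis using that[of 1] by auto
    qed
    have "f j z \<in> FF" using julia_unique[OF i(2) _ i(1) j(1)] j(2) by (auto simp: julia_iff)
    then show ?thesis using that[of "[j]"] j by simp
  qed
  have nb: "\<exists>r>0. \<forall>y\<in>ball z r. fw f w y \<in> ball (fw f w z) d" if wd: "w \<in> Wd" "d > 0" for w d
  proof -
    obtain r where "r > 0" "\<And>y. dist y z < r \<Longrightarrow> dist (fw f w y) (fw f w z) < d"
      using word_isCont[OF wd(1), of z] wd(2) unfolding continuous_at_eps_delta by blast
    then show ?thesis by (intro exI[of _ r]) (auto simp: dist_commute)
  qed
  obtain rL where rL: "rL > 0" "\<And>l y. l \<in> L \<Longrightarrow> dist y l < rL \<Longrightarrow> y \<in> UL" by (rule L_nbhd) (rule that)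
  show ?thesis
  proof (cases "\<exists>u\<in>Wd. \<exists>l\<in>L. dist (fw f u (fw f v z)) l < rL")
    case True
    then obtain u l where u: "u \<in> Wd" "l \<in> L" "dist (fw f (v @ u) z) l < rL" by auto
    define d where "d = rL - dist (fw f (v @ u) z) l"
    have W: "v @ u \<in> Wd" using u v by simp
    have "d > 0" using u by (simp add: d_def)
    then obtain r where r: "r > 0" "\<forall>y\<in>ball z r. fw f (v @ u) y \<in> ball (fw f (v @ u) z) d" using nb[OF W] by blast
    have "fw f (v @ u) y \<in> UL" if "y \<in> ball z r" for y
    proof (rule rL(2)[OF u(2)])
      have "dist (fw f (v @ u) y) (fw f (v @ u) z) < d" using r(2) that by (simp add: dist_commute)
      then show "dist (fw f (v @ u) y) l < rL" using dist_triangle[of "fw f (v @ u) y" l "fw f (v @ u) z"] by (simp add: d_def)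
    qed
    then show ?thesis using W r(1) by blast
  next
    case False
    have "\<not> tends_L \<omega> (fw f v z)" if "\<omega> \<in> Om" for \<omega>
    proof
      assume "tends_L \<omega> (fw f v z)"
      then have "eventually (\<lambda>n. infdist (rorbit f \<omega> n (fw f v z)) L < rL) sequentially"
        unfolding tends_L_def using rL(1) order_tendstoD(2) by blast
      then obtain n where n: "infdist (rorbit f \<omega> n (fw f v z)) L < rL" by (auto simp: eventually_sequentially)
      have "rL \<le> infdist (rorbit f \<omega> n (fw f v z)) L"
        unfolding infdist_notempty[OF L_nonempty] rorbit_eq_fw
        using False Om_word[OF that, of n] by (intro cINF_greatest[OF L_nonempty]) (auto simp: not_less)
      then show False using n by simp
    qed
    then have v0: "fw f v z \<in> U0" by (simp add: U0_def)
    obtain d where d: "d > 0" "\<And>y. dist y (fw f v z) < d \<Longrightarrow> asym y (fw f v z)"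
      by (rule asym_fatou[OF v(2)]) (rule that)
    obtain r where r: "r > 0" "\<forall>y\<in>ball z r. fw f v y \<in> ball (fw f v z) d" using nb[OF v(1) d(1)] by blast
    have "fw f v y \<in> U0" if "y \<in> ball z r" for y
      using d(2)[of "fw f v y"] r(2) that asym_U0 v0 by (auto simp: dist_commute)
    then show ?thesis using v(1) r(1) by blast
  qed
qed

lemma absorption:
  obtains N where "N \<ge> 1" "\<And>z. \<exists>w\<in>Wd. length w = N \<and> fw f w z \<in> UL \<union> U0"
proof -
  obtain w r where wr: "\<And>z. w z \<in> Wd" "\<And>z. r z > 0" "\<And>z y. y \<in> ball z (r z) \<Longrightarrow> fw f (w z) y \<in> UL \<union> U0"
    using absorption_local by metis
  have "(UNIV::sph set) \<subseteq> (\<Union>z\<in>UNIV. ball z (r z))" using wr(2) by (auto intro!: exI)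
  then obtain Z where Z: "finite Z" "(UNIV::sph set) \<subseteq> (\<Union>z\<in>Z. ball z (r z))"
    by (rule compactE_image[OF compact_UNIV_sph, rotated]) auto
  define N where "N = Max (insert 1 ((\<lambda>z. length (w z)) ` Z))"
  have "\<exists>w\<in>Wd. length w = N \<and> fw f w y \<in> UL \<union> U0" for y
  proof -
    have "y \<in> (\<Union>z\<in>Z. ball z (r z))" using Z by blast
    then obtain z where z: "z \<in> Z" "y \<in> ball z (r z)" by blast
    have len: "length (w z) \<le> N" unfolding N_def using z Z by (intro Max_ge) auto
    \<comment> \<open>The finitely many words are padded to a common length; forward invariance
      keeps the point decided.\<close>
    define w' where "w' = w z @ replicate (N - length (w z)) 1"
    have "replicate (N - length (w z)) 1 \<in> Wd" by (auto simp: in_lists_conv_set)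
    then have "fw f w' y \<in> UL \<union> U0" "w' \<in> Wd" unfolding w'_def using U_word[OF wr(3)[OF z(2)]] wr(1) by auto
    then show ?thesis using len by (intro bexI[of _ w']) (auto simp: w'_def)
  qed
  moreover have "N \<ge> 1" unfolding N_def using Z by (intro Max_ge) auto
  ultimately show ?thesis using that by blast
qed

end

section \<open>Iterates of the transfer operator at complex parameters and their limit\<close>

lemma geometric_cauchy:
  fixes a :: "nat \<Rightarrow> complex"
  assumes "\<And>k. norm (a (Suc k) - a k) \<le> C * \<sigma>^k" "0 < \<sigma>" "\<sigma> < 1"
  shows "a \<longlonglongrightarrow> lim a" "norm (lim a - a k) \<le> C * \<sigma>^k / (1 - \<sigma>)"
proof -
  have sg: "summable (\<lambda>k. C * \<sigma>^k)" using assms by (intro summable_mult summable_geometric) auto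
  have sm: "summable (\<lambda>k. norm (a (Suc k) - a k))"
    by (rule summable_comparison_test'[OF sg, of 0]) (use assms(1) in auto)
  have "summable (\<lambda>k. a (Suc k) - a k)" by (rule summable_norm_cancel[OF sm])
  then have "(\<lambda>n. \<Sum>k<n. a (Suc k) - a k) \<longlonglongrightarrow> (\<Sum>k. a (Suc k) - a k)" by (rule summable_LIMSEQ)
  then have "(\<lambda>n. a n - a 0) \<longlonglongrightarrow> (\<Sum>k. a (Suc k) - a k)" by (simp add: sum_lessThan_telescope)
  then have "(\<lambda>n. (a n - a 0) + a 0) \<longlonglongrightarrow> (\<Sum>k. a (Suc k) - a k) + a 0" by (intro tendsto_add tendsto_const)
  then have conv: "a \<longlonglongrightarrow> (\<Sum>k. a (Suc k) - a k) + a 0" by simp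
  then show l: "a \<longlonglongrightarrow> lim a" using limI by metis
  have fin: "norm (a (k + n) - a k) \<le> C * \<sigma>^k / (1 - \<sigma>)" for n
  proof -
    have "a (k + n) - a k = (\<Sum>j<n. a (Suc (k + j)) - a (k + j))"
      using sum_lessThan_telescope[of "\<lambda>j. a (k + j)" n] by simp
    then have "norm (a (k + n) - a k) \<le> (\<Sum>j<n. norm (a (Suc (k + j)) - a (k + j)))" by (simp add: norm_sum)
    also have "\<dots> \<le> (\<Sum>j<n. C * \<sigma>^k * \<sigma>^j)"
      by (intro sum_mono) (use assms(1)[of "k + _"] in \<open>simp add: power_add mult.assoc\<close>)
    also have "\<dots> = C * \<sigma>^k * (\<Sum>j<n. \<sigma>^j)" by (simp add: sum_distrib_left)
    also have "\<dots> \<le> C * \<sigma>^k * (1 / (1 - \<sigma>))"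
    proof (rule mult_left_mono)
      have "(\<Sum>j<n. \<sigma>^j) = (1 - \<sigma>^n) / (1 - \<sigma>)" using assms by (simp add: sum_gp_strict)
      also have "\<dots> \<le> 1 / (1 - \<sigma>)" using assms by (intro divide_right_mono) auto
      finally show "(\<Sum>j<n. \<sigma>^j) \<le> 1 / (1 - \<sigma>)" .
      show "0 \<le> C * \<sigma>^k" using assms(1)[of k] norm_ge_zero order_trans by blast
    qed
    finally show ?thesis by simp
  qed
  have "(\<lambda>n. norm (a (k + n) - a k)) \<longlonglongrightarrow> norm (lim a - a k)"
    using LIMSEQ_ignore_initial_segment[OF l, of k] by (intro tendsto_norm tendsto_diff tendsto_const) (simp add: add.commute)
  then show "norm (lim a - a k) \<le> C * \<sigma>^k / (1 - \<sigma>)"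
    by (rule LIMSEQ_le_const2) (use fin in auto)
qed

context attractor_system
begin

text \<open>Polymorphic, to serve real probability vectors and complex parameters alike.\<close>

definition wt :: "(nat \<Rightarrow> 'a::comm_ring_1) \<Rightarrow> nat \<Rightarrow> 'a" where
  "wt x i = (if i = s + 1 then 1 - (\<Sum>j\<in>{1..s}. x j) else x i)"

definition pc :: "nat \<Rightarrow> complex" where "pc i = of_real (p i)"

definition Pd :: "real \<Rightarrow> (nat \<Rightarrow> complex) set" where
  "Pd r = {x. \<forall>i\<in>{1..s}. norm (x i - pc i) < r}"

text \<open>The iterates of the transfer operator on the indicator function of
  \<open>UL\<close>.\<close>

primrec tk :: "nat \<Rightarrow> (nat \<Rightarrow> complex) \<Rightarrow> sph \<Rightarrow> complex" where
  "tk 0 x z = (if z \<in> UL then 1 else 0)"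
| "tk (Suc k) x z = (\<Sum>i\<in>II. wt x i * tk k x (f i z))"

text \<open>The same iteration on the indicator of the undecided points. It is used with the moduli
  of the complex weights, where it dominates the error of \<open>tk\<close>.\<close>

primrec nk :: "nat \<Rightarrow> (nat \<Rightarrow> real) \<Rightarrow> sph \<Rightarrow> real" where
  "nk 0 y z = (if z \<in> UL \<union> U0 then 0 else 1)"
| "nk (Suc k) y z = (\<Sum>i\<in>II. y i * nk k y (f i z))"

lemma II_insert: "II = insert (s + 1) {1..s}" by (auto simp: II_def)

lemma sum_II: "(\<Sum>i\<in>II. g i) = g (s + 1) + (\<Sum>i\<in>{1..s}. g i)"
  unfolding II_insert by (subst sum.insert) auto

lemma sum_wt: "(\<Sum>i\<in>II. wt x i) = 1"
proof -
  have "(\<Sum>i\<in>{1..s}. wt x i) = (\<Sum>i\<in>{1..s}. x i)" by (intro sum.cong) (auto simp: wt_def)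
  then show ?thesis by (simp add: sum_II wt_def)
qed

lemma tk_UL: "z \<in> UL \<Longrightarrow> tk k x z = 1"
proof (induction k arbitrary: z)
  case (Suc k)
  have "tk (Suc k) x z = (\<Sum>i\<in>II. wt x i)" using Suc UL_image by simp
  then show ?case by (simp add: sum_wt)
qed simp

lemma tk_U0: "z \<in> U0 \<Longrightarrow> tk k x z = 0"
  by (induction k arbitrary: z) (use UL_U0_disjoint U0_image in auto)

lemma tk_asym: "asym y z \<Longrightarrow> tk k x y = tk k x z"
proof (induction k arbitrary: y z)
  case 0 then show ?case using asym_UL[of y z] by simp
next
  case (Suc k)
  have "tk k x (f i y) = tk k x (f i z)" if "i \<in> II" for i using Suc.IH[OF asym_image[OF Suc.prems that]] .
  then show ?case by simp
qed

lemma nk_U: "z \<in> UL \<union> U0 \<Longrightarrow> nk k y z = 0"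
proof (induction k arbitrary: z)
  case (Suc k)
  have "f i z \<in> UL \<union> U0" if "i \<in> II" for i using U_word[OF Suc.prems, of "[i]"] that by simp
  then show ?case using Suc.IH by simp
qed simp

lemma nk_nonneg: "(\<And>i. i \<in> II \<Longrightarrow> 0 \<le> y i) \<Longrightarrow> 0 \<le> nk k y z"
  by (induction k arbitrary: z) (auto intro!: sum_nonneg)

lemma nk_add_le:
  assumes "\<And>i. i \<in> II \<Longrightarrow> 0 \<le> y i" "\<And>z. nk m y z \<le> b"
  shows "nk (l + m) y z \<le> b * (\<Sum>i\<in>II. y i) ^ l"
proof (induction l arbitrary: z)
  case (Suc l)
  have "nk (Suc l + m) y z \<le> (\<Sum>i\<in>II. y i * (b * (\<Sum>i\<in>II. y i) ^ l))"
    using Suc assms(1) by (auto intro!: sum_mono mult_left_mono)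
  also have "\<dots> = (\<Sum>i\<in>II. y i) * (b * (\<Sum>i\<in>II. y i) ^ l)" by (rule sum_distrib_right[symmetric])
  also have "\<dots> = b * (\<Sum>i\<in>II. y i) ^ Suc l" by (simp add: mult_ac)
  finally show ?case .
qed (use assms in auto)

text \<open>Among all words of its length at least \<open>w\<close> ends in a decided point, so its
  weight, which is at least \<open>q ^ length w\<close>, is missing from the total.\<close>

lemma nk_block:
  assumes y: "\<And>i. i \<in> II \<Longrightarrow> q \<le> y i" and q: "0 \<le> q" and b: "\<And>z. nk m y z \<le> b" "0 \<le> b"
    and w: "w \<in> Wd" "fw f w z \<in> UL \<union> U0"
  shows "nk (length w + m) y z \<le> b * ((\<Sum>i\<in>II. y i) ^ length w - q ^ length w)"
  using w
proof (induction w arbitrary: z)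
  case Nil
  then show ?case using nk_U by simp
next
  case (Cons i w)
  define S where "S = (\<Sum>i\<in>II. y i)"
  define l where "l = length w"
  have y0: "0 \<le> y j" if "j \<in> II" for j using y[OF that] q by linarith
  have i: "i \<in> II" and w: "w \<in> Wd" using Cons by auto
  have IH: "nk (l + m) y (f i z) \<le> b * (S ^ l - q ^ l)" using Cons by (simp add: S_def l_def)
  have A: "nk (l + m) y z \<le> b * S ^ l" for z unfolding S_def by (rule nk_add_le[OF y0 b(1)])
  have e1: "(\<Sum>j\<in>II - {i}. y j * (b * S ^ l)) = (S - y i) * (b * S ^ l)"
    unfolding sum_distrib_right[symmetric] S_def using i by (simp add: sum.remove[of II i])
  have s1: "nk (length (i # w) + m) y z = y i * nk (l + m) y (f i z) + (\<Sum>j\<in>II - {i}. y j * nk (l + m) y (f j z))"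
    using i by (simp add: l_def sum.remove[of II i])
  have s2: "y i * nk (l + m) y (f i z) + (\<Sum>j\<in>II - {i}. y j * nk (l + m) y (f j z)) \<le> y i * (b * (S ^ l - q ^ l)) + (\<Sum>j\<in>II - {i}. y j * (b * S ^ l))"
    using IH A y0 i by (intro add_mono mult_left_mono sum_mono) auto
  have s3: "y i * (b * (S ^ l - q ^ l)) + (S - y i) * (b * S ^ l) = b * (S ^ Suc l - y i * q ^ l)"
    by (simp add: algebra_simps)
  have "q * q ^ l \<le> y i * q ^ l" using y[OF i] q by (intro mult_right_mono) auto
  then have s4: "b * (S ^ Suc l - y i * q ^ l) \<le> b * (S ^ Suc l - q ^ Suc l)"
    using b(2) by (intro mult_left_mono) auto
  show ?case using s1 s2 s3 s4 unfolding e1 S_def[symmetric] l_def[symmetric] by (simp add: l_def S_def)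
qed

text \<open>Consecutive iterates agree at decided points, so their difference is carried by the
  undecided ones.\<close>

lemma tk_diff: "norm (tk (Suc k) x z - tk k x z) \<le> (\<Sum>i\<in>II. norm (wt x i)) * nk k (\<lambda>i. norm (wt x i)) z"
proof (induction k arbitrary: z)
  case 0
  show ?case
  proof (cases "z \<in> UL \<union> U0")
    case True
    then have "tk (Suc 0) x z = tk 0 x z" using tk_UL[of z] tk_U0[of z] by (metis UnE)
    then show ?thesis using True by simp
  next
    case False
    have "norm (tk (Suc 0) x z - tk 0 x z) = norm (\<Sum>i\<in>II. wt x i * (if f i z \<in> UL then 1 else 0))" using False by simp
    also have "\<dots> \<le> (\<Sum>i\<in>II. norm (wt x i))" by (rule sum_norm_le) (auto simp: norm_mult)
    finally show ?thesis using False by simp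
  qed
next
  case (Suc k)
  define S where "S = (\<Sum>i\<in>II. norm (wt x i))"
  have e: "tk (Suc (Suc k)) x z - tk (Suc k) x z = (\<Sum>i\<in>II. wt x i * (tk (Suc k) x (f i z) - tk k x (f i z)))"
    by (simp add: sum_subtractf right_diff_distrib)
  have "norm (tk (Suc (Suc k)) x z - tk (Suc k) x z) \<le> (\<Sum>i\<in>II. norm (wt x i) * (S * nk k (\<lambda>i. norm (wt x i)) (f i z)))"
    unfolding e using Suc by (intro sum_norm_le) (auto simp: norm_mult S_def intro!: mult_left_mono)
  also have "\<dots> = S * nk (Suc k) (\<lambda>i. norm (wt x i)) z" by (simp add: sum_distrib_left mult_ac)
  finally show ?case by (simp add: S_def)
qed

definition pmin :: real where "pmin = Min (wt p ` II)"

lemma wt_p_pos: "i \<in> II \<Longrightarrow> 0 < wt p i"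
  using p_pos p_sum by (auto simp: wt_def II_def)

lemma pmin: "0 < pmin" "i \<in> II \<Longrightarrow> pmin \<le> wt p i"
  unfolding pmin_def using wt_p_pos by (auto simp: Min_gr_iff)

lemma wt_p_le_1: assumes "i \<in> II" shows "wt p i \<le> 1"
proof -
  have "wt p i \<le> (\<Sum>i\<in>II. wt p i)" using assms wt_p_pos by (intro member_le_sum) (auto intro: less_imp_le)
  then show ?thesis by (simp add: sum_wt)
qed

lemma pmin_le_1: "pmin \<le> 1" using pmin(2)[of 1] wt_p_le_1[of 1] by auto

lemma wt_close:
  fixes r :: real
  assumes "x \<in> Pd r" "i \<in> II" shows "norm (wt x i - of_real (wt p i)) \<le> real s * r"
proof -
  have r: "norm (x j - pc j) \<le> r" if "j \<in> {1..s}" for j using assms that by (auto simp: Pd_def intro: less_imp_le)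
  have "norm (x 1 - pc 1) \<le> r" using r[of 1] s_ge by simp
  then have r0: "0 \<le> r" using norm_ge_zero[of "x 1 - pc 1"] by linarith
  show ?thesis
  proof (cases "i = s + 1")
    case True
    have e: "wt x i - of_real (wt p i) = - (\<Sum>j\<in>{1..s}. x j - pc j)" by (simp add: True wt_def pc_def sum_subtractf)
    have "norm (wt x i - of_real (wt p i)) \<le> (\<Sum>j\<in>{1..s}. r)" unfolding e norm_minus_cancel by (rule sum_norm_le) (use r in auto)
    then show ?thesis by simp
  next
    case False
    then have "i \<in> {1..s}" using assms by (auto simp: II_def)
    then have "norm (wt x i - of_real (wt p i)) \<le> r" using r[of i] False by (simp add: wt_def pc_def)
    also have "r \<le> s * r" using s_ge r0 mult_right_mono[of 1 "real s" r] by simp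
    finally show ?thesis .
  qed
qed

text \<open>At \<open>p\<close> the weights sum to 1 and every block of \<open>N\<close> letters
  decides a fixed proportion of what is left. For complex parameters near \<open>p\<close> the sum
  \<open>S\<close> of the moduli exceeds 1 so little that \<open>S ^ N - q ^ N\<close> stays below
  1.\<close>

lemma transfer_convergence:
  "\<exists>r>0. real s * r \<le> pmin / 2 \<and> (\<exists>C \<sigma>. 0 < \<sigma> \<and> \<sigma> < 1 \<and> (\<forall>x\<in>Pd r. \<forall>z k. norm (tk (Suc k) x z - tk k x z) \<le> C * \<sigma>^k \<and>
     nk k (\<lambda>i. norm (wt x i)) z \<le> C * \<sigma>^k))"
proof -
  obtain N where N: "N \<ge> 1" "\<And>z. \<exists>w\<in>Wd. length w = N \<and> fw f w z \<in> UL \<union> U0" by (rule absorption) (rule that)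
  define q where "q = pmin / 2"
  have q: "0 < q" "q \<le> 1/2" using pmin(1) pmin_le_1 by (auto simp: q_def)
  have qN: "0 < q ^ N" "q ^ N \<le> 1" using q by (auto intro: power_le_one)
  have "((\<lambda>h::real. (1 + h) ^ N) \<longlongrightarrow> (1 + 0) ^ N) (at 0)" by (intro tendsto_intros)
  then have "eventually (\<lambda>h::real. (1 + h) ^ N < 1 + q ^ N / 2) (at 0)"
    using qN by (intro order_tendstoD(2)) auto
  then obtain d where d: "d > 0" "\<And>h::real. h \<noteq> 0 \<Longrightarrow> dist h 0 < d \<Longrightarrow> (1 + h) ^ N < 1 + q ^ N / 2"
    unfolding eventually_at by auto
  define h where "h = d / 2"
  have h: "h > 0" "(1 + h) ^ N \<le> 1 + q ^ N / 2" using d(1) d(2)[of h] by (auto simp: h_def)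
  have s0: "real s > 0" using s_ge by simp
  \<comment> \<open>The first bound gives \<open>S \<le> 1 + h\<close>; the second keeps every
    modulus at least \<open>q\<close>, which is half of \<open>pmin\<close>.\<close>
  define r where "r = min (h / ((real s + 1) * real s)) (q / s)"
  have r: "r > 0" unfolding r_def using h q s0 by (simp only: min_less_iff_conj) (auto intro!: divide_pos_pos mult_pos_pos add_pos_pos)
  have r2: "s * r \<le> q"
  proof -
    have "s * r \<le> s * (q / s)" unfolding r_def by (intro mult_left_mono min.cobounded2) auto
    then show ?thesis using s0 by simp
  qed
  have r3: "(s + 1) * (s * r) \<le> h"
  proof -
    define t where "t = (real s + 1) * real s"
    have t: "t > 0" using s0 by (simp add: t_def add_pos_pos)
    have "r \<le> h / t" unfolding r_def t_def by (rule min.cobounded1)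
    then have "t * r \<le> h" using t by (simp add: field_simps)
    then show ?thesis by (simp add: t_def mult.assoc add.commute)
  qed
  define \<gamma> where "\<gamma> = 1 - q ^ N / 2"
  have \<gamma>: "0 < \<gamma>" "\<gamma> < 1" using qN by (auto simp: \<gamma>_def)
  \<comment> \<open>An N-th root turns decay per block into decay per letter.\<close>
  define \<sigma> where "\<sigma> = root N \<gamma>"
  have \<sigma>: "0 < \<sigma>" "\<sigma> < 1" "\<sigma> ^ N = \<gamma>"
    using \<gamma> N(1) by (auto simp: \<sigma>_def real_root_pow_pos)
  define C where "C = 4 / \<gamma>"
  have main: "nk k (\<lambda>i. norm (wt x i)) z \<le> 2 / \<gamma> * \<sigma>^k \<and> (\<Sum>i\<in>II. norm (wt x i)) \<le> 2" if x: "x \<in> Pd r" for x z k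
  proof -
    define y where "y i = norm (wt x i)" for i
    define S where "S = (\<Sum>i\<in>II. y i)"
    have cl: "\<bar>y i - wt p i\<bar> \<le> s * r" if "i \<in> II" for i
      using wt_close[OF x that] norm_triangle_ineq3[of "wt x i" "of_real (wt p i)"] wt_p_pos[OF that] by (simp add: y_def)
    have yq: "q \<le> y i" if "i \<in> II" for i using cl[OF that] pmin(2)[OF that] r2 unfolding q_def by linarith
    have y0: "0 \<le> y i" for i by (simp add: y_def)
    have "S \<le> (\<Sum>i\<in>II. wt p i + s * r)" unfolding S_def by (intro sum_mono) (use cl in fastforce)
    also have "\<dots> = 1 + card II * (s * r)" by (simp add: sum.distrib sum_wt)
    also have "card II = s + 1" by (simp add: II_def)
    finally have S1: "S \<le> 1 + h" using r3 by linarith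
    have "norm (\<Sum>i\<in>II. wt x i) \<le> S" unfolding S_def y_def by (rule norm_sum)
    then have Sge: "1 \<le> S" by (simp add: sum_wt)
    have "S ^ N \<le> (1 + h) ^ N" using S1 Sge by (intro power_mono) auto
    then have SN: "S ^ N \<le> 1 + q ^ N / 2" using h(2) by linarith
    have S2: "S ^ l \<le> 2" if "l \<le> N" for l
      using power_increasing[OF that Sge] SN qN by linarith
    have blk: "nk (j * N) y z \<le> \<gamma> ^ j" for j z
    proof (induction j arbitrary: z)
      case (Suc j)
      obtain w where w: "w \<in> Wd" "length w = N" "fw f w z \<in> UL \<union> U0" using N(2) by blast
      have "nk (length w + j * N) y z \<le> \<gamma> ^ j * (S ^ length w - q ^ length w)"
        unfolding S_def by (rule nk_block) (use yq q Suc w \<gamma> in auto)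
      also have "\<dots> \<le> \<gamma> ^ j * \<gamma>" using w(2) SN \<gamma> by (intro mult_left_mono) (auto simp: \<gamma>_def)
      finally show ?case using w(2) by (simp add: mult.commute)
    qed simp
    have "nk (k mod N + (k div N) * N) y z \<le> \<gamma> ^ (k div N) * S ^ (k mod N)"
      unfolding S_def by (rule nk_add_le[OF y0 blk])
    also have "\<dots> \<le> \<gamma> ^ (k div N) * 2" using S2[of "k mod N"] N(1) \<gamma> by (intro mult_left_mono) (auto simp: less_imp_le)
    also have "\<gamma> ^ (k div N) \<le> \<sigma> ^ k / \<gamma>"
    proof -
      have "\<sigma> ^ N \<le> \<sigma> ^ (k mod N)" using \<sigma> N(1) by (intro power_decreasing) (auto simp: less_imp_le)
      then have "\<gamma> ^ (k div N) * \<gamma> \<le> \<gamma> ^ (k div N) * \<sigma> ^ (k mod N)" using \<gamma> \<sigma> by (intro mult_left_mono) auto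
      also have "\<dots> = \<sigma> ^ (N * (k div N) + k mod N)" by (simp only: power_add power_mult \<sigma>(3))
      also have "\<dots> = \<sigma> ^ k" by simp
      finally show ?thesis using \<gamma> by (simp add: field_simps)
    qed
    finally have "nk k y z \<le> 2 / \<gamma> * \<sigma> ^ k" by (simp add: mult.commute)
    moreover have "S \<le> 2" using S2[of 1] N(1) by simp
    moreover have "y = (\<lambda>i. norm (wt x i))" by (simp add: y_def fun_eq_iff)
    ultimately show ?thesis by (simp add: S_def)
  qed
  have "norm (tk (Suc k) x z - tk k x z) \<le> C * \<sigma>^k \<and> nk k (\<lambda>i. norm (wt x i)) z \<le> C * \<sigma>^k" if x: "x \<in> Pd r" for x z k
  proof -
    have n0: "0 \<le> nk k (\<lambda>i. norm (wt x i)) z" by (rule nk_nonneg) auto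
    have "norm (tk (Suc k) x z - tk k x z) \<le> 2 * (2 / \<gamma> * \<sigma>^k)"
      by (rule order_trans[OF tk_diff], rule mult_mono[OF main[OF x, THEN conjunct2] main[OF x, THEN conjunct1] _ n0]) simp
    moreover have "0 \<le> 2 / \<gamma> * \<sigma>^k" using \<gamma> \<sigma> by simp
    moreover have "C * \<sigma>^k = 2 * (2 / \<gamma> * \<sigma>^k)" by (simp add: C_def)
    moreover have "nk k (\<lambda>i. norm (wt x i)) z \<le> 2 / \<gamma> * \<sigma>^k" using main[OF x] by blast
    ultimately show ?thesis by linarith
  qed
  then show ?thesis using r r2[unfolded q_def] \<sigma>(1,2) by blast
qed

definition rad :: real where
  "rad = (SOME r. 0 < r \<and> real s * r \<le> pmin / 2 \<and> (\<exists>C \<sigma>. 0 < \<sigma> \<and> \<sigma> < 1 \<and> (\<forall>x\<in>Pd r. \<forall>z k. norm (tk (Suc k) x z - tk k x z) \<le> C * \<sigma>^k \<and>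
     nk k (\<lambda>i. norm (wt x i)) z \<le> C * \<sigma>^k)))"

lemma rad: "0 < rad" "\<exists>C \<sigma>. 0 < \<sigma> \<and> \<sigma> < 1 \<and> (\<forall>x\<in>Pd rad. \<forall>z k. norm (tk (Suc k) x z - tk k x z) \<le> C * \<sigma>^k \<and>
     nk k (\<lambda>i. norm (wt x i)) z \<le> C * \<sigma>^k)" "real s * rad \<le> pmin / 2"
  using someI_ex[OF transfer_convergence[unfolded Bex_def]] unfolding rad_def by auto

definition Tc :: "(nat \<Rightarrow> complex) \<Rightarrow> sph \<Rightarrow> complex" where "Tc x z = lim (\<lambda>k. tk k x z)"

lemma Tc_tendsto: assumes "x \<in> Pd rad" shows "(\<lambda>k. tk k x z) \<longlonglongrightarrow> Tc x z"
  using rad(2) assms geometric_cauchy(1)[of "\<lambda>k. tk k x z"] unfolding Tc_def by blast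

lemma Tc_uniform:
  obtains C \<sigma> where "0 < \<sigma>" "\<sigma> < 1" "\<And>x z k. x \<in> Pd rad \<Longrightarrow> norm (Tc x z - tk k x z) \<le> C * \<sigma>^k"
    "\<And>x z k. x \<in> Pd rad \<Longrightarrow> nk k (\<lambda>i. norm (wt x i)) z \<le> C * \<sigma>^k"
proof -
  obtain C \<sigma> where c: "0 < \<sigma>" "\<sigma> < 1" "\<And>x z k. x \<in> Pd rad \<Longrightarrow> norm (tk (Suc k) x z - tk k x z) \<le> C * \<sigma>^k"
     "\<And>x z k. x \<in> Pd rad \<Longrightarrow> nk k (\<lambda>i. norm (wt x i)) z \<le> C * \<sigma>^k"
    using rad(2) by blast
  show ?thesis
  proof (rule that[OF c(1,2), of "max C (C / (1 - \<sigma>))"])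
    fix x z k assume x: "x \<in> Pd rad"
    have "norm (Tc x z - tk k x z) \<le> C * \<sigma>^k / (1 - \<sigma>)"
      unfolding Tc_def by (rule geometric_cauchy(2)) (use c x in auto)
    also have "\<dots> = C / (1 - \<sigma>) * \<sigma>^k" by simp
    also have "\<dots> \<le> max C (C / (1 - \<sigma>)) * \<sigma>^k" using c by (intro mult_right_mono) auto
    finally show "norm (Tc x z - tk k x z) \<le> max C (C / (1 - \<sigma>)) * \<sigma>^k" .
    show "nk k (\<lambda>i. norm (wt x i)) z \<le> max C (C / (1 - \<sigma>)) * \<sigma>^k"
      by (rule order_trans[OF c(4)[OF x]]) (use c in \<open>auto intro: mult_right_mono\<close>)
  qed
qed

lemma Tc_bounded: obtains B where "B > 0" "\<And>x z. x \<in> Pd rad \<Longrightarrow> norm (Tc x z) \<le> B"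
proof -
  obtain C \<sigma> where c: "\<And>x z k. x \<in> Pd rad \<Longrightarrow> norm (Tc x z - tk k x z) \<le> C * \<sigma>^k"
    using Tc_uniform by metis
  have "norm (Tc x z) \<le> max 1 (C + 1)" if x: "x \<in> Pd rad" for x z
  proof -
    have "norm (Tc x z - tk 0 x z) \<le> C" using c[OF x, of z 0] by simp
    moreover have "norm (tk 0 x z) \<le> 1" by simp
    ultimately have "norm (Tc x z) \<le> C + 1" using norm_triangle_sub[of "Tc x z" "tk 0 x z"] by linarith
    then show ?thesis by simp
  qed
  then show ?thesis using that[of "max 1 (C + 1)"] by (simp add: less_max_iff_disj)
qed

lemma Tc_eq: assumes "x \<in> Pd rad" shows "Tc x z = (\<Sum>i\<in>II. wt x i * Tc x (f i z))"
proof -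
  have "(\<lambda>k. tk (Suc k) x z) \<longlonglongrightarrow> Tc x z" using Tc_tendsto[OF assms] by (rule LIMSEQ_Suc)
  moreover have "(\<lambda>k. tk (Suc k) x z) \<longlonglongrightarrow> (\<Sum>i\<in>II. wt x i * Tc x (f i z))"
    unfolding tk.simps using Tc_tendsto[OF assms] by (intro tendsto_sum tendsto_mult tendsto_const)
  ultimately show ?thesis by (rule LIMSEQ_unique)
qed

lemma Tc_UL: "z \<in> UL \<Longrightarrow> Tc x z = 1" by (simp add: Tc_def tk_UL)

lemma Tc_U0: "z \<in> U0 \<Longrightarrow> Tc x z = 0" by (simp add: Tc_def tk_U0)

lemma Tc_asym: "asym y z \<Longrightarrow> Tc x y = Tc x z" by (simp add: Tc_def tk_asym)

end

section \<open>The probability of tending to the minimal set\<close>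

context attractor_system
begin

lemma rorbit_measurable:
  fixes P :: "nat pmf"
  shows "{\<omega>. rorbit f \<omega> n z \<in> A} \<in> sets (PiM UNIV (\<lambda>_::nat. measure_pmf P))"
proof (induction n arbitrary: A)
  case 0
  have "{\<omega>. rorbit f \<omega> 0 z \<in> A} = (if z \<in> A then space (PiM UNIV (\<lambda>_::nat. measure_pmf P)) else {})"
    by (auto simp: space_PiM)
  then show ?case by auto
next
  case (Suc n)
  have c: "{\<omega>. \<omega> n = i} \<in> sets (PiM UNIV (\<lambda>_::nat. measure_pmf P))" for i
  proof -
    have "(\<lambda>\<omega>. \<omega> n) \<in> measurable (PiM UNIV (\<lambda>_::nat. measure_pmf P)) (measure_pmf P)" by simp
    then have "(\<lambda>\<omega>. \<omega> n) -` {i} \<inter> space (PiM UNIV (\<lambda>_::nat. measure_pmf P)) \<in> sets (PiM UNIV (\<lambda>_::nat. measure_pmf P))"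
      by (rule measurable_sets) simp
    moreover have "(\<lambda>\<omega>. \<omega> n) -` {i} \<inter> space (PiM UNIV (\<lambda>_::nat. measure_pmf P)) = {\<omega>. \<omega> n = i}" by (auto simp: space_PiM)
    ultimately show ?thesis by simp
  qed
  have "{\<omega>. rorbit f \<omega> (Suc n) z \<in> A} = (\<Union>i. {\<omega>. \<omega> n = i} \<inter> {\<omega>. rorbit f \<omega> n z \<in> f i -` A})" by auto
  also have "\<dots> \<in> sets (PiM UNIV (\<lambda>_::nat. measure_pmf P))"
    using sets.Int[OF c Suc] by (intro sets.countable_nat_UN) blast
  finally show ?case .
qed

lemma tends_L_eq: "{\<omega>. tends_L \<omega> z} = (\<Inter>m. \<Union>N. \<Inter>n\<in>{N..}. {\<omega>. rorbit f \<omega> n z \<in> {y. infdist y L < 1 / real (Suc m)}})"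
proof (intro set_eqI iffI)
  fix \<omega> assume "\<omega> \<in> {\<omega>. tends_L \<omega> z}"
  then have "eventually (\<lambda>n. infdist (rorbit f \<omega> n z) L < 1 / real (Suc m)) sequentially" for m
    unfolding tends_L_def mem_Collect_eq by (rule order_tendstoD(2)) simp
  then have e: "\<exists>N. \<forall>n\<ge>N. infdist (rorbit f \<omega> n z) L < 1 / real (Suc m)" for m
    unfolding eventually_sequentially .
  show "\<omega> \<in> (\<Inter>m. \<Union>N. \<Inter>n\<in>{N..}. {\<omega>. rorbit f \<omega> n z \<in> {y. infdist y L < 1 / real (Suc m)}})"
  proof (intro INT_I)
    fix m
    obtain N where "\<forall>n\<ge>N. infdist (rorbit f \<omega> n z) L < 1 / real (Suc m)" using e by blast
    then show "\<omega> \<in> (\<Union>N. \<Inter>n\<in>{N..}. {\<omega>. rorbit f \<omega> n z \<in> {y. infdist y L < 1 / real (Suc m)}})"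
      by (intro UN_I[of N]) auto
  qed
next
  fix \<omega> assume that0: "\<omega> \<in> (\<Inter>m. \<Union>N. \<Inter>n\<in>{N..}. {\<omega>. rorbit f \<omega> n z \<in> {y. infdist y L < 1 / real (Suc m)}})"
  have a: "\<exists>N. \<forall>n\<ge>N. infdist (rorbit f \<omega> n z) L < 1 / real (Suc m)" for m
  proof -
    from that0 have "\<omega> \<in> (\<Union>N. \<Inter>n\<in>{N..}. {\<omega>. rorbit f \<omega> n z \<in> {y. infdist y L < 1 / real (Suc m)}})"
      by (rule INT_D) simp
    then obtain N where "\<omega> \<in> (\<Inter>n\<in>{N..}. {\<omega>. rorbit f \<omega> n z \<in> {y. infdist y L < 1 / real (Suc m)}})" by (rule UN_E)
    then show ?thesis by (intro exI[of _ N]) auto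
  qed
  have "tends_L \<omega> z" unfolding tends_L_def
  proof (rule LIMSEQ_I)
    fix e :: real assume "e > 0"
    then obtain m where m: "1 / real (Suc m) < e" using nat_approx_posE by blast
    obtain N where "\<forall>n\<ge>N. infdist (rorbit f \<omega> n z) L < 1 / real (Suc m)" using a by blast
    then have "norm (infdist (rorbit f \<omega> n z) L - 0) < e" if "n \<ge> N" for n
      using m infdist_nonneg[of "rorbit f \<omega> n z" L] that by force
    then show "\<exists>no. \<forall>n\<ge>no. norm (infdist (rorbit f \<omega> n z) L - 0) < e" by blast
  qed
  then show "\<omega> \<in> {\<omega>. tends_L \<omega> z}" by simp
qed

lemma tends_L_measurable:
  fixes P :: "nat pmf"
  shows "{\<omega>. tends_L \<omega> z} \<in> sets (PiM UNIV (\<lambda>_::nat. measure_pmf P))"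
proof -
  let ?S = "PiM UNIV (\<lambda>_::nat. measure_pmf P)"
  have 1: "(\<Inter>n\<in>{N..}. {\<omega>. rorbit f \<omega> n z \<in> A}) \<in> sets ?S" for N A
    using rorbit_measurable by (intro sets.countable_INT') auto
  have 2: "(\<Union>N. \<Inter>n\<in>{N..}. {\<omega>. rorbit f \<omega> n z \<in> A}) \<in> sets ?S" for A
    using 1 by (intro sets.countable_nat_UN) blast
  show ?thesis unfolding tends_L_eq using 2 by (intro sets.countable_INT') blast+
qed

lemma infdist_stereo: "infdist (stereo a) (stereo ` A) = infdist a A"
  by (cases "A = {}") (auto simp: infdist_def dist_stereo image_image)

lemma Tprob_eq: "Tprob f s L x z = measure (PiM UNIV (\<lambda>_::nat. measure_pmf (gen_pmf s x))) {\<omega>. tends_L \<omega> z}"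
proof -
  have "{\<omega> \<in> space (PiM UNIV (\<lambda>_::nat. measure_pmf (gen_pmf s x))). (\<lambda>n. infdist (stereo (rorbit f \<omega> n z)) (stereo ` L)) \<longlonglongrightarrow> 0} = {\<omega>. tends_L \<omega> z}"
    by (auto simp: space_PiM infdist_stereo tends_L_def)
  then show ?thesis unfolding Tprob_def by simp
qed

lemma pmf_gen_pmf:
  assumes "\<And>i. i \<in> {1..s} \<Longrightarrow> 0 \<le> x i" "(\<Sum>i\<in>{1..s}. x i) \<le> 1"
  shows "pmf (gen_pmf s x) i = (if i \<in> II then wt x i else 0)"
proof -
  define g where "g i = (if 1 \<le> i \<and> i \<le> s then x i else if i = s + 1 then 1 - (\<Sum>j\<in>{1..s}. x j) else 0)" for i
  have gw: "g i = (if i \<in> II then wt x i else 0)" for i by (auto simp: g_def wt_def II_def)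
  have g0: "0 \<le> g i" for i using assms by (auto simp: g_def)
  have "(\<integral>\<^sup>+ i. ennreal (g i) \<partial>count_space UNIV) = (\<Sum>i\<in>II. ennreal (g i))"
    by (rule nn_integral_count_space') (auto simp: gw)
  also have "\<dots> = ennreal (\<Sum>i\<in>II. g i)" using g0 by (simp add: sum_ennreal)
  also have "(\<Sum>i\<in>II. g i) = (\<Sum>i\<in>II. wt x i)" by (intro sum.cong) (auto simp: gw)
  finally have "(\<integral>\<^sup>+ i. ennreal (g i) \<partial>count_space UNIV) = 1" by (simp add: sum_wt)
  then have "pmf (embed_pmf g) i = g i" using g0 by (rule pmf_embed_pmf[rotated])
  then show ?thesis unfolding gen_pmf_def g_def[abs_def, symmetric] gw .
qed

text \<open>The Markov property at the first step: prepending an independent letter maps the product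
  measure to itself.\<close>

lemma measure_first_letter:
  fixes P :: "nat pmf"
  assumes fin: "finite I" "set_pmf P \<subseteq> I" and A: "A \<in> sets (PiM UNIV (\<lambda>_::nat. measure_pmf P))"
  shows "measure (PiM UNIV (\<lambda>_::nat. measure_pmf P)) A =
    (\<Sum>i\<in>I. pmf P i * measure (PiM UNIV (\<lambda>_::nat. measure_pmf P)) {\<omega>. case_nat i \<omega> \<in> A})"
proof -
  interpret sequence_space "measure_pmf P" by unfold_locales
  have m: "(\<lambda>(i, \<omega>). case_nat i \<omega>) \<in> measurable (measure_pmf P \<Otimes>\<^sub>M S) S" by measurable
  define B where "B = (\<lambda>(i, \<omega>). case_nat i \<omega>) -` A \<inter> space (measure_pmf P \<Otimes>\<^sub>M S)"
  have B: "B \<in> sets (measure_pmf P \<Otimes>\<^sub>M S)" unfolding B_def using m A by (rule measurable_sets)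
  have e: "Pair i -` B = {\<omega>. case_nat i \<omega> \<in> A}" for i
    by (auto simp: B_def space_pair_measure space_PiM)
  have "emeasure S A = emeasure (distr (measure_pmf P \<Otimes>\<^sub>M S) S (\<lambda>(i, \<omega>). case_nat i \<omega>)) A"
    by (simp only: PiM_iter)
  also have "\<dots> = emeasure (measure_pmf P \<Otimes>\<^sub>M S) B" unfolding B_def by (rule emeasure_distr[OF m A])
  also have "\<dots> = (\<integral>\<^sup>+ i. emeasure S (Pair i -` B) \<partial>measure_pmf P)"
    by (rule P.emeasure_pair_measure_alt[OF B])
  also have "\<dots> = (\<Sum>i\<in>I. emeasure S (Pair i -` B) * pmf P i)"
    by (rule nn_integral_measure_pmf_support) (use fin in auto)
  also have "\<dots> = (\<Sum>i\<in>I. ennreal (pmf P i * measure S {\<omega>. case_nat i \<omega> \<in> A}))"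
    unfolding e by (intro sum.cong refl) (simp add: P.emeasure_eq_measure ennreal_mult mult.commute)
  also have "\<dots> = ennreal (\<Sum>i\<in>I. pmf P i * measure S {\<omega>. case_nat i \<omega> \<in> A})"
    by (intro sum_ennreal) auto
  finally have "emeasure S A = ennreal (\<Sum>i\<in>I. pmf P i * measure S {\<omega>. case_nat i \<omega> \<in> A})" .
  then show ?thesis unfolding measure_def by (simp add: sum_nonneg)
qed

text \<open>After \<open>n\<close> steps the orbit lies in \<open>UL\<close> with probability
  \<open>tk n\<close> and is undecided with probability \<open>nk n\<close>, which tends to 0. Up to
  null sets the event of tending to \<open>L\<close> lies between the first possibility and the
  union of both.\<close>

lemma Tprob_eq_Tc:
  fixes x :: "nat \<Rightarrow> real"
  assumes x: "\<And>i. i \<in> {1..s} \<Longrightarrow> 0 \<le> x i" "(\<Sum>i\<in>{1..s}. x i) \<le> 1" and xP: "(\<lambda>i. of_real (x i)) \<in> Pd rad"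
  shows "of_real (Tprob f s L x z) = Tc (\<lambda>i. of_real (x i)) z"
proof -
  define P where "P = gen_pmf s x"
  define S where "S = PiM UNIV (\<lambda>_::nat. measure_pmf P)"
  interpret S: prob_space S unfolding S_def by (intro prob_space_PiM) (simp add: measure_pmf.prob_space_axioms)
  have pmf: "pmf P i = (if i \<in> II then wt x i else 0)" for i unfolding P_def by (rule pmf_gen_pmf[OF x])
  have wt0: "0 \<le> wt x i" if "i \<in> II" for i using pmf[of i] pmf_nonneg[of P i] that by simp
  have wtc: "wt (\<lambda>i. complex_of_real (x i)) i = of_real (wt x i)" for i by (simp add: wt_def)
  have sP: "set_pmf P \<subseteq> II" using pmf by (auto simp: set_pmf_iff split: if_splits)
  have sm: "{\<omega>. rorbit f \<omega> n z \<in> A} \<in> sets S" for n z A unfolding S_def by (rule rorbit_measurable)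
  have first: "measure S {\<omega>. rorbit f \<omega> (Suc n) z \<in> A} = (\<Sum>i\<in>II. wt x i * measure S {\<omega>. rorbit f \<omega> n (f i z) \<in> A})" for n z A
  proof -
    have "measure S {\<omega>. rorbit f \<omega> (Suc n) z \<in> A} = (\<Sum>i\<in>II. pmf P i * measure S {\<omega>. case_nat i \<omega> \<in> {\<omega>. rorbit f \<omega> (Suc n) z \<in> A}})"
      unfolding S_def by (rule measure_first_letter[OF _ sP]) (auto simp del: rorbit.simps intro: rorbit_measurable)
    then show ?thesis by (simp add: pmf rorbit_case_nat del: rorbit.simps)
  qed
  have tk: "of_real (measure S {\<omega>. rorbit f \<omega> n z \<in> UL}) = tk n (\<lambda>i. of_real (x i)) z" for n z
  proof (induction n arbitrary: z)
    case 0
    show ?case using S.prob_space by (auto simp: S_def space_PiM)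
  next
    case (Suc n)
    then show ?case unfolding first by (simp add: wtc)
  qed
  have nk: "measure S {\<omega>. rorbit f \<omega> n z \<in> - (UL \<union> U0)} = nk n (\<lambda>i. norm (wt (\<lambda>i. complex_of_real (x i)) i)) z" for n z
  proof (induction n arbitrary: z)
    case 0
    show ?case using S.prob_space by (auto simp: S_def space_PiM)
  next
    case (Suc n)
    then show ?case unfolding first by (simp add: wtc wt0)
  qed
  have "AE \<omega> in S. \<omega> n \<in> II" for n
    unfolding S_def
    by (rule AE_PiM_component[where I = UNIV and i = n]) (use sP in \<open>auto simp: AE_measure_pmf_iff measure_pmf.prob_space_axioms\<close>)
  then have "AE \<omega> in S. \<forall>n. \<omega> n \<in> II" by (subst AE_all_countable) auto
  then have Om: "AE \<omega> in S. \<omega> \<in> Om" by (simp add: Om_def)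
  define T where "T = measure S {\<omega>. tends_L \<omega> z}"
  have Tm: "{\<omega>. tends_L \<omega> z} \<in> sets S" unfolding S_def by (rule tends_L_measurable)
  have sand: "measure S {\<omega>. rorbit f \<omega> n z \<in> UL} \<le> T"
    "T \<le> measure S {\<omega>. rorbit f \<omega> n z \<in> UL} + measure S {\<omega>. rorbit f \<omega> n z \<in> - (UL \<union> U0)}" for n
  proof -
    have UL: "tends_L \<omega> z" if "\<omega> \<in> Om" "rorbit f \<omega> n z \<in> UL" for \<omega>
      using that Om_shift[OF that(1), of n] tends_L_shift[of \<omega> n z] unfolding UL_def by blast
    have U0: "\<not> tends_L \<omega> z" if "\<omega> \<in> Om" "rorbit f \<omega> n z \<in> U0" for \<omega>
      using that Om_shift[OF that(1), of n] tends_L_shift[of \<omega> n z] unfolding U0_def by blast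
    show "measure S {\<omega>. rorbit f \<omega> n z \<in> UL} \<le> T"
      unfolding T_def by (rule S.finite_measure_mono_AE[OF _ Tm]) (use Om UL in \<open>auto elim!: eventually_mono\<close>)
    have "T \<le> measure S ({\<omega>. rorbit f \<omega> n z \<in> UL} \<union> {\<omega>. rorbit f \<omega> n z \<in> - (UL \<union> U0)})"
      unfolding T_def by (rule S.finite_measure_mono_AE[OF _ sets.Un[OF sm sm]]) (use Om U0 in \<open>auto elim!: eventually_mono\<close>)
    also have "\<dots> \<le> measure S {\<omega>. rorbit f \<omega> n z \<in> UL} + measure S {\<omega>. rorbit f \<omega> n z \<in> - (UL \<union> U0)}"
      by (rule measure_Un_le[OF sm sm])
    finally show "T \<le> measure S {\<omega>. rorbit f \<omega> n z \<in> UL} + measure S {\<omega>. rorbit f \<omega> n z \<in> - (UL \<union> U0)}" .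
  qed
  obtain C \<sigma> where c: "0 < \<sigma>" "\<sigma> < 1" "\<And>x z k. x \<in> Pd rad \<Longrightarrow> nk k (\<lambda>i. norm (wt x i)) z \<le> C * \<sigma>^k"
    by (rule Tc_uniform) (rule that)
  have bnd: "norm (of_real T - tk n (\<lambda>i. of_real (x i)) z) \<le> C * \<sigma>^n" for n
  proof -
    have "\<bar>T - measure S {\<omega>. rorbit f \<omega> n z \<in> UL}\<bar> \<le> C * \<sigma>^n"
      using sand[of n] c(3)[OF xP, of n z] nk[of n z] by simp
    then show ?thesis unfolding tk[symmetric] by (simp only: of_real_diff[symmetric] norm_of_real)
  qed
  have "(\<lambda>n. C * \<sigma>^n) \<longlonglongrightarrow> C * 0"
    by (intro tendsto_mult tendsto_const LIMSEQ_realpow_zero less_imp_le[OF c(1)] c(2))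
  then have "(\<lambda>n. C * \<sigma>^n) \<longlonglongrightarrow> 0" by simp
  then have "(\<lambda>n. of_real T - tk n (\<lambda>i. of_real (x i)) z) \<longlonglongrightarrow> (0::complex)"
    by (rule Lim_null_comparison[OF always_eventually[OF allI[OF bnd]]])
  then have "(\<lambda>n. of_real T - (of_real T - tk n (\<lambda>i. of_real (x i)) z)) \<longlonglongrightarrow> of_real T - 0"
    by (intro tendsto_diff tendsto_const)
  then have "(\<lambda>n. tk n (\<lambda>i. of_real (x i)) z) \<longlonglongrightarrow> of_real T" by simp
  then have "of_real T = Tc (\<lambda>i. of_real (x i)) z" using Tc_tendsto[OF xP] LIMSEQ_unique by blast
  then show ?thesis by (simp add: T_def Tprob_eq S_def P_def)
qed

end

section \<open>Differentiation in the probability parameters\<close>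

lemma deriv_bound:
  fixes h :: "complex \<Rightarrow> complex"
  assumes h: "h holomorphic_on ball c r1" and M: "\<And>t. t \<in> ball c r1 \<Longrightarrow> norm (h t) \<le> M" and r: "r2 < r1" and t: "t \<in> ball c r2"
  shows "norm (deriv h t) \<le> 2 * M / (r1 - r2)"
proof -
  define \<rho> where "\<rho> = (r1 - r2) / 2"
  have sub: "cball t \<rho> \<subseteq> ball c r1"
  proof
    fix u assume "u \<in> cball t \<rho>"
    then have "dist c u \<le> dist c t + \<rho>" using dist_triangle[of c u t] by simp
    also have "\<dots> < r1" using t r by (simp add: \<rho>_def field_simps)
    finally show "u \<in> ball c r1" by simp
  qed
  have "norm ((deriv ^^ 1) h t) \<le> fact 1 * M / \<rho> ^ 1"
  proof (rule Cauchy_inequality)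
    show "h holomorphic_on ball t \<rho>" using h sub by (meson ball_subset_cball holomorphic_on_subset order_trans)
    show "continuous_on (cball t \<rho>) h" using h sub by (meson holomorphic_on_imp_continuous_on holomorphic_on_subset)
    show "norm (h x) \<le> M" if "norm (t - x) = \<rho>" for x using M[of x] sub that by (auto simp: dist_norm)
  qed (use r in \<open>auto simp: \<rho>_def\<close>)
  then show ?thesis by (simp add: \<rho>_def mult.commute)
qed

context attractor_system
begin

definition pd :: "nat \<Rightarrow> ((nat \<Rightarrow> complex) \<Rightarrow> complex) \<Rightarrow> (nat \<Rightarrow> complex) \<Rightarrow> complex" where
  "pd i g x = deriv (\<lambda>t. g (x(i := t))) (x i)"

text \<open>The complex counterpart of \<open>mixed_deriv\<close>, with the derivatives taken in the
  same order.\<close>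

fun cm :: "(nat \<Rightarrow> nat) \<Rightarrow> nat \<Rightarrow> ((nat \<Rightarrow> complex) \<Rightarrow> complex) \<Rightarrow> ((nat \<Rightarrow> complex) \<Rightarrow> complex)" where
  "cm n 0 g = g"
| "cm n (Suc j) g = (pd (Suc j) ^^ n (Suc j)) (cm n j g)"

inductive Pol :: "((nat \<Rightarrow> complex) \<Rightarrow> complex) \<Rightarrow> bool" where
  const: "Pol (\<lambda>x. c)"
| coord: "i \<in> {1..s} \<Longrightarrow> Pol (\<lambda>x. x i)"
| add: "Pol g \<Longrightarrow> Pol h \<Longrightarrow> Pol (\<lambda>x. g x + h x)"
| mult: "Pol g \<Longrightarrow> Pol h \<Longrightarrow> Pol (\<lambda>x. g x * h x)"

text \<open>Uniform limits of polynomials on every smaller polydisc. This form of holomorphy in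
  several variables is inherited by partial derivatives through Cauchy estimates in one
  variable.\<close>

definition UU :: "((nat \<Rightarrow> complex) \<Rightarrow> complex) \<Rightarrow> bool" where
  "UU g \<longleftrightarrow> (\<forall>r \<epsilon>. 0 < r \<longrightarrow> r < rad \<longrightarrow> 0 < \<epsilon> \<longrightarrow> (\<exists>h. Pol h \<and> (\<forall>x\<in>Pd r. norm (g x - h x) < \<epsilon>)))"

lemma Pol_sum: "finite A \<Longrightarrow> (\<And>a. a \<in> A \<Longrightarrow> Pol (g a)) \<Longrightarrow> Pol (\<lambda>x. \<Sum>a\<in>A. g a x)"
  by (induction A rule: finite_induct) (auto intro: Pol.intros)

lemma Pol_deriv:
  assumes "Pol g"
  shows "\<exists>g'. Pol g' \<and> (\<forall>x t. ((\<lambda>t. g (x(i := t))) has_field_derivative g' (x(i := t))) (at t))"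
  using assms
proof induction
  case (const c)
  show ?case by (intro exI[of _ "\<lambda>x. 0"]) (auto intro: Pol.intros)
next
  case (coord j)
  show ?case by (cases "j = i") (auto intro!: exI[of _ "\<lambda>x. if j = i then 1 else 0"] Pol.intros derivative_eq_intros)
next
  case (add g h)
  then obtain g' h' where gh: "Pol g'" "\<forall>x t. ((\<lambda>t. g (x(i := t))) has_field_derivative g' (x(i := t))) (at t)"
    "Pol h'" "\<forall>x t. ((\<lambda>t. h (x(i := t))) has_field_derivative h' (x(i := t))) (at t)" by blast
  have "Pol (\<lambda>x. g' x + h' x)" using gh by (auto intro!: Pol.intros)
  moreover have "((\<lambda>t. g (x(i := t)) + h (x(i := t))) has_field_derivative g' (x(i := t)) + h' (x(i := t))) (at t)" for x t
    using gh by (intro DERIV_add) auto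
  ultimately show ?case by blast
next
  case (mult g h)
  then obtain g' h' where gh: "Pol g'" "\<forall>x t. ((\<lambda>t. g (x(i := t))) has_field_derivative g' (x(i := t))) (at t)"
    "Pol h'" "\<forall>x t. ((\<lambda>t. h (x(i := t))) has_field_derivative h' (x(i := t))) (at t)" by blast
  have "Pol (\<lambda>x. g' x * h x + h' x * g x)" using gh mult by (auto intro!: Pol.intros)
  moreover have "((\<lambda>t. g (x(i := t)) * h (x(i := t))) has_field_derivative g' (x(i := t)) * h (x(i := t)) + h' (x(i := t)) * g (x(i := t))) (at t)" for x t
    using gh by (intro DERIV_mult) auto
  ultimately show ?case by blast
qed

lemma Pol_pd:
  assumes "Pol g" shows "Pol (pd i g)" "((\<lambda>t. g (x(i := t))) has_field_derivative pd i g (x(i := t))) (at t)"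
proof -
  obtain g' where g': "Pol g'" "\<And>x t. ((\<lambda>t. g (x(i := t))) has_field_derivative g' (x(i := t))) (at t)"
    using Pol_deriv[OF assms] by blast
  have "pd i g = g'"
  proof
    fix x
    have "deriv (\<lambda>t. g (x(i := t))) (x i) = g' (x(i := x i))" using g'(2) by (rule DERIV_imp_deriv)
    then show "pd i g x = g' x" by (simp add: pd_def)
  qed
  then show "Pol (pd i g)" "((\<lambda>t. g (x(i := t))) has_field_derivative pd i g (x(i := t))) (at t)" using g' by auto
qed

lemma Pd_mono: "r \<le> r' \<Longrightarrow> Pd r \<subseteq> Pd r'" unfolding Pd_def by fastforce

lemma Pd_upd: "x \<in> Pd r \<Longrightarrow> norm (t - pc i) < r \<Longrightarrow> x(i := t) \<in> Pd r" by (auto simp: Pd_def)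

lemma pc_Pd: "r > 0 \<Longrightarrow> pc \<in> Pd r" by (simp add: Pd_def)

lemma Pd_inner:
  assumes "x \<in> Pd r" obtains r' where "0 < r'" "r' < r" "x \<in> Pd r'"
proof -
  define m where "m = Max ((\<lambda>i. norm (x i - pc i)) ` {1..s})"
  have fin: "finite ((\<lambda>i. norm (x i - pc i)) ` {1..s})" "(\<lambda>i. norm (x i - pc i)) ` {1..s} \<noteq> {}" using s_ge by auto
  have m: "m < r" unfolding m_def using assms fin by (subst Max_less_iff) (auto simp: Pd_def)
  have le: "norm (x i - pc i) \<le> m" if "i \<in> {1..s}" for i unfolding m_def using that fin by (intro Max_ge) auto
  have "0 \<le> m" using le[of 1] s_ge by (intro order_trans[OF norm_ge_zero le[of 1]]) simp
  then show ?thesis using that[of "(m + r) / 2"] m le unfolding Pd_def by fastforce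
qed

lemma Pol_bounded: "Pol g \<Longrightarrow> \<exists>B. \<forall>x\<in>Pd r. norm (g x) \<le> B"
proof (induction rule: Pol.induct)
  case (coord i)
  have "norm (x i) \<le> norm (pc i) + r" if "x \<in> Pd r" for x
    using that coord norm_triangle_sub[of "x i" "pc i"] unfolding Pd_def by fastforce
  then show ?case by blast
next
  case (add g h)
  then obtain A B where "\<forall>x\<in>Pd r. norm (g x) \<le> A" "\<forall>x\<in>Pd r. norm (h x) \<le> B" by blast
  then show ?case by (intro exI[of _ "A + B"]) (meson add_mono norm_triangle_ineq order_trans)
next
  case (mult g h)
  then obtain A B where AB: "\<forall>x\<in>Pd r. norm (g x) \<le> A" "\<forall>x\<in>Pd r. norm (h x) \<le> B" by blast
  have "norm (g x * h x) \<le> A * B" if "x \<in> Pd r" for x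
    unfolding norm_mult using AB that norm_ge_zero[of "g x"] by (intro mult_mono) (auto intro: order_trans[OF norm_ge_zero])
  then show ?case by blast
qed auto

lemma Pol_UU: "Pol g \<Longrightarrow> UU g" unfolding UU_def by (auto intro: exI[of _ g])

lemma UU_add: assumes "UU g" "UU h" shows "UU (\<lambda>x. g x + h x)"
  unfolding UU_def
proof (intro allI impI)
  fix r \<epsilon> :: real assume a: "0 < r" "r < rad" "0 < \<epsilon>"
  then have "0 < \<epsilon> / 2" by simp
  then obtain g' h' where gh: "Pol g'" "\<forall>x\<in>Pd r. norm (g x - g' x) < \<epsilon> / 2" "Pol h'" "\<forall>x\<in>Pd r. norm (h x - h' x) < \<epsilon> / 2"
    using assms a unfolding UU_def by meson
  have "norm (g x + h x - (g' x + h' x)) < \<epsilon>" if "x \<in> Pd r" for x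
    using gh that norm_triangle_ineq[of "g x - g' x" "h x - h' x"] by (fastforce simp: algebra_simps)
  then show "\<exists>q. Pol q \<and> (\<forall>x\<in>Pd r. norm (g x + h x - q x) < \<epsilon>)"
    using Pol.add[OF gh(1,3)] by (intro exI[of _ "\<lambda>x. g' x + h' x"]) auto
qed

lemma UU_mult_Pol: assumes "UU g" "Pol h" shows "UU (\<lambda>x. h x * g x)"
  unfolding UU_def
proof (intro allI impI)
  fix r \<epsilon> :: real assume a: "0 < r" "r < rad" "0 < \<epsilon>"
  obtain B where B: "\<forall>x\<in>Pd r. norm (h x) \<le> B" using Pol_bounded[OF assms(2)] by blast
  have B1: "\<bar>B\<bar> + 1 > 0" by simp
  then have "0 < \<epsilon> / (\<bar>B\<bar> + 1)" using a by simp
  then obtain g' where g: "Pol g'" "\<forall>x\<in>Pd r. norm (g x - g' x) < \<epsilon> / (\<bar>B\<bar> + 1)"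
    using assms(1) a unfolding UU_def by meson
  have "norm (h x * g x - h x * g' x) < \<epsilon>" if x: "x \<in> Pd r" for x
  proof -
    have "norm (h x * g x - h x * g' x) = norm (h x) * norm (g x - g' x)" by (simp add: norm_mult flip: right_diff_distrib)
    also have "\<dots> \<le> (\<bar>B\<bar> + 1) * norm (g x - g' x)" using B x by (intro mult_right_mono) auto
    also have "\<dots> < (\<bar>B\<bar> + 1) * (\<epsilon> / (\<bar>B\<bar> + 1))" using g x B1 by (intro mult_strict_left_mono) auto
    also have "\<dots> = \<epsilon>" using B1 by simp
    finally show ?thesis .
  qed
  then show "\<exists>q. Pol q \<and> (\<forall>x\<in>Pd r. norm (h x * g x - q x) < \<epsilon>)"
    using Pol.mult[OF assms(2) g(1)] by blast
qed

lemma UU_cmult: "UU g \<Longrightarrow> UU (\<lambda>x. c * g x)"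
  using UU_mult_Pol[OF _ Pol.const] by simp

lemma UU_holomorphic:
  assumes g: "UU g" and r: "0 < r" "r < rad" and x: "x \<in> Pd r"
  shows "(\<lambda>t. g (x(i := t))) holomorphic_on ball (pc i) r"
proof -
  have "\<exists>h. Pol h \<and> (\<forall>x\<in>Pd r. norm (g x - h x) < 1 / real (Suc k))" for k
    using g r unfolding UU_def by simp
  then obtain h where h: "\<And>k. Pol (h k)" "\<And>k x. x \<in> Pd r \<Longrightarrow> norm (g x - h k x) < 1 / real (Suc k)" by metis
  have up: "x(i := t) \<in> Pd r" if "t \<in> ball (pc i) r" for t
    using Pd_upd[OF x] that by (simp add: dist_norm norm_minus_commute)
  show ?thesis
  proof (rule holomorphic_uniform_sequence[where f = "\<lambda>k t. h k (x(i := t))"])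
    show "(\<lambda>t. h k (x(i := t))) holomorphic_on ball (pc i) r" for k
      using Pol_pd(2)[OF h(1)] by (meson DERIV_subset holomorphic_onI field_differentiable_def top_greatest has_field_derivative_at_within)
    fix t assume "t \<in> ball (pc i) r"
    then obtain d where d: "d > 0" "cball t d \<subseteq> ball (pc i) r" by (meson open_ball open_contains_cball)
    have "uniform_limit (cball t d) (\<lambda>k t. h k (x(i := t))) (\<lambda>t. g (x(i := t))) sequentially"
      unfolding uniform_limit_sequentially_iff
    proof (intro allI impI)
      fix e :: real assume "e > 0"
      then obtain N where N: "1 / real (Suc N) < e" using nat_approx_posE by blast
      have "dist (h k (x(i := u))) (g (x(i := u))) < e" if "k \<ge> N" "u \<in> cball t d" for k u
      proof -
        have "dist (h k (x(i := u))) (g (x(i := u))) < 1 / real (Suc k)"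
          using h(2)[of "x(i := u)" k] up[of u] that d(2) by (auto simp: dist_norm norm_minus_commute)
        also have "\<dots> \<le> 1 / real (Suc N)" using that by (intro divide_left_mono) auto
        finally show ?thesis using N by simp
      qed
      then show "\<exists>N. \<forall>n\<ge>N. \<forall>u\<in>cball t d. dist (h n (x(i := u))) (g (x(i := u))) < e" by blast
    qed
    then show "\<exists>d>0. cball t d \<subseteq> ball (pc i) r \<and> uniform_limit (cball t d) (\<lambda>k t. h k (x(i := t))) (\<lambda>t. g (x(i := t))) sequentially"
      using d by blast
  qed auto
qed

lemma UU_has_derivative:
  assumes g: "UU g" and x: "x \<in> Pd rad" and i: "i \<in> {1..s}"
  shows "((\<lambda>t. g (x(i := t))) has_field_derivative pd i g x) (at (x i))"
proof -
  obtain r where r: "0 < r" "r < rad" "x \<in> Pd r" using Pd_inner[OF x] by blast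
  have "x i \<in> ball (pc i) r" using r(3) i by (auto simp: Pd_def dist_norm norm_minus_commute)
  then show ?thesis unfolding pd_def by (rule holomorphic_derivI[OF UU_holomorphic[OF g r] open_ball])
qed

lemma pd_bound:
  assumes g: "UU g" and M: "\<And>x. x \<in> Pd r1 \<Longrightarrow> norm (g x) \<le> M" and r: "0 < r2" "r2 < r1" "r1 \<le> rad"
    and x: "x \<in> Pd r2" and i: "i \<in> {1..s}"
  shows "norm (pd i g x) \<le> 4 * M / (r1 - r2)"
proof -
  \<comment> \<open>Holomorphy is known on radii strictly below \<open>rad\<close>, while
    \<open>r1\<close> may equal \<open>rad\<close>. The intermediate radius halves the gap and so
    doubles the constant of \<open>deriv_bound\<close>.\<close>
  define r3 where "r3 = (r1 + r2) / 2"
  have r3: "0 < r3" "r3 < rad" "r2 < r3" "r3 < r1" using r by (auto simp: r3_def)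
  have x3: "x \<in> Pd r3" using x Pd_mono[of r2 r3] r3 by auto
  have "norm (deriv (\<lambda>t. g (x(i := t))) (x i)) \<le> 2 * M / (r3 - r2)"
  proof (rule deriv_bound[OF UU_holomorphic[OF g r3(1,2) x3]])
    fix t assume "t \<in> ball (pc i) r3"
    then have "x(i := t) \<in> Pd r3" using Pd_upd[OF x3] by (simp add: dist_norm norm_minus_commute)
    then show "norm (g (x(i := t))) \<le> M" using M Pd_mono[of r3 r1] r3 by auto
  next
    show "x i \<in> ball (pc i) r2" using x i by (auto simp: Pd_def dist_norm norm_minus_commute)
  qed (use r3 in auto)
  also have "2 * M / (r3 - r2) = 4 * M / (r1 - r2)" using r by (simp add: r3_def field_simps)
  finally show ?thesis by (simp add: pd_def)
qed

lemma pd_diff_UU: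
  assumes "UU g" "UU h" "x \<in> Pd rad" "i \<in> {1..s}"
  shows "pd i (\<lambda>x. a * g x + b * h x) x = a * pd i g x + b * pd i h x"
  unfolding pd_def[of i "\<lambda>x. a * g x + b * h x"]
  using UU_has_derivative[OF assms(1,3,4)] UU_has_derivative[OF assms(2,3,4)]
  by (intro DERIV_imp_deriv DERIV_add DERIV_cmult)

lemma UU_pd: assumes g: "UU g" and i: "i \<in> {1..s}" shows "UU (pd i g)"
  unfolding UU_def
proof (intro allI impI)
  fix r \<epsilon> :: real assume a: "0 < r" "r < rad" "0 < \<epsilon>"
  define r1 where "r1 = (r + rad) / 2"
  have r1: "0 < r1" "r1 < rad" "r < r1" using a by (auto simp: r1_def)
  define e where "e = \<epsilon> * (r1 - r) / 8"
  have "e > 0" using a r1 by (simp add: e_def)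
  then obtain h where h: "Pol h" "\<And>x. x \<in> Pd r1 \<Longrightarrow> norm (g x - h x) < e"
    using g r1 unfolding UU_def by meson
  have gh: "UU (\<lambda>x. 1 * g x + (-1) * h x)" using g Pol_UU[OF h(1)] by (intro UU_add UU_cmult)
  have "norm (pd i g x - pd i h x) < \<epsilon>" if x: "x \<in> Pd r" for x
  proof -
    have "norm (pd i (\<lambda>x. 1 * g x + (-1) * h x) x) \<le> 4 * e / (r1 - r)"
      by (rule pd_bound[OF gh _ a(1) r1(3) less_imp_le[OF r1(2)] x i]) (use h(2) in \<open>auto intro: less_imp_le\<close>)
    also have "pd i (\<lambda>x. 1 * g x + (-1) * h x) x = 1 * pd i g x + (-1) * pd i h x"
      by (rule pd_diff_UU[OF g Pol_UU[OF h(1)] _ i]) (use x Pd_mono[of r rad] a in auto)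
    also have "4 * e / (r1 - r) = \<epsilon> / 2"
    proof -
      have "r1 - r \<noteq> 0" using r1 by simp
      then show ?thesis unfolding e_def by (simp add: field_simps)
    qed
    finally show ?thesis using a by simp
  qed
  then show "\<exists>h. Pol h \<and> (\<forall>x\<in>Pd r. norm (pd i g x - h x) < \<epsilon>)" using Pol_pd(1)[OF h(1)] by blast
qed

lemma UU_pd_iter: "UU g \<Longrightarrow> i \<in> {1..s} \<Longrightarrow> UU ((pd i ^^ k) g)"
  by (induction k) (auto intro: UU_pd)

lemma UU_cm: "UU g \<Longrightarrow> j \<le> s \<Longrightarrow> UU (cm n j g)"
  by (induction j) (auto intro: UU_pd_iter)

lemma pd_cong:
  assumes "\<And>x. x \<in> Pd rad \<Longrightarrow> g x = h x" "x \<in> Pd rad" "i \<in> {1..s}" shows "pd i g x = pd i h x"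
proof -
  have "eventually (\<lambda>t. t \<in> ball (pc i) rad) (nhds (x i))"
    using assms(2,3) by (intro eventually_nhds_in_open) (auto simp: Pd_def dist_norm norm_minus_commute)
  then have "eventually (\<lambda>t. g (x(i := t)) = h (x(i := t))) (nhds (x i))"
    by (rule eventually_mono) (use assms Pd_upd[OF assms(2)] in \<open>auto simp: dist_norm norm_minus_commute\<close>)
  then show ?thesis unfolding pd_def by (intro deriv_cong_ev) auto
qed

lemma pd_iter_cong:
  assumes "\<And>x. x \<in> Pd rad \<Longrightarrow> g x = h x" "x \<in> Pd rad" "i \<in> {1..s}" shows "(pd i ^^ k) g x = (pd i ^^ k) h x"
  using assms(2) by (induction k arbitrary: x) (auto simp: assms(1) intro!: pd_cong assms(3))

lemma pd_iter_linear:
  assumes "UU g" "UU h" "x \<in> Pd rad" "i \<in> {1..s}"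
  shows "(pd i ^^ k) (\<lambda>x. a * g x + b * h x) x = a * (pd i ^^ k) g x + b * (pd i ^^ k) h x"
  using assms(3)
proof (induction k arbitrary: x)
  case (Suc k)
  have "(pd i ^^ Suc k) (\<lambda>x. a * g x + b * h x) x = pd i (\<lambda>x. a * (pd i ^^ k) g x + b * (pd i ^^ k) h x) x"
    unfolding funpow.simps o_apply by (rule pd_cong[OF Suc.IH Suc.prems assms(4)])
  also have "\<dots> = a * pd i ((pd i ^^ k) g) x + b * pd i ((pd i ^^ k) h) x"
    by (rule pd_diff_UU) (use assms Suc.prems UU_pd_iter in auto)
  finally show ?case by simp
qed simp

lemma cm_linear:
  assumes "UU g" "UU h" "j \<le> s" "x \<in> Pd rad"
  shows "cm n j (\<lambda>x. a * g x + b * h x) x = a * cm n j g x + b * cm n j h x"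
  using assms(3,4)
proof (induction j arbitrary: x)
  case (Suc j)
  have j: "Suc j \<in> {1..s}" using Suc.prems by simp
  have "cm n (Suc j) (\<lambda>x. a * g x + b * h x) x = (pd (Suc j) ^^ n (Suc j)) (\<lambda>x. a * cm n j g x + b * cm n j h x) x"
    unfolding cm.simps by (rule pd_iter_cong[OF Suc.IH Suc.prems(2) j]) (use Suc.prems in auto)
  also have "\<dots> = a * cm n (Suc j) g x + b * cm n (Suc j) h x"
    unfolding cm.simps by (rule pd_iter_linear) (use Suc.prems j UU_cm assms in auto)
  finally show ?case .
qed simp

lemma pd_iter_bound:
  assumes i: "i \<in> {1..s}" and r: "0 < r2" "r2 < r1" "r1 \<le> rad"
  shows "\<exists>C\<ge>0. \<forall>g M. UU g \<longrightarrow> (\<forall>x\<in>Pd r1. norm (g x) \<le> M) \<longrightarrow> (\<forall>x\<in>Pd r2. norm ((pd i ^^ k) g x) \<le> C * M)"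
  using r(1,2)
proof (induction k arbitrary: r2)
  case 0
  have "\<forall>x\<in>Pd r2. norm (g x) \<le> 1 * M" if "\<forall>x\<in>Pd r1. norm (g x) \<le> M" for g M
    using that Pd_mono[of r2 r1] 0 by auto
  then show ?case unfolding funpow_0 cm.simps id_apply using zero_le_one by blast
next
  case (Suc k)
  define r3 where "r3 = (r1 + r2) / 2"
  have r3: "0 < r3" "r3 < r1" "r2 < r3" "r3 \<le> rad" using Suc.prems r(3) by (auto simp: r3_def)
  obtain C where C: "C \<ge> 0" "\<And>g M. UU g \<Longrightarrow> (\<forall>x\<in>Pd r1. norm (g x) \<le> M) \<Longrightarrow> (\<forall>x\<in>Pd r3. norm ((pd i ^^ k) g x) \<le> C * M)"
    using Suc.IH[OF r3(1,2)] by blast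
  have "norm ((pd i ^^ Suc k) g x) \<le> (4 * C / (r3 - r2)) * M" if g: "UU g" "\<forall>x\<in>Pd r1. norm (g x) \<le> M" and x: "x \<in> Pd r2" for g M x
  proof -
    have "norm (pd i ((pd i ^^ k) g) x) \<le> 4 * (C * M) / (r3 - r2)"
      using C(2)[OF g] by (intro pd_bound[OF UU_pd_iter[OF g(1) i] _ Suc.prems(1) r3(3,4) x i]) auto
    then show ?thesis by simp
  qed
  then show ?case using C(1) r3 by (intro exI[of _ "4 * C / (r3 - r2)"]) auto
qed

lemma cm_bound:
  assumes "j \<le> s" and r: "0 < r2" "r2 < r1" "r1 \<le> rad"
  shows "\<exists>C\<ge>0. \<forall>g M. UU g \<longrightarrow> (\<forall>x\<in>Pd r1. norm (g x) \<le> M) \<longrightarrow> (\<forall>x\<in>Pd r2. norm (cm n j g x) \<le> C * M)"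
  using assms(1) r(1,2)
proof (induction j arbitrary: r2)
  case 0
  have "\<forall>x\<in>Pd r2. norm (g x) \<le> 1 * M" if "\<forall>x\<in>Pd r1. norm (g x) \<le> M" for g M
    using that Pd_mono[of r2 r1] 0 by auto
  then show ?case unfolding funpow_0 cm.simps id_apply using zero_le_one by blast
next
  case (Suc j)
  define r3 where "r3 = (r1 + r2) / 2"
  have r3: "0 < r3" "r3 < r1" "r2 < r3" "r3 \<le> rad" using Suc.prems r(3) by (auto simp: r3_def)
  have j: "Suc j \<in> {1..s}" "j \<le> s" using Suc.prems by auto
  obtain C where C: "C \<ge> 0" "\<And>g M. UU g \<Longrightarrow> (\<forall>x\<in>Pd r1. norm (g x) \<le> M) \<Longrightarrow> (\<forall>x\<in>Pd r3. norm (cm n j g x) \<le> C * M)"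
    using Suc.IH[OF j(2) r3(1,2)] by blast
  obtain C' where C': "C' \<ge> 0" "\<And>g M. UU g \<Longrightarrow> (\<forall>x\<in>Pd r3. norm (g x) \<le> M) \<Longrightarrow> (\<forall>x\<in>Pd r2. norm ((pd (Suc j) ^^ n (Suc j)) g x) \<le> C' * M)"
    using pd_iter_bound[OF j(1) Suc.prems(2) r3(3,4)] by blast
  have "\<forall>x\<in>Pd r2. norm (cm n (Suc j) g x) \<le> (C' * C) * M" if g: "UU g" "\<forall>x\<in>Pd r1. norm (g x) \<le> M" for g M
    using C'(2)[OF UU_cm[OF g(1) j(2)] C(2)[OF g]] by (simp add: mult.assoc)
  then show ?case using C C' by (intro exI[of _ "C' * C"]) auto
qed

lemma pd_coord:
  assumes g: "UU g" and x: "x \<in> Pd rad" and j: "j \<in> {1..s}"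
  shows "pd j (\<lambda>x. x i * g x) x = x i * pd j g x + (if i = j then g x else 0)"
proof -
  have d: "((\<lambda>t. g (x(j := t))) has_field_derivative pd j g x) (at (x j))" by (rule UU_has_derivative[OF g x j])
  show ?thesis
  proof (cases "i = j")
    case True
    have "((\<lambda>t. t * g (x(j := t))) has_field_derivative 1 * g (x(j := x j)) + pd j g x * x j) (at (x j))"
      using d by (intro DERIV_mult) auto
    then have "deriv (\<lambda>t. t * g (x(j := t))) (x j) = g x + pd j g x * x j" by (simp add: DERIV_imp_deriv)
    then show ?thesis using True by (simp add: pd_def mult.commute)
  next
    case False
    have "((\<lambda>t. x i * g (x(j := t))) has_field_derivative x i * pd j g x) (at (x j))"
      using d by (rule DERIV_cmult)
    then show ?thesis using False by (simp add: pd_def DERIV_imp_deriv)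
  qed
qed

lemma pd_iter_coord:
  assumes g: "UU g" and x: "x \<in> Pd rad" and j: "j \<in> {1..s}" and i: "i \<in> {1..s}"
  shows "(pd j ^^ k) (\<lambda>x. x i * g x) x = x i * (pd j ^^ k) g x + (if i = j then of_nat k * (pd j ^^ (k - 1)) g x else 0)"
  using x
proof (induction k arbitrary: x)
  case (Suc k)
  define c where "c = (if i = j then of_nat k else (0::complex))"
  have u: "UU (\<lambda>x. x i * (pd j ^^ k) g x)" "UU ((pd j ^^ (k - 1)) g)" "UU ((pd j ^^ k) g)"
    using UU_mult_Pol[OF UU_pd_iter[OF g j] Pol.coord[OF i]] UU_pd_iter[OF g j] by auto
  have "(pd j ^^ Suc k) (\<lambda>x. x i * g x) x = pd j (\<lambda>x. 1 * (x i * (pd j ^^ k) g x) + c * (pd j ^^ (k - 1)) g x) x"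
    unfolding funpow.simps o_apply by (rule pd_cong[OF _ Suc.prems j]) (use Suc.IH in \<open>auto simp: c_def\<close>)
  also have "\<dots> = 1 * pd j (\<lambda>x. x i * (pd j ^^ k) g x) x + c * pd j ((pd j ^^ (k - 1)) g) x"
    by (rule pd_diff_UU[OF u(1,2) Suc.prems j])
  also have "pd j (\<lambda>x. x i * (pd j ^^ k) g x) x = x i * pd j ((pd j ^^ k) g) x + (if i = j then (pd j ^^ k) g x else 0)"
    by (rule pd_coord[OF u(3) Suc.prems j])
  also have "c * pd j ((pd j ^^ (k - 1)) g) x = c * (pd j ^^ k) g x"
    by (cases k) (auto simp: c_def)
  finally show ?case by (auto simp: c_def algebra_simps)
qed simp

lemma cm_cong_index: "(\<And>i. i \<le> j \<Longrightarrow> n i = n' i) \<Longrightarrow> cm n j g = cm n' j g"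
  by (induction j) auto

text \<open>Leibniz's rule for a linear factor, where only one correction term survives. If
  \<open>n i = 0\<close>, the truncated difference \<open>n i - 1\<close> is multiplied by
  0.\<close>

lemma cm_coord:
  assumes g: "UU g" and i: "i \<in> {1..s}" and "j \<le> s" "x \<in> Pd rad"
  shows "cm n j (\<lambda>x. x i * g x) x = x i * cm n j g x + (if i \<le> j then of_nat (n i) * cm (n(i := n i - 1)) j g x else 0)"
  using assms(3,4)
proof (induction j arbitrary: x)
  case 0
  then show ?case using i by simp
next
  case (Suc j)
  define m where "m = n(i := n i - 1)"
  define c where "c = (if i \<le> j then of_nat (n i) else (0::complex))"
  have j: "Suc j \<in> {1..s}" "j \<le> s" using Suc.prems by auto
  have u: "UU (\<lambda>x. x i * cm n j g x)" "UU (cm m j g)" "UU (cm n j g)"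
    using UU_mult_Pol[OF UU_cm[OF g j(2)] Pol.coord[OF i]] UU_cm[OF g j(2)] by auto
  have "cm n (Suc j) (\<lambda>x. x i * g x) x = (pd (Suc j) ^^ n (Suc j)) (\<lambda>x. 1 * (x i * cm n j g x) + c * cm m j g x) x"
    unfolding cm.simps by (rule pd_iter_cong[OF _ Suc.prems(2) j(1)]) (use Suc.IH j in \<open>auto simp: c_def m_def\<close>)
  also have "\<dots> = 1 * (pd (Suc j) ^^ n (Suc j)) (\<lambda>x. x i * cm n j g x) x + c * (pd (Suc j) ^^ n (Suc j)) (cm m j g) x"
    by (rule pd_iter_linear[OF u(1,2) Suc.prems(2) j(1)])
  also have "(pd (Suc j) ^^ n (Suc j)) (\<lambda>x. x i * cm n j g x) x = x i * (pd (Suc j) ^^ n (Suc j)) (cm n j g) x +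
      (if i = Suc j then of_nat (n (Suc j)) * (pd (Suc j) ^^ (n (Suc j) - 1)) (cm n j g) x else 0)"
    by (rule pd_iter_coord[OF u(3) Suc.prems(2) j(1) i])
  finally have e: "cm n (Suc j) (\<lambda>x. x i * g x) x = x i * cm n (Suc j) g x +
      (if i = Suc j then of_nat (n (Suc j)) * (pd (Suc j) ^^ (n (Suc j) - 1)) (cm n j g) x else 0) +
      c * (pd (Suc j) ^^ n (Suc j)) (cm m j g) x" by (simp only: mult_1_left cm.simps)
  show ?case
  proof (cases "i = Suc j")
    case True
    then have "cm m j g = cm n j g" by (intro cm_cong_index) (auto simp: m_def)
    moreover have "m (Suc j) = n (Suc j) - 1" using True by (simp add: m_def)
    ultimately show ?thesis using e True unfolding m_def[symmetric] by (simp add: c_def)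
  next
    case False
    then have "m (Suc j) = n (Suc j)" by (simp add: m_def)
    then show ?thesis using e False unfolding m_def[symmetric] by (auto simp: c_def)
  qed
qed

text \<open>At a real point the complex derivative can be taken along the real axis, where the
  function is real; its imaginary part is then the derivative of 0. Agreement on the real points of
  the open polydisc is enough, as derivatives see only a neighbourhood.\<close>

lemma mixed_deriv_eq_cm:
  fixes R :: "(nat \<Rightarrow> real) \<Rightarrow> real"
  assumes g: "UU g" and R: "\<And>x. (\<lambda>i. of_real (x i)) \<in> Pd rad \<Longrightarrow> of_real (R x) = g (\<lambda>i. of_real (x i))"
    and "j \<le> s" "(\<lambda>i. complex_of_real (x i)) \<in> Pd rad"
  shows "of_real (mixed_deriv n j R x) = cm n j g (\<lambda>i. of_real (x i))"
proof -
  have step: "of_real (coord_deriv i Q x) = pd i h (\<lambda>i. of_real (x i))"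
    if h: "UU h" and Q: "\<And>x. (\<lambda>i. of_real (x i)) \<in> Pd rad \<Longrightarrow> of_real (Q x) = h (\<lambda>i. of_real (x i))"
      and i: "i \<in> {1..s}" and x: "(\<lambda>i. complex_of_real (x i)) \<in> Pd rad" for Q h i and x :: "nat \<Rightarrow> real"
  proof -
    define cx where "cx = (\<lambda>i. complex_of_real (x i))"
    define d where "d = pd i h cx"
    have cx: "cx \<in> Pd rad" using x by (simp add: cx_def)
    have "((\<lambda>t. h (cx(i := t))) has_field_derivative d) (at (of_real (x i)))"
      using UU_has_derivative[OF h cx i] by (simp add: d_def cx_def)
    then have v: "((\<lambda>t. h (cx(i := of_real t))) has_vector_derivative d) (at (x i))"
      by (rule has_vector_derivative_real_field)
    have ev: "eventually (\<lambda>t. h (cx(i := of_real t)) = of_real (Q (x(i := t)))) (nhds (x i))"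
    proof -
      have "open {t::real. norm (of_real t - pc i) < rad}" by (intro open_Collect_less continuous_intros)
      moreover have "x i \<in> {t::real. norm (of_real t - pc i) < rad}" using cx i by (auto simp: Pd_def cx_def)
      ultimately have "eventually (\<lambda>t. t \<in> {t::real. norm (of_real t - pc i) < rad}) (nhds (x i))" by (rule eventually_nhds_in_open)
      then show ?thesis
      proof (rule eventually_mono)
        fix t :: real assume "t \<in> {t. norm (of_real t - pc i) < rad}"
        then have "cx(i := of_real t) \<in> Pd rad" using Pd_upd[OF cx] by simp
        moreover have e: "cx(i := of_real t) = (\<lambda>k. of_real ((x(i := t)) k))" by (auto simp: cx_def)
        ultimately show "h (cx(i := of_real t)) = of_real (Q (x(i := t)))" using Q[of "x(i := t)"] by simp
      qed
    qed
    have v2: "((\<lambda>t. complex_of_real (Q (x(i := t)))) has_vector_derivative d) (at (x i))"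
    proof -
      have "((\<lambda>t. h (cx(i := of_real t))) has_vector_derivative d) (at (x i)) \<longleftrightarrow>
          ((\<lambda>t. complex_of_real (Q (x(i := t)))) has_vector_derivative d) (at (x i))"
      proof (rule has_vector_derivative_cong_ev)
        show "eventually (\<lambda>t. t \<in> UNIV \<longrightarrow> h (cx(i := of_real t)) = complex_of_real (Q (x(i := t)))) (nhds (x i))"
          using ev by (rule eventually_mono) simp
      qed (rule eventually_nhds_x_imp_x[OF ev])
      then show ?thesis using v by blast
    qed
    have re: "((\<lambda>t. Re (complex_of_real (Q (x(i := t))))) has_vector_derivative Re d) (at (x i))"
      by (rule bounded_linear.has_vector_derivative[OF bounded_linear_Re v2])
    have im: "((\<lambda>t. Im (complex_of_real (Q (x(i := t))))) has_vector_derivative Im d) (at (x i))"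
      by (rule bounded_linear.has_vector_derivative[OF bounded_linear_Im v2])
    have "((\<lambda>t. Q (x(i := t))) has_field_derivative Re d) (at (x i))"
      using re by (simp add: has_real_derivative_iff_has_vector_derivative)
    then have 1: "coord_deriv i Q x = Re d" unfolding coord_deriv_def by (rule DERIV_imp_deriv)
    have "((\<lambda>t. 0::real) has_field_derivative Im d) (at (x i))"
      using im by (simp add: has_real_derivative_iff_has_vector_derivative)
    then have "Im d = 0" using DERIV_unique[OF _ DERIV_const[of "0::real" "at (x i)"]] by blast
    then show ?thesis using 1 by (simp add: complex_eq_iff d_def cx_def)
  qed
  have iter: "of_real ((coord_deriv i ^^ k) Q x) = (pd i ^^ k) h (\<lambda>i. of_real (x i))"
    if h: "UU h" and Q: "\<And>x. (\<lambda>i. of_real (x i)) \<in> Pd rad \<Longrightarrow> of_real (Q x) = h (\<lambda>i. of_real (x i))"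
      and i: "i \<in> {1..s}" and x: "(\<lambda>i. complex_of_real (x i)) \<in> Pd rad" for Q h i k and x :: "nat \<Rightarrow> real"
    using x
  proof (induction k arbitrary: x)
    case (Suc k)
    show ?case unfolding funpow.simps o_apply
      by (rule step[OF UU_pd_iter[OF h i] Suc.IH i Suc.prems])
  qed (use Q in auto)
  show ?thesis using assms(3,4)
  proof (induction j arbitrary: x)
    case (Suc j)
    have j: "Suc j \<in> {1..s}" "j \<le> s" using Suc.prems by auto
    show ?case unfolding mixed_deriv.simps cm.simps
      by (rule iter[OF UU_cm[OF g j(2)] Suc.IH[OF j(2)] j(1) Suc.prems(2)])
  qed (use R in auto)
qed

end

section \<open>Combinations of derivatives\<close>

context attractor_system
begin

definition wtw :: "(nat \<Rightarrow> 'a::comm_ring_1) \<Rightarrow> nat list \<Rightarrow> 'a" where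
  "wtw x w = prod_list (map (wt x) w)"

lemma wtw_simps [simp]: "wtw x [] = 1" "wtw x (i # w) = wt x i * wtw x w" "wtw x (v @ w) = wtw x v * wtw x w"
  by (auto simp: wtw_def)

lemma wtw_p_pos: "w \<in> Wd \<Longrightarrow> 0 < wtw p w"
  by (induction w) (auto simp: wt_p_pos)

lemma wtw_p_le_1: "w \<in> Wd \<Longrightarrow> wtw p w \<le> 1"
proof (induction w)
  case (Cons i w)
  then show ?case using mult_le_one[OF wt_p_le_1[of i] less_imp_le[OF wtw_p_pos[of w]]] by simp
qed simp

lemma wtw_p_ge: "w \<in> Wd \<Longrightarrow> pmin ^ length w \<le> wtw p w"
proof (induction w)
  case (Cons i w)
  then show ?case using pmin(1) pmin(2)[of i] by (auto intro!: mult_mono)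
qed simp

text \<open>Each letter contributes a relative error of at most \<epsilon>, because
  \<open>wt_close\<close> bounds the absolute error by \<open>\<epsilon> * pmin\<close>.\<close>

lemma wtw_bound:
  assumes x: "x \<in> Pd r" and r: "real s * r \<le> \<epsilon> * pmin" and "w \<in> Wd" and \<epsilon>: "0 \<le> \<epsilon>"
  shows "norm (wtw x w) \<le> (1 + \<epsilon>) ^ length w * wtw p w"
  using assms(3)
proof (induction w)
  case (Cons i w)
  then have i: "i \<in> II" "w \<in> Wd" by auto
  have "norm (wt x i) \<le> norm (of_real (wt p i) :: complex) + norm (wt x i - of_real (wt p i))"
    using norm_triangle_ineq[of "of_real (wt p i)" "wt x i - of_real (wt p i)"] by simp
  also have "\<dots> \<le> wt p i + \<epsilon> * pmin" using wt_close[OF x i(1)] r wt_p_pos[OF i(1)] by simp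
  also have "\<dots> \<le> wt p i + \<epsilon> * wt p i" using pmin(2)[OF i(1)] \<epsilon> by (intro add_left_mono mult_left_mono) auto
  finally have 1: "norm (wt x i) \<le> (1 + \<epsilon>) * wt p i" by (simp add: algebra_simps)
  have "norm (wtw x (i # w)) = norm (wt x i) * norm (wtw x w)" by (simp add: norm_mult)
  also have "\<dots> \<le> ((1 + \<epsilon>) * wt p i) * ((1 + \<epsilon>) ^ length w * wtw p w)"
    using 1 Cons.IH wt_p_pos[OF i(1)] \<epsilon> by (intro mult_mono) auto
  finally show ?case by (simp add: mult_ac)
qed simp

lemma Pol_wt: assumes "i \<in> II" shows "Pol (\<lambda>x. wt x i)"
proof (cases "i = s + 1")
  case True
  have "Pol (\<lambda>x. 1 + (-1) * (\<Sum>j\<in>{1..s}. x j))" by (intro Pol.intros Pol_sum) auto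
  then show ?thesis using True by (simp add: wt_def)
next
  case False
  then have "i \<in> {1..s}" using assms by (auto simp: II_def)
  then show ?thesis using False by (simp add: wt_def Pol.coord)
qed

lemma Pol_tk: "Pol (\<lambda>x. tk k x z)"
  by (induction k arbitrary: z) (auto intro!: Pol.intros Pol_sum Pol_wt)

lemma Pol_wtw: "w \<in> Wd \<Longrightarrow> Pol (\<lambda>x. wtw x w)"
  by (induction w) (auto intro!: Pol.intros Pol_wt)

lemma Tc_UU: "UU (\<lambda>x. Tc x z)"
  unfolding UU_def
proof (intro allI impI)
  fix r \<epsilon> :: real assume a: "0 < r" "r < rad" "0 < \<epsilon>"
  obtain C \<sigma> where c: "0 < \<sigma>" "\<sigma> < 1" "\<And>x z k. x \<in> Pd rad \<Longrightarrow> norm (Tc x z - tk k x z) \<le> C * \<sigma>^k"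
    by (rule Tc_uniform) (rule that)
  have "(\<lambda>n. C * \<sigma>^n) \<longlonglongrightarrow> C * 0"
    by (intro tendsto_mult tendsto_const LIMSEQ_realpow_zero less_imp_le[OF c(1)] c(2))
  then have "(\<lambda>n. C * \<sigma>^n) \<longlonglongrightarrow> 0" by simp
  then have "eventually (\<lambda>n. C * \<sigma>^n < \<epsilon>) sequentially" using a(3) by (rule order_tendstoD)
  then obtain k where "C * \<sigma>^k < \<epsilon>" by (auto simp: eventually_sequentially)
  then have "norm (Tc x z - tk k x z) < \<epsilon>" if "x \<in> Pd r" for x
    using c(3)[of x z k] that Pd_mono[of r rad] a by fastforce
  then show "\<exists>h. Pol h \<and> (\<forall>x\<in>Pd r. norm (Tc x z - h x) < \<epsilon>)"
    using Pol_tk by (intro exI[of _ "\<lambda>x. tk k x z"]) auto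
qed

lemma Cn_eq_cm: "of_real (Cn f s L p n z) = cm n s (\<lambda>x. Tc x z) pc"
proof -
  have pc: "pc = (\<lambda>i. of_real (p i))" by (simp add: pc_def fun_eq_iff)
  have P: "(\<lambda>i. complex_of_real (p i)) \<in> Pd rad" using pc_Pd[OF rad(1)] by (simp add: pc)
  show ?thesis
    unfolding Cn_def pc
  proof (rule mixed_deriv_eq_cm[OF Tc_UU _ order_refl P])
    fix x :: "nat \<Rightarrow> real" assume x: "(\<lambda>i. of_real (x i)) \<in> Pd rad"
    \<comment> \<open>The choice of \<open>rad\<close> keeps the weights at real points of the
      polydisc nonnegative, so that they form a probability vector.\<close>
    have wx: "wt x i \<ge> 0" if i: "i \<in> II" for i
    proof -
      have "norm (wt (\<lambda>i. complex_of_real (x i)) i - of_real (wt p i)) \<le> pmin / 2"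
        using wt_close[OF x i] rad(3) by linarith
      moreover have "wt (\<lambda>i. complex_of_real (x i)) i = of_real (wt x i)" by (simp add: wt_def)
      ultimately have "\<bar>wt x i - wt p i\<bar> \<le> pmin / 2" by (simp only: of_real_diff[symmetric] norm_of_real)
      then show ?thesis using pmin(1) pmin(2)[OF i] by linarith
    qed
    have 1: "0 \<le> x i" if "i \<in> {1..s}" for i using wx[of i] that by (auto simp: wt_def II_def split: if_splits)
    have 2: "(\<Sum>i\<in>{1..s}. x i) \<le> 1" using wx[of "s + 1"] by (simp add: wt_def II_def)
    show "of_real (Tprob f s L x z) = Tc (\<lambda>i. of_real (x i)) z"
      by (rule Tprob_eq_Tc[OF 1 2 x])
  qed
qed

definition Bx :: "nat \<Rightarrow> (nat \<Rightarrow> nat) set" where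
  "Bx d = {n. multi_index s n \<and> (\<Sum>i\<in>{1..s}. n i) \<le> d}"

text \<open>The filtration of the coefficient families by total degree, on which the inductions run;
  membership also makes the support finite.\<close>

definition CF :: "nat \<Rightarrow> ((nat \<Rightarrow> nat) \<Rightarrow> complex) set" where
  "CF d = {\<beta>. \<forall>n. \<beta> n \<noteq> 0 \<longrightarrow> n \<in> Bx d}"

definition DD :: "((nat \<Rightarrow> nat) \<Rightarrow> complex) \<Rightarrow> ((nat \<Rightarrow> complex) \<Rightarrow> complex) \<Rightarrow> complex" where
  "DD \<beta> g = (\<Sum>n\<in>{n. \<beta> n \<noteq> 0}. \<beta> n * cm n s g pc)"

text \<open>The transpose of the correction term in \<open>cm_coord\<close>: the entry at n receives
  what the derivative of index n + e_i passes down.\<close>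

definition lower :: "nat \<Rightarrow> ((nat \<Rightarrow> nat) \<Rightarrow> complex) \<Rightarrow> (nat \<Rightarrow> nat) \<Rightarrow> complex" where
  "lower i \<beta> n = of_nat (n i + 1) * \<beta> (n(i := n i + 1))"

text \<open>The last weight is 1 minus the sum of the other parameters, whence the negative
  sum.\<close>

definition low :: "nat \<Rightarrow> ((nat \<Rightarrow> nat) \<Rightarrow> complex) \<Rightarrow> (nat \<Rightarrow> nat) \<Rightarrow> complex" where
  "low i \<beta> n = (if i = s + 1 then - (\<Sum>j\<in>{1..s}. lower j \<beta> n) else lower i \<beta> n)"

text \<open>By the Leibniz rule, a factor \<open>wt x i\<close> inside the derivatives turns the coefficient family
  \<open>\<beta>\<close> into \<open>act i \<beta>\<close>; see \<open>DD_act\<close>.\<close>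

definition act :: "nat \<Rightarrow> ((nat \<Rightarrow> nat) \<Rightarrow> complex) \<Rightarrow> (nat \<Rightarrow> nat) \<Rightarrow> complex" where
  "act i \<beta> n = of_real (wt p i) * \<beta> n + low i \<beta> n"

primrec actw :: "nat list \<Rightarrow> ((nat \<Rightarrow> nat) \<Rightarrow> complex) \<Rightarrow> (nat \<Rightarrow> nat) \<Rightarrow> complex" where
  "actw [] \<beta> = \<beta>"
| "actw (i # w) \<beta> = actw w (act i \<beta>)"

lemma finite_Bx: "finite (Bx d)"
proof (rule finite_subset)
  show "Bx d \<subseteq> {n. \<forall>i. (i \<in> {1..s} \<longrightarrow> n i \<in> {..d}) \<and> (i \<notin> {1..s} \<longrightarrow> n i = 0)}"
  proof
    fix n assume n: "n \<in> Bx d"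
    have "n i \<le> d" if "i \<in> {1..s}" for i
    proof -
      have "n i \<le> (\<Sum>i\<in>{1..s}. n i)" using that by (intro member_le_sum) auto
      then show ?thesis using n by (auto simp: Bx_def)
    qed
    moreover have "n i = 0" if "i \<notin> {1..s}" for i using n that by (auto simp: Bx_def multi_index_def)
    ultimately show "n \<in> {n. \<forall>i. (i \<in> {1..s} \<longrightarrow> n i \<in> {..d}) \<and> (i \<notin> {1..s} \<longrightarrow> n i = 0)}" by auto
  qed
  show "finite {n. \<forall>i. (i \<in> {1..s} \<longrightarrow> n i \<in> {..d}) \<and> (i \<notin> {1..s} \<longrightarrow> n i = (0::nat))}"
    by (rule finite_set_of_finite_funs) auto
qed

lemma DD_eq: "\<beta> \<in> CF d \<Longrightarrow> DD \<beta> g = (\<Sum>n\<in>Bx d. \<beta> n * cm n s g pc)"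
  unfolding DD_def by (rule sum.mono_neutral_left) (auto simp: finite_Bx CF_def)

lemma CF_mono: "d \<le> d' \<Longrightarrow> CF d \<subseteq> CF d'"
  by (fastforce simp: CF_def Bx_def)

lemma CF_linear: "\<beta> \<in> CF d \<Longrightarrow> \<gamma> \<in> CF d \<Longrightarrow> (\<lambda>n. a * \<beta> n + b * \<gamma> n) \<in> CF d"
  unfolding CF_def mem_Collect_eq by (metis add_cancel_right_left mult_zero_right)

lemma DD_lin_coef:
  assumes "\<beta> \<in> CF d" "\<gamma> \<in> CF d"
  shows "DD (\<lambda>n. a * \<beta> n + b * \<gamma> n) g = a * DD \<beta> g + b * DD \<gamma> g"
  unfolding DD_eq[OF CF_linear[OF assms]] DD_eq[OF assms(1)] DD_eq[OF assms(2)]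
  by (simp add: sum_distrib_left sum.distrib[symmetric] algebra_simps)

lemma DD_linear:
  assumes "UU g" "UU h"
  shows "DD \<beta> (\<lambda>x. a * g x + b * h x) = a * DD \<beta> g + b * DD \<beta> h"
  unfolding DD_def cm_linear[OF assms order_refl pc_Pd[OF rad(1)]]
  by (simp add: sum_distrib_left sum.distrib[symmetric] algebra_simps)

lemma UU_sum: "finite A \<Longrightarrow> (\<And>a. a \<in> A \<Longrightarrow> UU (g a)) \<Longrightarrow> UU (\<lambda>x. \<Sum>a\<in>A. g a x)"
  by (induction A rule: finite_induct) (auto intro: Pol_UU Pol.const UU_add)

lemma DD_sum: "finite A \<Longrightarrow> (\<And>a. a \<in> A \<Longrightarrow> UU (g a)) \<Longrightarrow> DD \<beta> (\<lambda>x. \<Sum>a\<in>A. g a x) = (\<Sum>a\<in>A. DD \<beta> (g a))"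
proof (induction A rule: finite_induct)
  case empty
  show ?case using DD_linear[OF Pol_UU[OF Pol.const[of 0]] Pol_UU[OF Pol.const[of 0]], of \<beta> 0 0] by simp
next
  case (insert a A)
  have "DD \<beta> (\<lambda>x. 1 * g a x + 1 * (\<Sum>a\<in>A. g a x)) = 1 * DD \<beta> (g a) + 1 * DD \<beta> (\<lambda>x. \<Sum>a\<in>A. g a x)"
    by (rule DD_linear) (use insert in \<open>auto intro: UU_sum\<close>)
  then show ?case using insert by simp
qed

lemma lower_CF_Suc: assumes "\<beta> \<in> CF (Suc d)" "i \<in> {1..s}" shows "lower i \<beta> \<in> CF d"
  unfolding CF_def
proof (intro CollectI allI impI)
  fix n assume "lower i \<beta> n \<noteq> 0"
  then have "n(i := n i + 1) \<in> Bx (Suc d)" using assms(1) by (auto simp: lower_def CF_def)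
  then have n: "multi_index s (n(i := n i + 1))" "(\<Sum>j\<in>{1..s}. (n(i := n i + 1)) j) \<le> Suc d" by (auto simp: Bx_def)
  have e: "(\<Sum>j\<in>{1..s}. (n(i := n i + 1)) j) = (\<Sum>j\<in>{1..s}. n j) + 1"
  proof -
    have "(\<Sum>j\<in>{1..s} - {i}. (n(i := n i + 1)) j) = (\<Sum>j\<in>{1..s} - {i}. n j)" by (intro sum.cong) auto
    then show ?thesis using assms(2) by (simp add: sum.remove[of "{1..s}" i] del: One_nat_def)
  qed
  have "multi_index s n"
    unfolding multi_index_def
  proof (intro allI impI)
    fix j assume "n j \<noteq> 0"
    then have "(n(i := n i + 1)) j \<noteq> 0" by simp
    then show "1 \<le> j \<and> j \<le> s" using n(1) unfolding multi_index_def by blast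
  qed
  then show "n \<in> Bx d" using n(2) e by (simp add: Bx_def)
qed

lemma lower_CF_0: assumes "\<beta> \<in> CF 0" "i \<in> {1..s}" shows "lower i \<beta> = (\<lambda>_. 0)"
proof (rule ccontr)
  assume "lower i \<beta> \<noteq> (\<lambda>_. 0)"
  then obtain n where "lower i \<beta> n \<noteq> 0" by blast
  then have "n(i := n i + 1) \<in> Bx 0" using assms(1) by (auto simp: lower_def CF_def)
  moreover have "(\<Sum>j\<in>{1..s}. (n(i := n i + 1)) j) = (\<Sum>j\<in>{1..s} - {i}. n j) + (n i + 1)"
  proof -
    have "(\<Sum>j\<in>{1..s} - {i}. (n(i := n i + 1)) j) = (\<Sum>j\<in>{1..s} - {i}. n j)" by (intro sum.cong) auto
    then show ?thesis using assms(2) by (simp add: sum.remove[of "{1..s}" i] del: One_nat_def)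
  qed
  ultimately show False by (simp add: Bx_def del: fun_upd_apply)
qed

lemma zero_CF: "(\<lambda>_. 0) \<in> CF d" by (simp add: CF_def)

lemma CF_sum: "finite A \<Longrightarrow> (\<And>a. a \<in> A \<Longrightarrow> \<beta> a \<in> CF d) \<Longrightarrow> (\<lambda>n. \<Sum>a\<in>A. \<beta> a n) \<in> CF d"
proof (induction A rule: finite_induct)
  case (insert a A)
  then show ?case using CF_linear[of "\<beta> a" d "\<lambda>n. \<Sum>a\<in>A. \<beta> a n" 1 1] by simp
qed (simp add: zero_CF)

lemma II_cases: "i \<in> II \<Longrightarrow> i \<noteq> s + 1 \<Longrightarrow> i \<in> {1..s}" by (auto simp: II_def)

lemma low_CF_Suc: assumes "\<beta> \<in> CF (Suc d)" "i \<in> II" shows "low i \<beta> \<in> CF d"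
proof (cases "i = s + 1")
  case True
  have "(\<lambda>n. \<Sum>j\<in>{1..s}. lower j \<beta> n) \<in> CF d" by (intro CF_sum lower_CF_Suc assms) auto
  then have "(\<lambda>n. (-1) * (\<Sum>j\<in>{1..s}. lower j \<beta> n) + 0 * 0) \<in> CF d" using zero_CF by (rule CF_linear)
  then show ?thesis using True by (simp add: low_def[abs_def])
next
  case False
  then show ?thesis using lower_CF_Suc[OF assms(1) II_cases[OF assms(2)]] by (simp add: low_def[abs_def])
qed

lemma low_CF_0: assumes "\<beta> \<in> CF 0" "i \<in> II" shows "low i \<beta> = (\<lambda>_. 0)"
proof (cases "i = s + 1")
  case True
  have "(\<Sum>j\<in>{1..s}. lower j \<beta> n) = 0" for n by (rule sum.neutral) (use lower_CF_0[OF assms(1)] in \<open>auto simp: fun_eq_iff\<close>)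
  then show ?thesis using True by (simp add: low_def fun_eq_iff)
next
  case False
  then show ?thesis using lower_CF_0[OF assms(1) II_cases[OF assms(2)]] by (simp add: low_def fun_eq_iff)
qed

lemma low_CF: assumes "\<beta> \<in> CF d" "i \<in> II" shows "low i \<beta> \<in> CF d"
proof (cases d)
  case 0 then show ?thesis using low_CF_0 assms zero_CF by metis
next
  case (Suc e) then show ?thesis using low_CF_Suc[of \<beta> e i] assms CF_mono[of e d] by auto
qed

lemma act_CF: "\<beta> \<in> CF d \<Longrightarrow> i \<in> II \<Longrightarrow> act i \<beta> \<in> CF d"
  using CF_linear[OF _ low_CF, of \<beta> d \<beta> i "of_real (wt p i)" 1] by (simp add: act_def[abs_def])

lemma actw_CF: "\<beta> \<in> CF d \<Longrightarrow> w \<in> Wd \<Longrightarrow> actw w \<beta> \<in> CF d"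
  by (induction w arbitrary: \<beta>) (auto intro: act_CF)

text \<open>Each letter acts as a scalar plus an operator that lowers the degree, so modulo lower
  degree a word acts as the product of its probabilities.\<close>

lemma actw_top:
  "\<beta> \<in> CF (Suc d) \<Longrightarrow> w \<in> Wd \<Longrightarrow> (\<lambda>n. actw w \<beta> n - of_real (wtw p w) * \<beta> n) \<in> CF d"
    "\<beta> \<in> CF 0 \<Longrightarrow> w \<in> Wd \<Longrightarrow> actw w \<beta> = (\<lambda>n. of_real (wtw p w) * \<beta> n)"
proof (induction w arbitrary: \<beta>)
  case Nil
  {
    case 1 show ?case using zero_CF by simp
  next
    case 2 show ?case by simp
  }
next
  case (Cons i w)
  {
    case 1
    then have i: "i \<in> II" "w \<in> Wd" by auto
    have "(\<lambda>n. 1 * (actw w (act i \<beta>) n - of_real (wtw p w) * act i \<beta> n) + of_real (wtw p w) * low i \<beta> n) \<in> CF d"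
      by (rule CF_linear[OF Cons.IH(1)[OF act_CF[OF 1(1) i(1)] i(2)] low_CF_Suc[OF 1(1) i(1)]])
    then show ?case by (simp add: act_def algebra_simps)
  next
    case 2
    then have i: "i \<in> II" "w \<in> Wd" by auto
    have "act i \<beta> = (\<lambda>n. of_real (wt p i) * \<beta> n)" using low_CF_0[OF 2(1) i(1)] by (simp add: act_def fun_eq_iff)
    moreover have "actw w (act i \<beta>) = (\<lambda>n. of_real (wtw p w) * act i \<beta> n)"
      by (rule Cons.IH(2)[OF act_CF[OF 2(1) i(1)] i(2)])
    ultimately show ?case by (simp add: mult_ac)
  }
qed

lemma DD_coord:
  assumes \<beta>: "\<beta> \<in> CF d" and i: "i \<in> {1..s}" and g: "UU g"
  shows "DD \<beta> (\<lambda>x. x i * g x) = pc i * DD \<beta> g + DD (lower i \<beta>) g"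
proof -
  define c where "c n = \<beta> n * (of_nat (n i) * cm (n(i := n i - 1)) s g pc)" for n
  have L: "lower i \<beta> \<in> CF d"
  proof (cases d)
    case 0 then show ?thesis using lower_CF_0[of \<beta> i] \<beta> i zero_CF by metis
  next
    case (Suc e) then show ?thesis using lower_CF_Suc[of \<beta> e i] \<beta> i CF_mono[of e d] by auto
  qed
  have "DD \<beta> (\<lambda>x. x i * g x) = (\<Sum>n\<in>Bx d. \<beta> n * (pc i * cm n s g pc + of_nat (n i) * cm (n(i := n i - 1)) s g pc))"
    unfolding DD_eq[OF \<beta>] using cm_coord[OF g i order_refl pc_Pd[OF rad(1)]] i by simp
  also have "\<dots> = pc i * DD \<beta> g + (\<Sum>n\<in>Bx d. c n)"
    unfolding DD_eq[OF \<beta>] by (simp add: c_def sum_distrib_left sum.distrib[symmetric] algebra_simps)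
  \<comment> \<open>Only indices with positive i-th entry contribute; written as m + e_i they
    produce \<open>lower i \<beta>\<close>.\<close>
  also have "(\<Sum>n\<in>Bx d. c n) = (\<Sum>n\<in>{n\<in>Bx d. n i > 0}. c n)"
    by (rule sum.mono_neutral_right) (auto simp: finite_Bx c_def)
  also have "\<dots> = (\<Sum>m\<in>{m. m(i := m i + 1) \<in> Bx d}. lower i \<beta> m * cm m s g pc)"
  proof (rule sum.reindex_bij_witness[of _ "\<lambda>m. m(i := m i + 1)" "\<lambda>n. n(i := n i - 1)"])
    fix n assume n: "n \<in> {n\<in>Bx d. n i > 0}"
    then show e: "(n(i := n i - 1))(i := (n(i := n i - 1)) i + 1) = n" by auto
    show "n(i := n i - 1) \<in> {m. m(i := m i + 1) \<in> Bx d}" using n e by (simp del: fun_upd_upd)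
    have "n i - 1 + 1 = n i" using n by simp
    then show "lower i \<beta> (n(i := n i - 1)) * cm (n(i := n i - 1)) s g pc = c n"
      unfolding lower_def e by (simp add: c_def mult_ac)
  qed auto
  also have "\<dots> = DD (lower i \<beta>) g"
    unfolding DD_eq[OF L]
  proof (rule sum.mono_neutral_left[OF finite_Bx])
    show "{m. m(i := m i + 1) \<in> Bx d} \<subseteq> Bx d"
    proof
      fix m assume "m \<in> {m. m(i := m i + 1) \<in> Bx d}"
      then have m: "multi_index s (m(i := m i + 1))" "(\<Sum>j\<in>{1..s}. (m(i := m i + 1)) j) \<le> d" by (auto simp: Bx_def)
      have "multi_index s m"
        unfolding multi_index_def
      proof (intro allI impI)
        fix j assume "m j \<noteq> 0"
        then have "(m(i := m i + 1)) j \<noteq> 0" by simp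
        then show "1 \<le> j \<and> j \<le> s" using m(1) unfolding multi_index_def by blast
      qed
      moreover have "(\<Sum>j\<in>{1..s}. m j) \<le> (\<Sum>j\<in>{1..s}. (m(i := m i + 1)) j)" by (rule sum_mono) auto
      ultimately show "m \<in> Bx d" using m(2) by (simp add: Bx_def del: fun_upd_apply)
    qed
    show "\<forall>m\<in>Bx d - {m. m(i := m i + 1) \<in> Bx d}. lower i \<beta> m * cm m s g pc = 0"
      using \<beta> by (auto simp: lower_def CF_def)
  qed
  finally show ?thesis .
qed

lemma DD_act:
  assumes \<beta>: "\<beta> \<in> CF d" and i: "i \<in> II" and g: "UU g"
  shows "DD \<beta> (\<lambda>x. wt x i * g x) = DD (act i \<beta>) g"
proof (cases "i = s + 1")
  case False
  then have i': "i \<in> {1..s}" using i II_cases by blast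
  have "DD (act i \<beta>) g = of_real (wt p i) * DD \<beta> g + 1 * DD (low i \<beta>) g"
    using DD_lin_coef[OF \<beta> low_CF[OF \<beta> i], of "of_real (wt p i)" 1 g] by (simp add: act_def[abs_def])
  moreover have "low i \<beta> = lower i \<beta>" using False by (simp add: low_def fun_eq_iff)
  ultimately show ?thesis using DD_coord[OF \<beta> i' g] False by (simp add: wt_def pc_def)
next
  case True
  have Lj: "lower j \<beta> \<in> CF d" if "j \<in> {1..s}" for j
    using low_CF[OF \<beta>, of j] that by (auto simp: low_def[abs_def] II_def split: if_splits)
  have u: "UU (\<lambda>x. x j * g x)" if "j \<in> {1..s}" for j using UU_mult_Pol[OF g Pol.coord[OF that]] .
  have us: "UU (\<lambda>x. \<Sum>j\<in>{1..s}. x j * g x)" by (rule UU_sum) (use u in auto)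
  have Sl: "DD (\<lambda>n. \<Sum>j\<in>A. lower j \<beta> n) g = (\<Sum>j\<in>A. DD (lower j \<beta>) g)" if "A \<subseteq> {1..s}" for A
    using finite_subset[OF that finite_atLeastAtMost] that
  proof (induction A rule: finite_induct)
    case empty then show ?case by (simp add: DD_def)
  next
    case (insert a A)
    then have c: "lower a \<beta> \<in> CF d" "(\<lambda>n. \<Sum>j\<in>A. lower j \<beta> n) \<in> CF d" by (auto intro!: Lj CF_sum)
    show ?case using DD_lin_coef[OF c, of 1 1 g] insert by simp
  qed
  have "(\<lambda>x. wt x i * g x) = (\<lambda>x. 1 * g x + (-1) * (\<Sum>j\<in>{1..s}. x j * g x))"
    by (simp add: True wt_def fun_eq_iff left_diff_distrib sum_distrib_right)
  then have "DD \<beta> (\<lambda>x. wt x i * g x) = 1 * DD \<beta> g + (-1) * DD \<beta> (\<lambda>x. \<Sum>j\<in>{1..s}. x j * g x)"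
    using DD_linear[OF g us, of \<beta> 1 "-1"] by simp
  also have "DD \<beta> (\<lambda>x. \<Sum>j\<in>{1..s}. x j * g x) = (\<Sum>j\<in>{1..s}. pc j * DD \<beta> g + DD (lower j \<beta>) g)"
    using DD_sum[of "{1..s}" "\<lambda>j x. x j * g x" \<beta>] u DD_coord[OF \<beta> _ g] by simp
  also have "\<dots> = (\<Sum>j\<in>{1..s}. pc j) * DD \<beta> g + DD (\<lambda>n. \<Sum>j\<in>{1..s}. lower j \<beta> n) g"
    by (simp add: sum.distrib sum_distrib_right Sl)
  finally have 1: "DD \<beta> (\<lambda>x. wt x i * g x) = (1 - (\<Sum>j\<in>{1..s}. pc j)) * DD \<beta> g - DD (\<lambda>n. \<Sum>j\<in>{1..s}. lower j \<beta> n) g"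
    by (simp add: algebra_simps)
  have "(\<lambda>n. \<Sum>j\<in>{1..s}. lower j \<beta> n) \<in> CF d" by (intro CF_sum Lj) auto
  then have "DD (\<lambda>n. of_real (wt p i) * \<beta> n + (-1) * (\<Sum>j\<in>{1..s}. lower j \<beta> n)) g =
      of_real (wt p i) * DD \<beta> g + (-1) * DD (\<lambda>n. \<Sum>j\<in>{1..s}. lower j \<beta> n) g"
    by (rule DD_lin_coef[OF \<beta>])
  moreover have "act i \<beta> = (\<lambda>n. of_real (wt p i) * \<beta> n + (-1) * (\<Sum>j\<in>{1..s}. lower j \<beta> n))"
    using True by (simp add: act_def low_def fun_eq_iff)
  ultimately show ?thesis using 1 True by (simp add: wt_def pc_def)
qed

lemma DD_actw:
  assumes "\<beta> \<in> CF d" "w \<in> Wd" "UU g"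
  shows "DD \<beta> (\<lambda>x. wtw x w * g x) = DD (actw w \<beta>) g"
  using assms(1,2)
proof (induction w arbitrary: \<beta>)
  case (Cons i w)
  then have i: "i \<in> II" "w \<in> Wd" by auto
  have u: "UU (\<lambda>x. wtw x w * g x)" by (rule UU_mult_Pol[OF assms(3) Pol_wtw[OF i(2)]])
  have "DD \<beta> (\<lambda>x. wtw x (i # w) * g x) = DD (act i \<beta>) (\<lambda>x. wtw x w * g x)"
    using DD_act[OF Cons.prems(1) i(1) u] by (simp add: mult.assoc)
  also have "\<dots> = DD (actw (i # w) \<beta>) g" using Cons.IH[OF act_CF[OF Cons.prems(1) i(1)] i(2)] by simp
  finally show ?case .
qed simp

text \<open>Cauchy's estimates on a polydisc about \<open>pc\<close>. The radius is left free since
  it is later taken small, to control the complex weights of long words.\<close>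

lemma DD_bound:
  assumes "0 < r" "r \<le> rad"
  shows "\<exists>C\<ge>0. \<forall>g M. UU g \<longrightarrow> (\<forall>x\<in>Pd r. norm (g x) \<le> M) \<longrightarrow> norm (DD \<beta> g) \<le> C * M"
proof -
  have "\<exists>C\<ge>0. \<forall>g M. UU g \<longrightarrow> (\<forall>x\<in>Pd r. norm (g x) \<le> M) \<longrightarrow> (\<forall>x\<in>Pd (r/2). norm (cm n s g x) \<le> C * M)" for n
    using cm_bound[of s "r/2" r n] assms by simp
  then obtain C where C: "\<And>n. C n \<ge> 0"
    "\<And>n g M. UU g \<Longrightarrow> (\<forall>x\<in>Pd r. norm (g x) \<le> M) \<Longrightarrow> (\<forall>x\<in>Pd (r/2). norm (cm n s g x) \<le> C n * M)" by metis
  have "norm (DD \<beta> g) \<le> (\<Sum>n\<in>{n. \<beta> n \<noteq> 0}. norm (\<beta> n) * C n) * M" if g: "UU g" "\<forall>x\<in>Pd r. norm (g x) \<le> M" for g M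
  proof -
    have "norm (cm n s g pc) \<le> C n * M" for n using C(2)[OF g] pc_Pd[of "r/2"] assms by auto
    then have "norm (DD \<beta> g) \<le> (\<Sum>n\<in>{n. \<beta> n \<noteq> 0}. norm (\<beta> n) * (C n * M))"
      unfolding DD_def by (intro sum_norm_le) (auto simp: norm_mult intro: mult_left_mono)
    then show ?thesis by (simp add: sum_distrib_right mult.assoc)
  qed
  moreover have "(\<Sum>n\<in>{n. \<beta> n \<noteq> 0}. norm (\<beta> n) * C n) \<ge> 0" using C(1) by (intro sum_nonneg) auto
  ultimately show ?thesis by blast
qed

definition Cf :: "((nat \<Rightarrow> nat) \<Rightarrow> complex) \<Rightarrow> sph \<Rightarrow> complex" where
  "Cf \<beta> z = DD \<beta> (\<lambda>x. Tc x z)"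

lemma Cf_eq: "Cf \<beta> z = (\<Sum>n\<in>{n. \<beta> n \<noteq> 0}. \<beta> n * of_real (Cn f s L p n z))"
  by (simp add: Cf_def DD_def Cn_eq_cm)

lemma Cf_linear: "\<beta> \<in> CF d \<Longrightarrow> \<gamma> \<in> CF d \<Longrightarrow> Cf (\<lambda>n. a * \<beta> n + b * \<gamma> n) z = a * Cf \<beta> z + b * Cf \<gamma> z"
  unfolding Cf_def by (rule DD_lin_coef)

lemma Cf_asym: "asym y z \<Longrightarrow> Cf \<beta> y = Cf \<beta> z"
  unfolding Cf_def using Tc_asym by metis

lemma Cf_diff: "Cf \<beta> y - Cf \<beta> z = DD \<beta> (\<lambda>x. 1 * Tc x y + (-1) * Tc x z)"
  unfolding Cf_def DD_linear[OF Tc_UU Tc_UU] by simp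

lemma Cf_diff_bounded: obtains B where "B \<ge> 0" "\<And>y z. norm (Cf \<beta> y - Cf \<beta> z) \<le> 2 * B"
proof -
  obtain B where B: "B > 0" "\<And>x z. x \<in> Pd rad \<Longrightarrow> norm (Tc x z) \<le> B" by (rule Tc_bounded) (rule that)
  obtain C where C: "C \<ge> 0" "\<And>g M. UU g \<Longrightarrow> (\<forall>x\<in>Pd rad. norm (g x) \<le> M) \<Longrightarrow> norm (DD \<beta> g) \<le> C * M"
    using DD_bound[of rad \<beta>] rad(1) by auto
  have b: "norm (Cf \<beta> z) \<le> C * B" for z using B C Tc_UU unfolding Cf_def by simp
  have "norm (Cf \<beta> y - Cf \<beta> z) \<le> 2 * (C * B)" for y z
    using b[of y] b[of z] norm_triangle_ineq4[of "Cf \<beta> y" "Cf \<beta> z"] by linarith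
  then show ?thesis using that[of "C * B"] B C by simp
qed

end

section \<open>Transitivity and periodic points\<close>

context rational_semigroup
begin

text \<open>The case of Montel's theorem in which a whole ball about \<open>e\<close> is omitted: in
  the chart with pole \<open>e\<close> the words become uniformly bounded holomorphic functions,
  with a common Lipschitz constant on a smaller disc.\<close>

lemma omission_imp_fatou:
  assumes r: "r > 0" and \<eta>: "\<eta> > 0" and om: "\<And>w y. w \<in> Wd \<Longrightarrow> y \<in> ball x r \<Longrightarrow> \<eta> \<le> dist (fw f w y) e"
  shows "x \<in> FF"
proof -
  obtain e0 where e0: "dist x e0 \<ge> 1" using far_chart by blast
  define c where "c = coord e0 x"
  have xe: "x \<noteq> e0" using e0 by auto
  then have pc: "param e0 c = x" by (simp add: c_def)
  obtain Kp where Kp: "Kp > 0" "\<And>z w. dist (param e0 z) (param e0 w) \<le> Kp * dist z w" using param_Lipschitz by metis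
  obtain Kc where Kc: "Kc > 0" "\<And>a b. dist a e0 \<ge> 1/2 \<Longrightarrow> dist b e0 \<ge> 1/2 \<Longrightarrow> dist (coord e0 a) (coord e0 b) \<le> Kc * dist a b"
    using coord_Lipschitz[of "1/2" e0] by auto
  obtain Ke where Ke: "Ke > 0" "\<And>a. dist a e \<ge> \<eta> \<Longrightarrow> norm (coord e a) \<le> Ke" using coord_Lipschitz[OF \<eta>, of e] by metis
  obtain Kq where Kq: "Kq > 0" "\<And>z w. dist (param e z) (param e w) \<le> Kq * dist z w" using param_Lipschitz by metis
  define \<rho> where "\<rho> = r / Kp"
  have \<rho>: "\<rho> > 0" using r Kp by (simp add: \<rho>_def)
  have inb: "param e0 z \<in> ball x r" if "z \<in> ball c \<rho>" for z
  proof -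
    have "dist x (param e0 z) \<le> Kp * dist c z" using Kp(2)[of c z] pc by simp
    also have "\<dots> < Kp * \<rho>" using that Kp(1) by simp
    finally show ?thesis using Kp(1) by (simp add: \<rho>_def)
  qed
  define h where "h w z = coord e (fw f w (param e0 z))" for w z
  have hne: "fw f w (param e0 z) \<noteq> e" if "w \<in> Wd" "z \<in> ball c \<rho>" for w z
    using om[OF that(1) inb[OF that(2)]] \<eta> by auto
  have hol: "h w holomorphic_on ball c \<rho>" if "w \<in> Wd" for w
    unfolding h_def by (rule coord_holomorphic[OF smap_param[OF word_smap[OF that]] open_ball hne[OF that]])
  have hb: "norm (h w z) \<le> Ke" if "w \<in> Wd" "z \<in> ball c \<rho>" for w z
    unfolding h_def by (rule Ke(2)[OF om[OF that(1) inb[OF that(2)]]])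
  define \<Lambda> where "\<Lambda> = 4 * Ke / \<rho>"
  have \<Lambda>0: "\<Lambda> \<ge> 0" using Ke \<rho> by (simp add: \<Lambda>_def)
  have hL: "norm (h w a - h w b) \<le> \<Lambda> * norm (a - b)" if w: "w \<in> Wd" and ab: "a \<in> ball c (\<rho>/2)" "b \<in> ball c (\<rho>/2)" for w a b
  proof (rule field_differentiable_bound[of "ball c (\<rho>/2)" _ "deriv (h w)"])
    fix t assume t: "t \<in> ball c (\<rho>/2)"
    have t1: "t \<in> ball c \<rho>" using t \<rho> by auto
    show "(h w has_field_derivative deriv (h w) t) (at t within ball c (\<rho>/2))"
      using holomorphic_derivI[OF hol[OF w] open_ball t1] by (rule has_field_derivative_at_within)
    show "norm (deriv (h w) t) \<le> \<Lambda>"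
      using deriv_bound[OF hol[OF w] hb[OF w], of "\<rho>/2" t] t \<rho> by (simp add: \<Lambda>_def field_simps)
  qed (use ab in auto)
  define r1 where "r1 = min (1/2) (\<rho> / (2 * Kc))"
  have r1: "r1 > 0" using \<rho> Kc by (simp add: r1_def)
  have far: "dist y e0 \<ge> 1/2" if "y \<in> ball x r1" for y
    using that e0 dist_triangle[of x e0 y] by (simp add: r1_def)
  have cin: "coord e0 y \<in> ball c (\<rho>/2)" if "y \<in> ball x r1" for y
  proof -
    have "dist c (coord e0 y) \<le> Kc * dist x y" unfolding c_def using Kc(2)[of x y] far[OF that] e0 by simp
    also have "\<dots> < Kc * (\<rho> / (2 * Kc))" using that Kc(1) by (intro mult_strict_left_mono) (auto simp: r1_def)
    finally show ?thesis using Kc(1) by simp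
  qed
  define M where "M = Kq * \<Lambda> * Kc"
  have M: "M \<ge> 0" using Kq \<Lambda>0 Kc by (simp add: M_def)
  have lip: "dist (fw f w y) (fw f w y') \<le> M * dist y y'" if w: "w \<in> Wd" and y: "y \<in> ball x r1" "y' \<in> ball x r1" for w y y'
  proof -
    have fe: "fw f w u = param e (h w (coord e0 u))" if u: "u \<in> ball x r1" for u
    proof -
      have "u \<noteq> e0" using far[OF u] by auto
      moreover have "coord e0 u \<in> ball c \<rho>" using cin[OF u] \<rho> by auto
      ultimately show ?thesis using hne[OF w, of "coord e0 u"] by (simp add: h_def)
    qed
    have "dist (fw f w y) (fw f w y') \<le> Kq * dist (h w (coord e0 y)) (h w (coord e0 y'))"
      unfolding fe[OF y(1)] fe[OF y(2)] by (rule Kq(2))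
    also have "\<dots> \<le> Kq * (\<Lambda> * dist (coord e0 y) (coord e0 y'))"
      using hL[OF w cin[OF y(1)] cin[OF y(2)]] Kq(1) by (intro mult_left_mono) (auto simp: dist_norm)
    also have "\<dots> \<le> Kq * (\<Lambda> * (Kc * dist y y'))"
      using Kc(2)[OF far[OF y(1)] far[OF y(2)]] Kq(1) \<Lambda>0 by (intro mult_left_mono) auto
    finally show ?thesis by (simp add: M_def mult.assoc)
  qed
  have "eqc y" if y: "y \<in> ball x r1" for y
    unfolding eqc_def
  proof (intro allI impI)
    fix \<epsilon> :: real assume \<epsilon>: "\<epsilon> > 0"
    define d where "d = min (r1 - dist x y) (\<epsilon> / (M + 1))"
    have d: "d > 0" using y \<epsilon> M by (simp add: d_def)
    have "dist (fw f w u) (fw f w y) < \<epsilon>" if w: "w \<in> Wd" and u: "dist u y < d" for w u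
    proof -
      have "u \<in> ball x r1" using u dist_triangle[of x u y] by (simp add: d_def dist_commute)
      then have "dist (fw f w u) (fw f w y) \<le> M * dist u y" using lip w y by blast
      also have "\<dots> \<le> M * (\<epsilon> / (M + 1))" using u M by (intro mult_left_mono) (auto simp: d_def)
      also have "\<dots> < \<epsilon>" using M \<epsilon> by (simp add: field_simps)
      finally show ?thesis .
    qed
    then show "\<exists>\<delta>>0. \<forall>w\<in>Wd. \<forall>u. dist u y < \<delta> \<longrightarrow> dist (fw f w u) (fw f w y) < \<epsilon>" using d by blast
  qed
  then show ?thesis unfolding fatou_iff using r1 by blast
qed

end

context branched_semigroup
begin

text \<open>From points near \<open>x\<close> some word must come close to \<open>e\<close>,
  otherwise \<open>x\<close> would be a Fatou point. The inverse branch of this word over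
  \<open>e\<close> replaces the point found by an exact preimage of \<open>e\<close>, at the price
  of a small displacement.\<close>

lemma julia_transitive:
  assumes x: "x \<in> JJ" and e: "e \<in> JJ" and r: "r > 0"
  obtains v y where "v \<in> Wd" "y \<in> ball x r" "fw f v y = e"
proof -
  \<comment> \<open>Branches are Lipschitz with constant at most \<open>\<kappa>^2\<close>, so an
    error \<eta> at \<open>e\<close> becomes a displacement of at most r/2 near
    \<open>x\<close>.\<close>
  define \<eta> where "\<eta> = min \<delta> (r / (2 * \<kappa>^2))"
  have \<eta>: "\<eta> > 0" using \<delta> r \<kappa>_pos by (simp add: \<eta>_def)
  have "\<not> (\<forall>w\<in>Wd. \<forall>y\<in>ball x (r/2). \<eta> \<le> dist (fw f w y) e)"
    using omission_imp_fatou[OF half_gt_zero[OF r] \<eta>, of x e] x julia_iff by blast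
  then obtain w y where w: "w \<in> Wd" "y \<in> ball x (r/2)" "dist (fw f w y) e < \<eta>" by fastforce
  have "dist e (fw f w y) < \<delta>" using w(3) by (simp add: \<eta>_def dist_commute)
  then obtain H \<rho> where H: "BB w e H \<rho>" "dist y (H e) \<le> \<kappa> * \<rho> * dist (fw f w y) e"
    by (rule pull_back[OF w(1) e]) (rule that)
  have "\<kappa> * \<rho> * dist (fw f w y) e \<le> \<kappa> * \<kappa> * \<eta>"
    using BB_D(1,2)[OF H(1)] w(3) \<kappa>_pos by (intro mult_mono) auto
  also have "\<dots> \<le> \<kappa>^2 * (r / (2 * \<kappa>^2))" unfolding power2_eq_square[symmetric] by (intro mult_left_mono) (auto simp: \<eta>_def)
  also have "\<dots> = r / 2" using \<kappa>_pos by simp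
  finally have "dist y (H e) \<le> r / 2" using H(2) by simp
  then have "H e \<in> ball x r" using w(2) dist_triangle[of x "H e" y] by simp
  moreover have "fw f w (H e) = e" by (rule BB_D(3)[OF H(1)]) (use \<delta> in simp)
  ultimately show ?thesis using that w(1) by blast
qed

text \<open>By compactness: a word that joins the limits of a sequence of counterexamples also joins
  the nearby pairs, because its inverse branch is defined on a whole ball about the limit of the
  targets.\<close>

lemma julia_transitive_uniform:
  assumes r: "r > 0"
  obtains V where "\<And>x e. x \<in> JJ \<Longrightarrow> e \<in> JJ \<Longrightarrow> \<exists>v y. v \<in> Wd \<and> length v \<le> V \<and> y \<in> ball x r \<and> fw f v y = e"
proof -
  have "\<exists>V. \<forall>x\<in>JJ. \<forall>e\<in>JJ. \<exists>v y. v \<in> Wd \<and> length v \<le> V \<and> y \<in> ball x r \<and> fw f v y = e"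
  proof (rule ccontr)
    assume "\<not> ?thesis"
    then have "\<forall>n. \<exists>x e. x \<in> JJ \<and> e \<in> JJ \<and> (\<forall>v y. v \<in> Wd \<longrightarrow> length v \<le> n \<longrightarrow> y \<in> ball x r \<longrightarrow> fw f v y \<noteq> e)" by blast
    then obtain X E where XE: "\<And>n. X n \<in> JJ" "\<And>n. E n \<in> JJ"
      "\<And>n v y. v \<in> Wd \<Longrightarrow> length v \<le> n \<Longrightarrow> y \<in> ball (X n) r \<Longrightarrow> fw f v y \<noteq> E n" by metis
    obtain x a where x: "x \<in> JJ" "strict_mono a" "(X \<circ> a) \<longlonglongrightarrow> x"
      using compact_julia XE(1) unfolding compact_def by metis
    have "\<forall>n. (E \<circ> a) n \<in> JJ" using XE(2) by simp
    then obtain e b where e: "e \<in> JJ" "strict_mono b" "((E \<circ> a) \<circ> b) \<longlonglongrightarrow> e"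
      using compact_julia unfolding compact_def by metis
    have x': "((X \<circ> a) \<circ> b) \<longlonglongrightarrow> x" using LIMSEQ_subseq_LIMSEQ[OF x(3) e(2)] .
    obtain v y where v: "v \<in> Wd" "y \<in> ball x (r/3)" "fw f v y = e"
      using julia_transitive[OF x(1) e(1), of "r/3"] r by (metis divide_pos_pos zero_less_numeral)
    define d where "d = min \<delta> (r / (3 * \<kappa>^2))"
    have d: "d > 0" using \<delta> r \<kappa>_pos by (simp add: d_def)
    have "eventually (\<lambda>n. dist (((X \<circ> a) \<circ> b) n) x < r/3) sequentially" by (rule tendstoD[OF x']) (use r in simp)
    moreover have "eventually (\<lambda>n. dist (((E \<circ> a) \<circ> b) n) e < d) sequentially" by (rule tendstoD[OF e(3) d])
    moreover have "eventually (\<lambda>n. n \<ge> length v) sequentially" by (rule eventually_ge_at_top)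
    ultimately have "eventually (\<lambda>n. dist (((X \<circ> a) \<circ> b) n) x < r/3 \<and> dist (((E \<circ> a) \<circ> b) n) e < d \<and> n \<ge> length v) sequentially"
      by (intro eventually_conj)
    then obtain n where n: "dist (X (a (b n))) x < r/3" "dist (E (a (b n))) e < d" "n \<ge> length v"
      by (auto simp: eventually_sequentially)
    define m where "m = a (b n)"
    have m: "length v \<le> m" using n(3) seq_suble[OF x(2), of "b n"] seq_suble[OF e(2), of n] by (simp add: m_def)
    obtain H where H: "BB v e H (R v y)" "H e = y" using R_branch[of v y] v e(1) by auto
    have eb: "E m \<in> ball e \<delta>" "e \<in> ball e \<delta>" using n(2) \<delta> by (auto simp: m_def d_def dist_commute)
    have "dist (H (E m)) y \<le> \<kappa> * R v y * dist (E m) e" using BB_D(5)[OF H(1) eb] H(2) by simp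
    also have "\<dots> \<le> \<kappa> * \<kappa> * d" using BB_D(1,2)[OF H(1)] n(2) \<kappa>_pos by (intro mult_mono) (auto simp: m_def)
    also have "\<dots> \<le> \<kappa>^2 * (r / (3 * \<kappa>^2))" unfolding power2_eq_square[symmetric] by (intro mult_left_mono) (auto simp: d_def)
    also have "\<dots> = r / 3" using \<kappa>_pos by simp
    finally have 1: "dist (H (E m)) y \<le> r / 3" .
    have "dist (X m) (H (E m)) \<le> dist (X m) x + dist x y + dist y (H (E m))"
      using dist_triangle[of "X m" "H (E m)" x] dist_triangle[of x "H (E m)" y] by linarith
    then have "H (E m) \<in> ball (X m) r" using 1 n(1) v(2) by (simp add: m_def dist_commute)
    moreover have "fw f v (H (E m)) = E m" by (rule BB_D(3)[OF H(1) eb(1)])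
    ultimately show False using XE(3)[OF v(1) m] by blast
  qed
  then show ?thesis using that by blast
qed

text \<open>The branch contracts by 1/2 and moves \<open>x\<close> by at most \<delta>/4, so it maps
  the closed half ball into itself. Julia points stay Julia points under it, so the fixed point
  given by Banach's theorem lies in the Julia set.\<close>

lemma closing:
  assumes w: "w \<in> Wd" and x: "x \<in> JJ" and H: "BB w x H \<rho>" and \<rho>: "\<kappa> * \<rho> \<le> 1/2" and near: "dist x (H x) \<le> \<delta> / 4"
  obtains q where "q \<in> JJ" "fw f w q = q" "R w q \<le> \<kappa>^2 * \<rho>"
proof -
  define S where "S = cball x (\<delta>/2) \<inter> JJ"
  have sub: "S \<subseteq> ball x \<delta>" using \<delta> by (auto simp: S_def)
  have xS: "x \<in> S" "x \<in> ball x \<delta>" using x \<delta> by (auto simp: S_def)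
  have contr: "dist (H u) (H v) \<le> 1/2 * dist u v" if "u \<in> S" "v \<in> S" for u v
  proof -
    have "dist (H u) (H v) \<le> \<kappa> * \<rho> * dist u v" using BB_D(5)[OF H] that sub by blast
    also have "\<dots> \<le> 1/2 * dist u v" using \<rho> by (intro mult_right_mono) auto
    finally show ?thesis .
  qed
  have "Topological_Spaces.complete S" unfolding S_def
    by (intro compact_imp_complete closed_Int_compact closed_cball compact_julia)
  moreover have "H ` S \<subseteq> S"
  proof
    fix t assume "t \<in> H ` S"
    then obtain u where u: "u \<in> S" "t = H u" by blast
    have "dist (H x) (H u) \<le> 1/2 * dist x u" by (rule contr[OF xS(1) u(1)])
    also have "\<dots> \<le> \<delta> / 4" using u(1) by (simp add: S_def)
    finally have "dist x (H u) \<le> \<delta> / 2" using near dist_triangle[of x "H u" "H x"] by linarith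
    moreover have "H u \<in> JJ" using BB_julia[OF H w, of u] u(1) sub by (auto simp: S_def)
    ultimately show "t \<in> S" using u(2) by (simp add: S_def)
  qed
  ultimately have "\<exists>!q\<in>S. H q = q"
    using contr xS(1) by (intro Banach_fix[of S "1/2"]) auto
  then obtain q where q: "q \<in> S" "H q = q" by blast
  have qb: "q \<in> ball x \<delta>" "q \<in> JJ" using q(1) sub by (auto simp: S_def)
  have "fw f w q = q" using BB_D(3)[OF H qb(1)] q(2) by simp
  moreover have "R w q \<le> \<kappa>^2 * \<rho>" using R_compare(1)[OF w H x qb(2,1)] q(2) by simp
  ultimately show ?thesis using that qb(2) by blast
qed

text \<open>A backward orbit under \<open>f i\<close> stays in the compact Julia set and comes back
  close to itself after many steps; the branch of this long word contracts, and
  \<open>closing\<close> applies.\<close>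

lemma generator_periodic_point:
  assumes i: "i \<in> II"
  obtains m q where "m \<ge> 1" "q \<in> JJ" "fw f (replicate m i) q = q"
proof -
  obtain y0 where y0: "y0 \<in> JJ" using julia_nonempty by blast
  have pre: "\<exists>y'. y' \<in> JJ \<and> f i y' = y" if "y \<in> JJ" for y
    using word_surj[of "[i]" y] julia_back[of "[i]"] i that by auto
  have "\<exists>y. y 0 = y0 \<and> (\<forall>n. y n \<in> JJ \<and> f i (y (Suc n)) = y n)"
  proof -
    obtain g where g: "\<And>y. y \<in> JJ \<Longrightarrow> g y \<in> JJ \<and> f i (g y) = y" using pre by metis
    define y where "y = rec_nat y0 (\<lambda>_. g)"
    have "y n \<in> JJ" for n by (induction n) (use g y0 in \<open>auto simp: y_def\<close>)
    then show ?thesis using g by (intro exI[of _ y]) (auto simp: y_def)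
  qed
  then obtain y where y: "\<And>n. y n \<in> JJ" "\<And>n. f i (y (Suc n)) = y n" by blast
  have it: "fw f (replicate k i) (y (n + k)) = y n" for n k
    by (induction k) (simp_all add: y(2))
  have "1 / (2 * \<kappa>) > 0" using \<kappa>_pos by simp
  then obtain N where N: "N \<ge> 1" "\<And>w z. w \<in> Wd \<Longrightarrow> length w \<ge> N \<Longrightarrow> fw f w z \<in> JJ \<Longrightarrow> R w z < 1 / (2 * \<kappa>)"
    by (rule R_small) (rule that)
  obtain l a where a: "strict_mono a" "(y \<circ> a) \<longlonglongrightarrow> l" using compact_julia y(1) unfolding compact_def by metis
  have "Cauchy (y \<circ> a)" using a(2) by (rule LIMSEQ_imp_Cauchy)
  moreover have "\<delta> / 4 > 0" using \<delta> by simp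
  ultimately obtain M where M: "\<And>m n. m \<ge> M \<Longrightarrow> n \<ge> M \<Longrightarrow> dist ((y \<circ> a) m) ((y \<circ> a) n) < \<delta> / 4" unfolding Cauchy_def by meson
  have gap: "a M + k \<le> a (M + k)" for k
  proof (induction k)
    case (Suc k)
    have "a (M + k) < a (Suc (M + k))" using a(1) by (simp add: strict_mono_def)
    then show ?case using Suc by simp
  qed simp
  define k where "k = a (M + N) - a M"
  have k: "k \<ge> N" "a (M + N) = a M + k" using gap[of N] by (auto simp: k_def)
  define w where "w = replicate k i"
  have w: "w \<in> Wd" "length w = k" using i by (auto simp: w_def)
  have fwz: "fw f w (y (a (M + N))) = y (a M)" unfolding w_def k(2) by (rule it)
  then have fJ: "fw f w (y (a (M + N))) \<in> JJ" using y(1) by simp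
  obtain H where H: "BB w (y (a M)) H (R w (y (a (M + N))))" "H (y (a M)) = y (a (M + N))"
    using R_branch[OF w(1) fJ] fwz by metis
  have "R w (y (a (M + N))) < 1 / (2 * \<kappa>)" by (rule N(2)[OF w(1) _ fJ]) (use k w in simp)
  then have "\<kappa> * R w (y (a (M + N))) \<le> 1/2" using \<kappa>_pos by (simp add: field_simps)
  moreover have "dist (y (a M)) (H (y (a M))) \<le> \<delta> / 4" using M[of M "M + N"] H(2) by simp
  ultimately obtain q where q: "q \<in> JJ" "fw f w q = q"
    by (rule closing[OF w(1) y(1) H(1)]) (rule that)
  show ?thesis using that[of k q] q k(1) N(1) by (simp add: w_def)
qed

end

section \<open>The functional equation along inverse branches\<close>

context attractor_system
begin

text \<open>In \<open>Tc_eq\<close> only the letter that keeps \<open>b\<close> in the Julia set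
  survives in the difference: the others lead to asymptotic points, where \<open>Tc\<close> agrees.
  Iteration along \<open>w\<close> multiplies the weights.\<close>

lemma Tc_difference:
  assumes \<eta>: "\<And>i j y z. i \<in> II \<Longrightarrow> j \<in> II \<Longrightarrow> i \<noteq> j \<Longrightarrow> f i z \<in> JJ \<Longrightarrow> dist y z < \<eta> \<Longrightarrow> asym (f j y) (f j z)"
    and X: "X \<in> Pd rad"
  shows "w \<in> Wd \<Longrightarrow> fw f w b \<in> JJ \<Longrightarrow> (\<And>t v. w = t @ v \<Longrightarrow> dist (fw f t a) (fw f t b) < \<eta>) \<Longrightarrow>
    Tc X a - Tc X b = wtw X w * (Tc X (fw f w a) - Tc X (fw f w b))"
proof (induction w arbitrary: a b)
  case (Cons i w)
  then have i: "i \<in> II" "w \<in> Wd" by auto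
  have fb: "f i b \<in> JJ" using julia_back[of w "f i b"] Cons.prems(2) i(2) by simp
  have ab: "dist a b < \<eta>" using Cons.prems(3)[of "[]"] by simp
  have IH: "Tc X (f i a) - Tc X (f i b) = wtw X w * (Tc X (fw f w (f i a)) - Tc X (fw f w (f i b)))"
  proof (rule Cons.IH[OF i(2)])
    fix t v assume "w = t @ v"
    then show "dist (fw f t (f i a)) (fw f t (f i b)) < \<eta>" using Cons.prems(3)[of "i # t" v] by simp
  qed (use Cons.prems in simp)
  have "Tc X a - Tc X b = (\<Sum>j\<in>II. wt X j * (Tc X (f j a) - Tc X (f j b)))"
    unfolding Tc_eq[OF X, of a] Tc_eq[OF X, of b] by (simp add: sum_subtractf right_diff_distrib)
  also have "\<dots> = wt X i * (Tc X (f i a) - Tc X (f i b)) + (\<Sum>j\<in>II - {i}. wt X j * (Tc X (f j a) - Tc X (f j b)))"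
    using i(1) by (intro sum.remove) auto
  also have "(\<Sum>j\<in>II - {i}. wt X j * (Tc X (f j a) - Tc X (f j b))) = 0"
  proof (rule sum.neutral, rule ballI)
    fix j assume "j \<in> II - {i}"
    then have "asym (f j a) (f j b)" using \<eta>[OF i(1) _ _ fb ab] by auto
    then show "wt X j * (Tc X (f j a) - Tc X (f j b)) = 0" using Tc_asym by simp
  qed
  finally show ?case using IH by (simp add: mult.assoc)
qed simp

text \<open>One radius for all words and all parameters. It exists because the prefix clause of
  \<open>Br\<close> keeps the two orbits close along the whole word.\<close>

definition brad :: real where
  "brad = (SOME r. 0 < r \<and> r \<le> \<delta> \<and> r \<le> 1 \<and> (\<forall>X w x H \<rho> u. X \<in> Pd rad \<longrightarrow> w \<in> Wd \<longrightarrow> x \<in> JJ \<longrightarrow> BB w x H \<rho> \<longrightarrow> u \<in> ball x r \<longrightarrow>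
     Tc X (H u) - Tc X (H x) = wtw X w * (Tc X u - Tc X x)))"

lemma brad: "0 < brad" "brad \<le> \<delta>" "brad \<le> 1"
  "X \<in> Pd rad \<Longrightarrow> w \<in> Wd \<Longrightarrow> x \<in> JJ \<Longrightarrow> BB w x H \<rho> \<Longrightarrow> u \<in> ball x brad \<Longrightarrow> Tc X (H u) - Tc X (H x) = wtw X w * (Tc X u - Tc X x)"
proof -
  obtain \<eta> where \<eta>: "\<eta> > 0" "\<And>i j y z. i \<in> II \<Longrightarrow> j \<in> II \<Longrightarrow> i \<noteq> j \<Longrightarrow> f i z \<in> JJ \<Longrightarrow> dist y z < \<eta> \<Longrightarrow> asym (f j y) (f j z)"
    by (rule asym_julia_offbranch) (rule that)
  define r where "r = min (min \<delta> 1) (\<eta> / \<kappa>)"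
  have r: "0 < r" "r \<le> \<delta>" "r \<le> 1" "r \<le> \<eta> / \<kappa>" using \<eta>(1) \<delta> \<kappa>_pos by (auto simp: r_def)
  have "Tc X (H u) - Tc X (H x) = wtw X w * (Tc X u - Tc X x)"
    if X: "X \<in> Pd rad" and w: "w \<in> Wd" and x: "x \<in> JJ" and H: "BB w x H \<rho>" and u: "u \<in> ball x r" for X w x H \<rho> u
  proof -
    have b: "u \<in> ball x \<delta>" "x \<in> ball x \<delta>" using u r \<delta> by auto
    have e: "fw f w (H u) = u" "fw f w (H x) = x" using BB_D(3)[OF H] b by auto
    have "Tc X (H u) - Tc X (H x) = wtw X w * (Tc X (fw f w (H u)) - Tc X (fw f w (H x)))"
    proof (rule Tc_difference[OF \<eta>(2) X w])
      fix t v assume "w = t @ v"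
      then have "dist (fw f t (H u)) (fw f t (H x)) \<le> \<kappa> * dist u x" by (rule BB_D(6)[OF H _ b])
      also have "\<dots> < \<kappa> * (\<eta> / \<kappa>)" using u r(4) \<kappa>_pos by (intro mult_strict_left_mono) (auto simp: dist_commute)
      finally show "dist (fw f t (H u)) (fw f t (H x)) < \<eta>" using \<kappa>_pos by simp
    qed (use e x in auto)
    then show ?thesis unfolding e .
  qed
  then have "\<exists>r. 0 < r \<and> r \<le> \<delta> \<and> r \<le> 1 \<and> (\<forall>X w x H \<rho> u. X \<in> Pd rad \<longrightarrow> w \<in> Wd \<longrightarrow> x \<in> JJ \<longrightarrow> BB w x H \<rho> \<longrightarrow> u \<in> ball x r \<longrightarrow>
     Tc X (H u) - Tc X (H x) = wtw X w * (Tc X u - Tc X x))" using r(1-3) by blast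
  note * = someI_ex[OF this, folded brad_def]
  show "0 < brad" "brad \<le> \<delta>" "brad \<le> 1"
    "X \<in> Pd rad \<Longrightarrow> w \<in> Wd \<Longrightarrow> x \<in> JJ \<Longrightarrow> BB w x H \<rho> \<Longrightarrow> u \<in> ball x brad \<Longrightarrow> Tc X (H u) - Tc X (H x) = wtw X w * (Tc X u - Tc X x)"
    using * by blast+
qed

lemma cm_cong:
  assumes "\<And>x. x \<in> Pd rad \<Longrightarrow> g x = h x"
  shows "j \<le> s \<Longrightarrow> x \<in> Pd rad \<Longrightarrow> cm n j g x = cm n j h x"
proof (induction j arbitrary: x)
  case (Suc j)
  show ?case unfolding cm.simps by (rule pd_iter_cong) (use Suc in auto)
qed (use assms in simp)

lemma DD_cong: "(\<And>x. x \<in> Pd rad \<Longrightarrow> g x = h x) \<Longrightarrow> DD \<beta> g = DD \<beta> h"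
  unfolding DD_def using cm_cong[of g h s pc] pc_Pd[OF rad(1)] by simp

lemma Cf_branch_DD:
  assumes "w \<in> Wd" "x \<in> JJ" "BB w x H \<rho>" "u \<in> ball x brad"
  shows "Cf \<beta> (H u) - Cf \<beta> (H x) = DD \<beta> (\<lambda>X. wtw X w * (1 * Tc X u + (-1) * Tc X x))"
  unfolding Cf_diff by (rule DD_cong) (use brad(4)[OF _ assms] in simp)

lemma UU_diff_Tc: "UU (\<lambda>X. 1 * Tc X u + (-1) * Tc X x)"
  by (intro UU_add UU_cmult Tc_UU)

text \<open>The functional equation differentiated in the parameters, with the weight of
  \<open>w\<close> moved onto the coefficients.\<close>

lemma Cf_branch:
  assumes "w \<in> Wd" "x \<in> JJ" "BB w x H \<rho>" "u \<in> ball x brad" "\<beta> \<in> CF d"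
  shows "Cf \<beta> (H u) - Cf \<beta> (H x) = Cf (actw w \<beta>) u - Cf (actw w \<beta>) x"
  using Cf_branch_DD[OF assms(1-4), of \<beta>] DD_actw[OF assms(5,1) UU_diff_Tc, of u x] Cf_diff[of "actw w \<beta>" u x] by simp

end

section \<open>The pressure exponent\<close>

lemma power_powr_swap: "0 < x \<Longrightarrow> (x ^ n) powr \<alpha> = (x powr \<alpha>) ^ n" for x :: real
  by (induction n) (auto simp: powr_mult)

lemma half_power_powr: "((1/2) ^ n) powr \<alpha> = (2 powr (- \<alpha>)) ^ n" for \<alpha> :: real
  by (simp add: power_powr_swap powr_divide powr_minus_divide)

context attractor_system
begin

definition wrep :: "nat \<Rightarrow> nat list \<Rightarrow> nat list" where
  "wrep n u = concat (replicate n u)"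

lemma wrep_simps [simp]: "wrep 0 u = []" "wrep (Suc n) u = u @ wrep n u"
  by (auto simp: wrep_def)

lemma wrep_Wd: "u \<in> Wd \<Longrightarrow> wrep n u \<in> Wd"
  by (induction n) auto

lemma wrep_fixed: "fw f u q = q \<Longrightarrow> fw f (wrep n u) q = q"
  by (induction n) auto

lemma wtw_wrep: "wtw x (wrep n u) = wtw x u ^ n"
  by (induction n) auto

lemma R_wrep:
  assumes "u \<in> Wd" "q \<in> JJ" "fw f u q = q"
  shows "R (wrep n u) q \<le> \<kappa> * (\<kappa>^3 * R u q) ^ n"
proof (induction n)
  case 0
  then show ?case using R_pos(2)[of "[]" q] assms(2) by simp
next
  case (Suc n)
  have fq: "fw f (u @ wrep n u) q \<in> JJ" using assms wrep_fixed[OF assms(3), of n] by simp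
  have p: "0 < R u q" using R_pos(1)[of u q] assms by simp
  have "R (wrep (Suc n) u) q \<le> \<kappa>^3 * (R u q * R (wrep n u) q)"
    using R_mult(1)[OF assms(1) wrep_Wd[OF assms(1)] fq] assms(3) by simp
  also have "\<dots> \<le> \<kappa>^3 * (R u q * (\<kappa> * (\<kappa>^3 * R u q) ^ n))"
    using Suc p \<kappa>_pos by (intro mult_left_mono) auto
  finally show ?case by (simp add: mult_ac)
qed

definition Bdd :: "real \<Rightarrow> bool" where
  "Bdd \<alpha> \<longleftrightarrow> (\<exists>K. \<forall>w z. w \<in> Wd \<longrightarrow> fw f w z \<in> JJ \<longrightarrow> wtw p w \<le> K * R w z powr \<alpha>)"

text \<open>A periodic word that refutes \<alpha>: along its powers the weight exceeds the
  \<alpha>-th power of the ratio exponentially, so every constant in \<open>Bdd\<close> is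
  beaten.\<close>

definition growth :: "real \<Rightarrow> nat list \<Rightarrow> sph \<Rightarrow> bool" where
  "growth \<alpha> u q \<longleftrightarrow> u \<in> Wd \<and> q \<in> JJ \<and> fw f u q = q \<and>
     (\<forall>n\<ge>1. 2 ^ n * R (wrep n u) q powr \<alpha> \<le> wtw p (wrep n u))"

text \<open>Words of bounded length lead from \<open>fw f w z\<close> back to \<open>z\<close>, so a violation of the estimate by a large
  factor can be closed up to a periodic word.\<close>

lemma growth_exists:
  assumes "0 \<le> A"
  obtains K0 where "K0 > 0" "\<And>\<alpha> w z. 0 \<le> \<alpha> \<Longrightarrow> \<alpha> \<le> A \<Longrightarrow> w \<in> Wd \<Longrightarrow> fw f w z \<in> JJ \<Longrightarrow> K0 * R w z powr \<alpha> < wtw p w \<Longrightarrow> \<exists>u q. growth \<alpha> u q"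
proof -
  obtain V where V: "\<And>x e. x \<in> JJ \<Longrightarrow> e \<in> JJ \<Longrightarrow> \<exists>v y. v \<in> Wd \<and> length v \<le> V \<and> y \<in> ball x \<delta> \<and> fw f v y = e"
    by (rule julia_transitive_uniform[OF \<delta>]) (rule that)
  \<comment> \<open>Makes \<open>\<kappa>^7 * \<rho> \<le> 1/4\<close>, which yields both hypotheses
    of \<open>closing\<close> for the word \<open>w @ v\<close>.\<close>
  define \<epsilon> where "\<epsilon> = 1 / (4 * \<kappa>^7)"
  have k7: "1 \<le> \<kappa>^7" "0 < \<kappa>" using \<kappa> \<kappa>_pos by (auto intro: one_le_power)
  have \<epsilon>: "0 < \<epsilon>" "\<epsilon> \<le> 1" using k7 by (auto simp: \<epsilon>_def divide_simps)
  \<comment> \<open>The first value forces \<rho> < \<epsilon>, since weights are at most 1. The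
    second pays for the returning word \<open>v\<close>, for the factor 2 and for 12 powers of
    \<kappa>: six from passing to \<open>w @ v\<close>, two from \<open>closing\<close>, three from
    concatenating periods and one from the start of \<open>R_wrep\<close>. With A in place of
    \<alpha> the constant is uniform.\<close>
  define K0 where "K0 = max (\<epsilon> powr (- A)) (2 * \<kappa> powr (12 * A) / pmin ^ V)"
  have pV: "0 < pmin ^ V" using pmin(1) by simp
  have K0: "\<epsilon> powr (- A) \<le> K0" "2 * \<kappa> powr (12 * A) / pmin ^ V \<le> K0" by (auto simp: K0_def)
  have K0p: "K0 > 0" using \<epsilon> by (intro less_le_trans[OF _ K0(1)]) simp
  have "\<exists>u q. growth \<alpha> u q" if \<alpha>: "0 \<le> \<alpha>" "\<alpha> \<le> A" and w: "w \<in> Wd" and fz: "fw f w z \<in> JJ" and big: "K0 * R w z powr \<alpha> < wtw p w" for \<alpha> w z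
  proof -
    define \<rho> where "\<rho> = R w z"
    have \<rho>: "0 < \<rho>" using R_pos(1)[OF w fz] by (simp add: \<rho>_def)
    have small: "\<rho> < \<epsilon>"
    proof (rule ccontr)
      assume "\<not> \<rho> < \<epsilon>"
      then have "\<epsilon> powr \<alpha> \<le> \<rho> powr \<alpha>" using \<epsilon> \<alpha> by (intro powr_mono2) auto
      moreover have "\<epsilon> powr A \<le> \<epsilon> powr \<alpha>" using \<epsilon> \<alpha> by (intro powr_mono') auto
      ultimately have "\<epsilon> powr (- A) * \<epsilon> powr A \<le> K0 * \<rho> powr \<alpha>" using K0(1) \<epsilon> K0p by (intro mult_mono) auto
      moreover have "\<epsilon> powr (- A) * \<epsilon> powr A = 1" using \<epsilon> by (simp add: powr_minus)
      ultimately show False using big wtw_p_le_1[OF w] by (simp add: \<rho>_def)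
    qed
    have zJ: "z \<in> JJ" using julia_back[OF fz w] .
    define x where "x = fw f w z"
    have x: "x \<in> JJ" "x \<in> ball x \<delta>" using fz \<delta> by (auto simp: x_def)
    obtain H where H: "BB w x H \<rho>" "H x = z" unfolding x_def \<rho>_def by (rule R_branch[OF w fz])
    obtain v y where v: "v \<in> Wd" "length v \<le> V" "y \<in> ball x \<delta>" "fw f v y = z" using V[OF x(1) zJ] by blast
    have yJ: "y \<in> JJ" using julia_back[of v y] v zJ by simp
    define z' where "z' = H y"
    have fz': "fw f w z' = y" unfolding z'_def by (rule BB_D(3)[OF H(1) v(3)])
    define u where "u = w @ v"
    have u: "u \<in> Wd" "fw f u z' = z" using w v fz' by (auto simp: u_def)
    have Ru: "R u z' \<le> \<kappa>^6 * \<rho>"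
    proof -
      have "R u z' \<le> \<kappa>^3 * (R w z' * R v y)" using R_mult(1)[OF w v(1), of z'] u(2) zJ fz' by (simp add: u_def)
      also have "\<dots> \<le> \<kappa>^3 * ((\<kappa>^2 * \<rho>) * \<kappa>)"
      proof (intro mult_left_mono mult_mono)
        show "R w z' \<le> \<kappa>^2 * \<rho>" unfolding z'_def by (rule R_compare(1)[OF w H(1) x(1) yJ v(3)])
        show "R v y \<le> \<kappa>" "0 \<le> R v y" using R_pos[OF v(1), of y] v(4) zJ by auto
      qed (use \<kappa>_pos \<rho> in auto)
      also have "\<dots> = \<kappa>^6 * \<rho>" by (simp add: power_numeral_reduce mult_ac)
      finally show ?thesis .
    qed
    have uJ: "fw f u z' \<in> JJ" using u(2) zJ by simp
    obtain H' where H': "BB u z H' (R u z')" "H' z = z'" using R_branch[OF u(1) uJ] u(2) by metis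
    have e7: "\<kappa>^7 * \<rho> \<le> 1/4" using small \<kappa>_pos by (simp add: \<epsilon>_def field_simps)
    have "\<kappa> * R u z' \<le> \<kappa> * (\<kappa>^6 * \<rho>)" using Ru \<kappa>_pos by (intro mult_left_mono) auto
    also have "\<dots> = \<kappa>^7 * \<rho>" by (simp add: power_numeral_reduce mult_ac)
    finally have c1: "\<kappa> * R u z' \<le> 1/2" using e7 by simp
    have "dist z z' \<le> \<kappa> * \<rho> * dist x y" using BB_D(5)[OF H(1) x(2) v(3)] H(2) by (simp add: z'_def)
    also have "\<dots> \<le> (1/4) * \<delta>"
    proof (rule mult_mono)
      have "\<kappa>^1 * \<rho> \<le> \<kappa>^7 * \<rho>" using \<kappa> \<rho> by (intro mult_right_mono power_increasing) auto
      then show "\<kappa> * \<rho> \<le> 1/4" using e7 by simp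
    qed (use v in auto)
    finally have c2: "dist z (H' z) \<le> \<delta> / 4" using H'(2) by simp
    obtain q where q: "q \<in> JJ" "fw f u q = q" "R u q \<le> \<kappa>^2 * R u z'"
      by (rule closing[OF u(1) zJ H'(1) c1 c2]) (rule that)
    have Rq0: "0 < R u q" using R_pos(1)[OF u(1), of q] q by simp
    have Rq: "\<kappa>^3 * R u q \<le> \<kappa>^11 * \<rho>"
    proof -
      have "\<kappa>^3 * R u q \<le> \<kappa>^3 * (\<kappa>^2 * (\<kappa>^6 * \<rho>))"
        using q(3) Ru \<kappa>_pos by (intro mult_left_mono order_trans[OF q(3)]) auto
      then show ?thesis by (simp add: power_numeral_reduce mult_ac)
    qed
    have pu: "2 * \<kappa> powr (12 * A) * \<rho> powr \<alpha> \<le> wtw p u"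
    proof -
      have "pmin ^ V \<le> pmin ^ length v" using v(2) pmin(1) pmin_le_1 by (intro power_decreasing) auto
      then have pv: "pmin ^ V \<le> wtw p v" using wtw_p_ge[OF v(1)] by linarith
      have "2 * \<kappa> powr (12 * A) \<le> K0 * pmin ^ V" using K0(2) pV by (simp add: field_simps)
      then have "2 * \<kappa> powr (12 * A) * \<rho> powr \<alpha> \<le> (K0 * \<rho> powr \<alpha>) * pmin ^ V"
        using mult_right_mono[of "2 * \<kappa> powr (12 * A)" "K0 * pmin ^ V" "\<rho> powr \<alpha>"] by (simp add: mult_ac)
      also have "\<dots> \<le> wtw p w * wtw p v"
        using big pv pV wtw_p_pos[OF w] by (intro mult_mono) (auto simp: \<rho>_def)
      finally show ?thesis by (simp add: u_def)
    qed
    have "2 ^ n * R (wrep n u) q powr \<alpha> \<le> wtw p (wrep n u)" if n: "n \<ge> 1" for n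
    proof -
      have Rn0: "0 < R (wrep n u) q" using R_pos(1)[OF wrep_Wd[OF u(1)], of n q] wrep_fixed[OF q(2)] q(1) by simp
      have "R (wrep n u) q \<le> \<kappa> * (\<kappa>^3 * R u q) ^ n" by (rule R_wrep[OF u(1) q(1,2)])
      also have "\<dots> \<le> \<kappa>^n * (\<kappa>^11 * \<rho>) ^ n"
      proof (rule mult_mono)
        show "(\<kappa>^3 * R u q) ^ n \<le> (\<kappa>^11 * \<rho>) ^ n" by (rule power_mono[OF Rq]) (use \<kappa>_pos Rq0 in simp)
        have "\<kappa>^1 \<le> \<kappa>^n" using n \<kappa> by (intro power_increasing) auto
        then show "\<kappa> \<le> \<kappa>^n" by simp
      qed (use \<kappa>_pos Rq0 in auto)
      also have "\<dots> = (\<kappa>^12 * \<rho>) ^ n" by (simp add: power_mult_distrib[symmetric] power_numeral_reduce mult_ac)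
      finally have "R (wrep n u) q powr \<alpha> \<le> ((\<kappa>^12 * \<rho>) ^ n) powr \<alpha>" using Rn0 \<alpha> by (intro powr_mono2) auto
      also have "\<dots> = ((\<kappa>^12 * \<rho>) powr \<alpha>) ^ n" using \<kappa>_pos \<rho> by (intro power_powr_swap) simp
      also have "(\<kappa>^12 * \<rho>) powr \<alpha> = \<kappa> powr (12 * \<alpha>) * \<rho> powr \<alpha>"
      proof -
        have "\<kappa>^12 = \<kappa> powr 12" using \<kappa>_pos by simp
        then have "(\<kappa>^12) powr \<alpha> = \<kappa> powr (12 * \<alpha>)" by (simp only: powr_powr)
        then show ?thesis using \<kappa>_pos \<rho> by (simp add: powr_mult)
      qed
      finally have 1: "R (wrep n u) q powr \<alpha> \<le> (\<kappa> powr (12 * \<alpha>) * \<rho> powr \<alpha>) ^ n" .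
      have "\<kappa> powr (12 * \<alpha>) \<le> \<kappa> powr (12 * A)" using \<kappa> \<alpha> by (intro powr_mono) auto
      then have "(\<kappa> powr (12 * \<alpha>) * \<rho> powr \<alpha>) ^ n \<le> (\<kappa> powr (12 * A) * \<rho> powr \<alpha>) ^ n"
        by (intro power_mono mult_right_mono) auto
      then have "2 ^ n * R (wrep n u) q powr \<alpha> \<le> 2 ^ n * (\<kappa> powr (12 * A) * \<rho> powr \<alpha>) ^ n"
        using 1 by (intro mult_left_mono) auto
      also have "\<dots> = (2 * \<kappa> powr (12 * A) * \<rho> powr \<alpha>) ^ n" by (simp add: power_mult_distrib mult_ac)
      also have "\<dots> \<le> wtw p u ^ n" using pu by (intro power_mono) auto
      finally show ?thesis by (simp add: wtw_wrep)
    qed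
    then show ?thesis using u(1) q(1,2) unfolding growth_def by blast
  qed
  then show ?thesis using that K0p by blast
qed

lemma growth_not_Bdd: assumes "growth \<alpha> u q" shows "\<not> Bdd \<alpha>"
proof
  assume "Bdd \<alpha>"
  then obtain K where K: "\<And>w z. w \<in> Wd \<Longrightarrow> fw f w z \<in> JJ \<Longrightarrow> wtw p w \<le> K * R w z powr \<alpha>" unfolding Bdd_def by blast
  have g: "u \<in> Wd" "q \<in> JJ" "fw f u q = q" using assms by (auto simp: growth_def)
  obtain n where n: "K < 2 ^ n" using real_arch_pow[of 2 K] by auto
  have "2 ^ Suc n * R (wrep (Suc n) u) q powr \<alpha> \<le> wtw p (wrep (Suc n) u)" using assms unfolding growth_def by (metis le_add1 plus_1_eq_Suc)
  also have "\<dots> \<le> K * R (wrep (Suc n) u) q powr \<alpha>"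
    by (rule K[OF wrep_Wd[OF g(1)]]) (use wrep_fixed[OF g(3), of "Suc n"] g(2) in simp)
  finally have "2 ^ Suc n \<le> K"
    using R_pos(1)[OF wrep_Wd[OF g(1)], of "Suc n" q] wrep_fixed[OF g(3), of "Suc n"] g(2) by simp
  moreover have "(2::real) ^ n \<le> 2 ^ Suc n" by simp
  ultimately show False using n by linarith
qed

text \<open>Weights lose at most a factor \<open>pmin\<close> per letter, while ratios shrink at
  least by 1/2 per \<open>N\<close> letters; so a sufficiently large power of the ratio decays
  faster than the weight.\<close>

lemma Bdd_upper: obtains A where "A \<ge> 0" "\<And>\<alpha>. \<alpha> \<ge> A \<Longrightarrow> \<not> Bdd \<alpha>"
proof -
  obtain N where N: "N \<ge> 1" "\<And>w z. w \<in> Wd \<Longrightarrow> fw f w z \<in> JJ \<Longrightarrow> R w z \<le> \<kappa> * (1/2) ^ (length w div N)"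
    by (rule R_decay) (rule that)
  define b where "b = pmin ^ N / 2"
  have b: "0 < b" "b \<le> 1" using pmin(1) pmin_le_1 power_le_one[of pmin N] by (auto simp: b_def)
  define A where "A = - log 2 b"
  have A: "A \<ge> 0" "2 powr (- A) = b" using b by (auto simp: A_def)
  have "\<not> Bdd \<alpha>" if \<alpha>: "\<alpha> \<ge> A" for \<alpha>
  proof
    assume "Bdd \<alpha>"
    then obtain K where K: "\<And>w z. w \<in> Wd \<Longrightarrow> fw f w z \<in> JJ \<Longrightarrow> wtw p w \<le> K * R w z powr \<alpha>" unfolding Bdd_def by blast
    obtain y0 where y0: "y0 \<in> JJ" using julia_nonempty by blast
    have \<alpha>0: "\<alpha> \<ge> 0" using \<alpha> A by simp
    have le: "2 ^ n \<le> \<bar>K\<bar> * \<kappa> powr \<alpha>" for n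
    proof -
      define w where "w = replicate (n * N) (1::nat)"
      have w: "w \<in> Wd" "length w = n * N" by (auto simp: w_def)
      obtain z where z: "fw f w z = y0" using word_surj[OF w(1)] by blast
      have zJ: "fw f w z \<in> JJ" using z y0 by simp
      have "R w z \<le> \<kappa> * (1/2) ^ n" using N(2)[OF w(1) zJ] N(1) w(2) by simp
      then have "R w z powr \<alpha> \<le> (\<kappa> * (1/2) ^ n) powr \<alpha>" using R_pos(1)[OF w(1) zJ] \<alpha>0 by (intro powr_mono2) auto
      also have "\<dots> = \<kappa> powr \<alpha> * (2 powr (- \<alpha>)) ^ n"
        using \<kappa>_pos by (simp only: powr_mult half_power_powr)
      also have "\<dots> \<le> \<kappa> powr \<alpha> * b ^ n"
        using \<alpha> unfolding A(2)[symmetric] by (intro mult_left_mono power_mono powr_mono) auto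
      finally have 1: "R w z powr \<alpha> \<le> \<kappa> powr \<alpha> * b ^ n" .
      have "(2 * b) ^ n = pmin ^ length w" by (simp add: b_def w(2) power_mult[symmetric] mult.commute)
      also have "\<dots> \<le> wtw p w" by (rule wtw_p_ge[OF w(1)])
      also have "\<dots> \<le> K * R w z powr \<alpha>" by (rule K[OF w(1) zJ])
      also have "\<dots> \<le> \<bar>K\<bar> * (\<kappa> powr \<alpha> * b ^ n)" using 1 by (intro mult_mono) auto
      finally have "2 ^ n * b ^ n \<le> (\<bar>K\<bar> * \<kappa> powr \<alpha>) * b ^ n" by (simp add: power_mult_distrib mult_ac)
      then show ?thesis using b(1) by simp
    qed
    obtain n where "\<bar>K\<bar> * \<kappa> powr \<alpha> < 2 ^ n" using real_arch_pow[of 2 "\<bar>K\<bar> * \<kappa> powr \<alpha>"] by auto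
    then show False using le[of n] by linarith
  qed
  then show ?thesis using that A(1) by blast
qed

text \<open>For a single word the estimate is a closed condition on \<alpha>, and by
  \<open>growth_exists\<close> one constant serves all \<alpha> in \<open>S\<close>; hence it passes
  to the supremum. For larger \<alpha> the constant belonging to the interval up to \<alpha> is
  violated, which produces growth.\<close>

lemma critical_exponent:
  obtains a K where "a \<ge> 0" "K > 0" "\<And>w z. w \<in> Wd \<Longrightarrow> fw f w z \<in> JJ \<Longrightarrow> wtw p w \<le> K * R w z powr a"
    "\<And>\<alpha>. \<alpha> > a \<Longrightarrow> \<exists>u q. growth \<alpha> u q"
proof -
  obtain A where A: "A \<ge> 0" "\<And>\<alpha>. \<alpha> \<ge> A \<Longrightarrow> \<not> Bdd \<alpha>" by (rule Bdd_upper) (rule that)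
  define S where "S = {\<alpha>. 0 \<le> \<alpha> \<and> Bdd \<alpha>}"
  have R0: "R w z powr 0 = 1" if "w \<in> Wd" "fw f w z \<in> JJ" for w z using R_pos(1)[OF that] by simp
  have "Bdd 0" unfolding Bdd_def using wtw_p_le_1 R0 by (intro exI[of _ 1]) auto
  then have S0: "0 \<in> S" by (simp add: S_def)
  have SA: "\<alpha> \<le> A" if "\<alpha> \<in> S" for \<alpha> using A(2)[of \<alpha>] that unfolding S_def by fastforce
  have bdd: "bdd_above S" using SA by (meson bdd_aboveI)
  obtain K0 where K0: "K0 > 0" "\<And>\<alpha> w z. 0 \<le> \<alpha> \<Longrightarrow> \<alpha> \<le> A \<Longrightarrow> w \<in> Wd \<Longrightarrow> fw f w z \<in> JJ \<Longrightarrow> K0 * R w z powr \<alpha> < wtw p w \<Longrightarrow> \<exists>u q. growth \<alpha> u q"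
    by (rule growth_exists[OF A(1)]) (rule that)
  define a where "a = Sup S"
  have a0: "a \<ge> 0" unfolding a_def using S0 bdd by (rule cSup_upper)
  have K: "wtw p w \<le> K0 * R w z powr a" if w: "w \<in> Wd" "fw f w z \<in> JJ" for w z
  proof -
    have "closed {\<alpha>. wtw p w \<le> K0 * R w z powr \<alpha>}"
      using R_pos(1)[OF w] by (intro closed_Collect_le continuous_intros) auto
    moreover have "S \<subseteq> {\<alpha>. wtw p w \<le> K0 * R w z powr \<alpha>}"
    proof
      fix \<alpha> assume \<alpha>: "\<alpha> \<in> S"
      then have "\<not> (\<exists>u q. growth \<alpha> u q)" using growth_not_Bdd by (auto simp: S_def)
      then have "\<not> K0 * R w z powr \<alpha> < wtw p w" using K0(2)[OF _ SA[OF \<alpha>] w] \<alpha> by (auto simp: S_def)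
      then show "\<alpha> \<in> {\<alpha>. wtw p w \<le> K0 * R w z powr \<alpha>}" by simp
    qed
    ultimately have "closure S \<subseteq> {\<alpha>. wtw p w \<le> K0 * R w z powr \<alpha>}" by (rule closure_minimal[rotated])
    moreover have "a \<in> closure S" unfolding a_def using S0 bdd by (intro closure_contains_Sup) auto
    ultimately show ?thesis by blast
  qed
  have gr: "\<exists>u q. growth \<alpha> u q" if \<alpha>: "\<alpha> > a" for \<alpha>
  proof -
    have "\<alpha> \<notin> S" using cSup_upper[OF _ bdd, of \<alpha>] \<alpha> by (auto simp: a_def)
    then have nb: "\<not> Bdd \<alpha>" using \<alpha> a0 by (simp add: S_def)
    have \<alpha>0: "0 \<le> \<alpha>" using \<alpha> a0 by simp
    obtain K1 where K1: "\<And>w z. w \<in> Wd \<Longrightarrow> fw f w z \<in> JJ \<Longrightarrow> K1 * R w z powr \<alpha> < wtw p w \<Longrightarrow> \<exists>u q. growth \<alpha> u q"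
      by (rule growth_exists[OF \<alpha>0]) (use \<alpha>0 in blast)
    have "\<exists>w z. w \<in> Wd \<and> fw f w z \<in> JJ \<and> K1 * R w z powr \<alpha> < wtw p w"
      using nb unfolding Bdd_def by (meson not_le)
    then show ?thesis using K1 by blast
  qed
  show ?thesis by (rule that[OF a0 K0(1) K gr])
qed

section \<open>Hoelder continuity\<close>

text \<open>The word follows the orbit of \<open>z\<close> inside the Julia set as long as its ratio
  exceeds the scale of \<open>dist y z\<close>. For the longest such word the branch still reaches
  \<open>y\<close>, and by \<open>R_single_ge\<close> the ratio is comparable with
  \<open>dist y z\<close>.\<close>

lemma julia_holder:
  assumes \<alpha>: "\<alpha> \<ge> 0"
    and br: "\<And>w z u H. w \<in> Wd \<Longrightarrow> fw f w z \<in> JJ \<Longrightarrow> BB w (fw f w z) H (R w z) \<Longrightarrow> H (fw f w z) = z \<Longrightarrow>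
      u \<in> ball (fw f w z) brad \<Longrightarrow> norm (Cf \<beta> (H u) - Cf \<beta> z) \<le> K * R w z powr \<alpha>"
  obtains M where "M \<ge> 0" "\<And>y z. z \<in> JJ \<Longrightarrow> norm (Cf \<beta> y - Cf \<beta> z) \<le> M * dist y z powr \<alpha>"
proof -
  obtain c where c: "c > 0" "\<And>i z. i \<in> II \<Longrightarrow> f i z \<in> JJ \<Longrightarrow> c \<le> R [i] z" by (rule R_single_ge) (rule that)
  obtain B where B: "B \<ge> 0" "\<And>y z. norm (Cf \<beta> y - Cf \<beta> z) \<le> 2 * B" by (rule Cf_diff_bounded) (rule that)
  \<comment> \<open>Division by \<kappa> puts the point \<open>u\<close> with \<open>y = H u\<close>
    within \<open>brad\<close> of the centre; as \<open>brad \<le> 1\<close>, it also puts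
    \<open>y\<close> inside the image of the branch.\<close>
  define r0 where "r0 = brad / \<kappa>"
  have r0: "r0 > 0" "r0 * \<kappa> = brad" using brad(1) \<kappa>_pos by (auto simp: r0_def)
  define M1 where "M1 = 2 * B / (r0 / \<kappa>) powr \<alpha>"
  define M2 where "M2 = \<bar>K\<bar> * (\<kappa>^3 / (c * r0)) powr \<alpha>"
  have M: "M1 \<ge> 0" "M2 \<ge> 0" using B by (auto simp: M1_def M2_def)
  have "norm (Cf \<beta> y - Cf \<beta> z) \<le> (M1 + M2) * dist y z powr \<alpha>" if z: "z \<in> JJ" for y z
  proof (cases "y = z")
    case False
    define D where "D = dist y z"
    have D: "D > 0" using False by (simp add: D_def)
    define P where "P w \<longleftrightarrow> w \<in> Wd \<and> fw f w z \<in> JJ \<and> D < R w z * r0" for w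
    show ?thesis
    proof (cases "P []")
      case False
      then have "R [] z * r0 \<le> D" using z by (auto simp: P_def)
      moreover have "r0 / \<kappa> \<le> R [] z * r0" using R_Nil_ge[OF z] r0 \<kappa>_pos by (simp add: field_simps)
      ultimately have "(r0 / \<kappa>) powr \<alpha> \<le> D powr \<alpha>" using r0 \<kappa>_pos \<alpha> by (intro powr_mono2) auto
      moreover have "0 < (r0 / \<kappa>) powr \<alpha>" using r0 \<kappa>_pos by simp
      ultimately have "2 * B \<le> M1 * D powr \<alpha>"
        unfolding M1_def using B(1) mult_left_mono[of "(r0 / \<kappa>) powr \<alpha>" "D powr \<alpha>" "2 * B"] by (simp add: field_simps)
      moreover have "norm (Cf \<beta> y - Cf \<beta> z) \<le> 2 * B" by (rule B(2))
      moreover have "0 \<le> M2 * D powr \<alpha>" using M by simp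
      ultimately show ?thesis by (simp add: D_def distrib_right)
    next
      case True
      have "D / r0 > 0" using D r0 by simp
      then obtain N where N: "\<And>w z. w \<in> Wd \<Longrightarrow> length w \<ge> N \<Longrightarrow> fw f w z \<in> JJ \<Longrightarrow> R w z < D / r0"
        by (rule R_small) (rule that)
      have lenN: "length w \<le> N" if "P w" for w
      proof (rule ccontr)
        assume "\<not> length w \<le> N"
        then have "R w z < D / r0" using N that by (auto simp: P_def)
        then have "R w z * r0 < D" using r0 by (simp add: field_simps)
        then show False using that by (simp add: P_def)
      qed
      have "\<exists>w. P w \<and> (\<forall>v. P v \<longrightarrow> length v \<le> length w)"
        by (rule ex_has_greatest_nat[of P "[]" length "Suc N", OF True]) (use lenN in \<open>auto simp: less_Suc_eq_le\<close>)
      then obtain w where w: "P w" "\<And>v. P v \<Longrightarrow> length v \<le> length w" by blast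
      have ww: "w \<in> Wd" "fw f w z \<in> JJ" "D < R w z * r0" using w(1) by (auto simp: P_def)
      obtain i where i: "i \<in> II" "f i (fw f w z) \<in> JJ" using julia_step[OF ww(2)] by blast
      have wi: "w @ [i] \<in> Wd" "fw f (w @ [i]) z \<in> JJ" using ww i by auto
      have "\<not> P (w @ [i])" using w(2)[of "w @ [i]"] by auto
      then have "R (w @ [i]) z * r0 \<le> D" using wi by (auto simp: P_def)
      moreover have "R w z * c \<le> \<kappa>^3 * R (w @ [i]) z"
      proof -
        have "R w z * c \<le> R w z * R [i] (fw f w z)" using c(2)[OF i] R_pos(1)[OF ww(1,2)] by (intro mult_left_mono) auto
        also have "\<dots> \<le> \<kappa>^3 * R (w @ [i]) z" by (rule R_mult(2)[OF ww(1) _ wi(2)]) (use i in simp)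
        finally show ?thesis .
      qed
      ultimately have "R w z * c * r0 \<le> \<kappa>^3 * D"
      proof -
        assume a: "R (w @ [i]) z * r0 \<le> D" "R w z * c \<le> \<kappa>^3 * R (w @ [i]) z"
        have "R w z * c * r0 \<le> \<kappa>^3 * R (w @ [i]) z * r0" using a(2) r0 by (intro mult_right_mono) auto
        also have "\<dots> = \<kappa>^3 * (R (w @ [i]) z * r0)" by simp
        also have "\<dots> \<le> \<kappa>^3 * D" using a(1) \<kappa>_pos by (intro mult_left_mono) auto
        finally show ?thesis .
      qed
      then have RD: "R w z \<le> \<kappa>^3 / (c * r0) * D" using c(1) r0 by (simp add: field_simps)
      define \<rho> where "\<rho> = R w z"
      have \<rho>: "\<rho> > 0" using R_pos(1)[OF ww(1,2)] by (simp add: \<rho>_def)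
      obtain H where H: "BB w (fw f w z) H \<rho>" "H (fw f w z) = z" unfolding \<rho>_def by (rule R_branch[OF ww(1,2)])
      have xb: "fw f w z \<in> ball (fw f w z) \<delta>" using \<delta> by simp
      have "r0 \<le> 1 / \<kappa>" using brad(3) \<kappa>_pos by (simp add: r0_def divide_right_mono)
      then have "\<rho> * r0 \<le> \<rho> * (1 / \<kappa>)" using \<rho> by (intro mult_left_mono) auto
      then have "D < \<rho> / \<kappa>" using ww(3) by (simp add: \<rho>_def)
      then have "y \<in> ball (H (fw f w z)) (\<rho> / \<kappa>)" using H(2) by (simp add: D_def dist_commute)
      then obtain u where u: "u \<in> ball (fw f w z) \<delta>" "y = H u" using BB_D(7)[OF H(1)] by blast
      have "\<rho> * dist u (fw f w z) \<le> \<kappa> * D" using BB_D(4)[OF H(1) u(1) xb] H(2) u(2) by (simp add: D_def)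
      also have "\<dots> < \<kappa> * (\<rho> * r0)" using ww(3) \<kappa>_pos by (simp add: \<rho>_def)
      also have "\<dots> = \<rho> * brad" using r0(2) by (simp add: mult_ac)
      finally have "u \<in> ball (fw f w z) brad" using \<rho> by (simp add: dist_commute)
      then have "norm (Cf \<beta> y - Cf \<beta> z) \<le> K * R w z powr \<alpha>"
        unfolding u(2) by (rule br[OF ww(1,2) H(1)[unfolded \<rho>_def] H(2)])
      also have "\<dots> \<le> \<bar>K\<bar> * (\<kappa>^3 / (c * r0) * D) powr \<alpha>"
        using RD \<rho> \<alpha> by (intro mult_mono powr_mono2) (auto simp: \<rho>_def)
      also have "\<dots> = M2 * D powr \<alpha>" unfolding M2_def using c(1) r0 \<kappa>_pos D by (subst powr_mult) auto
      also have "\<dots> \<le> (M1 + M2) * D powr \<alpha>" using M by (intro mult_right_mono) auto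
      finally show ?thesis by (simp add: D_def)
    qed
  qed (use M in simp)
  then show ?thesis using that[of "M1 + M2"] M by auto
qed

section \<open>From the Julia set to the whole sphere\<close>

definition linked :: "real \<Rightarrow> sph \<Rightarrow> sph \<Rightarrow> bool" where
  "linked r y z \<longleftrightarrow> (\<exists>S. connected S \<and> y \<in> S \<and> z \<in> S \<and> (\<forall>x\<in>S. dist y x \<le> r \<and> dist z x \<le> r))"

text \<open>Images of segments in a chart replace geodesics: they are connected and stay within a
  multiple of the distance from both ends.\<close>

lemma chart_segment:
  obtains \<Lambda> where "\<Lambda> > 0" "\<And>y z::sph. dist y z < 1/2 \<Longrightarrow> linked (\<Lambda> * dist y z) y z"
proof -
  have "\<exists>\<Lambda>>0. \<forall>y z::sph. dist z e \<ge> 1 \<longrightarrow> dist y z < 1/2 \<longrightarrow> linked (\<Lambda> * dist y z) y z" for e :: sph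
  proof -
    obtain Kp where Kp: "Kp > 0" "\<And>z w. dist (param e z) (param e w) \<le> Kp * dist z w" using param_Lipschitz by metis
    obtain Kc where Kc: "Kc > 0" "\<And>a b. dist a e \<ge> 1/2 \<Longrightarrow> dist b e \<ge> 1/2 \<Longrightarrow> dist (coord e a) (coord e b) \<le> Kc * dist a b"
      using coord_Lipschitz[of "1/2" e] by auto
    have "linked (Kp * Kc * dist y z) y z"
      if d: "dist z e \<ge> 1" "dist y z < 1/2" for y z
    proof -
      have ye: "dist y e \<ge> 1/2" using d dist_triangle[of z e y] by (simp add: dist_commute)
      have ne: "y \<noteq> e" "z \<noteq> e" using ye d by auto
      define a b where ab: "a = coord e y" "b = coord e z"
      define S where "S = param e ` closed_segment a b"
      have "connected S" unfolding S_def by (intro connected_continuous_image continuous_on_param connected_segment)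
      moreover have yz: "param e a = y" "param e b = z" using ne by (auto simp: ab)
      have "y \<in> S" "z \<in> S" unfolding S_def yz[symmetric] by auto
      moreover have "dist y x \<le> Kp * Kc * dist y z \<and> dist z x \<le> Kp * Kc * dist y z" if x: "x \<in> S" for x
      proof -
        obtain t where t: "t \<in> closed_segment a b" "x = param e t" using x by (auto simp: S_def)
        have "dist a t \<le> dist a b" "dist b t \<le> dist a b" using segment_bound[OF t(1)] by (auto simp: dist_norm norm_minus_commute)
        moreover have abd: "dist a b \<le> Kc * dist y z" using Kc(2)[of y z] ye d by (simp add: ab)
        ultimately have "Kp * dist a t \<le> Kp * (Kc * dist y z)" "Kp * dist b t \<le> Kp * (Kc * dist y z)"
          using Kp(1) by (auto intro!: mult_left_mono)
        then show ?thesis using Kp(2)[of a t] Kp(2)[of b t] yz t(2) by (simp add: mult.assoc)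
      qed
      ultimately show ?thesis unfolding linked_def by blast
    qed
    moreover have "Kp * Kc > 0" using Kp Kc by simp
    ultimately show ?thesis by blast
  qed
  then have "\<forall>e. \<exists>\<Lambda>. \<Lambda> > 0 \<and> (\<forall>y z::sph. dist z e \<ge> 1 \<longrightarrow> dist y z < 1/2 \<longrightarrow>
      linked (\<Lambda> * dist y z) y z)" by blast
  then have "\<exists>\<Lambda>. \<forall>e. \<Lambda> e > 0 \<and> (\<forall>y z::sph. dist z e \<ge> 1 \<longrightarrow> dist y z < 1/2 \<longrightarrow>
      linked (\<Lambda> e * dist y z) y z)"
    by (rule choice)
  then obtain \<Lambda> where \<Lambda>: "\<And>e. \<Lambda> e > 0" "\<And>e y z::sph. dist z e \<ge> 1 \<Longrightarrow> dist y z < 1/2 \<Longrightarrow>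
      linked (\<Lambda> e * dist y z) y z"
    by blast
  define M where "M = max (\<Lambda> None) (\<Lambda> (Some 0))"
  show ?thesis
  proof (rule that[of M])
    show "M > 0" using \<Lambda>(1)[of None] by (simp add: M_def less_max_iff_disj)
    fix y z :: sph assume yz: "dist y z < 1/2"
    obtain e where e: "e \<in> {None, Some 0}" "dist z e \<ge> 1" using far_chart by blast
    have le: "\<Lambda> e \<le> M" using e(1) by (auto simp: M_def)
    obtain S where S: "connected S" "y \<in> S" "z \<in> S" "\<And>x. x \<in> S \<Longrightarrow> dist y x \<le> \<Lambda> e * dist y z \<and> dist z x \<le> \<Lambda> e * dist y z"
      using \<Lambda>(2)[OF e(2) yz] unfolding linked_def by blast
    have "\<Lambda> e * dist y z \<le> M * dist y z" using le by (intro mult_right_mono) auto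
    then have "\<forall>x\<in>S. dist y x \<le> M * dist y z \<and> dist z x \<le> M * dist y z" using S(4) by (meson order_trans)
    then show "linked (M * dist y z) y z"
      unfolding linked_def using S(1-3) by blast
  qed
qed

lemma Cf_const_connected:
  assumes "connected S" "S \<subseteq> FF" "y \<in> S" "z \<in> S" shows "Cf \<beta> y = Cf \<beta> z"
proof (rule connected_local_const[OF assms(1,3,4)], rule ballI)
  fix x assume "x \<in> S"
  then obtain r where r: "r > 0" "\<And>y. dist y x < r \<Longrightarrow> asym y x" using asym_fatou[of x] assms(2) by blast
  then show "eventually (\<lambda>b. Cf \<beta> x = Cf \<beta> b) (at x within S)"
    unfolding eventually_at by (intro exI[of _ r]) (use Cf_asym in fastforce)
qed

text \<open>Either the connecting set meets the Julia set, and the estimate is used twice through a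
  point there, or it lies in the Fatou set, where the combination is locally constant and so has
  equal values at both ends.\<close>

lemma holder_cont_from_julia:
  assumes \<alpha>: "\<alpha> \<ge> 0" and M: "M \<ge> 0" "\<And>y z. z \<in> JJ \<Longrightarrow> norm (Cf \<beta> y - Cf \<beta> z) \<le> M * dist y z powr \<alpha>"
  shows "holder_cont (Cf \<beta>) \<alpha>"
proof -
  obtain \<Lambda> where \<Lambda>: "\<Lambda> > 0" "\<And>y z::sph. dist y z < 1/2 \<Longrightarrow> linked (\<Lambda> * dist y z) y z"
    by (rule chart_segment) (rule that)
  obtain B where B: "B \<ge> 0" "\<And>y z. norm (Cf \<beta> y - Cf \<beta> z) \<le> 2 * B" by (rule Cf_diff_bounded) (rule that)
  define M1 where "M1 = 2 * B / (1/2) powr \<alpha>"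
  define M2 where "M2 = 2 * (M * \<Lambda> powr \<alpha>)"
  have M12: "M1 \<ge> 0" "M2 \<ge> 0" using B M by (auto simp: M1_def M2_def)
  have "norm (Cf \<beta> y - Cf \<beta> z) \<le> (M1 + M2) * dist y z powr \<alpha>" for y z
  proof (cases "dist y z < 1/2")
    case False
    then have "(1/2) powr \<alpha> \<le> dist y z powr \<alpha>" using \<alpha> by (intro powr_mono2) auto
    then have "2 * B \<le> M1 * dist y z powr \<alpha>"
      unfolding M1_def using B(1) mult_left_mono[of "(1/2) powr \<alpha>" "dist y z powr \<alpha>" "2 * B"] by (simp add: field_simps)
    moreover have "norm (Cf \<beta> y - Cf \<beta> z) \<le> 2 * B" by (rule B(2))
    moreover have "0 \<le> M2 * dist y z powr \<alpha>" using M12 by simp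
    ultimately show ?thesis by (simp add: distrib_right)
  next
    case True
    obtain S where S: "connected S" "y \<in> S" "z \<in> S" "\<And>x. x \<in> S \<Longrightarrow> dist y x \<le> \<Lambda> * dist y z" "\<And>x. x \<in> S \<Longrightarrow> dist z x \<le> \<Lambda> * dist y z"
      using \<Lambda>(2)[OF True] unfolding linked_def by blast
    show ?thesis
    proof (cases "S \<subseteq> FF")
      case True
      then show ?thesis using Cf_const_connected[OF S(1) True S(2,3), of \<beta>] M12 by simp
    next
      case False
      then obtain x where x: "x \<in> S" "x \<in> JJ" using julia_iff by blast
      have p: "(\<Lambda> * dist y z) powr \<alpha> = \<Lambda> powr \<alpha> * dist y z powr \<alpha>" using \<Lambda>(1) by (simp add: powr_mult)
      have b: "norm (Cf \<beta> t - Cf \<beta> x) \<le> M * (\<Lambda> powr \<alpha> * dist y z powr \<alpha>)" if "dist t x \<le> \<Lambda> * dist y z" for t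
      proof -
        have "dist t x powr \<alpha> \<le> (\<Lambda> * dist y z) powr \<alpha>" using that \<alpha> by (intro powr_mono2) auto
        then have "M * dist t x powr \<alpha> \<le> M * (\<Lambda> powr \<alpha> * dist y z powr \<alpha>)" unfolding p using M(1) by (rule mult_left_mono)
        then show ?thesis using M(2)[OF x(2), of t] by linarith
      qed
      have "norm (Cf \<beta> y - Cf \<beta> z) \<le> norm (Cf \<beta> y - Cf \<beta> x) + norm (Cf \<beta> z - Cf \<beta> x)"
        using norm_triangle_ineq4[of "Cf \<beta> y - Cf \<beta> x" "Cf \<beta> z - Cf \<beta> x"] by simp
      also have "\<dots> \<le> M2 * dist y z powr \<alpha>" using b[OF S(4)[OF x(1)]] b[OF S(5)[OF x(1)]] by (simp add: M2_def)
      also have "\<dots> \<le> (M1 + M2) * dist y z powr \<alpha>" using M12 by (intro mult_right_mono) auto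
      finally show ?thesis .
    qed
  qed
  then show ?thesis unfolding holder_cont_def sdist_eq_dist by blast
qed

text \<open>The theorem covers all real exponents below \<open>alpha_minus\<close>, negative ones
  included; for these boundedness suffices, as distances are at most 2.\<close>

lemma holder_cont_neg: assumes "\<alpha> < 0" shows "holder_cont (Cf \<beta>) \<alpha>"
proof -
  obtain B where B: "B \<ge> 0" "\<And>y z. norm (Cf \<beta> y - Cf \<beta> z) \<le> 2 * B" by (rule Cf_diff_bounded) (rule that)
  have "norm (Cf \<beta> y - Cf \<beta> z) \<le> 2 * B / 2 powr \<alpha> * dist y z powr \<alpha>" for y z
  proof (cases "y = z")
    case False
    have "2 powr \<alpha> \<le> dist y z powr \<alpha>" using False assms dist_option_le_2[of y z] by (intro powr_mono2') auto
    then have "2 * B * 2 powr \<alpha> \<le> 2 * B * dist y z powr \<alpha>" using B(1) by (intro mult_left_mono) auto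
    then have "2 * B \<le> 2 * B / 2 powr \<alpha> * dist y z powr \<alpha>" by (simp add: field_simps)
    moreover have "norm (Cf \<beta> y - Cf \<beta> z) \<le> 2 * B" by (rule B(2))
    ultimately show ?thesis by linarith
  qed simp
  then show ?thesis unfolding holder_cont_def sdist_eq_dist by blast
qed

text \<open>Cauchy's estimate in the parameters costs a factor
  \<open>(1 + \<epsilon>) ^ length w\<close>. The spare power
  \<open>R w z powr (a - \<alpha>)\<close> decays exponentially in the length and pays for
  it.\<close>

lemma holder_cont_subcritical:
  assumes K: "K > 0" "\<And>w z. w \<in> Wd \<Longrightarrow> fw f w z \<in> JJ \<Longrightarrow> wtw p w \<le> K * R w z powr a"
    and \<alpha>: "\<alpha> < a"
  shows "holder_cont (Cf \<beta>) \<alpha>"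
proof (cases "\<alpha> < 0")
  case True then show ?thesis by (rule holder_cont_neg)
next
  case False
  then have \<alpha>0: "\<alpha> \<ge> 0" by simp
  obtain N where N: "N \<ge> 1" "\<And>w z. w \<in> Wd \<Longrightarrow> fw f w z \<in> JJ \<Longrightarrow> R w z \<le> \<kappa> * (1/2) ^ (length w div N)"
    by (rule R_decay) (rule that)
  define g where "g = a - \<alpha>"
  have g: "g > 0" using \<alpha> by (simp add: g_def)
  \<comment> \<open>Calibrated so that the growth over \<open>N\<close> letters is
    \<open>2 powr g\<close>, the factor that the bound for the g-th power of the ratio loses per
    block.\<close>
  define \<epsilon> where "\<epsilon> = root N (2 powr g) - 1"
  have \<epsilon>: "\<epsilon> > 0" "(1 + \<epsilon>) ^ N = 2 powr g"
    using N(1) g by (auto simp: \<epsilon>_def real_root_pow_pos)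
  have slow: "(1 + \<epsilon>) ^ length w * R w z powr g \<le> 2 powr g * \<kappa> powr g" if w: "w \<in> Wd" "fw f w z \<in> JJ" for w z
  proof -
    define j where "j = length w div N"
    have "length w \<le> N * j + N" using N(1) unfolding j_def
      by (metis add_left_mono div_mult_mod_eq less_imp_le_nat mod_less_divisor mult.commute zero_less_one order_less_le_trans)
    then have "(1 + \<epsilon>) ^ length w \<le> (1 + \<epsilon>) ^ (N * j + N)" using \<epsilon>(1) by (intro power_increasing) auto
    also have "\<dots> = (2 powr g) ^ j * 2 powr g" by (simp add: power_add power_mult \<epsilon>(2))
    finally have 1: "(1 + \<epsilon>) ^ length w \<le> (2 powr g) ^ j * 2 powr g" .
    have "R w z powr g \<le> (\<kappa> * (1/2) ^ j) powr g"
      using N(2)[OF w] R_pos(1)[OF w] g by (intro powr_mono2) (auto simp: j_def)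
    also have "\<dots> = \<kappa> powr g * (2 powr (- g)) ^ j"
      using \<kappa>_pos by (simp only: powr_mult half_power_powr)
    finally have "(1 + \<epsilon>) ^ length w * R w z powr g \<le> ((2 powr g) ^ j * 2 powr g) * (\<kappa> powr g * (2 powr (- g)) ^ j)"
      using 1 \<epsilon>(1) by (intro mult_mono) auto
    also have "\<dots> = (2 powr g * 2 powr (- g)) ^ j * (2 powr g * \<kappa> powr g)" by (simp only: power_mult_distrib mult_ac)
    also have "2 powr g * 2 powr (- g) = 1" by (simp add: powr_minus)
    finally show ?thesis by simp
  qed
  \<comment> \<open>A polydisc on which \<open>wtw_bound\<close> holds with this \<epsilon>.\<close>
  define r where "r = min rad (\<epsilon> * pmin / s)"
  have s0: "real s > 0" using s_ge by simp
  have r: "0 < r" "r \<le> rad" using rad(1) \<epsilon>(1) pmin(1) s0 by (auto simp: r_def)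
  have "real s * r \<le> real s * (\<epsilon> * pmin / s)" by (intro mult_left_mono) (auto simp: r_def)
  then have sr: "real s * r \<le> \<epsilon> * pmin" using s0 by simp
  obtain B where B: "B > 0" "\<And>x z. x \<in> Pd rad \<Longrightarrow> norm (Tc x z) \<le> B" by (rule Tc_bounded) (rule that)
  obtain C where C: "C \<ge> 0" "\<And>g M. UU g \<Longrightarrow> (\<forall>x\<in>Pd r. norm (g x) \<le> M) \<Longrightarrow> norm (DD \<beta> g) \<le> C * M"
    using DD_bound[OF r, of \<beta>] by blast
  have br: "norm (Cf \<beta> (H u) - Cf \<beta> z) \<le> (C * (2 * B * K * (2 powr g * \<kappa> powr g))) * R w z powr \<alpha>"
    if w: "w \<in> Wd" "fw f w z \<in> JJ" and H: "BB w (fw f w z) H (R w z)" "H (fw f w z) = z" and u: "u \<in> ball (fw f w z) brad" for w z u H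
  proof -
    define M where "M = ((1 + \<epsilon>) ^ length w * wtw p w) * (2 * B)"
    have gb: "norm (wtw X w * (1 * Tc X u + (-1) * Tc X (fw f w z))) \<le> M" if X: "X \<in> Pd r" for X
    proof -
      have X': "X \<in> Pd rad" using X Pd_mono[OF r(2)] by blast
      have "norm (1 * Tc X u + (-1) * Tc X (fw f w z)) \<le> 2 * B"
        using B(2)[OF X', of u] B(2)[OF X', of "fw f w z"] norm_triangle_ineq4[of "Tc X u" "Tc X (fw f w z)"] by simp
      then show ?thesis unfolding M_def norm_mult
        using wtw_bound[OF X sr w(1) less_imp_le[OF \<epsilon>(1)]] \<epsilon>(1) wtw_p_pos[OF w(1)] by (intro mult_mono) auto
    qed
    have "norm (Cf \<beta> (H u) - Cf \<beta> (H (fw f w z))) \<le> C * M"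
      unfolding Cf_branch_DD[OF w(1,2) H(1) u]
      by (rule C(2)[OF UU_mult_Pol[OF UU_diff_Tc Pol_wtw[OF w(1)]]]) (use gb in blast)
    also have "M \<le> 2 * B * K * (2 powr g * \<kappa> powr g) * R w z powr \<alpha>"
    proof -
      have "R w z powr a = R w z powr \<alpha> * R w z powr g" by (simp add: g_def powr_add[symmetric])
      then have "wtw p w \<le> K * (R w z powr \<alpha> * R w z powr g)" using K(2)[OF w] by simp
      then have "M \<le> ((1 + \<epsilon>) ^ length w * (K * (R w z powr \<alpha> * R w z powr g))) * (2 * B)"
        unfolding M_def using B(1) \<epsilon>(1) by (intro mult_right_mono mult_left_mono) auto
      also have "\<dots> = (2 * B * K * R w z powr \<alpha>) * ((1 + \<epsilon>) ^ length w * R w z powr g)" by (simp add: mult_ac)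
      also have "\<dots> \<le> (2 * B * K * R w z powr \<alpha>) * (2 powr g * \<kappa> powr g)"
        using slow[OF w] B(1) K(1) by (intro mult_left_mono) auto
      finally show ?thesis by (simp add: mult_ac)
    qed
    finally show ?thesis using C(1) H(2) by (simp add: mult.assoc mult_left_mono)
  qed
  show ?thesis
  proof (rule julia_holder[of \<alpha> \<beta> "C * (2 * B * K * (2 powr g * \<kappa> powr g))"])
    show "0 \<le> \<alpha>" by (rule \<alpha>0)
    show "norm (Cf \<beta> (H u) - Cf \<beta> z) \<le> C * (2 * B * K * (2 powr g * \<kappa> powr g)) * R w z powr \<alpha>"
      if "w \<in> Wd" "fw f w z \<in> JJ" "BB w (fw f w z) H (R w z)" "H (fw f w z) = z" "u \<in> ball (fw f w z) brad" for w z u H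
      using br[OF that] .
    show ?thesis if "M \<ge> 0" "\<And>y z. z \<in> JJ \<Longrightarrow> norm (Cf \<beta> y - Cf \<beta> z) \<le> M * dist y z powr \<alpha>" for M
      by (rule holder_cont_from_julia[OF \<alpha>0 that])
  qed
qed

text \<open>In degree 0 a word acts exactly as its probability, so the critical exponent itself is
  reached.\<close>

lemma holder_cont_critical:
  assumes K: "K > 0" "\<And>w z. w \<in> Wd \<Longrightarrow> fw f w z \<in> JJ \<Longrightarrow> wtw p w \<le> K * R w z powr a"
    and a: "a \<ge> 0" and \<beta>: "\<beta> \<in> CF 0"
  shows "holder_cont (Cf \<beta>) a"
proof -
  obtain B where B: "B \<ge> 0" "\<And>y z. norm (Cf \<beta> y - Cf \<beta> z) \<le> 2 * B" by (rule Cf_diff_bounded) (rule that)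
  have br: "norm (Cf \<beta> (H u) - Cf \<beta> z) \<le> (2 * B * K) * R w z powr a"
    if w: "w \<in> Wd" "fw f w z \<in> JJ" and H: "BB w (fw f w z) H (R w z)" "H (fw f w z) = z" and u: "u \<in> ball (fw f w z) brad" for w z u H
  proof -
    have lin: "Cf (actw w \<beta>) t = of_real (wtw p w) * Cf \<beta> t" for t
      using Cf_linear[OF \<beta> \<beta>, of "of_real (wtw p w)" 0 t] by (simp add: actw_top(2)[OF \<beta> w(1)])
    have "Cf \<beta> (H u) - Cf \<beta> z = of_real (wtw p w) * (Cf \<beta> u - Cf \<beta> (fw f w z))"
      using Cf_branch[OF w(1,2) H(1) u \<beta>] H(2) by (simp add: lin right_diff_distrib)
    then have "norm (Cf \<beta> (H u) - Cf \<beta> z) = wtw p w * norm (Cf \<beta> u - Cf \<beta> (fw f w z))"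
      using wtw_p_pos[OF w(1)] by (simp add: norm_mult)
    also have "\<dots> \<le> (K * R w z powr a) * (2 * B)"
    proof (rule mult_mono[OF K(2)[OF w]])
      show "norm (Cf \<beta> u - Cf \<beta> (fw f w z)) \<le> 2 * B" by (rule B(2))
    qed (use K(1) in auto)
    finally show ?thesis by (simp add: mult_ac)
  qed
  show ?thesis
  proof (rule julia_holder[of a \<beta> "2 * B * K"])
    show "0 \<le> a" by (rule a)
    show "norm (Cf \<beta> (H u) - Cf \<beta> z) \<le> 2 * B * K * R w z powr a"
      if "w \<in> Wd" "fw f w z \<in> JJ" "BB w (fw f w z) H (R w z)" "H (fw f w z) = z" "u \<in> ball (fw f w z) brad" for w z u H
      using br[OF that] .
    show ?thesis if "M \<ge> 0" "\<And>y z. z \<in> JJ \<Longrightarrow> norm (Cf \<beta> y - Cf \<beta> z) \<le> M * dist y z powr a" for M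
      by (rule holder_cont_from_julia[OF a that])
  qed
qed

end

section \<open>Linear independence and the lower bound\<close>

context attractor_system
begin

definition flat :: "((nat \<Rightarrow> nat) \<Rightarrow> complex) \<Rightarrow> sph \<Rightarrow> bool" where
  "flat \<beta> z \<longleftrightarrow> (\<exists>r>0. \<forall>y\<in>ball z r. Cf \<beta> y = Cf \<beta> z)"

lemma flat_linear:
  assumes "flat \<beta> z" "flat \<gamma> z" "\<beta> \<in> CF d" "\<gamma> \<in> CF d"
  shows "flat (\<lambda>n. a * \<beta> n + b * \<gamma> n) z"
proof -
  obtain r r' where r: "r > 0" "\<And>y. y \<in> ball z r \<Longrightarrow> Cf \<beta> y = Cf \<beta> z" "r' > 0" "\<And>y. y \<in> ball z r' \<Longrightarrow> Cf \<gamma> y = Cf \<gamma> z"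
    using assms(1,2) unfolding flat_def by blast
  have "Cf (\<lambda>n. a * \<beta> n + b * \<gamma> n) y = Cf (\<lambda>n. a * \<beta> n + b * \<gamma> n) z" if "y \<in> ball z (min r r')" for y
  proof -
    have y: "y \<in> ball z r" "y \<in> ball z r'" using that by auto
    show ?thesis unfolding Cf_linear[OF assms(3,4)] by (simp only: r(2)[OF y(1)] r(4)[OF y(2)])
  qed
  moreover have "min r r' > 0" using r by simp
  ultimately show ?thesis unfolding flat_def by blast
qed

text \<open>By \<open>Cf_branch\<close> the differences of the transformed combination near the
  image point are differences of the original one near \<open>y\<close>.\<close>

lemma flat_image:
  assumes \<beta>: "\<beta> \<in> CF d" and w: "w \<in> Wd" and e: "fw f w y \<in> JJ" and fl: "\<And>y'. y' \<in> ball y r \<Longrightarrow> Cf \<beta> y' = Cf \<beta> y" and r: "r > 0"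
  shows "flat (actw w \<beta>) (fw f w y)"
proof -
  define x where "x = fw f w y"
  obtain H where H: "BB w x H (R w y)" "H x = y" unfolding x_def by (rule R_branch[OF w e])
  have \<rho>: "R w y > 0" by (rule R_pos(1)[OF w e])
  define t where "t = min brad (r / (\<kappa> * R w y))"
  have t: "t > 0" using brad(1) r \<kappa>_pos \<rho> by (simp add: t_def)
  have "Cf (actw w \<beta>) u = Cf (actw w \<beta>) x" if u: "u \<in> ball x t" for u
  proof -
    have ub: "u \<in> ball x brad" "u \<in> ball x \<delta>" "x \<in> ball x \<delta>" using u brad(2) \<delta> by (auto simp: t_def)
    have "dist (H x) (H u) \<le> \<kappa> * R w y * dist x u" by (rule BB_D(5)[OF H(1) ub(3,2)])
    also have "\<dots> < \<kappa> * R w y * (r / (\<kappa> * R w y))" using u \<kappa>_pos \<rho> by (intro mult_strict_left_mono) (auto simp: t_def)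
    also have "\<dots> = r" using \<kappa>_pos \<rho> by simp
    finally have "Cf \<beta> (H u) = Cf \<beta> (H x)" using fl[of "H u"] H(2) by simp
    then show ?thesis using Cf_branch[OF w e[folded x_def] H(1) ub(1) \<beta>] by simp
  qed
  then show ?thesis unfolding flat_def x_def[symmetric] using t by blast
qed

lemma flat_transport:
  assumes \<beta>: "\<beta> \<in> CF d" and fl: "flat \<beta> z" and z: "z \<in> JJ" and e: "e \<in> JJ"
  obtains v where "v \<in> Wd" "flat (actw v \<beta>) e"
proof -
  obtain r where r: "r > 0" "\<And>y. y \<in> ball z r \<Longrightarrow> Cf \<beta> y = Cf \<beta> z" using fl unfolding flat_def by blast
  obtain v y where v: "v \<in> Wd" "y \<in> ball z r" "fw f v y = e" by (rule julia_transitive[OF z e r(1)])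
  have "flat (actw v \<beta>) (fw f v y)"
  proof (rule flat_image[OF \<beta> v(1)])
    show "fw f v y \<in> JJ" using v(3) e by simp
    show "r - dist z y > 0" using v(2) by simp
    fix y' assume "y' \<in> ball y (r - dist z y)"
    then have "y' \<in> ball z r" using dist_triangle[of z y' y] by simp
    then show "Cf \<beta> y' = Cf \<beta> y" using r(2)[of y'] r(2)[OF v(2)] by simp
  qed
  then show ?thesis using that v by simp
qed

lemma actw_fixed_flat:
  assumes "\<beta> \<in> CF d" "w \<in> Wd" "e \<in> JJ" "fw f w e = e" "flat \<beta> e"
  shows "flat (actw w \<beta>) e"
proof -
  obtain r where r: "r > 0" "\<And>y. y \<in> ball e r \<Longrightarrow> Cf \<beta> y = Cf \<beta> e" using assms(5) unfolding flat_def by blast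
  have "flat (actw w \<beta>) (fw f w e)" by (rule flat_image[OF assms(1,2) _ r(2,1)]) (use assms in simp)
  then show ?thesis using assms(4) by simp
qed

text \<open>In degree 0 words act by nonzero scalars, so flatness at one Julia point spreads to all
  of them by transitivity, and at Fatou points it always holds. On the connected sphere the
  combination is then constant, although it is a nonzero multiple of a function with value 1 on
  \<open>UL\<close> and 0 on \<open>U0\<close>.\<close>

lemma not_flat_degree_0:
  assumes \<beta>: "\<beta> \<in> CF 0" "\<beta> \<noteq> (\<lambda>_. 0)" and z: "z \<in> JJ" shows "\<not> flat \<beta> z"
proof
  assume fl: "flat \<beta> z"
  have loc: "flat \<beta> e" for e
  proof (cases "e \<in> JJ")
    case True
    obtain v where v: "v \<in> Wd" "flat (actw v \<beta>) e" by (rule flat_transport[OF \<beta>(1) fl z True])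
    have a: "actw v \<beta> = (\<lambda>n. of_real (wtw p v) * \<beta> n)" by (rule actw_top(2)[OF \<beta>(1) v(1)])
    have "(\<lambda>n. of_real (1 / wtw p v) * actw v \<beta> n + 0 * \<beta> n) = \<beta>"
      using wtw_p_pos[OF v(1)] by (simp add: a fun_eq_iff)
    moreover have "flat (\<lambda>n. of_real (1 / wtw p v) * actw v \<beta> n + 0 * actw v \<beta> n) e"
      by (rule flat_linear[OF v(2) v(2)]) (rule actw_CF[OF \<beta>(1) v(1)])+
    ultimately show ?thesis by simp
  next
    case False
    then have "e \<in> FF" using julia_iff by blast
    then obtain r where r: "r > 0" "\<And>y. dist y e < r \<Longrightarrow> asym y e" by (rule asym_fatou) (rule that)
    have "Cf \<beta> y = Cf \<beta> e" if "y \<in> ball e r" for y using Cf_asym[OF r(2)[of y]] that by (simp add: dist_commute)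
    then show ?thesis unfolding flat_def using r(1) by blast
  qed
  have const: "Cf \<beta> x = Cf \<beta> y" for x y
  proof (rule connected_local_const[OF connected_UNIV_sph], simp, simp, rule ballI)
    fix a
    obtain r where r: "r > 0" "\<And>y. y \<in> ball a r \<Longrightarrow> Cf \<beta> y = Cf \<beta> a" using loc[of a] unfolding flat_def by blast
    have "Cf \<beta> a = Cf \<beta> y" if "dist y a < r" for y using r(2)[of y] that by (simp add: dist_commute)
    then show "eventually (\<lambda>b. Cf \<beta> a = Cf \<beta> b) (at a within UNIV)"
      unfolding eventually_at using r(1) by blast
  qed
  obtain y1 y0 where y: "y1 \<in> UL" "y0 \<in> U0" using UL_nonempty U0_nonempty by blast
  obtain n where n: "\<beta> n \<noteq> 0" using \<beta>(2) by blast
  have nz: "m = (\<lambda>_. 0)" if "\<beta> m \<noteq> 0" for m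
  proof
    fix i
    have "m \<in> Bx 0" using \<beta>(1) that unfolding CF_def by blast
    then have m: "multi_index s m" "(\<Sum>i\<in>{1..s}. m i) = 0" unfolding Bx_def le_zero_eq by blast+
    have "\<forall>i\<in>{1..s}. m i = 0" using m(2) by (subst (asm) sum_eq_0_iff) (rule finite_atLeastAtMost)
    then show "m i = 0" using m(1) unfolding multi_index_def by (meson atLeastAtMost_iff)
  qed
  have "{m. \<beta> m \<noteq> 0} = {\<lambda>_. 0}" using n nz by auto
  moreover have "cm (\<lambda>_. 0) j g = g" for j g by (induction j) auto
  ultimately have "Cf \<beta> y = \<beta> (\<lambda>_. 0) * Tc pc y" for y by (simp add: Cf_def DD_def)
  then show False using const[of y1 y0] Tc_UL[OF y(1)] Tc_U0[OF y(2)] n nz[OF n] by simp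
qed

text \<open>The binomial expansion of the m-th power of scalar plus \<open>low i\<close>, modulo
  terms at least two degrees below the top.\<close>

lemma low_act_commute_top:
  assumes \<beta>: "\<beta> \<in> CF (Suc (Suc d))" and i: "i \<in> II"
  shows "(\<lambda>n. actw (replicate m i) \<beta> n - of_real (wt p i ^ m) * \<beta> n - of_nat m * of_real (wt p i ^ (m - 1)) * low i \<beta> n) \<in> CF d"
proof (induction m)
  case 0
  show ?case using zero_CF by simp
next
  case (Suc m)
  define q where "q = complex_of_real (wt p i)"
  define E where "E = (\<lambda>n. actw (replicate m i) \<beta> n - q ^ m * \<beta> n - of_nat m * q ^ (m - 1) * low i \<beta> n)"
  have E: "E \<in> CF d" using Suc by (simp add: E_def q_def)
  have comm: "actw (w @ [i]) \<gamma> = act i (actw w \<gamma>)" for w \<gamma> by (induction w arbitrary: \<gamma>) auto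
  have "actw (replicate (Suc m) i) \<beta> = act i (actw (replicate m i) \<beta>)"
    unfolding comm[symmetric] replicate_append_same by simp
  moreover have A: "actw (replicate m i) \<beta> = (\<lambda>n. q ^ m * \<beta> n + of_nat m * q ^ (m - 1) * low i \<beta> n + E n)"
    by (simp add: E_def fun_eq_iff)
  have lowlin: "low i (\<lambda>n. a * g n + b * h n + k n) n = a * low i g n + b * low i h n + low i k n" for a b g h k n
    by (simp add: low_def lower_def sum_distrib_left sum.distrib algebra_simps)
  have L2: "low i (low i \<beta>) \<in> CF d" by (rule low_CF_Suc[OF low_CF_Suc[OF \<beta> i] i])
  have "(\<lambda>n. (of_nat m * q ^ (m - 1)) * low i (low i \<beta>) n + 1 * act i E n) \<in> CF d"
    by (rule CF_linear[OF L2 act_CF[OF E i]])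
  moreover have "(\<lambda>n. (of_nat m * q ^ (m - 1)) * low i (low i \<beta>) n + 1 * act i E n) =
      (\<lambda>n. act i (actw (replicate m i) \<beta>) n - q ^ Suc m * \<beta> n - of_nat (Suc m) * q ^ m * low i \<beta> n)"
  proof
    fix n
    have m: "of_nat m * q ^ m = of_nat m * (q ^ (m - 1) * q)" by (cases m) auto
    show "(of_nat m * q ^ (m - 1)) * low i (low i \<beta>) n + 1 * act i E n =
      act i (actw (replicate m i) \<beta>) n - q ^ Suc m * \<beta> n - of_nat (Suc m) * q ^ m * low i \<beta> n"
      unfolding act_def A lowlin q_def[symmetric] using m by (auto simp: algebra_simps)
  qed
  ultimately show ?case by (simp add: q_def)
qed

text \<open>At a periodic point of \<open>f i\<close> in the Julia set the action of the period, minus its leading scalar,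
  lowers the degree by exactly one.\<close>

lemma not_flat:
  assumes "\<beta> \<in> CF d" "\<beta> \<noteq> (\<lambda>_. 0)" "z \<in> JJ" shows "\<not> flat \<beta> z"
  using assms
proof (induction d arbitrary: \<beta> z)
  case 0
  then show ?case by (rule not_flat_degree_0)
next
  case (Suc d)
  show ?case
  proof (cases "\<beta> \<in> CF d")
    case True then show ?thesis using Suc by blast
  next
    case False
    show ?thesis
    proof
      assume fl: "flat \<beta> z"
      obtain n where n: "\<beta> n \<noteq> 0" "n \<notin> Bx d" using False by (auto simp: CF_def)
      have nB: "multi_index s n" "(\<Sum>i\<in>{1..s}. n i) = Suc d" using n Suc.prems(1) by (fastforce simp: CF_def Bx_def)+
      have "\<exists>i\<in>{1..s}. n i \<noteq> 0" using nB(2) by (metis nat.distinct(1) sum.neutral)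
      then obtain i where i: "i \<in> {1..s}" "n i \<noteq> 0" by blast
      have iI: "i \<in> II" using i by (auto simp: II_def)
      obtain m q where q: "m \<ge> 1" "q \<in> JJ" "fw f (replicate m i) q = q" by (rule generator_periodic_point[OF iI])
      define w where "w = replicate m i"
      have w: "w \<in> Wd" using iI by (auto simp: w_def)
      obtain v where v: "v \<in> Wd" "flat (actw v \<beta>) q" by (rule flat_transport[OF Suc.prems(1) fl Suc.prems(3) q(2)])
      define \<gamma> where "\<gamma> = actw v \<beta>"
      have \<gamma>: "\<gamma> \<in> CF (Suc d)" unfolding \<gamma>_def by (rule actw_CF[OF Suc.prems(1) v(1)])
      have fl2: "flat (actw w \<gamma>) q"
        by (rule actw_fixed_flat[OF \<gamma> w q(2)]) (use q(3) v(2) in \<open>auto simp: w_def \<gamma>_def\<close>)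
      have top: "\<gamma> n \<noteq> 0"
      proof -
        have "(\<lambda>n. actw v \<beta> n - of_real (wtw p v) * \<beta> n) \<in> CF d" by (rule actw_top(1)[OF Suc.prems(1) v(1)])
        then have "actw v \<beta> n - of_real (wtw p v) * \<beta> n = 0" using n(2) by (auto simp: CF_def)
        then show ?thesis using n(1) wtw_p_pos[OF v(1)] by (auto simp: \<gamma>_def)
      qed
      define \<eta> where "\<eta> = (\<lambda>n. 1 * actw w \<gamma> n + (- of_real (wtw p w)) * \<gamma> n)"
      have \<eta>: "\<eta> \<in> CF d" using actw_top(1)[OF \<gamma> w] by (simp add: \<eta>_def)
      have "flat \<eta> q" unfolding \<eta>_def
        by (rule flat_linear[OF fl2 _ actw_CF[OF \<gamma> w] \<gamma>]) (use v(2) in \<open>simp add: \<gamma>_def\<close>)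
      then have "\<eta> = (\<lambda>_. 0)" using Suc.IH[OF \<eta> _ q(2)] by blast
      moreover have "\<eta> (n(i := n i - 1)) \<noteq> 0"
      proof -
        \<comment> \<open>One step below the top index \<open>n\<close> only the linear term of the
          expansion is visible, and \<open>low i \<gamma> k\<close> is \<open>n i\<close> times the
          nonzero top coefficient.\<close>
        define k where "k = n(i := n i - 1)"
        have low: "low i \<gamma> k = of_nat (n i) * \<gamma> n" using i by (auto simp: low_def lower_def k_def)
        have pw: "wtw p (replicate m i) = wt p i ^ m" by (simp add: wtw_def prod_list_replicate)
        have ek: "\<eta> k = of_nat m * of_real (wt p i ^ (m - 1)) * low i \<gamma> k"
        proof (cases d)
          case (Suc d')
          have "(\<Sum>j\<in>{1..s}. k j) = d"
          proof -
            have "(\<Sum>j\<in>{1..s} - {i}. k j) = (\<Sum>j\<in>{1..s} - {i}. n j)" by (intro sum.cong) (auto simp: k_def)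
            moreover have "(\<Sum>j\<in>{1..s}. k j) = k i + (\<Sum>j\<in>{1..s} - {i}. k j)" "(\<Sum>j\<in>{1..s}. n j) = n i + (\<Sum>j\<in>{1..s} - {i}. n j)"
              using i(1) by (auto intro: sum.remove)
            ultimately show ?thesis using nB(2) i(2) by (simp add: k_def)
          qed
          then have "k \<notin> Bx d'" using Suc by (simp add: Bx_def)
          moreover have "(\<lambda>n. actw (replicate m i) \<gamma> n - of_real (wt p i ^ m) * \<gamma> n - of_nat m * of_real (wt p i ^ (m - 1)) * low i \<gamma> n) \<in> CF d'"
            by (rule low_act_commute_top[OF _ iI]) (use \<gamma> Suc in simp)
          ultimately have "actw (replicate m i) \<gamma> k - of_real (wt p i ^ m) * \<gamma> k - of_nat m * of_real (wt p i ^ (m - 1)) * low i \<gamma> k = 0"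
            by (auto simp: CF_def)
          then show ?thesis by (simp add: \<eta>_def pw w_def algebra_simps)
        next
          \<comment> \<open>There is no lower degree to calculate modulo; here \<open>low i\<close>
            applied twice vanishes and the two-term expansion is exact.\<close>
          case 0
          have LL: "low i (low i \<gamma>) = (\<lambda>_. 0)" by (rule low_CF_0[OF low_CF_Suc iI]) (use \<gamma> 0 iI in auto)
          have lowlin: "low i (\<lambda>n. a * g n + b * h n) n = a * low i g n + b * low i h n" for a b g h n
            by (simp add: low_def lower_def sum_distrib_left sum.distrib algebra_simps)
          have "actw (replicate m i) \<gamma> = (\<lambda>n. of_real (wt p i ^ m) * \<gamma> n + (of_nat m * of_real (wt p i ^ (m - 1))) * low i \<gamma> n)" for m
          proof (induction m)
            case (Suc m)
            have comm: "actw (w @ [i]) \<gamma> = act i (actw w \<gamma>)" for w \<gamma> by (induction w arbitrary: \<gamma>) auto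
            have e: "actw (replicate (Suc m) i) \<gamma> = act i (actw (replicate m i) \<gamma>)"
              unfolding comm[symmetric] replicate_append_same by simp
            have mm: "of_nat m * complex_of_real (wt p i) ^ m = of_nat m * (of_real (wt p i) ^ (m - 1) * of_real (wt p i))" by (cases m) auto
            show ?case
              unfolding e act_def Suc.IH lowlin LL fun_eq_iff using mm by (auto simp: algebra_simps)
          qed simp
          then show ?thesis by (simp add: \<eta>_def pw w_def)
        qed
        have "of_nat m * complex_of_real (wt p i ^ (m - 1)) * low i \<gamma> k \<noteq> 0"
          unfolding low using top i(2) q(1) wt_p_pos[OF iI] by simp
        then show ?thesis using ek by (simp add: k_def)
      qed
      ultimately show False by simp
    qed
  qed
qed

section \<open>Pointwise Hoelder bounds at a periodic point\<close>

definition hb :: "((nat \<Rightarrow> nat) \<Rightarrow> complex) \<Rightarrow> sph \<Rightarrow> real \<Rightarrow> bool" where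
  "hb \<beta> q \<alpha> \<longleftrightarrow> (\<exists>M\<ge>0. \<forall>y. norm (Cf \<beta> y - Cf \<beta> q) \<le> M * dist y q powr \<alpha>)"

text \<open>Combinations are bounded, so away from \<open>q\<close> the estimate holds with a large
  constant. In the global form it can be applied at the image point of a branch without a check of
  distances.\<close>

lemma holder_bounded_hb:
  assumes "holder_bounded (Cf \<beta>) q \<alpha>" "\<alpha> \<ge> 0" shows "hb \<beta> q \<alpha>"
proof -
  obtain M d where M: "d > 0" "\<And>y. y \<noteq> q \<Longrightarrow> dist y q < d \<Longrightarrow> norm (Cf \<beta> y - Cf \<beta> q) \<le> M * dist y q powr \<alpha>"
    using assms(1) unfolding holder_bounded_def sdist_eq_dist by blast
  obtain B where B: "B \<ge> 0" "\<And>y z. norm (Cf \<beta> y - Cf \<beta> z) \<le> 2 * B" by (rule Cf_diff_bounded) (rule that)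
  define M1 where "M1 = 2 * B / d powr \<alpha>"
  have M1: "M1 \<ge> 0" using B by (simp add: M1_def)
  have "norm (Cf \<beta> y - Cf \<beta> q) \<le> (\<bar>M\<bar> + M1) * dist y q powr \<alpha>" for y
  proof (cases "y = q")
    case False
    have p: "0 \<le> dist y q powr \<alpha>" by simp
    show ?thesis
    proof (cases "dist y q < d")
      case True
      have "norm (Cf \<beta> y - Cf \<beta> q) \<le> M * dist y q powr \<alpha>" by (rule M(2)[OF False True])
      also have "\<dots> \<le> (\<bar>M\<bar> + M1) * dist y q powr \<alpha>" using M1 by (intro mult_right_mono) auto
      finally show ?thesis .
    next
      case nd: False
      then have "d powr \<alpha> \<le> dist y q powr \<alpha>" using M(1) assms(2) by (intro powr_mono2) auto
      then have "2 * B \<le> M1 * dist y q powr \<alpha>"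
        unfolding M1_def using B(1) M(1) mult_left_mono[of "d powr \<alpha>" "dist y q powr \<alpha>" "2 * B"] by (simp add: field_simps)
      moreover have "norm (Cf \<beta> y - Cf \<beta> q) \<le> 2 * B" by (rule B(2))
      moreover have "0 \<le> \<bar>M\<bar> * dist y q powr \<alpha>" by simp
      ultimately show ?thesis unfolding distrib_right by linarith
    qed
  qed simp
  then show ?thesis unfolding hb_def using M1 by (intro exI[of _ "\<bar>M\<bar> + M1"]) auto
qed

lemma hb_linear:
  assumes "hb \<beta> q \<alpha>" "hb \<gamma> q \<alpha>" "\<beta> \<in> CF d" "\<gamma> \<in> CF d"
  shows "hb (\<lambda>n. a * \<beta> n + b * \<gamma> n) q \<alpha>"
proof -
  obtain M N where M: "M \<ge> 0" "\<And>y. norm (Cf \<beta> y - Cf \<beta> q) \<le> M * dist y q powr \<alpha>"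
    and N: "N \<ge> 0" "\<And>y. norm (Cf \<gamma> y - Cf \<gamma> q) \<le> N * dist y q powr \<alpha>"
    using assms(1,2) unfolding hb_def by blast
  have "norm (Cf (\<lambda>n. a * \<beta> n + b * \<gamma> n) y - Cf (\<lambda>n. a * \<beta> n + b * \<gamma> n) q) \<le> (norm a * M + norm b * N) * dist y q powr \<alpha>" for y
  proof -
    have "Cf (\<lambda>n. a * \<beta> n + b * \<gamma> n) y - Cf (\<lambda>n. a * \<beta> n + b * \<gamma> n) q = a * (Cf \<beta> y - Cf \<beta> q) + b * (Cf \<gamma> y - Cf \<gamma> q)"
      by (simp add: Cf_linear[OF assms(3,4)] algebra_simps)
    then have "norm (Cf (\<lambda>n. a * \<beta> n + b * \<gamma> n) y - Cf (\<lambda>n. a * \<beta> n + b * \<gamma> n) q) \<le> norm a * norm (Cf \<beta> y - Cf \<beta> q) + norm b * norm (Cf \<gamma> y - Cf \<gamma> q)"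
      using norm_triangle_ineq[of "a * (Cf \<beta> y - Cf \<beta> q)" "b * (Cf \<gamma> y - Cf \<gamma> q)"] by (simp add: norm_mult)
    also have "\<dots> \<le> norm a * (M * dist y q powr \<alpha>) + norm b * (N * dist y q powr \<alpha>)"
      using M(2)[of y] N(2)[of y] by (intro add_mono mult_left_mono) auto
    finally show ?thesis by (simp add: algebra_simps)
  qed
  moreover have "norm a * M + norm b * N \<ge> 0" using M N by simp
  ultimately show ?thesis unfolding hb_def by blast
qed

lemma hb_cong:
  assumes M: "\<And>y. y \<in> ball q r \<Longrightarrow> norm (Cf \<beta> y - Cf \<beta> q) \<le> M * dist y q powr \<alpha>" and r: "r > 0" and \<alpha>: "\<alpha> \<ge> 0"
  shows "hb \<beta> q \<alpha>"
proof (rule holder_bounded_hb[OF _ \<alpha>])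
  show "holder_bounded (Cf \<beta>) q \<alpha>"
    unfolding holder_bounded_def sdist_eq_dist using M r by (intro exI[of _ M] exI[of _ r]) (auto simp: dist_commute)
qed

text \<open>The branch of \<open>u\<close> through \<open>q\<close> fixes \<open>q\<close> and is
  Lipschitz, so the pointwise bound survives composition with it.\<close>

lemma hb_act:
  assumes \<beta>: "\<beta> \<in> CF d" and u: "u \<in> Wd" "fw f u q = q" "q \<in> JJ" and hb: "hb \<beta> q \<alpha>" and \<alpha>: "\<alpha> \<ge> 0"
  shows "hb (actw u \<beta>) q \<alpha>"
proof -
  obtain M where M: "M \<ge> 0" "\<And>y. norm (Cf \<beta> y - Cf \<beta> q) \<le> M * dist y q powr \<alpha>" using hb unfolding hb_def by blast
  obtain H where H: "BB u q H (R u q)" "H q = q" using R_branch[of u q] u by auto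
  have \<rho>: "R u q > 0" using R_pos(1)[of u q] u by simp
  have "norm (Cf (actw u \<beta>) y - Cf (actw u \<beta>) q) \<le> (M * (\<kappa> * R u q) powr \<alpha>) * dist y q powr \<alpha>" if y: "y \<in> ball q brad" for y
  proof -
    have yb: "y \<in> ball q \<delta>" "q \<in> ball q \<delta>" using y brad(2) \<delta> by auto
    have "Cf (actw u \<beta>) y - Cf (actw u \<beta>) q = Cf \<beta> (H y) - Cf \<beta> q"
      using Cf_branch[OF u(1,3) H(1) y \<beta>] H(2) by simp
    then have "norm (Cf (actw u \<beta>) y - Cf (actw u \<beta>) q) \<le> M * dist (H y) q powr \<alpha>" using M(2) by simp
    also have "\<dots> \<le> M * (\<kappa> * R u q * dist y q) powr \<alpha>"
      using BB_D(5)[OF H(1) yb] H(2) \<alpha> M(1) by (intro mult_left_mono powr_mono2) auto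
    also have "(\<kappa> * R u q * dist y q) powr \<alpha> = (\<kappa> * R u q) powr \<alpha> * dist y q powr \<alpha>"
      using \<kappa>_pos \<rho> by (subst powr_mult) auto
    finally show ?thesis by (simp add: mult.assoc)
  qed
  then show ?thesis using brad(1) \<alpha> by (rule hb_cong)
qed

text \<open>Subtracting the scalar from the action of \<open>u\<close> lowers the degree and keeps
  the Hoelder bound, so minimality of the degree leaves zero. For the resulting eigenvector the
  equation along the n-th power of \<open>u\<close> bounds weight times difference by a constant
  times the \<alpha>-th power of the ratio; by growth the difference is at most c / 2^n for every
  n.\<close>

lemma not_hb:
  assumes g: "growth \<alpha> u q" and \<alpha>: "\<alpha> \<ge> 0" and \<beta>: "\<beta> \<in> CF d" "\<beta> \<noteq> (\<lambda>_. 0)"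
  shows "\<not> hb \<beta> q \<alpha>"
proof
  assume hb: "hb \<beta> q \<alpha>"
  have u: "u \<in> Wd" "fw f u q = q" "q \<in> JJ"
    and gr: "\<And>n. n \<ge> 1 \<Longrightarrow> 2 ^ n * R (wrep n u) q powr \<alpha> \<le> wtw p (wrep n u)" using g by (auto simp: growth_def)
  define P where "P d \<longleftrightarrow> (\<exists>\<gamma>\<in>CF d. \<gamma> \<noteq> (\<lambda>_. 0) \<and> hb \<gamma> q \<alpha>)" for d
  define e where "e = (LEAST d. P d)"
  have "P d" using \<beta> hb by (auto simp: P_def)
  then have "P e" unfolding e_def by (rule LeastI)
  then obtain \<gamma> where \<gamma>: "\<gamma> \<in> CF e" "\<gamma> \<noteq> (\<lambda>_. 0)" "hb \<gamma> q \<alpha>" unfolding P_def by blast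
  have eig: "actw u \<gamma> = (\<lambda>n. of_real (wtw p u) * \<gamma> n)"
  proof (cases e)
    case 0
    then show ?thesis using actw_top(2)[OF _ u(1)] \<gamma>(1) by blast
  next
    case (Suc e')
    define \<eta> where "\<eta> = (\<lambda>n. 1 * actw u \<gamma> n + (- of_real (wtw p u)) * \<gamma> n)"
    have \<eta>: "\<eta> \<in> CF e'" using actw_top(1)[of \<gamma> e' u] \<gamma>(1) u(1) Suc by (simp add: \<eta>_def)
    have "hb \<eta> q \<alpha>" unfolding \<eta>_def
      by (rule hb_linear[OF hb_act[OF \<gamma>(1) u \<gamma>(3) \<alpha>] \<gamma>(3) actw_CF[OF \<gamma>(1) u(1)] \<gamma>(1)])
    moreover have "\<not> P e'" using not_less_Least[of e' P] Suc by (simp add: e_def)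
    ultimately have "\<eta> = (\<lambda>_. 0)" using \<eta> unfolding P_def by blast
    then show ?thesis by (simp add: \<eta>_def fun_eq_iff)
  qed
  have actscale: "act i (\<lambda>n. c * b n) = (\<lambda>n. c * act i b n)" for i c b
    by (simp add: act_def low_def lower_def fun_eq_iff sum_distrib_left algebra_simps)
  have actwscale: "actw w (\<lambda>n. c * b n) = (\<lambda>n. c * actw w b n)" for w c b
    by (induction w arbitrary: b) (auto simp: actscale)
  have actwapp: "actw (v @ w) b = actw w (actw v b)" for v w b
    by (induction v arbitrary: b) auto
  have eign: "actw (wrep n u) \<gamma> = (\<lambda>k. of_real (wtw p (wrep n u)) * \<gamma> k)" for n
    by (induction n) (auto simp: actwapp eig actwscale mult.assoc)
  obtain M where M: "M \<ge> 0" "\<And>y. norm (Cf \<gamma> y - Cf \<gamma> q) \<le> M * dist y q powr \<alpha>" using \<gamma>(3) unfolding hb_def by blast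
  have "Cf \<gamma> y = Cf \<gamma> q" if y: "y \<in> ball q brad" for y
  proof -
    have yb: "y \<in> ball q \<delta>" "q \<in> ball q \<delta>" using y brad(2) \<delta> by auto
    define N where "N = norm (Cf \<gamma> y - Cf \<gamma> q)"
    define c where "c = M * (\<kappa> * brad) powr \<alpha>"
    have c0: "c \<ge> 0" using M by (simp add: c_def)
    have bound: "2 ^ n * N \<le> c" if n: "n \<ge> 1" for n
    proof -
      define v where "v = wrep n u"
      have v: "v \<in> Wd" "fw f v q = q" using u by (auto simp: v_def wrep_Wd wrep_fixed)
      obtain H where H: "BB v q H (R v q)" "H q = q" using R_branch[of v q] v u(3) by auto
      have \<rho>: "R v q > 0" using R_pos(1)[of v q] v u(3) by simp
      have lin: "Cf (actw v \<gamma>) t = of_real (wtw p v) * Cf \<gamma> t" for t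
        using Cf_linear[OF \<gamma>(1) \<gamma>(1), of "of_real (wtw p v)" 0 t] by (simp add: eign v_def)
      have "Cf \<gamma> (H y) - Cf \<gamma> q = of_real (wtw p v) * (Cf \<gamma> y - Cf \<gamma> q)"
        using Cf_branch[OF v(1) u(3) H(1) y \<gamma>(1)] H(2) by (simp add: lin right_diff_distrib)
      then have "wtw p v * N = norm (Cf \<gamma> (H y) - Cf \<gamma> q)"
        using wtw_p_pos[OF v(1)] by (simp add: norm_mult N_def)
      also have "\<dots> \<le> M * dist (H y) q powr \<alpha>" by (rule M(2))
      also have "\<dots> \<le> M * (\<kappa> * R v q * brad) powr \<alpha>"
      proof -
        have "dist (H y) q \<le> \<kappa> * R v q * dist y q" using BB_D(5)[OF H(1) yb] H(2) by simp
        also have "\<dots> \<le> \<kappa> * R v q * brad" using y \<kappa>_pos \<rho> by (intro mult_left_mono) (auto simp: dist_commute)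
        finally show ?thesis using M(1) \<alpha> by (intro mult_left_mono powr_mono2) auto
      qed
      also have "(\<kappa> * R v q * brad) powr \<alpha> = (\<kappa> * brad) powr \<alpha> * R v q powr \<alpha>"
        using \<kappa>_pos \<rho> brad(1) powr_mult[of "\<kappa> * brad" "R v q" \<alpha>] by (simp add: mult_ac)
      finally have 1: "wtw p v * N \<le> c * R v q powr \<alpha>" by (simp add: c_def mult.assoc)
      have "2 ^ n * R v q powr \<alpha> * N \<le> wtw p v * N"
        using gr[OF n] by (intro mult_right_mono) (auto simp: v_def N_def)
      then have "(2 ^ n * N) * R v q powr \<alpha> \<le> c * R v q powr \<alpha>" using 1 by (simp add: mult_ac)
      then show ?thesis using \<rho> by simp
    qed
    have "N = 0"
    proof (rule ccontr)
      assume "N \<noteq> 0"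
      then have Np: "N > 0" by (simp add: N_def)
      obtain n where n: "c / N < 2 ^ n" using real_arch_pow[of 2 "c / N"] by auto
      have "c < 2 ^ n * N" using n Np by (simp add: field_simps)
      also have "\<dots> \<le> 2 ^ Suc n * N" using Np by simp
      finally show False using bound[of "Suc n"] by simp
    qed
    then show ?thesis by (simp add: N_def)
  qed
  then have "flat \<gamma> q" unfolding flat_def using brad(1) by blast
  then show False using not_flat[OF \<gamma>(1,2) u(3)] by blast
qed

section \<open>Comparison of \<open>alpha_minus\<close> with the critical exponent\<close>

lemma Hol_le:
  assumes g: "growth \<alpha> u q" and \<alpha>: "\<alpha> \<ge> 0" and \<beta>: "\<beta> \<in> CF d" "\<beta> \<noteq> (\<lambda>_. 0)"
  shows "Hol (Cf \<beta>) q \<le> ereal \<alpha>"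
  unfolding Hol_def
proof (rule Sup_least)
  fix h assume "h \<in> {ereal \<alpha> |\<alpha>. \<alpha> \<ge> 0 \<and> holder_bounded (Cf \<beta>) q \<alpha>}"
  then obtain a where a: "h = ereal a" "a \<ge> 0" "holder_bounded (Cf \<beta>) q a" by blast
  have "a \<le> \<alpha>"
  proof (rule ccontr)
    assume "\<not> a \<le> \<alpha>"
    obtain M where M: "M \<ge> 0" "\<And>y. norm (Cf \<beta> y - Cf \<beta> q) \<le> M * dist y q powr a"
      using holder_bounded_hb[OF a(3,2)] unfolding hb_def by blast
    have "norm (Cf \<beta> y - Cf \<beta> q) \<le> M * dist y q powr \<alpha>" if y: "y \<in> ball q 1" for y
    proof -
      have "dist y q powr a \<le> dist y q powr \<alpha>" using \<open>\<not> a \<le> \<alpha>\<close> y by (intro powr_mono') (auto simp: dist_commute)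
      then show ?thesis using M mult_left_mono[of "dist y q powr a" "dist y q powr \<alpha>" M] by (meson order_trans)
    qed
    then have "hb \<beta> q \<alpha>" using zero_less_one \<alpha> by (rule hb_cong)
    then show False using not_hb[OF g \<alpha> \<beta>] by blast
  qed
  then show "h \<le> ereal \<alpha>" using a(1) by simp
qed

text \<open>Shows that the supremum runs over a nonempty set. Together with a finite upper bound
  this makes \<open>Hol\<close> a real number, so that \<open>q\<close> lies in one of the level
  sets.\<close>

lemma Hol_nonneg: "0 \<le> Hol (Cf \<beta>) q"
proof -
  obtain B where B: "B \<ge> 0" "\<And>y z. norm (Cf \<beta> y - Cf \<beta> z) \<le> 2 * B" by (rule Cf_diff_bounded) (rule that)
  have "norm (Cf \<beta> y - Cf \<beta> q) \<le> 2 * B" for y by (rule B(2))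
  then have "holder_bounded (Cf \<beta>) q 0"
    unfolding holder_bounded_def sdist_eq_dist by (intro exI[of _ "2 * B"] exI[of _ 1]) auto
  then have "ereal 0 \<le> Hol (Cf \<beta>) q" unfolding Hol_def by (intro Sup_upper CollectI exI[of _ 0]) simp
  then show ?thesis by (simp only: zero_ereal_def)
qed

lemma alpha_minus_le:
  assumes g: "growth \<alpha> u q" and \<alpha>: "\<alpha> \<ge> 0" and \<beta>: "\<beta> \<in> CF d" "\<beta> \<noteq> (\<lambda>_. 0)"
  shows "alpha_minus (Cf \<beta>) \<le> ereal \<alpha>"
proof -
  have h: "0 \<le> Hol (Cf \<beta>) q" "Hol (Cf \<beta>) q \<le> ereal \<alpha>" using Hol_nonneg Hol_le[OF assms] by auto
  then obtain b where b: "Hol (Cf \<beta>) q = ereal b" by (cases "Hol (Cf \<beta>) q") auto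
  then have "Hlevel (Cf \<beta>) b \<noteq> {}" by (auto simp: Hlevel_def)
  then have "alpha_minus (Cf \<beta>) \<le> ereal b" unfolding alpha_minus_def by (intro Inf_lower) auto
  also have "ereal b \<le> ereal \<alpha>" using h(2) unfolding b .
  finally show ?thesis .
qed

lemma Hol_ge: assumes "holder_cont C a" "a \<ge> 0" shows "ereal a \<le> Hol C z"
proof -
  obtain K where "\<forall>y z. cmod (C y - C z) \<le> K * sdist y z powr a" using assms(1) unfolding holder_cont_def by blast
  then have "holder_bounded C z a" unfolding holder_bounded_def by (intro exI[of _ K] exI[of _ 1]) auto
  then show ?thesis unfolding Hol_def using assms(2) by (intro Sup_upper CollectI exI[of _ a]) simp
qed

lemma CF_exists:
  assumes "finite {n. \<beta> n \<noteq> 0}" "\<forall>n. \<beta> n \<noteq> 0 \<longrightarrow> multi_index s n"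
  shows "\<exists>d. \<beta> \<in> CF d"
proof -
  define d where "d = Max ((\<lambda>n. \<Sum>i\<in>{1..s}. n i) ` {n. \<beta> n \<noteq> 0})"
  have "(\<Sum>i\<in>{1..s}. n i) \<le> d" if "\<beta> n \<noteq> 0" for n
    unfolding d_def using assms(1) that by (intro Max_ge) auto
  then have "\<beta> \<in> CF d" using assms(2) by (simp add: CF_def Bx_def)
  then show ?thesis by blast
qed

text \<open>Growth is available only strictly above the critical exponent, so the bound is obtained
  with an arbitrary excess.\<close>

lemma alpha_minus_le_exponent:
  assumes a: "a \<ge> 0" "\<And>\<alpha>. \<alpha> > a \<Longrightarrow> \<exists>u q. growth \<alpha> u q" and \<beta>: "\<beta> \<in> CF d" "\<beta> \<noteq> (\<lambda>_. 0)"
  shows "alpha_minus (Cf \<beta>) \<le> ereal a"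
proof (rule ereal_le_epsilon2)
  fix e :: real assume "0 < e"
  then obtain u q where "growth (a + e) u q" using a(2)[of "a + e"] by auto
  then have "alpha_minus (Cf \<beta>) \<le> ereal (a + e)" using a(1) \<open>0 < e\<close> by (intro alpha_minus_le[OF _ _ \<beta>]) auto
  then show "alpha_minus (Cf \<beta>) \<le> ereal a + ereal e" by simp
qed

lemma holder_cont_below_alpha_minus:
  assumes \<beta>: "finite {n. \<beta> n \<noteq> 0}" "\<forall>n. \<beta> n \<noteq> 0 \<longrightarrow> multi_index s n" "\<exists>n. \<beta> n \<noteq> 0" and \<alpha>: "ereal \<alpha> < alpha_minus (Cf \<beta>)"
  shows "holder_cont (Cf \<beta>) \<alpha>"
proof -
  obtain a K where a: "a \<ge> 0" and K: "K > 0" "\<And>w z. w \<in> Wd \<Longrightarrow> fw f w z \<in> JJ \<Longrightarrow> wtw p w \<le> K * R w z powr a"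
    and gr: "\<And>\<alpha>. \<alpha> > a \<Longrightarrow> \<exists>u q. growth \<alpha> u q"
    by (rule critical_exponent) (rule that)
  obtain d where d: "\<beta> \<in> CF d" using CF_exists \<beta> by blast
  have "\<beta> \<noteq> (\<lambda>_. 0)" using \<beta>(3) by auto
  then have "alpha_minus (Cf \<beta>) \<le> ereal a" using alpha_minus_le_exponent[OF a gr d] by blast
  then have "ereal \<alpha> < ereal a" using \<alpha> by (rule less_le_trans[rotated])
  then show ?thesis using holder_cont_subcritical[OF K] by simp
qed

lemma Cf_unit: "(\<lambda>z. of_real (Cn f s L p (\<lambda>_. 0) z)) = Cf (\<lambda>n. if n = (\<lambda>_. 0) then 1 else 0)"
proof -
  have "{n. (if n = (\<lambda>_. 0) then 1 else 0) \<noteq> (0::complex)} = {(\<lambda>_. 0) :: nat \<Rightarrow> nat}" by auto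
  then show ?thesis by (simp add: Cf_eq fun_eq_iff)
qed

lemma holder_cont_alpha_minus:
  assumes \<beta>: "\<beta> \<in> CF 0" "\<beta> \<noteq> (\<lambda>_. 0)"
  shows "\<exists>a. alpha_minus (Cf \<beta>) = ereal a \<and> holder_cont (Cf \<beta>) a"
proof -
  obtain a K where a: "a \<ge> 0" and K: "K > 0" "\<And>w z. w \<in> Wd \<Longrightarrow> fw f w z \<in> JJ \<Longrightarrow> wtw p w \<le> K * R w z powr a"
    and gr: "\<And>\<alpha>. \<alpha> > a \<Longrightarrow> \<exists>u q. growth \<alpha> u q"
    by (rule critical_exponent) (rule that)
  have hol: "holder_cont (Cf \<beta>) a" by (rule holder_cont_critical[OF K a \<beta>(1)])
  have "ereal a \<le> alpha_minus (Cf \<beta>)"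
    unfolding alpha_minus_def
  proof (rule Inf_greatest)
    fix h assume "h \<in> {ereal \<alpha> |\<alpha>. Hlevel (Cf \<beta>) \<alpha> \<noteq> {}}"
    then obtain z where "Hol (Cf \<beta>) z = h" unfolding Hlevel_def by blast
    then show "ereal a \<le> h" using Hol_ge[OF hol a, of z] by simp
  qed
  then have "alpha_minus (Cf \<beta>) = ereal a"
    using alpha_minus_le_exponent[OF a gr \<beta>] by (rule antisym[rotated])
  then show ?thesis using hol by blast
qed

lemma unit_CF: "(\<lambda>n. if n = (\<lambda>_. 0) then 1 else 0) \<in> CF 0"
  by (auto simp: CF_def Bx_def multi_index_def split: if_splits)

end

theorem theorem1p3:
  fixes s :: nat and f :: "nat \<Rightarrow> sph \<Rightarrow> sph" and L :: "sph set" and p :: "nat \<Rightarrow> real"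
    and G :: "(sph \<Rightarrow> sph) set"
  defines "G \<equiv> semigroup_gen f {1..s+1}"
  assumes s_ge: "s \<ge> 1"
    and deg: "\<forall>i\<in>{1..s+1}. \<exists>d\<ge>2. rational_map (f i) d"
    and A1: "postcrit f {1..s+1} \<subseteq> fatou G"
    and A2: "\<forall>i\<in>{1..s+1}. \<forall>j\<in>{1..s+1}. i \<noteq> j \<longrightarrow> f i -` julia G \<inter> f j -` julia G = {}"
    and A3: "\<exists>K1 K2. minimal_set G K1 \<and> minimal_set G K2 \<and> K1 \<noteq> K2"
    and L: "minimal_set G L"
    and p: "\<forall>i\<in>{1..s}. 0 < p i \<and> p i < 1" "(\<Sum>i\<in>{1..s}. p i) < 1"
  shows "(\<forall>\<beta> :: (nat \<Rightarrow> nat) \<Rightarrow> complex.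
            finite {n. \<beta> n \<noteq> 0} \<and> (\<forall>n. \<beta> n \<noteq> 0 \<longrightarrow> multi_index s n) \<and> (\<exists>n. \<beta> n \<noteq> 0) \<longrightarrow>
            (\<forall>\<alpha>::real. ereal \<alpha> < alpha_minus (\<lambda>z. \<Sum>n\<in>{n. \<beta> n \<noteq> 0}. \<beta> n * of_real (Cn f s L p n z))
                \<longrightarrow> holder_cont (\<lambda>z. \<Sum>n\<in>{n. \<beta> n \<noteq> 0}. \<beta> n * of_real (Cn f s L p n z)) \<alpha>))
       \<and> (\<exists>a. alpha_minus (\<lambda>z. of_real (Cn f s L p (\<lambda>_. 0) z)) = ereal a
              \<and> holder_cont (\<lambda>z. of_real (Cn f s L p (\<lambda>_. 0) z)) a)"
proof -
  have deg': "\<And>i. i \<in> {1..s+1} \<Longrightarrow> \<exists>d\<ge>2. rational_map (f i) d" using deg by blast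
  interpret rational_semigroup f s by unfold_locales (rule s_ge, rule deg')
  have G: "G = GG" by (simp add: G_def GG_def II_def)
  interpret hyperbolic_semigroup f s
  proof unfold_locales
    show "PP \<subseteq> FF" using A1 by (simp add: PP_def II_def G)
    show "f i -` JJ \<inter> f j -` JJ = {}" if "i \<in> II" "j \<in> II" "i \<noteq> j" for i j
      using A2 that by (simp add: II_def G)
  qed
  from inverse_branches obtain \<delta> \<kappa> where \<delta>\<kappa>: "\<delta> > 0" "\<kappa> \<ge> 1"
    and br: "\<forall>w\<in>Wd. \<forall>x\<in>JJ. \<forall>x1\<in>ball x \<delta>. \<forall>a. fw f w a = x1 \<longrightarrow> (\<exists>H \<rho>. Br f \<kappa> \<delta> w x H \<rho> \<and> H x1 = a)"
    by (elim exE conjE) (rule that)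
  interpret branched_semigroup f s \<kappa> \<delta> by unfold_locales (rule \<delta>\<kappa>(1), rule \<delta>\<kappa>(2), rule br[rule_format])
  \<comment> \<open>At least one of the two minimal sets of \<open>A3\<close> differs from
    \<open>L\<close>.\<close>
  have mins: "minimal_set GG L" "\<exists>K. minimal_set GG K \<and> K \<noteq> L" using L A3 unfolding G by metis+
  interpret attractor_system f s \<kappa> \<delta> L p
    by unfold_locales (use mins p in auto)
  have C: "(\<lambda>z. \<Sum>n\<in>{n. \<beta> n \<noteq> 0}. \<beta> n * of_real (Cn f s L p n z)) = Cf \<beta>" for \<beta>
    by (simp add: Cf_eq fun_eq_iff)
  have "(\<lambda>n. if n = (\<lambda>_. 0) then 1 else 0) \<noteq> (\<lambda>_::nat \<Rightarrow> nat. 0::complex)" by (auto simp: fun_eq_iff)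
  then have "\<exists>a. alpha_minus (\<lambda>z. of_real (Cn f s L p (\<lambda>_. 0) z)) = ereal a \<and>
      holder_cont (\<lambda>z. of_real (Cn f s L p (\<lambda>_. 0) z)) a"
    unfolding Cf_unit by (rule holder_cont_alpha_minus[OF unit_CF])
  moreover have "holder_cont (Cf \<beta>) \<alpha>"
    if "finite {n. \<beta> n \<noteq> 0} \<and> (\<forall>n. \<beta> n \<noteq> 0 \<longrightarrow> multi_index s n) \<and> (\<exists>n. \<beta> n \<noteq> 0)" "ereal \<alpha> < alpha_minus (Cf \<beta>)" for \<beta> \<alpha>
    using holder_cont_below_alpha_minus[of \<beta> \<alpha>] that by blast
  ultimately show ?thesis unfolding C by blast
qed

end
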